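(* Assume that $\mathbf{u}^*=(u_0^*,\dots,u_N^* )^\top\in H$ solves the exact reduced system $$\begin{cases} \mathrm{i}\sum_{n=0}^Ns_{mn}u_n^*+\Delta u_m^*+\sum_{n=0}^Nb^N_{mn}(\mathbf{u}^*,\mathbf{x})\,u_n^*=0 & \text{in }\Omega, \\ u_m^*=0 & \text{on }\partial\Omega, \\ \partial_\nu u_m^*=f_m^* & \text{on }\partial\Omega, \end{cases}\qquad m=0,\dots,N,$$ with exact data $\mathbf{f}^*=(f_0^*,\dots,f_N^* )^\top$. Let $\mathbf{f}=(f_0,\dots,f_N)^\top$ be noisy data, and let $\mathbf{u}_{\lambda,\epsilon}\in H$ be the fixed point of the map $F_{\lambda,\epsilon}$ associated with the noisy data $\mathbf{f}$. Fix $\epsilon>0$ and $\beta\ge\beta_0$ (with $\mathbf{x}_0$ fixed). Then there exist $\lambda_1\ge\lambda_0$ (large enough that the fixed point $\mathbf{u}_{\lambda,\epsilon}$ is defined for $\lambda\ge\lambda_1$) and $C>0$, depending only on $\Omega$, $\beta$, $s$, $N$, $p$, $T$, $\|q\|_{L^\infty(\Omega\times(0,T))}$, $\{\Psi_\ell\}_{\ell=0}^N$, $\{s_{mn}\}_{m,n=0}^N$ and $M$, such that for all $\lambda\ge\lambda_1$, $$\|\mathbf{u}_{\lambda,\epsilon}-\mathbf{u}^*\|_{\lambda,\epsilon}^2\le C\frac{\epsilon}{\lambda^3}\|\mathbf{u}^*\|^2_{[H^s(\Omega)]^{N+1}}+C\int_{\partial\Omega}e^{2\lambda r^{-\beta}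}|\mathbf{f}-\mathbf{f}^*|^2\,d\sigma(\mathbf{x}).$$
   Context: Setting. $d\ge1$; $\Omega\subset\mathbb{R}^d$ is a bounded domain with smooth boundary and outward unit normal $\nu$; $T>0$; $p>1$ is real; $q\in L^\infty(\Omega\times(0,T))$ is real-valued; $N\ge0$ is an integer. All unknown functions are complex-valued; $\mathrm{i}$ is the imaginary unit. Time basis. Let $P_n$ be the Legendre polynomials on $(-1,1)$, $P_n(x)=\frac{1}{2^nn!}\frac{d^n}{dx^n}(x^2-1)^n$; $Q_n(t)=\sqrt{\frac{2n+1}{T}}\,P_n(\frac{2t}{T}-1)$; $\Psi_n(t)=e^tQ_n(t)$ for $t\in(0,T)$. For $m,n=0,\dots,N$ and $\boldsymbol{\varphi}=(\varphi_0,\dots,\varphi_N)^\top$ put $$s_{mn}=\int_0^Te^{-2t}\Psi_n'(t)\Psi_m(t)\,dt,\qquad b^N_{mn}(\boldsymbol{\varphi},\mathbf{x})=\int_0^Te^{-2t}q(\mathbf{x},t)\Big|\sum_{l=0}^N\varphi_l(\mathbf{x})\Psi_l(t)\Big|^{p-1}\Psi_n(t)\Psi_m(t)\,dt.$$ Carleman weight and constants $\beta_0,\lambda_0$. Fix $\mathbf{x}_0\in\mathbb{R}^d\setminus\overline\Omega$, $r(\mathbf{x})=|\mathbf{x}-\mathbf{x}_0|$, $R=\max_{\overline\Omega}r$. The constant $\beta_0>0$ is that of the following known pointwise Carleman estimate for the Laplacian: for every $\beta\ge\beta_0$, every $\lambda\ge\lambda_0:=2R^\beta$ and every $u\in C^2(\overline\Omega)$,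 $$r^{\beta+2}e^{2\lambda r^{-\beta}}|\Delta u|^2\ge C\big[\mathrm{div}(U)+\lambda^3\beta^4e^{2\lambda r^{-\beta}}r^{-2\beta-2}|u|^2+\lambda\beta e^{2\lambda r^{-\beta}}|\nabla u|^2\big]\quad\text{in }\Omega,$$ for a vector field $U$ (depending on $u$) with $|U|\le Ce^{2\lambda r^{-\beta}}(\lambda^3\beta^3r^{-2\beta-2}|u|^2+\lambda\beta|\nabla u|^2)$, where $C>0$ depends only on $\mathbf{x}_0,\Omega,d$. Admissible set. Fix $s>\frac d2+2$ and $M>0$, and let $$H=\{\boldsymbol{\varphi}\in[H^s(\Omega)]^{N+1}:\ \boldsymbol{\varphi}|_{\partial\Omega}=\mathbf{0},\ \|\boldsymbol{\varphi}\|_{[L^\infty(\Omega)]^{N+1}}\le M\}$$ (the $L^\infty$ norm being, say, the essential supremum of the Euclidean norm of $\boldsymbol{\varphi}(\mathbf{x})$). Functional and map. The noisy data satisfy $f_0,\dots,f_N\in L^2(\partial\Omega)$. For $\boldsymbol{\varphi}\in H$, $\lambda\ge\lambda_0$, $\epsilon>0$ define, for $\mathbf{u}=(u_0,\dots,u_N)^\top\in H$, $$J^{\lambda,\epsilon}_{\boldsymbol{\varphi}}(\mathbf{u})=\sum_{m=0}^N\Big[\int_\Omega e^{2\lambda r^{-\beta}}\Big|\mathrm{i}\sum_{n=0}^Ns_{mn}u_n+\Delta u_m+\sum_{n=0}^Nb^N_{mn}(\boldsymbol{\varphi},\mathbf{x})\varphi_n\Big|^2d\mathbf{x}+\lambda^3\int_{\partial\Omega}e^{2\lambda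 r^{-\beta}}|\partial_\nu u_m-f_m|^2d\sigma+\epsilon\|u_m\|^2_{H^s(\Omega)}\Big].$$ This functional has a unique minimizer on $H$, and $F_{\lambda,\epsilon}:H\to H$ is defined by $F_{\lambda,\epsilon}(\boldsymbol{\varphi})=\operatorname{argmin}_{\mathbf{u}\in H}J^{\lambda,\epsilon}_{\boldsymbol{\varphi}}(\mathbf{u})$. Norm. $$\|\mathbf{u}\|_{\lambda,\epsilon}^2=\int_\Omega e^{2\lambda r^{-\beta}}|\mathbf{u}|^2d\mathbf{x}+2\int_{\partial\Omega}e^{2\lambda r^{-\beta}}|\partial_\nu\mathbf{u}|^2d\sigma+\frac{2\epsilon}{\lambda^3}\|\mathbf{u}\|^2_{[H^s(\Omega)]^{N+1}}.$$ Fixed point. For all $\lambda$ above a threshold depending only on the parameters listed in the claim (not on $\epsilon$ or the data), $F_{\lambda,\epsilon}$ is a contraction of $(H,\|\cdot\|_{\lambda,\epsilon})$ and hence has a unique fixed point in $H$, denoted $\mathbf{u}_{\lambda,\epsilon}$. *)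

theory Defs
  imports "HOL-Analysis.Analysis" "HOL-Probability.Essential_Supremum"
begin

section \<open>Partial derivatives and classes of smooth functions\<close>

definition partial_deriv ::
    "'a::euclidean_space \<Rightarrow> ('a \<Rightarrow> 'b::real_normed_vector) \<Rightarrow> 'a \<Rightarrow> 'b" where
  "partial_deriv i f x = vector_derivative (\<lambda>t. f (x + t *\<^sub>R i)) (at 0)"

fun iter_partial ::
    "'a::euclidean_space list \<Rightarrow> ('a \<Rightarrow> 'b::real_normed_vector) \<Rightarrow> 'a \<Rightarrow> 'b" where
  "iter_partial [] f = f"
| "iter_partial (i # is) f = partial_deriv i (iter_partial is f)"

definition laplacian :: "('a::euclidean_space \<Rightarrow> complex) \<Rightarrow> 'a \<Rightarrow> complex" where
  "laplacian u x = (\<Sum>i\<in>Basis. partial_deriv i (partial_deriv i u) x)"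

definition grad_norm_sq :: "('a::euclidean_space \<Rightarrow> complex) \<Rightarrow> 'a \<Rightarrow> real" where
  "grad_norm_sq u x = (\<Sum>i\<in>Basis. (cmod (partial_deriv i u x))\<^sup>2)"

definition divergence :: "('a::euclidean_space \<Rightarrow> 'a) \<Rightarrow> 'a \<Rightarrow> real" where
  "divergence U x = (\<Sum>i\<in>Basis. partial_deriv i U x \<bullet> i)"

definition smooth_on :: "'a::euclidean_space set \<Rightarrow> ('a \<Rightarrow> 'b::real_normed_vector) \<Rightarrow> bool" where
  "smooth_on U f \<longleftrightarrow> (\<forall>is\<in>lists Basis. \<forall>x\<in>U. iter_partial is f differentiable (at x))"

text \<open>The class $C^k(\overline\Omega)$ for open $\Omega$: $k$ times continuously differentiable in
  $\Omega$, all derivatives of order at most $k$ extending continuously to $\overline\Omega$.\<close>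

definition Ck_closure ::
    "nat \<Rightarrow> 'a::euclidean_space set \<Rightarrow> ('a \<Rightarrow> 'b::real_normed_vector) \<Rightarrow> bool" where
  "Ck_closure k \<Omega> f \<longleftrightarrow>
     (\<forall>is\<in>lists Basis. length is < k \<longrightarrow> (\<forall>x\<in>\<Omega>. iter_partial is f differentiable (at x))) \<and>
     (\<forall>is\<in>lists Basis. length is \<le> k \<longrightarrow>
        (\<exists>g. continuous_on (closure \<Omega>) g \<and> (\<forall>x\<in>\<Omega>. g x = iter_partial is f x)))"


section \<open>Bounded smooth domains, outward normal, surface measure\<close>

definition local_defining_function ::
    "'a::euclidean_space set \<Rightarrow> 'a \<Rightarrow> 'a set \<Rightarrow> ('a \<Rightarrow> real) \<Rightarrow> bool" where
  "local_defining_function \<Omega> x U \<rho> \<longleftrightarrow>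
     open U \<and> x \<in> U \<and> smooth_on U \<rho> \<and>
     (\<forall>y\<in>U. y \<in> \<Omega> \<longleftrightarrow> \<rho> y < 0) \<and>
     (\<forall>y\<in>U. y \<in> frontier \<Omega> \<longleftrightarrow> \<rho> y = 0) \<and>
     (\<forall>y\<in>U \<inter> frontier \<Omega>. \<exists>D. (GDERIV \<rho> y :> D) \<and> D \<noteq> 0)"

definition bounded_smooth_domain :: "'a::euclidean_space set \<Rightarrow> bool" where
  "bounded_smooth_domain \<Omega> \<longleftrightarrow>
     \<Omega> \<noteq> {} \<and> open \<Omega> \<and> connected \<Omega> \<and> bounded \<Omega> \<and>
     (\<forall>x\<in>frontier \<Omega>. \<exists>U \<rho>. local_defining_function \<Omega> x U \<rho>)"

text \<open>The direction of the gradient does not depend on the defining function.\<close>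

definition outward_normal :: "'a::euclidean_space set \<Rightarrow> 'a \<Rightarrow> 'a" where
  "outward_normal \<Omega> x =
     (THE \<nu>. \<exists>U \<rho> D. local_defining_function \<Omega> x U \<rho> \<and> (GDERIV \<rho> x :> D) \<and> \<nu> = D /\<^sub>R norm D)"

text \<open>The normal derivative is taken from inside the domain, because functions on
  $\overline\Omega$ are extended by $0$ outside.\<close>

definition normal_deriv ::
    "'a::euclidean_space set \<Rightarrow> ('a \<Rightarrow> complex) \<Rightarrow> 'a \<Rightarrow> complex" where
  "normal_deriv \<Omega> u x =
     vector_derivative (\<lambda>t. u (x + t *\<^sub>R outward_normal \<Omega> x)) (at_left 0)"

text \<open>The $k$-dimensional Hausdorff measure, normalised by the volume of the unit ball of
  $\mathbb{R}^k$; for $k=0$ it is the counting measure, which is why the empty set is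
  treated separately (\<open>0 ^ 0 = 1\<close>).\<close>

definition hausdorff_weight :: "nat \<Rightarrow> 'a::euclidean_space set \<Rightarrow> ennreal" where
  "hausdorff_weight k A =
     (if A = {} then 0 else ennreal (unit_ball_vol (real k) * (diameter A / 2) ^ k))"

definition hausdorff_content :: "nat \<Rightarrow> real \<Rightarrow> 'a::euclidean_space set \<Rightarrow> ennreal" where
  "hausdorff_content k \<delta> A =
     (INF C\<in>{C :: nat \<Rightarrow> 'a set. A \<subseteq> (\<Union>i. C i) \<and> (\<forall>i. bounded (C i) \<and> diameter (C i) \<le> \<delta>)}.
        \<Sum>i. hausdorff_weight k (C i))"

definition hausdorff_measure :: "nat \<Rightarrow> 'a::euclidean_space measure" where
  "hausdorff_measure k = measure_of UNIV (sets borel) (\<lambda>A. SUP \<delta>\<in>{0<..}. hausdorff_content k \<delta> A)"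

definition surface_measure :: "'a::euclidean_space set \<Rightarrow> 'a measure" where
  "surface_measure \<Omega> = restrict_space (hausdorff_measure (DIM('a) - 1)) (frontier \<Omega>)"

definition L2_boundary :: "'a::euclidean_space set \<Rightarrow> ('a \<Rightarrow> complex) set" where
  "L2_boundary \<Omega> = {f. f \<in> borel_measurable (surface_measure \<Omega>) \<and>
                        integrable (surface_measure \<Omega>) (\<lambda>x. (cmod (f x))\<^sup>2)}"


section \<open>The Sobolev spaces $H^s(\Omega)$ for real $s > d/2$\<close>

text \<open>$H^s(\mathbb{R}^d)$ consists of the $U$ whose Fourier transform $g$ satisfies
  $(1+|\xi|^2)^{s/2} g \in L^2$. For $s > d/2$ such $g$ are integrable, and $U$ is (after
  correction on a null set) the continuous function given by the inverse Fourier integral of $g$.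
  $H^s(\Omega)$ is the space of restrictions to $\Omega$, with the quotient norm. A class in
  $H^s(\Omega)$ is represented by its unique continuous representative on $\overline\Omega$,
  extended by $0$ off $\overline\Omega$, so that equality in $H^s(\Omega)$ is equality of
  functions. The definitions below are meaningful only for $s > d/2$.\<close>

definition fourier_Hs :: "real \<Rightarrow> ('a::euclidean_space \<Rightarrow> complex) set" where
  "fourier_Hs s = {g. g \<in> borel_measurable borel \<and>
     integrable lborel (\<lambda>\<xi>. (1 + (norm \<xi>)\<^sup>2) powr s * (cmod (g \<xi>))\<^sup>2)}"

definition fourier_Hs_norm :: "real \<Rightarrow> ('a::euclidean_space \<Rightarrow> complex) \<Rightarrow> real" where
  "fourier_Hs_norm s g = sqrt (LINT \<xi>|lborel. (1 + (norm \<xi>)\<^sup>2) powr s * (cmod (g \<xi>))\<^sup>2)"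

definition inverse_fourier :: "('a::euclidean_space \<Rightarrow> complex) \<Rightarrow> 'a \<Rightarrow> complex" where
  "inverse_fourier g x =
     of_real ((2 * pi) powr (- real DIM('a) / 2)) * (LINT \<xi>|lborel. cis (x \<bullet> \<xi>) * g \<xi>)"

definition Hs_extensions ::
    "'a::euclidean_space set \<Rightarrow> real \<Rightarrow> ('a \<Rightarrow> complex) \<Rightarrow> ('a \<Rightarrow> complex) set" where
  "Hs_extensions \<Omega> s u = {g \<in> fourier_Hs s. \<forall>x\<in>closure \<Omega>. u x = inverse_fourier g x}"

definition Hs :: "'a::euclidean_space set \<Rightarrow> real \<Rightarrow> ('a \<Rightarrow> complex) set" where
  "Hs \<Omega> s = {u. Hs_extensions \<Omega> s u \<noteq> {} \<and> (\<forall>x. x \<notin> closure \<Omega> \<longrightarrow> u x = 0)}"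

definition Hs_norm :: "'a::euclidean_space set \<Rightarrow> real \<Rightarrow> ('a \<Rightarrow> complex) \<Rightarrow> real" where
  "Hs_norm \<Omega> s u = (INF g\<in>Hs_extensions \<Omega> s u. fourier_Hs_norm s g)"

definition Hs_vec_norm ::
    "'a::euclidean_space set \<Rightarrow> real \<Rightarrow> nat \<Rightarrow> (nat \<Rightarrow> 'a \<Rightarrow> complex) \<Rightarrow> real" where
  "Hs_vec_norm \<Omega> s N u = sqrt (\<Sum>n\<le>N. (Hs_norm \<Omega> s (u n))\<^sup>2)"


section \<open>Time basis and reduced system\<close>

definition legendre :: "nat \<Rightarrow> real \<Rightarrow> real" where
  "legendre n x = 1 / (2 ^ n * fact n) * (deriv ^^ n) (\<lambda>y. (y\<^sup>2 - 1) ^ n) x"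

definition Q_basis :: "real \<Rightarrow> nat \<Rightarrow> real \<Rightarrow> real" where
  "Q_basis T n t = sqrt ((2 * real n + 1) / T) * legendre n (2 * t / T - 1)"

definition Psi :: "real \<Rightarrow> nat \<Rightarrow> real \<Rightarrow> real" where
  "Psi T n t = exp t * Q_basis T n t"

definition s_coeff :: "real \<Rightarrow> nat \<Rightarrow> nat \<Rightarrow> real" where
  "s_coeff T m n = (LINT t:{0<..<T}|lebesgue. exp (- 2 * t) * deriv (Psi T n) t * Psi T m t)"

definition b_coeff ::
    "real \<Rightarrow> real \<Rightarrow> nat \<Rightarrow> ('a \<Rightarrow> real \<Rightarrow> real) \<Rightarrow> (nat \<Rightarrow> 'a \<Rightarrow> complex) \<Rightarrow> 'a \<Rightarrow> nat \<Rightarrow> nat \<Rightarrow> real" where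
  "b_coeff T p N q \<phi> x m n =
     (LINT t:{0<..<T}|lebesgue. exp (- 2 * t) * q x t *
        cmod (\<Sum>l\<le>N. \<phi> l x * of_real (Psi T l t)) powr (p - 1) * Psi T n t * Psi T m t)"

definition residual ::
    "real \<Rightarrow> real \<Rightarrow> nat \<Rightarrow> ('a::euclidean_space \<Rightarrow> real \<Rightarrow> real) \<Rightarrow> (nat \<Rightarrow> 'a \<Rightarrow> complex) \<Rightarrow>
     (nat \<Rightarrow> 'a \<Rightarrow> complex) \<Rightarrow> nat \<Rightarrow> 'a \<Rightarrow> complex" where
  "residual T p N q \<phi> u m x =
     \<i> * (\<Sum>n\<le>N. of_real (s_coeff T m n) * u n x) + laplacian (u m) x +
     (\<Sum>n\<le>N. of_real (b_coeff T p N q \<phi> x m n) * \<phi> n x)"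

text \<open>The reduced system contains the values of $q$, hence is understood almost everywhere; the
  Neumann data are classes in $L^2(\partial\Omega)$.\<close>

definition solves_reduced_system ::
    "'a::euclidean_space set \<Rightarrow> real \<Rightarrow> real \<Rightarrow> nat \<Rightarrow> ('a \<Rightarrow> real \<Rightarrow> real) \<Rightarrow>
     (nat \<Rightarrow> 'a \<Rightarrow> complex) \<Rightarrow> (nat \<Rightarrow> 'a \<Rightarrow> complex) \<Rightarrow> bool" where
  "solves_reduced_system \<Omega> T p N q f u \<longleftrightarrow>
     (\<forall>m\<le>N. (AE x in lebesgue_on \<Omega>. residual T p N q u u m x = 0) \<and>
            (\<forall>x\<in>frontier \<Omega>. u m x = 0) \<and>
            (AE x in surface_measure \<Omega>. normal_deriv \<Omega> (u m) x = f m x))"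


section \<open>Carleman weight and Carleman estimate\<close>

definition carleman_weight :: "'a::euclidean_space \<Rightarrow> real \<Rightarrow> real \<Rightarrow> 'a \<Rightarrow> real" where
  "carleman_weight x0 \<beta> lam x = exp (2 * lam * dist x x0 powr (- \<beta>))"

definition carleman_lambda0 :: "'a::euclidean_space set \<Rightarrow> 'a \<Rightarrow> real \<Rightarrow> real" where
  "carleman_lambda0 \<Omega> x0 \<beta> = 2 * (SUP x\<in>closure \<Omega>. dist x x0) powr \<beta>"

text \<open>The field $U$ is built from derivatives of order at most one of $u\in C^2(\overline\Omega)$,
  hence is taken in $C^1(\overline\Omega)$.\<close>

definition carleman_estimate :: "'a::euclidean_space set \<Rightarrow> 'a \<Rightarrow> real \<Rightarrow> bool" where
  "carleman_estimate \<Omega> x0 \<beta>0 \<longleftrightarrow>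
     (\<exists>C>0. \<forall>\<beta>\<ge>\<beta>0. \<forall>lam\<ge>carleman_lambda0 \<Omega> x0 \<beta>. \<forall>u :: 'a \<Rightarrow> complex. Ck_closure 2 \<Omega> u \<longrightarrow>
       (\<exists>U :: 'a \<Rightarrow> 'a. Ck_closure 1 \<Omega> U \<and>
         (\<forall>x\<in>\<Omega>.
            dist x x0 powr (\<beta> + 2) * carleman_weight x0 \<beta> lam x * (cmod (laplacian u x))\<^sup>2
            \<ge> C * (divergence U x
                 + lam ^ 3 * \<beta> ^ 4 * carleman_weight x0 \<beta> lam x *
                     dist x x0 powr (- 2 * \<beta> - 2) * (cmod (u x))\<^sup>2
                 + lam * \<beta> * carleman_weight x0 \<beta> lam x * grad_norm_sq u x)) \<and>
         (\<forall>x\<in>\<Omega>.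
            norm (U x) \<le> C * carleman_weight x0 \<beta> lam x *
              (lam ^ 3 * \<beta> ^ 3 * dist x x0 powr (- 2 * \<beta> - 2) * (cmod (u x))\<^sup>2
               + lam * \<beta> * grad_norm_sq u x))))"


section \<open>Admissible set, functional, fixed point, norm\<close>

text \<open>Vectors $(\varphi_0,\dots,\varphi_N)$ are extensional functions on \<open>{..N}\<close>, so that
  equality in the product space is equality of functions.\<close>

definition admissible ::
    "'a::euclidean_space set \<Rightarrow> real \<Rightarrow> nat \<Rightarrow> real \<Rightarrow> (nat \<Rightarrow> 'a \<Rightarrow> complex) set" where
  "admissible \<Omega> s N M =
     {\<phi> \<in> {..N} \<rightarrow>\<^sub>E Hs \<Omega> s.
        (\<forall>n\<le>N. \<forall>x\<in>frontier \<Omega>. \<phi> n x = 0) \<and>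
        esssup (lebesgue_on \<Omega>) (\<lambda>x. ereal (L2_set (\<lambda>n. cmod (\<phi> n x)) {..N})) \<le> ereal M}"

definition J_functional ::
    "'a::euclidean_space set \<Rightarrow> 'a \<Rightarrow> real \<Rightarrow> real \<Rightarrow> real \<Rightarrow> real \<Rightarrow> nat \<Rightarrow> ('a \<Rightarrow> real \<Rightarrow> real) \<Rightarrow>
     (nat \<Rightarrow> 'a \<Rightarrow> complex) \<Rightarrow> real \<Rightarrow> real \<Rightarrow> (nat \<Rightarrow> 'a \<Rightarrow> complex) \<Rightarrow> (nat \<Rightarrow> 'a \<Rightarrow> complex) \<Rightarrow> real" where
  "J_functional \<Omega> x0 \<beta> s T p N q f lam \<epsilon> \<phi> u =
     (\<Sum>m\<le>N.
        (LINT x:\<Omega>|lebesgue. carleman_weight x0 \<beta> lam x * (cmod (residual T p N q \<phi> u m x))\<^sup>2)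
        + lam ^ 3 * (LINT x|surface_measure \<Omega>.
            carleman_weight x0 \<beta> lam x * (cmod (normal_deriv \<Omega> (u m) x - f m x))\<^sup>2)
        + \<epsilon> * (Hs_norm \<Omega> s (u m))\<^sup>2)"

definition F_map ::
    "'a::euclidean_space set \<Rightarrow> 'a \<Rightarrow> real \<Rightarrow> real \<Rightarrow> real \<Rightarrow> real \<Rightarrow> nat \<Rightarrow> real \<Rightarrow> ('a \<Rightarrow> real \<Rightarrow> real) \<Rightarrow>
     (nat \<Rightarrow> 'a \<Rightarrow> complex) \<Rightarrow> real \<Rightarrow> real \<Rightarrow> (nat \<Rightarrow> 'a \<Rightarrow> complex) \<Rightarrow> (nat \<Rightarrow> 'a \<Rightarrow> complex)" where
  "F_map \<Omega> x0 \<beta> s T p N M q f lam \<epsilon> \<phi> =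
     arg_min_on (J_functional \<Omega> x0 \<beta> s T p N q f lam \<epsilon> \<phi>) (admissible \<Omega> s N M)"

definition is_fixed_point ::
    "'a::euclidean_space set \<Rightarrow> 'a \<Rightarrow> real \<Rightarrow> real \<Rightarrow> real \<Rightarrow> real \<Rightarrow> nat \<Rightarrow> real \<Rightarrow> ('a \<Rightarrow> real \<Rightarrow> real) \<Rightarrow>
     (nat \<Rightarrow> 'a \<Rightarrow> complex) \<Rightarrow> real \<Rightarrow> real \<Rightarrow> (nat \<Rightarrow> 'a \<Rightarrow> complex) \<Rightarrow> bool" where
  "is_fixed_point \<Omega> x0 \<beta> s T p N M q f lam \<epsilon> v \<longleftrightarrow>
     v \<in> admissible \<Omega> s N M \<and> F_map \<Omega> x0 \<beta> s T p N M q f lam \<epsilon> v = v"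

definition fixed_point ::
    "'a::euclidean_space set \<Rightarrow> 'a \<Rightarrow> real \<Rightarrow> real \<Rightarrow> real \<Rightarrow> real \<Rightarrow> nat \<Rightarrow> real \<Rightarrow> ('a \<Rightarrow> real \<Rightarrow> real) \<Rightarrow>
     (nat \<Rightarrow> 'a \<Rightarrow> complex) \<Rightarrow> real \<Rightarrow> real \<Rightarrow> (nat \<Rightarrow> 'a \<Rightarrow> complex)" where
  "fixed_point \<Omega> x0 \<beta> s T p N M q f lam \<epsilon> =
     (THE v. is_fixed_point \<Omega> x0 \<beta> s T p N M q f lam \<epsilon> v)"

definition weighted_norm ::
    "'a::euclidean_space set \<Rightarrow> 'a \<Rightarrow> real \<Rightarrow> real \<Rightarrow> nat \<Rightarrow> real \<Rightarrow> real \<Rightarrow> (nat \<Rightarrow> 'a \<Rightarrow> complex) \<Rightarrow> real" where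
  "weighted_norm \<Omega> x0 \<beta> s N lam \<epsilon> u = sqrt (
     (LINT x:\<Omega>|lebesgue. carleman_weight x0 \<beta> lam x * (\<Sum>n\<le>N. (cmod (u n x))\<^sup>2))
     + 2 * (LINT x|surface_measure \<Omega>.
         carleman_weight x0 \<beta> lam x * (\<Sum>n\<le>N. (cmod (normal_deriv \<Omega> (u n) x))\<^sup>2))
     + 2 * \<epsilon> / lam ^ 3 * (Hs_vec_norm \<Omega> s N u)\<^sup>2)"

end

theory Submission
  imports Defs "HOL-Probability.Characteristic_Functions"
begin

text \<open>Write \<open>Q\<close> for the quadratic part of the functional and \<open>P\<close> for the weighted \<open>L\<^sup>2\<close> norm squared.
  The functional is strongly convex with modulus \<open>Q\<close>, so minimisers exist and \<open>J v \<ge> J u + Q (u - v)\<close>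
  at a minimiser \<open>u\<close>. Integrating the Carleman estimate over the domain gives
  \<open>\<lambda>\<^sup>3 P h \<le> 4 K Q h\<close> for \<open>h\<close> vanishing on the boundary, and the nonlinear term is Lipschitz on the admissible
  set, so for large \<open>\<lambda>\<close> the map \<open>F\<close> contracts \<open>P\<close>, and its iterates converge in \<open>H\<^sup>s\<close>. Comparing the
  functional at the fixed point with its value at the exact solution bounds \<open>Q\<close> of the error.

  The boundary term of the Carleman estimate is controlled without a divergence theorem: the vector field is
  tested against a cutoff depending on the distance to the boundary, and the volume of thin tubes is
  compared with the Hausdorff measure of the boundary.\<close>

section \<open>Hausdorff measure\<close>

text \<open>The Carleman field \<open>U\<close> is known only through a pointwise bound
  \<open>norm (U x) \<le> G x\<close>, so a one-sided divergence inequality with an unspecified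
  constant in front of the boundary integral of \<open>G\<close> serves as well as the exact
  formula. This freedom in the constant is what lets crude packing and covering counts replace an
  area formula for Hausdorff measure. On the boundary \<open>u = 0\<close> leaves only the normal
  derivative in \<open>G\<close>, and the resulting term carries \<open>lam\<close>, against
  \<open>lam ^ 3\<close> in the functional.

  \<open>H\<close> need not be complete for the weighted L2 distance in which \<open>F\<close>
  contracts. Since \<open>Q\<close> contains \<open>\<epsilon>\<close> times the squared H^s norm,
  one more application of \<open>F\<close> turns closeness in that distance into closeness in H^s,
  with a factor \<open>1 / \<epsilon>\<close>. This factor enters the convergence of the iterates
  only, never the threshold or the final constant, which are therefore chosen before
  \<open>q\<close>, \<open>\<epsilon>\<close> and \<open>f\<close>.

  Bounding \<open>Q\<close> of the error and dividing by \<open>lam ^ 3\<close> produces the factor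
  \<open>\<epsilon> / lam ^ 3\<close> and removes the \<open>lam ^ 3\<close> in front of the
  noise.\<close>

lemma metric_outer_measure_separated_sum_le:
  fixes f :: "'a::metric_space set \<Rightarrow> ennreal" and R :: "nat \<Rightarrow> 'a set"
  assumes mono: "\<And>A B. A \<subseteq> B \<Longrightarrow> f A \<le> f B"
    and empty: "f {} = 0"
    and sep: "\<And>A B \<delta>. \<delta> > 0 \<Longrightarrow> (\<And>a b. a \<in> A \<Longrightarrow> b \<in> B \<Longrightarrow> dist a b \<ge> \<delta>) \<Longrightarrow> f A + f B \<le> f (A \<union> B)"
    and R: "\<And>k. \<exists>\<delta>>0. \<forall>j<k. \<forall>a\<in>R j. \<forall>b\<in>R k. dist a b \<ge> \<delta>"
    and sub: "\<And>k. R k \<subseteq> A"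
  shows "(\<Sum>k<m. f (R k)) \<le> f A"
proof -
  have "(\<Sum>k<m. f (R k)) \<le> f (\<Union>k<m. R k)"
  proof (induction m)
    case 0
    then show ?case by (simp add: empty)
  next
    case (Suc m)
    \<comment> \<open>Only the finitely many earlier sets must stay away from \<open>R m\<close>, so
      the separation may shrink as \<open>m\<close> grows.\<close>
    obtain \<delta> where \<delta>: "\<delta> > 0" "\<forall>j<m. \<forall>a\<in>R j. \<forall>b\<in>R m. dist a b \<ge> \<delta>"
      using R by blast
    have "(\<Sum>k<Suc m. f (R k)) \<le> f (\<Union>k<m. R k) + f (R m)"
      using Suc by (simp add: add_mono)
    also have "\<dots> \<le> f ((\<Union>k<m. R k) \<union> R m)"
      using \<delta> by (intro sep[of \<delta>]) auto
    also have "(\<Union>k<m. R k) \<union> R m = (\<Union>k<Suc m. R k)"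
      by (auto simp: less_Suc_eq)
    finally show ?case .
  qed
  also have "\<dots> \<le> f A" using sub by (intro mono) auto
  finally show ?thesis .
qed

text \<open>Caratheodory's criterion. The set \<open>A - F\<close> is exhausted by the points at distance at least
  \<open>1/(n+1)\<close> from \<open>F\<close>; the shells in between, taken with even or with odd index, are mutually
  separated, so their measures are summable.\<close>

lemma metric_outer_measure_closed:
  fixes f :: "'a::metric_space set \<Rightarrow> ennreal"
  assumes oms: "outer_measure_space (Pow UNIV) f"
    and sep: "\<And>A B \<delta>. \<delta> > 0 \<Longrightarrow> (\<And>a b. a \<in> A \<Longrightarrow> b \<in> B \<Longrightarrow> dist a b \<ge> \<delta>) \<Longrightarrow> f A + f B \<le> f (A \<union> B)"
    and F: "closed F"
  shows "f (A \<inter> F) + f (A - F) \<le> f A"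
proof (cases "F = {} \<or> f A = top")
  case True
  with oms show ?thesis by (auto simp: outer_measure_space_def positive_def)
next
  case False
  have empty: "f {} = 0" and mono: "\<And>A B. A \<subseteq> B \<Longrightarrow> f A \<le> f B"
    using oms by (auto simp: outer_measure_space_def positive_def increasing_def)
  have csub: "f (\<Union>i. B i) \<le> (\<Sum>i. f (B i))" for B :: "nat \<Rightarrow> 'a set"
  proof -
    have "f (\<Union>i. B i) = f (\<Union>i. disjointed B i)"
      by (simp add: UN_disjointed_eq)
    also have "\<dots> \<le> (\<Sum>i. f (disjointed B i))"
      using oms disjoint_family_disjointed[of B]
      unfolding outer_measure_space_def countably_subadditive_def by auto
    also have "\<dots> \<le> (\<Sum>i. f (B i))"
      by (intro suminf_le mono disjointed_subset) auto
    finally show ?thesis .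
  qed
  have sub2: "f (B \<union> C) \<le> f B + f C" for B C
  proof -
    have "f (\<Union>i. binaryset B C i) \<le> (\<Sum>i. f (binaryset B C i))" by (rule csub)
    then show ?thesis
      by (simp add: UN_binaryset_eq suminf_binaryset_eq empty)
  qed
  define An where "An n = {x\<in>A. infdist x F \<ge> 1 / real (n + 1)}" for n :: nat
  define R where "R n = {x\<in>A. infdist x F \<ge> 1 / real (n + 2) \<and> infdist x F < 1 / real (n + 1)}" for n :: nat
  have dist_infdist: "infdist x F \<le> infdist y F + dist x y" for x y
    by (rule infdist_triangle)
  \<comment> \<open>Shells of equal parity have a whole shell between them: \<open>R (2*j+p)\<close>
    lies at distance at least \<open>1 / (2*k+p)\<close> from \<open>F\<close>, and
    \<open>R (2*k+p)\<close> at distance below \<open>1 / (2*k+p+1)\<close>. The triangle inequality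
    for \<open>infdist\<close> turns this gap into a distance between the shells.\<close>
  have Rsep: "\<exists>\<delta>>0. \<forall>j<k. \<forall>a\<in>R (2*j+p). \<forall>b\<in>R (2*k+p). dist a b \<ge> \<delta>" for k p
  proof (cases "k = 0")
    case False
    show ?thesis
    proof (intro exI[of _ "1 / real (2*k+p) - 1 / real (2*k+p+1)"] conjI allI impI ballI)
      fix j a b assume j: "j < k" and a: "a \<in> R (2*j+p)" and b: "b \<in> R (2*k+p)"
      have "1 / real (2*k+p) \<le> 1 / real (2*j+p+2)"
        using j by (intro divide_left_mono) auto
      also have "\<dots> \<le> infdist a F" using a by (simp add: R_def)
      finally have 1: "1 / real (2*k+p) \<le> infdist a F" .
      have 2: "infdist b F < 1 / real (2*k+p+1)" using b by (simp add: R_def)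
      show "dist a b \<ge> 1 / real (2*k+p) - 1 / real (2*k+p+1)"
        using 1 2 dist_infdist[of a b] by linarith
    next
      show "0 < 1 / real (2*k+p) - 1 / real (2*k+p+1)"
        using False by (simp add: divide_strict_left_mono)
    qed
  qed (auto intro: exI[of _ 1])
  have half: "(\<Sum>k<m. f (R (2*k+p))) \<le> f A" for m p
    by (rule metric_outer_measure_separated_sum_le[of f "\<lambda>k. R (2*k+p)", OF mono empty sep])
       (use Rsep in \<open>auto simp: R_def\<close>)
  have sumR: "(\<Sum>k<m. f (R k)) \<le> 2 * f A" for m
  proof -
    have "(\<Sum>k<m. f (R k)) \<le> (\<Sum>k<2*m. f (R k))"
      by (intro sum_mono2) auto
    also have "\<dots> = (\<Sum>k<m. f (R (2*k+0))) + (\<Sum>k<m. f (R (2*k+1)))"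
      by (induction m) (auto simp: algebra_simps)
    also have "\<dots> \<le> 2 * f A"
      using add_mono[OF half[where m=m and p=0] half[where m=m and p=1]] by (simp only: mult_2)
    finally show ?thesis .
  qed
  have fin: "f A < top" using False by (simp add: less_top)
  have finR: "f (R k) < top" for k
  proof -
    have "f (R k) \<le> f A" by (rule mono) (auto simp: R_def)
    with fin show ?thesis by simp
  qed
  define r where "r k = enn2real (f (R k))" for k
  have fr: "f (R k) = ennreal (r k)" for k using finR[of k] by (simp add: r_def)
  have r0: "r k \<ge> 0" for k by (simp add: r_def)
  have "summable r"
  proof (rule bounded_imp_summable)
    fix m
    have "ennreal (sum r {..m}) = (\<Sum>k<Suc m. f (R k))"
      by (simp add: fr r0 sum_ennreal lessThan_Suc_atMost)
    also have "\<dots> \<le> 2 * f A" by (rule sumR)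
    also have "2 * f A = ennreal (enn2real (2 * f A))"
      using fin by (simp add: ennreal_mult_less_top)
    finally show "sum r {..m} \<le> enn2real (2 * f A)" by simp
  qed (rule r0)
  show ?thesis
  proof (rule ennreal_le_epsilon)
    fix e :: real assume e: "e > 0"
    \<comment> \<open>The tail of the shell series measures what \<open>An n\<close> misses of
      \<open>A - F\<close>.\<close>
    obtain n where n: "\<And>n'. n' \<ge> n \<Longrightarrow> norm (\<Sum>i. r (i + n')) < e"
      using suminf_exist_split[OF e \<open>summable r\<close>] by blast
    have "(\<Sum>k. f (R (k + n))) = ennreal (\<Sum>i. r (i + n))"
      unfolding fr using r0 \<open>summable r\<close> by (intro suminf_ennreal2) (auto simp: summable_iff_shift)
    also have "\<dots> \<le> ennreal e" using n[of n] by (intro ennreal_leI) auto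
    finally have tail: "(\<Sum>k. f (R (k + n))) \<le> ennreal e" .
    have "A - F \<subseteq> An n \<union> (\<Union>k. R (k + n))"
    proof
      fix x assume x: "x \<in> A - F"
      then have pos: "infdist x F > 0"
        using F False by (simp add: infdist_pos_not_in_closed)
      show "x \<in> An n \<union> (\<Union>k. R (k + n))"
      proof (cases "infdist x F \<ge> 1 / real (n + 1)")
        case False
        \<comment> \<open>The shell containing \<open>x\<close> has as index the predecessor of the
          first \<open>k\<close> with \<open>infdist x F \<ge> 1 / (k + 1)\<close>; such a
          \<open>k\<close> exists because closedness of \<open>F\<close> makes the distance
          positive.\<close>
        define P where "P k = (infdist x F \<ge> 1 / real (k + 1))" for k
        obtain k0 where "1 / real (k0 + 1) < infdist x F"
          using nat_approx_posE[OF pos] by (metis Suc_eq_plus1)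
        then have "P k0" by (simp add: P_def)
        define k where "k = (LEAST k. P k)"
        have Pk: "P k" unfolding k_def by (rule LeastI) fact
        have "\<not> P n" using False by (simp add: P_def)
        have nP: "\<not> P j" if "j \<le> n" for j
        proof
          assume "P j"
          moreover have "1 / real (n + 1) \<le> 1 / real (j + 1)" using that by (simp add: frac_le)
          ultimately show False using False by (simp add: P_def)
        qed
        have "k > n" using nP Pk by (meson not_le)
        then obtain m where k: "k = Suc m" "m \<ge> n" by (cases k) auto
        have "\<not> P m" using not_less_Least[of m P] k by (simp add: k_def)
        with Pk k x have "x \<in> R (m - n + n)" by (auto simp: P_def R_def add_ac)
        then show ?thesis by blast
      qed (use x in \<open>auto simp: An_def\<close>)
    qed
    then have "f (A - F) \<le> f (An n) + f (\<Union>k. R (k + n))"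
      by (rule order_trans[OF mono sub2])
    also have "\<dots> \<le> f (An n) + ennreal e"
      using order_trans[OF csub tail] by (intro add_mono) auto
    finally have 1: "f (A - F) \<le> f (An n) + ennreal e" .
    have "f (A \<inter> F) + f (An n) \<le> f ((A \<inter> F) \<union> An n)"
    proof (rule sep[of "1 / real (n + 1)"])
      fix a b assume "a \<in> A \<inter> F" "b \<in> An n"
      then show "1 / real (n + 1) \<le> dist a b"
        using infdist_le[of a F b] by (auto simp: An_def dist_commute)
    qed simp
    also have "\<dots> \<le> f A" by (rule mono) (auto simp: An_def)
    finally have 2: "f (A \<inter> F) + f (An n) \<le> f A" .
    have "f (A \<inter> F) + f (A - F) \<le> f (A \<inter> F) + (f (An n) + ennreal e)"
      using 1 by (rule add_left_mono)
    also have "\<dots> \<le> f A + ennreal e" using 2 by (simp add: add.assoc[symmetric] add_right_mono)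
    finally show "f (A \<inter> F) + f (A - F) \<le> f A + ennreal e" .
  qed
qed

text \<open>Each closed set splits every set additively, so it belongs to the lambda system, on
  which an outer measure is a measure; the closed sets generate the Borel sets.\<close>

lemma metric_outer_measure_measure_space:
  fixes f :: "'a::metric_space set \<Rightarrow> ennreal"
  assumes oms: "outer_measure_space (Pow UNIV) f"
    and sep: "\<And>A B \<delta>. \<delta> > 0 \<Longrightarrow> (\<And>a b. a \<in> A \<Longrightarrow> b \<in> B \<Longrightarrow> dist a b \<ge> \<delta>) \<Longrightarrow> f A + f B \<le> f (A \<union> B)"
  shows "measure_space UNIV (sets borel) f"
proof -
  interpret P: sigma_algebra UNIV "Pow (UNIV :: 'a set)" by (rule sigma_algebra_Pow)
  let ?L = "lambda_system UNIV (Pow UNIV) f"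
  have ms: "measure_space UNIV ?L f"
    by (rule P.caratheodory_lemma[OF oms])
  then have sa: "sigma_algebra UNIV ?L" by (simp add: measure_space_def)
  have csub: "countably_subadditive (Pow UNIV) f" and pos: "positive (Pow UNIV) f"
    using oms by (auto simp: outer_measure_space_def)
  have subadd: "f (A \<union> B) \<le> f A + f B" if "A \<inter> B = {}" for A B
    using subadditiveD[OF P.countably_subadditive_subadditive[OF pos csub], where x=A and y=B] that by simp
  have "closed F \<Longrightarrow> F \<in> ?L" for F
    unfolding lambda_system_def
  proof safe
    fix A assume F: "closed F"
    have "f (F \<inter> A) + f ((UNIV - F) \<inter> A) \<le> f A"
      using metric_outer_measure_closed[where A=A, OF oms sep F] by (simp add: Int_commute Diff_eq)
    moreover have "f A \<le> f (F \<inter> A) + f ((UNIV - F) \<inter> A)"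
      using subadd[of "F \<inter> A" "(UNIV - F) \<inter> A"] by (auto simp: Int_Un_distrib2[symmetric])
    ultimately show "f (F \<inter> A) + f ((UNIV - F) \<inter> A) = f A" by simp
  qed auto
  then have "sigma_sets UNIV (Collect closed) \<subseteq> ?L"
    by (intro sigma_algebra.sigma_sets_subset[OF sa]) auto
  then have "sets borel \<subseteq> ?L"
    by (simp add: borel_eq_closed)
  moreover have "sigma_algebra UNIV (sets (borel :: 'a measure))"
    using sets.sigma_algebra_axioms[of "borel :: 'a measure"] by simp
  ultimately show ?thesis by (rule measure_down[OF ms, rotated])
qed

section \<open>Hausdorff contents and the outer measure they define\<close>

definition hausdorff_outer :: "nat \<Rightarrow> 'a::euclidean_space set \<Rightarrow> ennreal" where
  "hausdorff_outer k A = (SUP \<delta>\<in>{0<..}. hausdorff_content k \<delta> A)"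

lemma hausdorff_content_le:
  assumes "A \<subseteq> (\<Union>i. C i)" "\<And>i. bounded (C i)" "\<And>i. diameter (C i) \<le> \<delta>"
  shows "hausdorff_content k \<delta> A \<le> (\<Sum>i. hausdorff_weight k (C i))"
  unfolding hausdorff_content_def using assms by (intro INF_lower) auto

lemma hausdorff_content_antimono:
  "\<delta> \<le> \<delta>' \<Longrightarrow> hausdorff_content k \<delta>' A \<le> hausdorff_content k \<delta> A"
  unfolding hausdorff_content_def by (intro INF_superset_mono) (auto intro: order_trans)

lemma hausdorff_content_mono:
  "A \<subseteq> B \<Longrightarrow> hausdorff_content k \<delta> A \<le> hausdorff_content k \<delta> B"
  unfolding hausdorff_content_def by (intro INF_superset_mono) auto

lemma hausdorff_weight_empty [simp]: "hausdorff_weight k {} = 0"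
  by (simp add: hausdorff_weight_def)

lemma hausdorff_weight_mono:
  assumes "A \<subseteq> B" "bounded B"
  shows "hausdorff_weight k A \<le> hausdorff_weight k B"
proof (cases "A = {}")
  case False
  then show ?thesis using assms
    by (auto simp: hausdorff_weight_def unit_ball_vol_nonneg
        intro!: ennreal_leI mult_left_mono power_mono diameter_subset diameter_ge_0
          bounded_subset[OF assms(2,1)] divide_right_mono)
qed simp

lemma hausdorff_content_empty: "\<delta> \<ge> 0 \<Longrightarrow> hausdorff_content k \<delta> {} = 0"
  using hausdorff_content_le[of "{}" "\<lambda>_. {}" \<delta> k] by simp

text \<open>Take for \<open>A n\<close> a cover exceeding the infimum by at most
  \<open>e * (1/2)^Suc n\<close> and enumerate the double family through \<open>prod_decode\<close>;
  the excesses add up to \<open>e\<close>. The scale \<open>\<delta>\<close> is kept, so the bound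
  survives the supremum over \<open>\<delta>\<close>.\<close>

lemma hausdorff_content_countably_subadditive:
  "hausdorff_content k \<delta> (\<Union>i::nat. A i) \<le> (\<Sum>i. hausdorff_content k \<delta> (A i))"
proof (rule ennreal_le_epsilon)
  let ?w = "hausdorff_weight k"
  fix e :: real assume e: "0 < e" and fin: "(\<Sum>n. hausdorff_content k \<delta> (A n)) < top"
  then have *: "\<And>n. hausdorff_content k \<delta> (A n) < hausdorff_content k \<delta> (A n) + e * (1/2)^Suc n"
    by (auto simp add: less_top dest!: ennreal_suminf_lessD)
  have "\<exists>C. A n \<subseteq> (\<Union>i::nat. C i) \<and> (\<forall>i. bounded (C i) \<and> diameter (C i) \<le> \<delta>) \<and>
          (\<Sum>i. ?w (C i)) < hausdorff_content k \<delta> (A n) + e * (1/2)^Suc n" for n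
    using *[of n] unfolding hausdorff_content_def[of k \<delta> "A n"] by (auto simp: INF_less_iff)
  then obtain B where B: "\<And>n. A n \<subseteq> (\<Union>i::nat. B n i)" "\<And>n i. bounded (B n i)"
      "\<And>n i. diameter (B n i) \<le> \<delta>"
      and Ble: "\<And>n. (\<Sum>i. ?w (B n i)) \<le> hausdorff_content k \<delta> (A n) + e * (1/2)^Suc n"
    by (metis less_imp_le)
  define C where "C = case_prod B o prod_decode"
  have A_C: "(\<Union>i. A i) \<subseteq> (\<Union>i. C i)"
    using B(1) by (auto simp add: C_def subset_eq) (metis prod.case prod_encode_inverse)
  have "hausdorff_content k \<delta> (\<Union>i. A i) \<le> (\<Sum>i. ?w (C i))"
    using A_C B by (intro hausdorff_content_le) (auto simp: C_def split: prod.split)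
  also have "\<dots> = (\<Sum>n. \<Sum>i. ?w (B n i))"
    unfolding C_def comp_def by (intro suminf_ennreal_2dimen) auto
  also have "\<dots> \<le> (\<Sum>n. hausdorff_content k \<delta> (A n) + e * (1/2) ^ Suc n)"
    by (intro suminf_le suminf_nonneg allI Ble) auto
  also have "... = (\<Sum>n. hausdorff_content k \<delta> (A n)) + (\<Sum>n. ennreal e * ennreal ((1/2) ^ Suc n))"
    using \<open>0 < e\<close> by (subst suminf_add[symmetric])
                     (auto simp del: ennreal_suminf_cmult simp add: ennreal_mult[symmetric])
  also have "\<dots> = (\<Sum>n. hausdorff_content k \<delta> (A n)) + e"
    unfolding ennreal_suminf_cmult
    by (subst suminf_ennreal_eq[OF zero_le_power power_half_series]) auto
  finally show "hausdorff_content k \<delta> (\<Union>i. A i) \<le> (\<Sum>n. hausdorff_content k \<delta> (A n)) + e" .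
qed

lemma hausdorff_content_le_outer: "\<delta> > 0 \<Longrightarrow> hausdorff_content k \<delta> A \<le> hausdorff_outer k A"
  unfolding hausdorff_outer_def by (intro SUP_upper) auto

lemma hausdorff_outer_least:
  "(\<And>\<delta>. \<delta> > 0 \<Longrightarrow> hausdorff_content k \<delta> A \<le> c) \<Longrightarrow> hausdorff_outer k A \<le> c"
  unfolding hausdorff_outer_def by (intro SUP_least) auto

lemma outer_measure_space_hausdorff_outer:
  "outer_measure_space (Pow UNIV) (hausdorff_outer k)"
  unfolding outer_measure_space_def positive_def increasing_def countably_subadditive_def
proof safe
  show "hausdorff_outer k ({} :: 'a set) = 0"
    by (simp add: hausdorff_outer_def hausdorff_content_empty)
  show "hausdorff_outer k A \<le> hausdorff_outer k B" if "A \<subseteq> B" for A B :: "'a set"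
    unfolding hausdorff_outer_def using that by (intro SUP_mono') (rule hausdorff_content_mono)
  show "hausdorff_outer k (\<Union>i. A i) \<le> (\<Sum>i. hausdorff_outer k (A i))" for A :: "nat \<Rightarrow> 'a set"
  proof (rule hausdorff_outer_least)
    fix \<delta> :: real assume "\<delta> > 0"
    have "hausdorff_content k \<delta> (\<Union>i. A i) \<le> (\<Sum>i. hausdorff_content k \<delta> (A i))"
      by (rule hausdorff_content_countably_subadditive)
    also have "\<dots> \<le> (\<Sum>i. hausdorff_outer k (A i))"
      using \<open>\<delta> > 0\<close> by (intro suminf_le hausdorff_content_le_outer) auto
    finally show "hausdorff_content k \<delta> (\<Union>i. A i) \<le> (\<Sum>i. hausdorff_outer k (A i))" .
  qed
qed

text \<open>A covering set of diameter at most \<open>\<delta>\<close> cannot meet both sides, so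
  intersecting a cover of the union with \<open>A\<close> and with \<open>B\<close> gives two covers
  in which each index contributes to at most one sum. For \<open>k = 0\<close> this relies on the
  empty set having weight 0.\<close>

lemma hausdorff_content_separated:
  fixes A B :: "'a::euclidean_space set"
  assumes "\<delta> < \<eta>" and sep: "\<And>a b. a \<in> A \<Longrightarrow> b \<in> B \<Longrightarrow> dist a b \<ge> \<eta>"
  shows "hausdorff_content k \<delta> A + hausdorff_content k \<delta> B \<le> hausdorff_content k \<delta> (A \<union> B)"
  unfolding hausdorff_content_def[of k \<delta> "A \<union> B"]
proof (safe intro!: INF_greatest)
  fix C :: "nat \<Rightarrow> 'a set"
  assume cov: "A \<union> B \<subseteq> (\<Union>i. C i)" and C: "\<forall>i. bounded (C i) \<and> diameter (C i) \<le> \<delta>"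
  let ?w = "hausdorff_weight k"
  have disj: "C i \<inter> A = {} \<or> C i \<inter> B = {}" for i
  proof (rule ccontr)
    assume "\<not> ?thesis"
    then obtain a b where ab: "a \<in> C i" "a \<in> A" "b \<in> C i" "b \<in> B" by blast
    then have "dist a b \<le> \<delta>" using C diameter_bounded_bound[of "C i" a b] by (meson order_trans)
    with sep[of a b] ab assms(1) show False by auto
  qed
  have "hausdorff_content k \<delta> A \<le> (\<Sum>i. ?w (C i \<inter> A))"
    using cov C by (intro hausdorff_content_le)
      (auto intro: bounded_subset order_trans[OF diameter_subset])
  moreover have "hausdorff_content k \<delta> B \<le> (\<Sum>i. ?w (C i \<inter> B))"
    using cov C by (intro hausdorff_content_le)
      (auto intro: bounded_subset order_trans[OF diameter_subset])
  ultimately have "hausdorff_content k \<delta> A + hausdorff_content k \<delta> B \<le>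
      (\<Sum>i. ?w (C i \<inter> A)) + (\<Sum>i. ?w (C i \<inter> B))" by (rule add_mono)
  also have "\<dots> = (\<Sum>i. ?w (C i \<inter> A) + ?w (C i \<inter> B))"
    by (rule suminf_add) auto
  also have "\<dots> \<le> (\<Sum>i. ?w (C i))"
  proof (intro suminf_le)
    fix i
    show "?w (C i \<inter> A) + ?w (C i \<inter> B) \<le> ?w (C i)"
      using disj[of i] C hausdorff_weight_mono[of "C i \<inter> A" "C i" k] hausdorff_weight_mono[of "C i \<inter> B" "C i" k]
        by auto
  qed auto
  finally show "hausdorff_content k \<delta> A + hausdorff_content k \<delta> B \<le> (\<Sum>i. ?w (C i))" .
qed

text \<open>Contents grow as the scale shrinks, so the scale may be lowered below the separation
  before the two sides are compared; directedness lets the sum of two suprema be taken at a common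
  scale.\<close>

lemma hausdorff_outer_separated:
  fixes A B :: "'a::euclidean_space set"
  assumes "\<eta> > 0" and sep: "\<And>a b. a \<in> A \<Longrightarrow> b \<in> B \<Longrightarrow> dist a b \<ge> \<eta>"
  shows "hausdorff_outer k A + hausdorff_outer k B \<le> hausdorff_outer k (A \<union> B)"
proof -
  have "hausdorff_outer k A + hausdorff_outer k B =
      (SUP \<delta>\<in>{0<..}. hausdorff_content k \<delta> A + hausdorff_content k \<delta> B)"
    unfolding hausdorff_outer_def
  proof (rule SUP_add_directed_ennreal[symmetric])
    fix i j :: real assume "i \<in> {0<..}" "j \<in> {0<..}"
    then show "\<exists>k'\<in>{0<..}. hausdorff_content k i A + hausdorff_content k j B \<le>
        hausdorff_content k k' A + hausdorff_content k k' B"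
      by (intro bexI[of _ "min i j"] add_mono hausdorff_content_antimono) auto
  qed
  also have "\<dots> \<le> hausdorff_outer k (A \<union> B)"
  proof (rule SUP_least)
    fix \<delta> :: real assume "\<delta> \<in> {0<..}"
    define \<delta>' where "\<delta>' = min \<delta> (\<eta> / 2)"
    have "\<delta>' > 0" "\<delta>' < \<eta>" "\<delta>' \<le> \<delta>" using \<open>\<delta> \<in> {0<..}\<close> assms(1) by (auto simp: \<delta>'_def)
    have "hausdorff_content k \<delta> A + hausdorff_content k \<delta> B \<le>
        hausdorff_content k \<delta>' A + hausdorff_content k \<delta>' B"
      by (intro add_mono hausdorff_content_antimono) fact+
    also have "\<dots> \<le> hausdorff_content k \<delta>' (A \<union> B)"
      by (rule hausdorff_content_separated[OF \<open>\<delta>' < \<eta>\<close> sep])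
    also have "\<dots> \<le> hausdorff_outer k (A \<union> B)"
      by (rule hausdorff_content_le_outer) fact
    finally show "hausdorff_content k \<delta> A + hausdorff_content k \<delta> B \<le> hausdorff_outer k (A \<union> B)" .
  qed
  finally show ?thesis .
qed

lemma sets_hausdorff_measure [simp, measurable_cong]: "sets (hausdorff_measure k) = sets borel"
  unfolding hausdorff_measure_def by (metis sets.sigma_sets_eq sets_measure_of space_borel subset_UNIV Pow_UNIV)

lemma space_hausdorff_measure [simp]: "space (hausdorff_measure k) = UNIV"
  by (simp add: hausdorff_measure_def)

text \<open>\<open>measure_of\<close> takes its values from the given set function only if that
  function is a measure on the generated sigma-algebra; otherwise it is the zero measure. The metric
  criterion supplies this.\<close>

lemma emeasure_hausdorff_measure:
  assumes "A \<in> sets borel"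
  shows "emeasure (hausdorff_measure k) A = hausdorff_outer k A"
proof -
  have ms: "measure_space UNIV (sets borel) (hausdorff_outer k :: 'a set \<Rightarrow> ennreal)"
    by (rule metric_outer_measure_measure_space[OF outer_measure_space_hausdorff_outer hausdorff_outer_separated])
  have sets: "sigma_sets UNIV (sets borel) = sets (borel :: 'a measure)"
    using sets.sigma_sets_eq[of "borel :: 'a measure"] by simp
  show ?thesis
    unfolding hausdorff_measure_def
    using ms assms
    by (subst emeasure_measure_of_sigma)
      (auto simp: measure_space_def hausdorff_outer_def[abs_def] sets)
qed

section \<open>Smooth boundaries as Lipschitz graphs\<close>

lemma partial_deriv_eq:
  assumes "(f has_derivative f') (at x)"
  shows "partial_deriv i f x = f' i"
proof -
  have "((\<lambda>t. f (x + t *\<^sub>R i)) has_vector_derivative f' i) (at 0)"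
    unfolding has_vector_derivative_def
  proof (rule has_derivative_eq_rhs)
    have "((\<lambda>t. x + t *\<^sub>R i) has_derivative (\<lambda>t. t *\<^sub>R i)) (at 0)"
      by (auto intro!: derivative_eq_intros)
    moreover have "(f has_derivative f') (at (x + 0 *\<^sub>R i))" using assms by simp
    ultimately show "((\<lambda>t. f (x + t *\<^sub>R i)) has_derivative (\<lambda>t. f' (t *\<^sub>R i))) (at 0)"
      by (rule has_derivative_compose)
    show "(\<lambda>t. f' (t *\<^sub>R i)) = (\<lambda>t. t *\<^sub>R f' i)"
      using has_derivative_linear[OF assms] by (simp add: linear_cmul)
  qed
  then show ?thesis unfolding partial_deriv_def by (rule vector_derivative_at)
qed

lemma has_derivative_partial_deriv:
  fixes f :: "'a::euclidean_space \<Rightarrow> 'b::real_normed_vector"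
  assumes "f differentiable (at x)"
  shows "(f has_derivative (\<lambda>v. \<Sum>j\<in>Basis. (v \<bullet> j) *\<^sub>R partial_deriv j f x)) (at x)"
proof -
  obtain f' where f': "(f has_derivative f') (at x)" using assms by (auto simp: differentiable_def)
  have lin: "linear f'" by (rule has_derivative_linear[OF f'])
  have "f' v = (\<Sum>j\<in>Basis. (v \<bullet> j) *\<^sub>R partial_deriv j f x)" for v
  proof -
    have "f' v = f' (\<Sum>j\<in>Basis. (v \<bullet> j) *\<^sub>R j)" by (simp add: euclidean_representation)
    also have "\<dots> = (\<Sum>j\<in>Basis. (v \<bullet> j) *\<^sub>R f' j)"
      by (simp add: linear_sum[OF lin] linear_cmul[OF lin])
    finally show ?thesis by (simp add: partial_deriv_eq[OF f'])
  qed
  then have "f' = (\<lambda>v. \<Sum>j\<in>Basis. (v \<bullet> j) *\<^sub>R partial_deriv j f x)" by (rule ext)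
  with f' show ?thesis by simp
qed

text \<open>The differential appears through coordinate functions \<open>g j\<close> because the
  applications bound the component along one axis from below and the others from above.\<close>

lemma ball_mvt:
  fixes f :: "'a::euclidean_space \<Rightarrow> real"
  assumes f: "\<And>y. y \<in> ball x r \<Longrightarrow> (f has_derivative (\<lambda>v. \<Sum>j\<in>Basis. (v \<bullet> j) * g j y)) (at y)"
    and ab: "a \<in> ball x r" "b \<in> ball x r"
  shows "\<exists>y\<in>ball x r. f b - f a = (\<Sum>j\<in>Basis. ((b - a) \<bullet> j) * g j y)"
proof -
  have seg: "a + t *\<^sub>R (b - a) \<in> ball x r" if "t \<in> {0..1}" for t
  proof -
    have "(1 - t) *\<^sub>R a + t *\<^sub>R b \<in> ball x r"
      using convex_ball[of x r] ab that by (intro convexD) auto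
    then show ?thesis by (simp add: algebra_simps)
  qed
  have "\<exists>t\<in>{0..1}. f (a + 1 *\<^sub>R (b - a)) - f (a + 0 *\<^sub>R (b - a)) =
     (\<lambda>h. \<Sum>j\<in>Basis. ((h *\<^sub>R (b - a)) \<bullet> j) * g j (a + t *\<^sub>R (b - a))) (1 - 0)"
  proof (rule mvt_very_simple)
    fix t :: real assume t: "0 \<le> t" "t \<le> 1"
    have "((\<lambda>t. a + t *\<^sub>R (b - a)) has_derivative (\<lambda>h. h *\<^sub>R (b - a))) (at t within {0..1})"
      by (auto intro!: derivative_eq_intros)
    from has_derivative_compose[OF this f[OF seg]] t
    show "((\<lambda>t. f (a + t *\<^sub>R (b - a))) has_derivative
        (\<lambda>h. \<Sum>j\<in>Basis. ((h *\<^sub>R (b - a)) \<bullet> j) * g j (a + t *\<^sub>R (b - a)))) (at t within {0..1})"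
      by simp
  qed simp
  with seg show ?thesis by fastforce
qed

text \<open>In the ball of radius \<open>r\<close> around \<open>x\<close> the set \<open>S\<close> is, in the coordinate direction \<open>i\<close>, the
  graph of an \<open>L\<close>-Lipschitz function of the remaining coordinates; \<open>p\<close> is a horizontal
  displacement.\<close>

definition lipschitz_graph_at ::
    "'a::euclidean_space set \<Rightarrow> real \<Rightarrow> real \<Rightarrow> 'a \<Rightarrow> 'a \<Rightarrow> bool" where
  "lipschitz_graph_at S L r x i \<longleftrightarrow> i \<in> Basis \<and>
     (\<forall>y\<in>S \<inter> ball x r. \<forall>z\<in>S \<inter> ball x r.
        \<bar>(y - z) \<bullet> i\<bar> \<le> L * (\<Sum>j\<in>Basis - {i}. \<bar>(y - z) \<bullet> j\<bar>)) \<and>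
     (\<forall>y\<in>S \<inter> ball x (r / 2). \<forall>p t. p \<bullet> i = 0 \<longrightarrow> t < r / 4 \<longrightarrow>
        L * (\<Sum>j\<in>Basis - {i}. \<bar>p \<bullet> j\<bar>) \<le> t \<longrightarrow> (\<exists>\<tau>. \<bar>\<tau>\<bar> \<le> t \<and> y + p + \<tau> *\<^sub>R i \<in> S))"

lemma lipschitz_graph_at_mono:
  assumes "lipschitz_graph_at S L R x i" "L \<le> L'" "ball y r \<subseteq> ball x R" "ball y (r / 2) \<subseteq> ball x (R / 2)" "r \<le> R"
  shows "lipschitz_graph_at S L' r y i"
proof -
  have le: "L * (\<Sum>j\<in>Basis - {i}. \<bar>v \<bullet> j\<bar>) \<le> L' * (\<Sum>j\<in>Basis - {i}. \<bar>v \<bullet> j\<bar>)" for v :: 'a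
    using assms(2) by (intro mult_right_mono sum_nonneg) auto
  show ?thesis unfolding lipschitz_graph_at_def
  proof (intro conjI ballI allI impI)
    show "i \<in> Basis" using assms(1) by (simp add: lipschitz_graph_at_def)
    fix a b assume "a \<in> S \<inter> ball y r" "b \<in> S \<inter> ball y r"
    then have "\<bar>(a - b) \<bullet> i\<bar> \<le> L * (\<Sum>j\<in>Basis - {i}. \<bar>(a - b) \<bullet> j\<bar>)"
      using assms(1,3) unfolding lipschitz_graph_at_def by blast
    with le[of "a - b"] show "\<bar>(a - b) \<bullet> i\<bar> \<le> L' * (\<Sum>j\<in>Basis - {i}. \<bar>(a - b) \<bullet> j\<bar>)" by linarith
  next
    fix a p t assume "a \<in> S \<inter> ball y (r / 2)" "p \<bullet> i = 0" "t < r / 4" "L' * (\<Sum>j\<in>Basis - {i}. \<bar>p \<bullet> j\<bar>) \<le> t"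
    then have "a \<in> S \<inter> ball x (R / 2)" "p \<bullet> i = 0" "t < R / 4" "L * (\<Sum>j\<in>Basis - {i}. \<bar>p \<bullet> j\<bar>) \<le> t"
      using assms(4,5) le[of p] by auto
    then show "\<exists>\<tau>. \<bar>\<tau>\<bar> \<le> t \<and> a + p + \<tau> *\<^sub>R i \<in> S"
      using assms(1) unfolding lipschitz_graph_at_def by blast
  qed
qed

text \<open>A quantitative implicit function theorem. The mean value theorem with
  \<open>f y = f z = 0\<close> bounds the component along \<open>i\<close> by \<open>C / c\<close>
  times the others. Conversely, a horizontal displacement \<open>p\<close> changes \<open>f\<close>
  by at most \<open>C\<close> times its 1-norm, that is by at most \<open>c * t\<close>, while
  moving by \<open>t\<close> along \<open>i\<close> changes it by at least \<open>c * t\<close>; so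
  \<open>f\<close> is \<open>\<le> 0\<close> at height \<open>-t\<close> and \<open>\<ge> 0\<close>
  at height \<open>t\<close>, with a zero in between.\<close>

lemma lipschitz_graph_at_level_set:
  fixes f :: "'a::euclidean_space \<Rightarrow> real"
  assumes f: "\<And>y. y \<in> ball x r \<Longrightarrow> (f has_derivative (\<lambda>v. \<Sum>j\<in>Basis. (v \<bullet> j) * g j y)) (at y)"
    and i: "i \<in> Basis" and c: "c > 0" "\<And>y. y \<in> ball x r \<Longrightarrow> g i y \<ge> c"
    and C: "C \<ge> c" "\<And>y j. y \<in> ball x r \<Longrightarrow> j \<in> Basis \<Longrightarrow> \<bar>g j y\<bar> \<le> C"
    and S: "\<And>y. y \<in> ball x r \<Longrightarrow> y \<in> S \<longleftrightarrow> f y = 0"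
  shows "lipschitz_graph_at S (C / c) r x i"
proof -
  let ?H = "\<lambda>v :: 'a. \<Sum>j\<in>Basis - {i}. \<bar>v \<bullet> j\<bar>"
  have split: "(\<Sum>j\<in>Basis. (v \<bullet> j) * g j y) = (v \<bullet> i) * g i y + (\<Sum>j\<in>Basis - {i}. (v \<bullet> j) * g j y)" for v y
    using i by (simp add: sum.remove)
  have rest: "\<bar>\<Sum>j\<in>Basis - {i}. (v \<bullet> j) * g j y\<bar> \<le> C * ?H v" if "y \<in> ball x r" for v y
  proof -
    have "\<bar>\<Sum>j\<in>Basis - {i}. (v \<bullet> j) * g j y\<bar> \<le> (\<Sum>j\<in>Basis - {i}. \<bar>v \<bullet> j\<bar> * \<bar>g j y\<bar>)"
      by (metis (no_types, lifting) sum_abs abs_mult sum.cong)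
    also have "\<dots> \<le> (\<Sum>j\<in>Basis - {i}. \<bar>v \<bullet> j\<bar> * C)"
      using C(2)[OF that] by (intro sum_mono mult_left_mono) auto
    finally show ?thesis by (simp add: sum_distrib_left sum_distrib_right mult.commute)
  qed
  have Cc: "C / c \<ge> 1" using c C by simp
  show ?thesis unfolding lipschitz_graph_at_def
  proof (intro conjI ballI allI impI i)
    fix y z assume yz: "y \<in> S \<inter> ball x r" "z \<in> S \<inter> ball x r"
    then obtain w where w: "w \<in> ball x r" "f y - f z = (\<Sum>j\<in>Basis. ((y - z) \<bullet> j) * g j w)"
      using ball_mvt[of x r f g z y, OF f] by auto
    then have eq: "((y - z) \<bullet> i) * g i w = - (\<Sum>j\<in>Basis - {i}. ((y - z) \<bullet> j) * g j w)"
      using yz S[of y] S[of z] split[of "y - z" w] by simp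
    have "\<bar>(y - z) \<bullet> i\<bar> * g i w \<le> C * ?H (y - z)"
    proof -
      have "\<bar>((y - z) \<bullet> i) * g i w\<bar> = \<bar>(y - z) \<bullet> i\<bar> * g i w"
        using c(1) c(2)[OF w(1)] by (simp add: abs_mult)
      then show ?thesis using eq rest[OF w(1), of "y - z"] by simp
    qed
    moreover have "\<bar>(y - z) \<bullet> i\<bar> * c \<le> \<bar>(y - z) \<bullet> i\<bar> * g i w"
      using c(2)[OF w(1)] by (intro mult_left_mono) auto
    ultimately have "\<bar>(y - z) \<bullet> i\<bar> * c \<le> C * ?H (y - z)" by linarith
    then show "\<bar>(y - z) \<bullet> i\<bar> \<le> C / c * ?H (y - z)" using c(1) by (simp add: field_simps)
  next
    fix y p t assume y: "y \<in> S \<inter> ball x (r / 2)" and p: "p \<bullet> i = 0" and t: "t < r / 4" and pt: "C / c * ?H p \<le> t"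
    have H0: "?H p \<ge> 0" by (intro sum_nonneg) auto
    have "1 * ?H p \<le> C / c * ?H p" using Cc H0 by (rule mult_right_mono)
    then have Hp: "?H p \<le> t" using pt by simp
    with H0 have t0: "t \<ge> 0" by linarith
    have "norm p \<le> (\<Sum>j\<in>Basis. \<bar>p \<bullet> j\<bar>)" by (rule norm_le_l1)
    also have "\<dots> = ?H p" using i p by (simp add: sum.remove)
    finally have np: "norm p \<le> t" using Hp by simp
    have "dist x y < r / 2" using y by simp
    then have r0: "r > 0" using zero_le_dist[of x y] by linarith
    have yr: "y \<in> ball x r" using y r0 by auto
    \<comment> \<open>The radii in \<open>lipschitz_graph_at\<close> are made for this: the distance
      to \<open>x\<close> stays below \<open>r / 2 + t + t < r\<close>.\<close>
    have inb: "y + p + \<tau> *\<^sub>R i \<in> ball x r" if "\<bar>\<tau>\<bar> \<le> t" for \<tau>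
    proof -
      have "dist x (y + p + \<tau> *\<^sub>R i) \<le> dist x y + norm p + norm (\<tau> *\<^sub>R i)"
        unfolding dist_norm using norm_triangle_ineq4[of "x - y" "p + \<tau> *\<^sub>R i"] norm_triangle_ineq[of p "\<tau> *\<^sub>R i"]
        by (simp add: algebra_simps)
      also have "norm (\<tau> *\<^sub>R i) = \<bar>\<tau>\<bar>" using i by simp
      finally show ?thesis using np that t y by auto
    qed
    have Hpt: "C * ?H p \<le> t * c" using pt c(1) by (simp add: field_simps)
    have fy: "f y = 0" using S[OF yr] y by simp
    have Hv: "?H (p + \<tau> *\<^sub>R i) = ?H p" for \<tau>
      using i by (intro sum.cong) (auto simp: inner_add_left inner_not_same_Basis)
    have up: "f (y + p + t *\<^sub>R i) \<ge> 0"
    proof -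
      obtain w where w: "w \<in> ball x r" "f (y + p + t *\<^sub>R i) - f y = (\<Sum>j\<in>Basis. ((p + t *\<^sub>R i) \<bullet> j) * g j w)"
        using ball_mvt[of x r f g y "y + p + t *\<^sub>R i", OF f] inb[of t] t0 yr by (auto simp: algebra_simps)
      have e: "(p + t *\<^sub>R i) \<bullet> i = t" using p i by (simp add: inner_add_left)
      have "f (y + p + t *\<^sub>R i) = t * g i w + (\<Sum>j\<in>Basis - {i}. ((p + t *\<^sub>R i) \<bullet> j) * g j w)"
        using w(2) fy unfolding split e by simp
      moreover have "t * g i w \<ge> t * c" using c(2)[OF w(1)] t0 by (rule mult_left_mono)
      ultimately show ?thesis using rest[OF w(1), of "p + t *\<^sub>R i"] Hpt unfolding Hv by linarith
    qed
    have down: "f (y + p + (- t) *\<^sub>R i) \<le> 0"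
    proof -
      obtain w where w: "w \<in> ball x r" "f (y + p + (-t) *\<^sub>R i) - f y = (\<Sum>j\<in>Basis. ((p + (-t) *\<^sub>R i) \<bullet> j) * g j w)"
        using ball_mvt[of x r f g y "y + p + (-t) *\<^sub>R i", OF f] inb[of "-t"] t0 yr by (auto simp: algebra_simps)
      have e: "(p + (-t) *\<^sub>R i) \<bullet> i = - t" using p i by (simp add: inner_diff_left)
      have "f (y + p + (-t) *\<^sub>R i) = - (t * g i w) + (\<Sum>j\<in>Basis - {i}. ((p + (-t) *\<^sub>R i) \<bullet> j) * g j w)"
        using w(2) fy unfolding split e by simp
      moreover have "t * g i w \<ge> t * c" using c(2)[OF w(1)] t0 by (rule mult_left_mono)
      ultimately show ?thesis using rest[OF w(1), of "p + (-t) *\<^sub>R i"] Hpt unfolding Hv by linarith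
    qed
    have "continuous_on {-t..t} (\<lambda>\<tau>. f (y + p + \<tau> *\<^sub>R i))"
    proof (rule continuous_on_compose2[of "ball x r" f])
      show "continuous_on (ball x r) f"
        using f has_derivative_continuous by (blast intro: continuous_at_imp_continuous_on)
    qed (use inb in \<open>auto intro!: continuous_intros\<close>)
    then obtain \<tau> where \<tau>: "-t \<le> \<tau>" "\<tau> \<le> t" "f (y + p + \<tau> *\<^sub>R i) = 0"
      using IVT'[of "\<lambda>\<tau>. f (y + p + \<tau> *\<^sub>R i)" "-t" 0 t] up down t0 by auto
    then show "\<exists>\<tau>. \<bar>\<tau>\<bar> \<le> t \<and> y + p + \<tau> *\<^sub>R i \<in> S"
      using S[OF inb[of \<tau>]] by (intro exI[of _ \<tau>]) auto
  qed
qed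

lemma smooth_on_partial_deriv_continuous:
  assumes "smooth_on U f" "j \<in> Basis"
  shows "continuous_on U (partial_deriv j f)"
proof -
  have "iter_partial [j] f differentiable (at x)" if "x \<in> U" for x
  proof -
    have "[j] \<in> lists Basis" using assms(2) by simp
    with assms(1) that show ?thesis unfolding smooth_on_def by blast
  qed
  then show ?thesis
    by (auto intro!: continuous_at_imp_continuous_on differentiable_imp_continuous_within)
qed

lemma smooth_on_differentiable:
  assumes "smooth_on U f" "x \<in> U"
  shows "f differentiable (at x)"
proof -
  have "iter_partial [] f differentiable (at x)"
    using assms unfolding smooth_on_def by blast
  then show ?thesis by simp
qed

lemma gderiv_inner_Basis:
  assumes "GDERIV f x :> D" "j \<in> Basis"
  shows "D \<bullet> j = partial_deriv j f x"
  using partial_deriv_eq[of f "\<lambda>h. h \<bullet> D" x j] assms by (simp add: gderiv_def inner_commute)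

text \<open>Some coordinate of the nonzero gradient is nonzero, and \<open>\<sigma>\<close>
  normalises its sign. Continuity of the partial derivatives gives the lower bound \<open>c\<close>
  in a small ball, and compactness the upper bound for all of them.\<close>

lemma local_defining_function_graph:
  fixes \<Omega> :: "'a::euclidean_space set"
  assumes ldf: "local_defining_function \<Omega> x U \<rho>" and x: "x \<in> frontier \<Omega>"
  shows "\<exists>r>0. \<exists>L\<ge>1. \<exists>i. lipschitz_graph_at (frontier \<Omega>) L r x i"
proof -
  have U: "open U" "x \<in> U" and sm: "smooth_on U \<rho>"
    and fr: "\<And>y. y \<in> U \<Longrightarrow> y \<in> frontier \<Omega> \<longleftrightarrow> \<rho> y = 0"
    using ldf by (auto simp: local_defining_function_def)
  obtain D where D: "GDERIV \<rho> x :> D" "D \<noteq> 0"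
    using ldf x U unfolding local_defining_function_def by blast
  obtain i where i: "i \<in> Basis" "D \<bullet> i \<noteq> 0" using D(2) by (metis euclidean_all_zero_iff)
  define \<sigma> where "\<sigma> = sgn (D \<bullet> i)"
  define g where "g j y = \<sigma> * partial_deriv j \<rho> y" for j y
  have gc: "continuous_on U (g j)" if "j \<in> Basis" for j
    unfolding g_def by (intro continuous_intros smooth_on_partial_deriv_continuous[OF sm that])
  have gix: "g i x > 0"
  proof -
    have "g i x = sgn (D \<bullet> i) * (D \<bullet> i)"
      by (simp add: g_def \<sigma>_def gderiv_inner_Basis[OF D(1) i(1)])
    then show ?thesis using i(2) by (simp add: sgn_if)
  qed
  define c where "c = g i x / 2"
  have c: "c > 0" using gix by (simp add: c_def)
  have "isCont (g i) x" using gc[OF i(1)] U by (simp add: continuous_on_eq_continuous_at)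
  then have "eventually (\<lambda>y. g i y > c) (at x)"
    using gix unfolding isCont_def by (intro order_tendstoD) (auto simp: c_def)
  then obtain r1 where r1: "r1 > 0" "\<And>y. y \<in> ball x r1 \<Longrightarrow> g i y \<ge> c"
      proof -
    assume *: "\<And>r1. 0 < r1 \<Longrightarrow> (\<And>y. y \<in> ball x r1 \<Longrightarrow> c \<le> g i y) \<Longrightarrow> thesis"
    obtain d where d: "d > 0" "\<And>y. y \<noteq> x \<Longrightarrow> dist y x < d \<Longrightarrow> g i y > c"
      using \<open>eventually _ _\<close> unfolding eventually_at by blast
    show thesis
    proof (rule *[OF d(1)])
      fix y assume "y \<in> ball x d"
      then show "c \<le> g i y" using d(2)[of y] gix by (cases "y = x") (auto simp: c_def dist_commute)
    qed
  qed
  obtain r2 where r2: "r2 > 0" "cball x r2 \<subseteq> U" using U open_contains_cball by blast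
  have "\<exists>B. \<forall>y\<in>cball x r2. \<bar>g j y\<bar> \<le> B" if "j \<in> Basis" for j
  proof -
    have "compact (g j ` cball x r2)"
      by (intro compact_continuous_image continuous_on_subset[OF gc[OF that] r2(2)]) auto
    then show ?thesis using compact_imp_bounded[of "g j ` cball x r2"] by (auto simp: bounded_iff)
  qed
  then obtain B where B: "\<And>j y. j \<in> Basis \<Longrightarrow> y \<in> cball x r2 \<Longrightarrow> \<bar>g j y\<bar> \<le> B j" by metis
  define C where "C = max c (\<Sum>j\<in>Basis. \<bar>B j\<bar>)"
  define r where "r = min r1 r2"
  have rU: "y \<in> U" if "y \<in> ball x r" for y using that r2(2) by (auto simp: r_def)
  have "lipschitz_graph_at (frontier \<Omega>) (C / c) r x i"
  proof (rule lipschitz_graph_at_level_set[where f = "\<lambda>y. \<sigma> * \<rho> y" and g = g])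
    fix y assume y: "y \<in> ball x r"
    have "(\<rho> has_derivative (\<lambda>v. \<Sum>j\<in>Basis. (v \<bullet> j) *\<^sub>R partial_deriv j \<rho> y)) (at y)"
      by (intro has_derivative_partial_deriv smooth_on_differentiable[OF sm] rU y)
    from has_derivative_mult_right[OF this, of \<sigma>]
    show "((\<lambda>y. \<sigma> * \<rho> y) has_derivative (\<lambda>v. \<Sum>j\<in>Basis. (v \<bullet> j) * g j y)) (at y)"
      by (simp add: g_def sum_distrib_left mult_ac)
    show "c \<le> g i y" using y r1 by (auto simp: r_def)
    show "(y \<in> frontier \<Omega>) = (\<sigma> * \<rho> y = 0)" using fr[OF rU[OF y]] i by (simp add: \<sigma>_def sgn_if)
    fix j :: 'a assume j: "j \<in> Basis"
    have "\<bar>g j y\<bar> \<le> B j" using B[OF j] y by (auto simp: r_def)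
    also have "\<dots> \<le> (\<Sum>j\<in>Basis. \<bar>B j\<bar>)" using j member_le_sum[of j Basis "\<lambda>j. \<bar>B j\<bar>"] by force
    finally show "\<bar>g j y\<bar> \<le> C" by (simp add: C_def)
  qed (use c i in \<open>auto simp: C_def\<close>)
  moreover have "C / c \<ge> 1" "r > 0" using c r1 r2 by (auto simp: C_def r_def)
  ultimately show ?thesis by blast
qed

section \<open>Uniform graph constants along a compact boundary\<close>

definition lipschitz_graphs :: "'a::euclidean_space set \<Rightarrow> real \<Rightarrow> real \<Rightarrow> bool" where
  "lipschitz_graphs S L r \<longleftrightarrow> L \<ge> 1 \<and> r > 0 \<and> (\<forall>x\<in>S. \<exists>i. lipschitz_graph_at S L r x i)"

lemma lipschitz_graphs_compact:
  fixes S :: "'a::euclidean_space set"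
  assumes S: "compact S" and loc: "\<And>x. x \<in> S \<Longrightarrow> \<exists>r>0. \<exists>L\<ge>1. \<exists>i. lipschitz_graph_at S L r x i"
  shows "\<exists>L r. lipschitz_graphs S L r"
proof -
  obtain R L i where R: "\<And>x. x \<in> S \<Longrightarrow> R x > 0" and L: "\<And>x. x \<in> S \<Longrightarrow> L x \<ge> 1"
    and g: "\<And>x. x \<in> S \<Longrightarrow> lipschitz_graph_at S (L x) (R x) x (i x)"
    using loc by metis
  \<comment> \<open>Quarter balls leave room: a point of \<open>ball y (R y / 4)\<close> and a
    radius \<open>r \<le> R y / 2\<close> satisfy \<open>R y / 4 + r / 2 \<le> R y / 2\<close>, so
    the balls of half radius are nested as well as the full ones.\<close>
  obtain F where F: "F \<subseteq> S" "finite F" "S \<subseteq> (\<Union>x\<in>F. ball x (R x / 4))"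
      proof (rule compactE_image[OF S, of S "\<lambda>x. ball x (R x / 4)"])
    show "S \<subseteq> (\<Union>x\<in>S. ball x (R x / 4))" using R by force
  qed auto
  define r where "r = Min (insert 1 ((\<lambda>x. R x / 2) ` F))"
  define L' where "L' = Max (insert 1 (L ` F))"
  have r: "r > 0" "\<And>x. x \<in> F \<Longrightarrow> r \<le> R x / 2"
  proof -
    show "r > 0" using F R by (auto simp: r_def subset_eq)
    show "r \<le> R x / 2" if "x \<in> F" for x
      unfolding r_def using F that by (intro Min_le) auto
  qed
  have L': "L' \<ge> 1" "\<And>x. x \<in> F \<Longrightarrow> L x \<le> L'"
  proof -
    show "L' \<ge> 1" unfolding L'_def using F by (intro Max_ge) auto
    show "L x \<le> L'" if "x \<in> F" for x unfolding L'_def using F that by (intro Max_ge) auto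
  qed
  have "\<exists>i. lipschitz_graph_at S L' r x i" if xS: "x \<in> S" for x
  proof -
    obtain y where y: "y \<in> F" "x \<in> ball y (R y / 4)" using F(3) xS by blast
    have "lipschitz_graph_at S L' r x (i y)"
    proof (rule lipschitz_graph_at_mono[OF g])
      show "ball x r \<subseteq> ball y (R y)" "ball x (r / 2) \<subseteq> ball y (R y / 2)" "r \<le> R y"
        using y r(2)[OF y(1)] R[of y] F(1) by (auto simp: ball_subset_ball_iff dist_commute)
    qed (use F y L' in auto)
    then show ?thesis by blast
  qed
  then show ?thesis using r L' unfolding lipschitz_graphs_def by blast
qed

lemma bounded_smooth_domain_compact_frontier:
  "bounded_smooth_domain \<Omega> \<Longrightarrow> compact (frontier \<Omega>)"
  by (auto simp: bounded_smooth_domain_def intro: compact_frontier_bounded)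

lemma bounded_smooth_domain_lipschitz_graphs:
  assumes "bounded_smooth_domain \<Omega>"
  shows "\<exists>L r. lipschitz_graphs (frontier \<Omega>) L r"
proof (rule lipschitz_graphs_compact)
  show "compact (frontier \<Omega>)" by (rule bounded_smooth_domain_compact_frontier[OF assms])
  show "\<exists>r>0. \<exists>L\<ge>1. \<exists>i. lipschitz_graph_at (frontier \<Omega>) L r x i" if "x \<in> frontier \<Omega>" for x
    using assms that local_defining_function_graph unfolding bounded_smooth_domain_def by blast
qed

section \<open>Surface measure and tubular neighbourhoods\<close>

definition slab :: "'a::euclidean_space \<Rightarrow> 'a \<Rightarrow> real \<Rightarrow> real \<Rightarrow> 'a set" where
  "slab i y a b = {z. (\<forall>j\<in>Basis - {i}. \<bar>(z - y) \<bullet> j\<bar> \<le> a) \<and> \<bar>(z - y) \<bullet> i\<bar> \<le> b}"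

lemma slab_eq_cbox:
  fixes y v :: "'a::euclidean_space"
  assumes i: "i \<in> Basis" and v_def: "v = (\<Sum>j\<in>Basis. (if j = i then b else a) *\<^sub>R j)"
  shows "slab i y a b = cbox (y - v) (y + v)"
proof -
  have v: "v \<bullet> j = (if j = i then b else a)" if "j \<in> Basis" for j
    using that by (simp add: v_def inner_sum_left_Basis)
  show ?thesis
  proof (rule set_eqI)
    fix z
    have "z \<in> cbox (y - v) (y + v) \<longleftrightarrow> (\<forall>j\<in>Basis. \<bar>(z - y) \<bullet> j\<bar> \<le> (if j = i then b else a))"
      unfolding mem_box by (rule ball_cong) (auto simp: v inner_diff_left inner_add_left)
    also have "\<dots> \<longleftrightarrow> z \<in> slab i y a b" using i by (auto simp: slab_def)
    finally show "z \<in> slab i y a b \<longleftrightarrow> z \<in> cbox (y - v) (y + v)" by simp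
  qed
qed

lemma sets_slab [measurable]: "i \<in> Basis \<Longrightarrow> slab i y a b \<in> sets borel"
  by (simp add: slab_eq_cbox[OF _ refl])

lemma emeasure_slab:
  fixes y :: "'a::euclidean_space"
  assumes i: "i \<in> Basis" and ab: "a \<ge> 0" "b \<ge> 0"
  shows "emeasure lborel (slab i y a b) = ennreal ((2 * a) ^ (DIM('a) - 1) * (2 * b))"
proof -
  define v :: 'a where "v = (\<Sum>j\<in>Basis. (if j = i then b else a) *\<^sub>R j)"
  have v: "v \<bullet> j = (if j = i then b else a)" if "j \<in> Basis" for j
    using that by (simp add: v_def inner_sum_left_Basis)
  have "emeasure lborel (slab i y a b) = ennreal (\<Prod>j\<in>Basis. ((y + v) - (y - v)) \<bullet> j)"
    using i ab unfolding slab_eq_cbox[OF i v_def]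
    by (subst emeasure_lborel_cbox) (auto simp: inner_diff_left inner_add_left v)
  also have "(\<Prod>j\<in>Basis. ((y + v) - (y - v)) \<bullet> j) = (\<Prod>j\<in>Basis. 2 * (if j = i then b else a))"
    by (intro prod.cong) (auto simp: inner_diff_left inner_add_left v)
  also have "\<dots> = (2 * b) * (\<Prod>j\<in>Basis - {i}. 2 * a)"
    using i by (subst prod.remove[of _ i]) (auto intro!: prod.cong)
  finally show ?thesis using i by (simp add: card_Diff_singleton mult.commute)
qed

text \<open>A separated set of largest cardinality is automatically a net. The cardinality is
  bounded because a ball of radius \<open>h / 2\<close> holds at most one of its points.\<close>

lemma compact_maximal_separated:
  fixes A :: "'a::metric_space set"
  assumes "compact A" "h > 0"
  obtains F where "finite F" "F \<subseteq> A" "\<And>y z. y \<in> F \<Longrightarrow> z \<in> F \<Longrightarrow> y \<noteq> z \<Longrightarrow> h \<le> dist y z"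
    "A \<subseteq> (\<Union>y\<in>F. ball y h)"
proof -
  define sep where "sep F \<longleftrightarrow> finite F \<and> F \<subseteq> A \<and> (\<forall>y\<in>F. \<forall>z\<in>F. y \<noteq> z \<longrightarrow> h \<le> dist y z)" for F
  obtain B where B: "B \<subseteq> A" "finite B" "A \<subseteq> (\<Union>b\<in>B. ball b (h / 2))"
  proof (rule compactE_image[OF assms(1), of A "\<lambda>b. ball b (h / 2)"])
    show "A \<subseteq> (\<Union>x\<in>A. ball x (h / 2))" using assms(2) by force
  qed auto
  have bound: "card F \<le> card B" if "sep F" for F
  proof -
    have "F \<subseteq> A" using that by (simp add: sep_def)
    then have "F \<subseteq> (\<Union>b\<in>B. ball b (h / 2))" using B(3) by (rule subset_trans)
    then have "\<forall>y\<in>F. \<exists>b\<in>B. y \<in> ball b (h / 2)" by blast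
    then obtain c where c: "\<And>y. y \<in> F \<Longrightarrow> c y \<in> B \<and> y \<in> ball (c y) (h / 2)" by metis
    have "inj_on c F"
    proof (rule inj_onI, rule ccontr)
      fix y z assume yz: "y \<in> F" "z \<in> F" "c y = c z" "y \<noteq> z"
      have "dist y z \<le> dist (c y) y + dist (c y) z" by (metis dist_commute dist_triangle)
      also have "\<dots> < h" using c[OF yz(1)] c[OF yz(2)] yz(3) by auto
      finally have "dist y z < h" .
      moreover have "h \<le> dist y z" using that yz(1,2,4) unfolding sep_def by blast
      ultimately show False by simp
    qed
    moreover have "c ` F \<subseteq> B" using c by blast
    ultimately show ?thesis using B(2) by (rule card_inj_on_le)
  qed
  have "sep {}" by (simp add: sep_def)
  moreover have "\<forall>G. sep G \<longrightarrow> card G < Suc (card B)" by (auto dest: bound)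
  ultimately have "\<exists>F. sep F \<and> (\<forall>G. sep G \<longrightarrow> card G \<le> card F)"
    by (rule ex_has_greatest_nat[of sep "{}" card])
  then obtain F where F: "sep F" "\<And>G. sep G \<Longrightarrow> card G \<le> card F" by auto
  show thesis
  proof (rule that[of F])
    show "A \<subseteq> (\<Union>y\<in>F. ball y h)"
    proof (rule ccontr)
      assume "\<not> ?thesis"
      then obtain a where a: "a \<in> A" "\<And>y. y \<in> F \<Longrightarrow> h \<le> dist y a"
        by (auto simp: subset_eq not_less)
      then have "a \<notin> F" using assms(2) by force
      have "sep (insert a F)" using a F(1) by (auto simp: sep_def dist_commute)
      from F(2)[OF this] \<open>a \<notin> F\<close> F(1) show False by (simp add: sep_def)
    qed
  qed (use F(1) in \<open>auto simp: sep_def\<close>)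
qed

text \<open>From comparing volumes: disjoint boxes of side \<open>h / (2 * (1 + L) * d)\<close> and
  height \<open>2 * \<rho>\<close> inside a cube of side \<open>4 * \<rho>\<close>, where
  \<open>d\<close> is the dimension; the leading 2 is the quotient of the heights.\<close>

definition packing_const :: "'a::euclidean_space itself \<Rightarrow> real \<Rightarrow> real" where
  "packing_const _ L = 2 * (8 * (1 + L) * real DIM('a)) ^ (DIM('a) - 1)"

lemma packing_const_pos: "L \<ge> 0 \<Longrightarrow> packing_const TYPE('a::euclidean_space) L > 0"
  by (simp add: packing_const_def)

text \<open>Slabs of width \<open>h\<close> and height \<open>\<rho>\<close> over the points of a separated set do not overlap,
  because separated points of a Lipschitz graph have separated base points.\<close>

lemma lipschitz_graph_packing:
  fixes S :: "'a::euclidean_space set"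
  assumes g: "lipschitz_graph_at S L r x i" and L: "L \<ge> 0"
    and F: "finite F" "F \<subseteq> S \<inter> cball x \<rho>" and sep: "\<And>y z. y \<in> F \<Longrightarrow> z \<in> F \<Longrightarrow> y \<noteq> z \<Longrightarrow> h \<le> dist y z"
    and h: "0 < h" "h \<le> \<rho>" "\<rho> < r"
  shows "real (card F) * h ^ (DIM('a) - 1) \<le> packing_const TYPE('a) L * \<rho> ^ (DIM('a) - 1)"
proof -
  have i: "i \<in> Basis" using g by (simp add: lipschitz_graph_at_def)
  let ?d = "real DIM('a)" and ?n = "DIM('a) - 1"
  \<comment> \<open>If all horizontal coordinates of \<open>y - z\<close> were below
    \<open>\<eta>\<close>, the graph bound would make its norm smaller than
    \<open>(1 + L) * d * \<eta> = h\<close>, \<open>d\<close> being the dimension.\<close>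
  define \<eta> where "\<eta> = h / ((1 + L) * ?d)"
  have d1: "?d \<ge> 1" using DIM_positive[where 'a='a] by linarith
  then have den: "(1 + L) * ?d \<ge> 1" using L mult_mono[of 1 "1 + L" 1 ?d] by simp
  then have \<eta>: "\<eta> > 0" "\<eta> \<le> h"
    using h mult_left_mono[OF den, of h] by (auto simp: \<eta>_def divide_le_eq)
  have far: "\<exists>j\<in>Basis - {i}. \<bar>(y - z) \<bullet> j\<bar> \<ge> \<eta>" if yz: "y \<in> F" "z \<in> F" "y \<noteq> z" for y z
  proof (rule ccontr)
    assume "\<not> ?thesis"
    then have small: "\<And>j. j \<in> Basis - {i} \<Longrightarrow> \<bar>(y - z) \<bullet> j\<bar> < \<eta>" by force
    let ?s = "\<Sum>j\<in>Basis - {i}. \<bar>(y - z) \<bullet> j\<bar>"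
    have "y \<in> S \<inter> ball x r" "z \<in> S \<inter> ball x r" using yz F h by auto
    then have "\<bar>(y - z) \<bullet> i\<bar> \<le> L * ?s" using g by (auto simp: lipschitz_graph_at_def)
    moreover have "norm (y - z) \<le> (\<Sum>j\<in>Basis. \<bar>(y - z) \<bullet> j\<bar>)" by (rule norm_le_l1)
    ultimately have "h \<le> (1 + L) * ?s"
      using sep[OF yz] i by (simp add: sum.remove dist_norm algebra_simps)
    moreover have "?s \<le> real (card (Basis - {i} :: 'a set)) * \<eta>"
      using small by (intro sum_bounded_above) (simp add: less_imp_le)
    then have "(1 + L) * ?s \<le> (1 + L) * (real (card (Basis - {i} :: 'a set)) * \<eta>)"
      using L by (intro mult_left_mono) auto
    moreover have "(1 + L) * (real (card (Basis - {i} :: 'a set)) * \<eta>) < (1 + L) * (?d * \<eta>)"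
      using L \<eta> i d1 by (intro mult_strict_left_mono mult_strict_right_mono) (auto simp: card_Diff_singleton)
    moreover have "(1 + L) * (?d * \<eta>) = h" using den by (auto simp: \<eta>_def)
    ultimately show False by linarith
  qed
  \<comment> \<open>Two boxes of half-width \<open>\<eta> / 4\<close> cannot overlap when some
    horizontal coordinate of their centres differs by \<open>\<eta>\<close>.\<close>
  define a where "a = \<eta> / 4"
  have a: "a > 0" "a \<le> \<rho>" using \<eta> h by (auto simp: a_def)
  have disj: "disjoint_family_on (\<lambda>y. slab i y a \<rho>) F"
    unfolding disjoint_family_on_def
  proof (intro ballI impI, rule ccontr)
    fix y z assume yz: "y \<in> F" "z \<in> F" "y \<noteq> z" "slab i y a \<rho> \<inter> slab i z a \<rho> \<noteq> {}"
    then obtain w j where "w \<in> slab i y a \<rho>" "w \<in> slab i z a \<rho>" "j \<in> Basis - {i}" "\<bar>(y - z) \<bullet> j\<bar> \<ge> \<eta>"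
      using far[OF yz(1-3)] by blast
    then have "\<bar>(w - y) \<bullet> j\<bar> \<le> a" "\<bar>(w - z) \<bullet> j\<bar> \<le> a" "\<bar>(y - z) \<bullet> j\<bar> \<ge> \<eta>" by (auto simp: slab_def)
    then show False using \<eta> unfolding a_def inner_diff_left by linarith
  qed
  have sub: "(\<Union>y\<in>F. slab i y a \<rho>) \<subseteq> slab i x (2 * \<rho>) (2 * \<rho>)"
  proof safe
    fix y w assume y: "y \<in> F" and w: "w \<in> slab i y a \<rho>"
    have yx: "\<bar>(y - x) \<bullet> j\<bar> \<le> \<rho>" if "j \<in> Basis" for j
      using Basis_le_norm[OF that, of "y - x"] y F(2) by (auto simp: dist_norm norm_minus_commute)
    have "\<bar>(w - x) \<bullet> j\<bar> \<le> 2 * \<rho>" if "j \<in> Basis" for j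
    proof -
      have "\<bar>(w - y) \<bullet> j\<bar> \<le> \<rho>" using w a that by (cases "j = i") (force simp: slab_def)+
      then show ?thesis using yx[OF that] unfolding inner_diff_left by linarith
    qed
    then show "w \<in> slab i x (2 * \<rho>) (2 * \<rho>)" using i by (simp add: slab_def)
  qed
  have "ennreal (real (card F) * ((2 * a) ^ ?n * (2 * \<rho>))) = (\<Sum>y\<in>F. emeasure lborel (slab i y a \<rho>))"
    using i a h by (simp add: emeasure_slab ennreal_of_nat_eq_real_of_nat ennreal_mult)
  also have "\<dots> = emeasure lborel (\<Union>y\<in>F. slab i y a \<rho>)"
    using F(1) i by (intro sum_emeasure disj) auto
  also have "\<dots> \<le> emeasure lborel (slab i x (2 * \<rho>) (2 * \<rho>))"
    using i by (intro emeasure_mono sub) auto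
  also have "\<dots> = ennreal ((4 * \<rho>) ^ ?n * (4 * \<rho>))" using i h by (simp add: emeasure_slab)
  finally have "real (card F) * ((2 * a) ^ ?n * (2 * \<rho>)) \<le> (4 * \<rho>) ^ ?n * (4 * \<rho>)"
    using h by (subst (asm) ennreal_le_iff) auto
  moreover have "c * Y \<le> 2 * X" if "c * (Y * (2 * \<rho>)) \<le> X * (4 * \<rho>)" for c X Y
    using that h by (intro mult_right_le_imp_le[of "c * Y" "2 * \<rho>" "2 * X"]) (auto simp: algebra_simps)
  ultimately have 1: "real (card F) * (2 * a) ^ ?n \<le> 2 * (4 * \<rho>) ^ ?n" by blast
  have "(1 + L) * ?d \<noteq> 0" using den by linarith
  moreover have "h / K * K = h" if "K \<noteq> 0" for K using that by simp
  ultimately have "\<eta> * ((1 + L) * ?d) = h" unfolding \<eta>_def by blast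
  then have "(2 * (1 + L) * ?d) * (2 * a) = h" by (simp add: a_def algebra_simps)
  then have "h ^ ?n = ((2 * (1 + L) * ?d) * (2 * a)) ^ ?n" by simp
  then have "real (card F) * h ^ ?n = (2 * (1 + L) * ?d) ^ ?n * (real (card F) * (2 * a) ^ ?n)"
    unfolding power_mult_distrib by (simp only: mult.assoc mult.left_commute[of "real (card F)"])
  also have "\<dots> \<le> (2 * (1 + L) * ?d) ^ ?n * (2 * (4 * \<rho>) ^ ?n)"
    using 1 L by (intro mult_left_mono) auto
  also have "\<dots> = 2 * ((2 * (1 + L) * ?d) * 4) ^ ?n * \<rho> ^ ?n"
    unfolding power_mult_distrib by (simp only: mult.assoc mult.left_commute[of "2::real"])
  also have "(2 * (1 + L) * ?d) * 4 = 8 * (1 + L) * ?d" by simp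
  finally show ?thesis by (simp add: packing_const_def)
qed

lemma lipschitz_graph_cover:
  fixes S :: "'a::euclidean_space set"
  assumes g: "lipschitz_graph_at S L r x i" and L: "L \<ge> 0" and S: "compact S"
    and h: "0 < h" "h \<le> \<rho>" "\<rho> < r"
  obtains F where "finite F" "S \<inter> cball x \<rho> \<subseteq> (\<Union>y\<in>F. ball y h)"
    "real (card F) * h ^ (DIM('a) - 1) \<le> packing_const TYPE('a) L * \<rho> ^ (DIM('a) - 1)"
proof -
  have "compact (S \<inter> cball x \<rho>)" using S by (intro compact_Int_closed) auto
  from compact_maximal_separated[OF this h(1)] obtain F where
    F: "finite F" "F \<subseteq> S \<inter> cball x \<rho>" "\<And>y z. y \<in> F \<Longrightarrow> z \<in> F \<Longrightarrow> y \<noteq> z \<Longrightarrow> h \<le> dist y z"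
      "S \<inter> cball x \<rho> \<subseteq> (\<Union>y\<in>F. ball y h)" by metis
  show thesis
    by (rule that[OF F(1,4) lipschitz_graph_packing[OF g L F(1,2) _ h]]) (rule F(3))
qed

text \<open>The packing bound controls the number of balls of radius \<open>h\<close> times their
  weight independently of \<open>h\<close>, so the same upper bound holds at every scale
  \<open>\<delta>\<close>.\<close>

lemma hausdorff_outer_graph_upper:
  fixes S :: "'a::euclidean_space set"
  assumes g: "lipschitz_graph_at S L r x i" and L: "L \<ge> 0" and S: "compact S" and \<rho>: "0 < \<rho>" "\<rho> < r"
  shows "hausdorff_outer (DIM('a) - 1) (S \<inter> cball x \<rho>) \<le>
    ennreal (unit_ball_vol (real (DIM('a) - 1)) * (packing_const TYPE('a) L * \<rho> ^ (DIM('a) - 1)))"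
proof (rule hausdorff_outer_least)
  let ?n = "DIM('a) - 1"
  fix \<delta> :: real assume \<delta>: "\<delta> > 0"
  define h where "h = min \<rho> (\<delta> / 2)"
  have h: "h > 0" "h \<le> \<rho>" "2 * h \<le> \<delta>" using \<delta> \<rho> by (auto simp: h_def)
  obtain F where F: "finite F" "S \<inter> cball x \<rho> \<subseteq> (\<Union>y\<in>F. ball y h)"
    "real (card F) * h ^ ?n \<le> packing_const TYPE('a) L * \<rho> ^ ?n"
    using lipschitz_graph_cover[OF g L S h(1,2) \<rho>(2)] by blast
  obtain e where e: "bij_betw e {..<card F} F"
    using ex_bij_betw_nat_finite[OF F(1)] by (auto simp: atLeast0LessThan)
  define C where "C n = (if n < card F then ball (e n) h else {})" for n
  have diam: "diameter (ball y h) \<le> 2 * h" for y :: 'a using h by (simp add: diameter_ball)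
  have "hausdorff_content ?n \<delta> (S \<inter> cball x \<rho>) \<le> (\<Sum>n. hausdorff_weight ?n (C n))"
  proof (rule hausdorff_content_le)
    show "S \<inter> cball x \<rho> \<subseteq> (\<Union>n. C n)"
    proof
      fix w assume "w \<in> S \<inter> cball x \<rho>"
      then obtain y where y: "y \<in> F" "w \<in> ball y h" using F(2) by blast
      then obtain n where "n < card F" "y = e n" using e by (auto simp: bij_betw_def)
      with y show "w \<in> (\<Union>n. C n)" by (auto simp: C_def intro!: exI[of _ n])
    qed
    show "bounded (C n)" for n by (simp add: C_def)
    show "diameter (C n) \<le> \<delta>" for n using diam[of "e n"] h \<delta> by (simp add: C_def)
  qed
  also have "\<dots> = (\<Sum>n<card F. hausdorff_weight ?n (C n))"
    by (rule suminf_finite) (auto simp: C_def)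
  also have "\<dots> \<le> (\<Sum>n<card F. ennreal (unit_ball_vol (real ?n) * h ^ ?n))"
  proof (rule sum_mono)
    fix n assume "n \<in> {..<card F}"
    then show "hausdorff_weight ?n (C n) \<le> ennreal (unit_ball_vol (real ?n) * h ^ ?n)"
      using h diam[of "e n"]
      by (auto simp: C_def hausdorff_weight_def unit_ball_vol_nonneg diameter_ge_0
          intro!: ennreal_leI mult_left_mono power_mono)
  qed
  also have "\<dots> = ennreal (unit_ball_vol (real ?n) * (real (card F) * h ^ ?n))"
    using h by (simp add: ennreal_of_nat_eq_real_of_nat ennreal_mult[symmetric] unit_ball_vol_nonneg mult_ac)
  also have "\<dots> \<le> ennreal (unit_ball_vol (real ?n) * (packing_const TYPE('a) L * \<rho> ^ ?n))"
    using F(3) by (intro ennreal_leI mult_left_mono) (auto simp: unit_ball_vol_nonneg)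
  finally show "hausdorff_content ?n \<delta> (S \<inter> cball x \<rho>) \<le> \<dots>" .
qed

lemma hausdorff_outer_finite:
  fixes S :: "'a::euclidean_space set"
  assumes lg: "lipschitz_graphs S L r" and S: "compact S"
  shows "hausdorff_outer (DIM('a) - 1) S < \<infinity>"
proof -
  have r: "r > 0" and L: "L \<ge> 0" using lg by (auto simp: lipschitz_graphs_def)
  have oms: "outer_measure_space (Pow UNIV) (hausdorff_outer (DIM('a) - 1) :: 'a set \<Rightarrow> ennreal)"
    by (rule outer_measure_space_hausdorff_outer)
  obtain F where F: "finite F" "F \<subseteq> S" "S \<subseteq> (\<Union>y\<in>F. ball y (r / 2))"
    using compact_maximal_separated[OF S, of "r / 2"] r by (metis half_gt_zero)
  have cl: "closed S" using S by (rule compact_imp_closed)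
  have Sc: "S \<inter> cball y t \<in> sets borel" for y t using cl by (intro borel_closed) auto
  let ?H = "hausdorff_measure (DIM('a) - 1) :: 'a measure"
  have "emeasure ?H S \<le> emeasure ?H (\<Union>y\<in>F. S \<inter> cball y (r / 2))"
  proof (rule emeasure_mono)
    show "S \<subseteq> (\<Union>y\<in>F. S \<inter> cball y (r / 2))" using F(3) by force
    have "(\<Union>y\<in>F. S \<inter> cball y (r / 2)) \<in> sets borel"
      using F(1) cl by (intro sets.finite_UN borel_closed) auto
    then show "(\<Union>y\<in>F. S \<inter> cball y (r / 2)) \<in> sets ?H" by simp
  qed
  also have "\<dots> \<le> (\<Sum>y\<in>F. emeasure ?H (S \<inter> cball y (r / 2)))"
    using F(1) Sc by (intro emeasure_subadditive_finite) auto
  also have "\<dots> < \<infinity>"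
  proof -
    have "emeasure ?H (S \<inter> cball y (r / 2)) < top" if yF: "y \<in> F" for y
    proof -
      obtain i where "lipschitz_graph_at S L r y i" using lg F(2) yF unfolding lipschitz_graphs_def by blast
      from hausdorff_outer_graph_upper[OF this L S, of "r / 2"] r
      have "hausdorff_outer (DIM('a) - 1) (S \<inter> cball y (r / 2)) < top"
        by (auto intro: le_less_trans)
      then show ?thesis by (simp add: emeasure_hausdorff_measure Sc)
    qed
    then show ?thesis using F(1) by (simp add: less_top)
  qed
  finally show ?thesis using cl by (simp add: emeasure_hausdorff_measure borel_closed)
qed

text \<open>A point within \<open>h\<close> of the graph is within \<open>2 * h\<close> of a point
  of an \<open>h\<close>-net, so cubes of side \<open>4 * h\<close> around the net cover the tube;
  one power of \<open>h\<close> is left after the packing bound.\<close>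

lemma tube_volume:
  fixes S :: "'a::euclidean_space set"
  assumes g: "lipschitz_graph_at S L r x i" and L: "L \<ge> 0" and S: "compact S"
    and h: "0 < h" "h \<le> \<rho>" "\<rho> < r"
  shows "emeasure lborel {z. \<exists>y\<in>S \<inter> cball x \<rho>. dist z y \<le> h} \<le>
    ennreal (4 ^ DIM('a) * packing_const TYPE('a) L * h * \<rho> ^ (DIM('a) - 1))"
proof -
  let ?n = "DIM('a) - 1"
  have i: "i \<in> Basis" using g by (simp add: lipschitz_graph_at_def)
  obtain F where F: "finite F" "S \<inter> cball x \<rho> \<subseteq> (\<Union>y\<in>F. ball y h)"
    "real (card F) * h ^ ?n \<le> packing_const TYPE('a) L * \<rho> ^ ?n"
    using lipschitz_graph_cover[OF g L S h] by blast
  have pow: "c * ((4 * h) ^ n * (4 * h)) = 4 ^ Suc n * h * (c * h ^ n)" for c n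
    by (simp add: power_mult_distrib)
  have "{z. \<exists>y\<in>S \<inter> cball x \<rho>. dist z y \<le> h} \<subseteq> (\<Union>y\<in>F. slab i y (2 * h) (2 * h))"
  proof safe
    fix z y assume y: "y \<in> S" "y \<in> cball x \<rho>" "dist z y \<le> h"
    then obtain w where w: "w \<in> F" "y \<in> ball w h" using F(2) by blast
    have "dist z w \<le> 2 * h" using y(3) w(2) dist_triangle[of z w y] by (simp add: dist_commute)
    then have "\<bar>(z - w) \<bullet> j\<bar> \<le> 2 * h" if "j \<in> Basis" for j
      using Basis_le_norm[OF that, of "z - w"] by (simp add: dist_norm)
    then show "z \<in> (\<Union>y\<in>F. slab i y (2 * h) (2 * h))" using w i by (auto simp: slab_def)
  qed
  then have "emeasure lborel {z. \<exists>y\<in>S \<inter> cball x \<rho>. dist z y \<le> h} \<le>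
      emeasure lborel (\<Union>y\<in>F. slab i y (2 * h) (2 * h))"
    using F(1) i by (intro emeasure_mono) auto
  also have "\<dots> \<le> (\<Sum>y\<in>F. emeasure lborel (slab i y (2 * h) (2 * h)))"
    using F(1) i by (intro emeasure_subadditive_finite) auto
  also have "\<dots> = ennreal (real (card F) * ((4 * h) ^ ?n * (4 * h)))"
    using i h by (simp add: emeasure_slab ennreal_of_nat_eq_real_of_nat ennreal_mult)
  also have "real (card F) * ((4 * h) ^ ?n * (4 * h)) = 4 ^ Suc ?n * h * (real (card F) * h ^ ?n)"
    using pow[of "real (card F)" ?n] by blast
  also have "Suc ?n = DIM('a)" by simp
  also have "ennreal (4 ^ DIM('a) * h * (real (card F) * h ^ ?n)) \<le>
      ennreal (4 ^ DIM('a) * h * (packing_const TYPE('a) L * \<rho> ^ ?n))"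
    using F(3) h by (intro ennreal_leI mult_left_mono) auto
  finally show ?thesis by (simp add: mult_ac)
qed

text \<open>Projecting along \<open>i\<close>: each piece of a cover of the graph is replaced by the slab over it, and
  these slabs cover a slab around \<open>x\<close>.\<close>

lemma hausdorff_outer_graph_lower:
  fixes S :: "'a::euclidean_space set"
  assumes g: "lipschitz_graph_at S L r x i" and x: "x \<in> S" and L: "L \<ge> 1" and \<rho>: "0 < \<rho>" "\<rho> < r / 2"
  shows "ennreal (unit_ball_vol (real (DIM('a) - 1)) / (2 * (4 * L * real DIM('a)) ^ (DIM('a) - 1)) * \<rho> ^ (DIM('a) - 1))
    \<le> hausdorff_outer (DIM('a) - 1) (S \<inter> cball x \<rho>)"
proof -
  let ?d = "real DIM('a)" and ?n = "DIM('a) - 1"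
  let ?\<omega> = "unit_ball_vol (real ?n)"
  have \<omega>: "?\<omega> > 0" by (simp add: unit_ball_vol_pos)
  have i: "i \<in> Basis" using g by (simp add: lipschitz_graph_at_def)
  have d1: "?d \<ge> 1" using DIM_positive[where 'a='a] by linarith
  let ?E = "S \<inter> cball x \<rho>"
  \<comment> \<open>With this width the graph rises by at most \<open>L * d * a = \<rho> / 2\<close>
    over the slab, \<open>d\<close> being the dimension, so that it stays inside
    \<open>cball x \<rho>\<close> there.\<close>
  define a where "a = \<rho> / (2 * L * ?d)"
  have a: "a > 0" using \<rho> L d1 by (auto simp: a_def)
  have Lda: "L * (?d * a) = \<rho> / 2" using L d1 by (simp add: a_def)
  have da: "?d * a \<le> \<rho> / 2"
  proof -
    have "1 * (?d * a) \<le> L * (?d * a)" using L a d1 by (intro mult_right_mono) auto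
    then show ?thesis using Lda by simp
  qed
  have hit: "\<exists>e\<in>?E. \<forall>j\<in>Basis - {i}. (e - z) \<bullet> j = 0" if z: "z \<in> slab i x a \<rho>" for z
  proof -
    define p where "p = (z - x) - ((z - x) \<bullet> i) *\<^sub>R i"
    have pi: "p \<bullet> i = 0" using i by (simp add: p_def inner_diff_left)
    have pj: "p \<bullet> j = (z - x) \<bullet> j" if "j \<in> Basis - {i}" for j
      using that i by (auto simp: p_def inner_diff_left inner_Basis)
    have "(\<Sum>j\<in>Basis - {i}. \<bar>p \<bullet> j\<bar>) \<le> real (card (Basis - {i} :: 'a set)) * a"
      using z pj by (intro sum_bounded_above) (auto simp: slab_def)
    also have "\<dots> \<le> ?d * a" using a by (intro mult_right_mono) (auto intro: card_mono)
    finally have sp: "(\<Sum>j\<in>Basis - {i}. \<bar>p \<bullet> j\<bar>) \<le> ?d * a" .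
    then have "L * (\<Sum>j\<in>Basis - {i}. \<bar>p \<bullet> j\<bar>) \<le> \<rho> / 2"
      using L mult_left_mono[of _ _ L, OF sp] Lda by simp
    moreover have "x \<in> S \<inter> ball x (r / 2)" "\<rho> / 2 < r / 4" using x \<rho> by auto
    ultimately obtain \<tau> where \<tau>: "\<bar>\<tau>\<bar> \<le> \<rho> / 2" "x + p + \<tau> *\<^sub>R i \<in> S"
      using g pi unfolding lipschitz_graph_at_def by blast
    have "norm p \<le> (\<Sum>j\<in>Basis. \<bar>p \<bullet> j\<bar>)" by (rule norm_le_l1)
    also have "\<dots> = (\<Sum>j\<in>Basis - {i}. \<bar>p \<bullet> j\<bar>)" using i pi by (simp add: sum.remove)
    finally have "norm p \<le> \<rho> / 2" using sp da by linarith
    moreover have "norm (p + \<tau> *\<^sub>R i) \<le> norm p + \<bar>\<tau>\<bar>"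
      using norm_triangle_ineq[of p "\<tau> *\<^sub>R i"] i by simp
    ultimately have "norm (p + \<tau> *\<^sub>R i) \<le> \<rho>" using \<tau> by linarith
    moreover have "dist x (x + v) = norm v" for v by (simp add: dist_norm)
    ultimately have "x + p + \<tau> *\<^sub>R i \<in> ?E" using \<tau>(2) by (simp only: add.assoc Int_iff mem_cball)
    moreover have "\<forall>j\<in>Basis - {i}. (x + p + \<tau> *\<^sub>R i - z) \<bullet> j = 0"
      using i by (auto simp: inner_add_left inner_diff_left pj inner_Basis)
    ultimately show ?thesis by blast
  qed
  \<comment> \<open>A piece \<open>C k\<close> that meets the graph is inflated to a box around one
    of its points. Its horizontal half-width is the diameter of the piece; the half-height
    \<open>2 * \<rho>\<close> suffices since all heights involved differ from that of
    \<open>x\<close> by at most \<open>\<rho>\<close>. The volume of the box is a fixed multiple of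
    the weight of the piece.\<close>
  have main: "ennreal ((2 * a) ^ ?n * (2 * \<rho>)) \<le> ennreal (4 ^ ?n * (4 * \<rho>) / ?\<omega>) * (\<Sum>k. hausdorff_weight ?n (C k))"
    if cov: "?E \<subseteq> (\<Union>k. C k)" and bd: "\<And>k. bounded (C k)" for C :: "nat \<Rightarrow> 'a set"
  proof -
    have "\<forall>k. \<exists>y. C k \<inter> ?E \<noteq> {} \<longrightarrow> y \<in> C k \<inter> ?E" by blast
    then obtain y where y: "\<And>k. C k \<inter> ?E \<noteq> {} \<Longrightarrow> y k \<in> C k \<inter> ?E" by metis
    define T where "T k = (if C k \<inter> ?E = {} then {} else slab i (y k) (diameter (C k)) (2 * \<rho>))" for k
    have "slab i x a \<rho> \<subseteq> (\<Union>k. T k)"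
    proof
      fix z assume z: "z \<in> slab i x a \<rho>"
      obtain e where e: "e \<in> ?E" "\<And>j. j \<in> Basis - {i} \<Longrightarrow> (e - z) \<bullet> j = 0" using hit[OF z] by blast
      then obtain k where k: "e \<in> C k" using cov by blast
      then have yk: "y k \<in> C k \<inter> ?E" using e by (intro y) blast
      have dle: "dist e (y k) \<le> diameter (C k)" using yk k by (intro diameter_bounded_bound[OF bd]) auto
      have "\<bar>(z - y k) \<bullet> j\<bar> \<le> diameter (C k)" if "j \<in> Basis - {i}" for j
        using Basis_le_norm[of j "e - y k"] that e(2)[OF that] dle by (auto simp: dist_norm inner_diff_left)
      moreover have "\<bar>(z - y k) \<bullet> i\<bar> \<le> 2 * \<rho>"
      proof -
        have "\<bar>(z - x) \<bullet> i\<bar> \<le> \<rho>" using z by (simp add: slab_def)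
        moreover have "\<bar>(x - y k) \<bullet> i\<bar> \<le> \<rho>"
          using Basis_le_norm[OF i, of "x - y k"] yk by (auto simp: dist_norm)
        ultimately show ?thesis unfolding inner_diff_left by linarith
      qed
      ultimately have "z \<in> T k" using yk by (auto simp: T_def slab_def)
      then show "z \<in> (\<Union>k. T k)" by blast
    qed
    then have "emeasure lborel (slab i x a \<rho>) \<le> emeasure lborel (\<Union>k. T k)"
      using i by (intro emeasure_mono) (auto simp: T_def intro!: sets.countable_UN)
    also have "\<dots> \<le> (\<Sum>k. emeasure lborel (T k))"
      using i by (intro emeasure_subadditive_countably) (auto simp: T_def)
    also have "\<dots> \<le> (\<Sum>k. ennreal (4 ^ ?n * (4 * \<rho>) / ?\<omega>) * hausdorff_weight ?n (C k))"
    proof (intro suminf_le)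
      fix k
      show "emeasure lborel (T k) \<le> ennreal (4 ^ ?n * (4 * \<rho>) / ?\<omega>) * hausdorff_weight ?n (C k)"
      proof (cases "C k \<inter> ?E = {}")
        case False
        have D: "diameter (C k) \<ge> 0" by (rule diameter_ge_0[OF bd])
        have "4 ^ ?n * (4 * \<rho>) / ?\<omega> * (?\<omega> * (diameter (C k) / 2) ^ ?n) = (2 * diameter (C k)) ^ ?n * (2 * (2 * \<rho>))"
        proof -
          have "4 * (diameter (C k) / 2) = 2 * diameter (C k)" by simp
          then have "4 ^ ?n * (diameter (C k) / 2) ^ ?n = (2 * diameter (C k)) ^ ?n"
            by (simp only: power_mult_distrib[symmetric])
          moreover have "P * (4 * \<rho>) / w * (w * X) = Y * (2 * (2 * \<rho>))"
            if "P * X = Y" "w > 0" for P X Y w :: real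
            using that by auto
          ultimately show ?thesis using \<omega> by blast
        qed
        moreover have "C k \<noteq> {}" using False by blast
        moreover have "ennreal (4 ^ ?n * (4 * \<rho>) / ?\<omega>) * ennreal (?\<omega> * (diameter (C k) / 2) ^ ?n) =
            ennreal (4 ^ ?n * (4 * \<rho>) / ?\<omega> * (?\<omega> * (diameter (C k) / 2) ^ ?n))"
          using D \<rho> \<omega> by (intro ennreal_mult[symmetric]) auto
        moreover have "emeasure lborel (slab i (y k) (diameter (C k)) (2 * \<rho>)) =
            ennreal ((2 * diameter (C k)) ^ ?n * (2 * (2 * \<rho>)))"
          using i D \<rho> by (intro emeasure_slab) auto
        ultimately show ?thesis using False by (simp only: T_def hausdorff_weight_def if_False)
      qed (simp add: T_def)
    qed auto
    finally show ?thesis using i a \<rho> by (simp add: emeasure_slab)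
  qed
  \<comment> \<open>Any scale would do: the content at each scale is below the outer measure, and
    the box comparison is insensitive to the size of the pieces.\<close>
  have "ennreal ((2 * a) ^ ?n * (2 * \<rho>) / (4 ^ ?n * (4 * \<rho>) / ?\<omega>)) \<le> hausdorff_content ?n 1 ?E"
    unfolding hausdorff_content_def
  proof (safe intro!: INF_greatest)
    fix C :: "nat \<Rightarrow> 'a set" assume C: "?E \<subseteq> (\<Union>k. C k)" "\<forall>k. bounded (C k) \<and> diameter (C k) \<le> 1"
    let ?c = "4 ^ ?n * (4 * \<rho>) / ?\<omega>"
    have c: "?c > 0" using \<rho> \<omega> by simp
    let ?X = "\<Sum>k. hausdorff_weight ?n (C k)"
    have "ennreal ((2 * a) ^ ?n * (2 * \<rho>) / ?c) = ennreal (1 / ?c) * ennreal ((2 * a) ^ ?n * (2 * \<rho>))"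
      using c a \<rho> by (simp add: ennreal_mult[symmetric])
    also have "\<dots> \<le> ennreal (1 / ?c) * (ennreal ?c * ?X)"
      using C by (intro mult_left_mono main) auto
    also have "ennreal (1 / c) * (ennreal c * X) = X" if "c > 0" for c X
      using that by (simp add: mult.assoc[symmetric] ennreal_mult[symmetric])
    from this[OF c] have "ennreal (1 / ?c) * (ennreal ?c * ?X) = ?X" .
    finally show "ennreal ((2 * a) ^ ?n * (2 * \<rho>) / ?c) \<le> ?X" .
  qed
  also have "\<dots> \<le> hausdorff_outer ?n ?E" by (rule hausdorff_content_le_outer) simp
  also have "(2 * a) ^ ?n * (2 * \<rho>) / (4 ^ ?n * (4 * \<rho>) / ?\<omega>) = ?\<omega> / (2 * (4 * L * ?d) ^ ?n) * \<rho> ^ ?n"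
  proof -
    have "(2 * a) ^ n * (2 * \<rho>) / (4 ^ n * (4 * \<rho>) / w) = w / (2 * (4 * L * ?d) ^ n) * \<rho> ^ n" if "w > 0" for n w
    proof -
      have "2 * a = \<rho> / (L * ?d)" by (simp add: a_def)
      then have "(2 * a) ^ n = \<rho> ^ n / (L * ?d) ^ n" by (simp only: power_divide)
      moreover have "(4 * L * ?d) ^ n = 4 ^ n * (L * ?d) ^ n" by (simp only: power_mult_distrib mult.assoc)
      moreover have "(L * ?d) ^ n > 0" using L d1 by simp
      moreover have "R / X * (2 * \<rho>) / (F * (4 * \<rho>) / w) = w / (2 * (F * X)) * R"
        if "X > 0" "F > 0" for X F R :: real
        using that \<open>w > 0\<close> \<rho> by (simp add: field_simps)
      ultimately show ?thesis by simp
    qed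
    then show ?thesis using \<omega> by blast
  qed
  finally show ?thesis .
qed

section \<open>Thin tubes around the boundary\<close>

lemma compact_tube:
  fixes S :: "'a::euclidean_space set"
  assumes "compact S"
  shows "compact {z. \<exists>y\<in>S. dist z y \<le> h}"
proof -
  have "{z. \<exists>y\<in>S. dist z y \<le> h} = (\<lambda>(y, v). y + v) ` (S \<times> cball 0 h)"
  proof (intro set_eqI iffI)
    fix z assume "z \<in> {z. \<exists>y\<in>S. dist z y \<le> h}"
    then obtain y where y: "y \<in> S" "dist z y \<le> h" by blast
    then have "z = (\<lambda>(y, v). y + v) (y, z - y)" "(y, z - y) \<in> S \<times> cball 0 h"
      by (auto simp: dist_norm norm_minus_commute)
    then show "z \<in> (\<lambda>(y, v). y + v) ` (S \<times> cball 0 h)" by (rule image_eqI)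
  next
    fix z assume "z \<in> (\<lambda>(y, v). y + v) ` (S \<times> cball 0 h)"
    then obtain y v where "y \<in> S" "norm v \<le> h" "z = y + v" by auto
    then show "z \<in> {z. \<exists>y\<in>S. dist z y \<le> h}" by (auto simp: dist_norm intro!: bexI[of _ y])
  qed
  moreover have "compact ((\<lambda>(y, v). y + v) ` (S \<times> cball (0::'a) h))"
    by (intro compact_continuous_image compact_Times assms compact_cball)
      (auto simp: split_beta intro!: continuous_intros)
  ultimately show ?thesis by simp
qed

text \<open>\<open>K\<close> is chosen before \<open>G\<close> and \<open>e\<close>; only
  \<open>h0\<close> may depend on them. The density \<open>G\<close> lives on a compact
  \<open>X\<close> containing \<open>S\<close>, in the application the closed domain, and the
  summand \<open>e\<close> absorbs the oscillation of \<open>G\<close> at small scales.\<close>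

definition tube_bound :: "'a::euclidean_space set \<Rightarrow> real \<Rightarrow> bool" where
  "tube_bound S K \<longleftrightarrow> (\<forall>X (G :: 'a \<Rightarrow> real). compact X \<longrightarrow> S \<subseteq> X \<longrightarrow> continuous_on X G \<longrightarrow> (\<forall>x\<in>X. 0 \<le> G x) \<longrightarrow>
    (\<forall>e>0. \<exists>h0>0. \<forall>h. 0 < h \<longrightarrow> h \<le> h0 \<longrightarrow>
      (\<integral>\<^sup>+x. ennreal (G x) * indicator (X \<inter> {z. \<exists>y\<in>S. dist z y \<le> h}) x \<partial>lborel) \<le>
      ennreal (K * h) * ((\<integral>\<^sup>+x. ennreal (G x) * indicator S x \<partial>hausdorff_measure (DIM('a) - 1)) + ennreal e)))"

text \<open>A Minkowski-content estimate: tubes of small radius are measured by the Hausdorff measure.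
  The sets \<open>S \<inter> cball y \<rho>\<close>, \<open>y \<in> P\<close>, are disjoint, while the balls of radius \<open>3 \<rho>\<close> cover \<open>S\<close>.\<close>

lemma tube_integral_le:
  fixes S :: "'a::euclidean_space set"
  assumes lg: "lipschitz_graphs S L r" and S: "compact S"
  shows "\<exists>K>0. tube_bound S K"
proof -
  let ?n = "DIM('a) - 1"
  let ?H = "hausdorff_measure ?n :: 'a measure"
  have r: "r > 0" and L1: "L \<ge> 1" and L: "L \<ge> 0" using lg by (auto simp: lipschitz_graphs_def)
  have clS: "closed S" using S by (rule compact_imp_closed)
  define cl where "cl = unit_ball_vol (real ?n) / (2 * (4 * L * real DIM('a)) ^ ?n)"
  have cl: "cl > 0" unfolding cl_def using L1 DIM_positive[where 'a='a]
    by (intro divide_pos_pos mult_pos_pos zero_less_power) (auto intro: unit_ball_vol_pos)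
  \<comment> \<open>\<open>3 ^ ?n\<close> enters because the tube over a ball of radius
    \<open>3 * \<rho>\<close> is compared with the part of \<open>S\<close> in a ball of radius
    \<open>\<rho>\<close>; \<open>cl\<close> is the lower density of \<open>S\<close>.\<close>
  define K where "K = 4 ^ DIM('a) * packing_const TYPE('a) L * 3 ^ ?n / cl"
  have K: "K > 0" using cl packing_const_pos[OF L, where 'a='a] by (simp add: K_def)
  have Sc [measurable]: "S \<inter> cball y t \<in> sets borel" for y t using clS by (intro borel_closed) auto
  have Sb [measurable]: "S \<in> sets borel" using clS by (intro borel_closed) auto
  show ?thesis
  proof (rule exI[of _ K], unfold tube_bound_def, intro conjI K allI impI)
    fix X and G :: "'a \<Rightarrow> real" and e :: real
    assume X: "compact X" "S \<subseteq> X" and G: "continuous_on X G" "\<forall>x\<in>X. 0 \<le> G x" and e: "e > 0"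
    define m where "m = enn2real (emeasure ?H S)"
    have m: "emeasure ?H S = ennreal m" "m \<ge> 0"
      using hausdorff_outer_finite[OF lg S] by (simp_all add: m_def emeasure_hausdorff_measure Sb)
    \<comment> \<open>\<open>G\<close> is replaced by its value at a net point and back, each time
      within \<open>e'\<close>; the total error \<open>2 * e'\<close> times the measure
      \<open>m\<close> of \<open>S\<close> must stay below \<open>e\<close>. The \<open>+ 1\<close>
      covers \<open>m = 0\<close>.\<close>
    define e' where "e' = e / (2 * (m + 1))"
    have e': "e' > 0" using e m by (simp add: e'_def)
    have e'm: "2 * e' * m \<le> e"
    proof -
      have "2 * e' * m \<le> 2 * e' * (m + 1)" using e' by (intro mult_left_mono) auto
      also have "2 * e' * (m + 1) = e" using m(2) unfolding e'_def by (simp add: field_simps)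
      finally show ?thesis .
    qed
    obtain \<delta> where \<delta>: "\<delta> > 0" "\<And>x y. x \<in> X \<Longrightarrow> y \<in> X \<Longrightarrow> dist x y < \<delta> \<Longrightarrow> \<bar>G x - G y\<bar> < e'"
      using compact_uniformly_continuous[OF G(1) X(1)] e' unfolding uniformly_continuous_on_def dist_real_def by metis
    \<comment> \<open>A tube point lies within \<open>h \<le> \<rho>\<close> of a point that is
      within \<open>3 * \<rho>\<close> of a net point, hence the requirement
      \<open>4 * \<rho> < \<delta>\<close>.\<close>
    define \<rho> where "\<rho> = min (r / 8) (\<delta> / 8)"
    have \<rho>: "\<rho> > 0" "3 * \<rho> < r" "\<rho> < r / 2" "4 * \<rho> < \<delta>" using r \<delta>(1) by (auto simp: \<rho>_def)
    obtain P where P: "finite P" "P \<subseteq> S" "\<And>y z. y \<in> P \<Longrightarrow> z \<in> P \<Longrightarrow> y \<noteq> z \<Longrightarrow> 3 * \<rho> \<le> dist y z"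
        "S \<subseteq> (\<Union>y\<in>P. ball y (3 * \<rho>))"
      using compact_maximal_separated[OF S, of "3 * \<rho>"] \<rho>(1) by (metis mult_pos_pos zero_less_numeral)
    let ?S = "\<lambda>y. S \<inter> cball y \<rho>"
    have disj: "disjoint_family_on ?S P"
      unfolding disjoint_family_on_def
    proof (intro ballI impI, rule ccontr)
      fix y z assume yz: "y \<in> P" "z \<in> P" "y \<noteq> z" "?S y \<inter> ?S z \<noteq> {}"
      then obtain w where "dist y w \<le> \<rho>" "dist z w \<le> \<rho>" by auto
      then have "dist y z \<le> 2 * \<rho>" using dist_triangle2[of y z w] by linarith
      with P(3)[OF yz(1-3)] \<rho>(1) show False by linarith
    qed
    have "(\<integral>\<^sup>+x. ennreal (G x) * indicator (X \<inter> {z. \<exists>y\<in>S. dist z y \<le> h}) x \<partial>lborel) \<le>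
      ennreal (K * h) * ((\<integral>\<^sup>+x. ennreal (G x) * indicator S x \<partial>?H) + ennreal e)" if h: "0 < h" "h \<le> \<rho>" for h
    proof -
      define T where "T y = {z. \<exists>w\<in>S \<inter> cball y (3 * \<rho>). dist z w \<le> h}" for y
      have T [measurable]: "T y \<in> sets borel" for y unfolding T_def
        by (intro borel_closed compact_imp_closed compact_tube compact_Int_closed S) auto
      have Gy: "G y \<ge> 0" if "y \<in> P" for y using that P(2) X(2) G(2) by blast
      have pw: "ennreal (G x) * indicator (X \<inter> {z. \<exists>y\<in>S. dist z y \<le> h}) x \<le>
          (\<Sum>y\<in>P. ennreal (G y + e') * indicator (T y) x)" for x
      proof (cases "x \<in> X \<inter> {z. \<exists>y\<in>S. dist z y \<le> h}")
        case True
        then obtain w where w: "x \<in> X" "w \<in> S" "dist x w \<le> h" by blast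
        then obtain y where y: "y \<in> P" "dist y w < 3 * \<rho>" using P(4) by auto
        have "dist x y \<le> dist x w + dist y w" by (rule dist_triangle2)
        then have "dist x y < \<delta>" using w(3) y(2) h \<rho> by linarith
        then have "\<bar>G x - G y\<bar> < e'" using w(1) y(1) P(2) X(2) by (intro \<delta>(2)) auto
        then have "ennreal (G x) \<le> ennreal (G y + e')" by (intro ennreal_leI) linarith
        moreover have "x \<in> T y" using w y(2) by (auto simp: T_def)
        ultimately have "ennreal (G x) * indicator (X \<inter> {z. \<exists>y\<in>S. dist z y \<le> h}) x \<le> ennreal (G y + e') * indicator (T y) x"
          using True by simp
        also have "\<dots> \<le> (\<Sum>y\<in>P. ennreal (G y + e') * indicator (T y) x)"
          using P(1) y(1) by (intro member_le_sum) auto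
        finally show ?thesis .
      qed simp
      have vol: "emeasure lborel (T y) \<le> ennreal (K * h) * emeasure ?H (?S y)" if y: "y \<in> P" for y
      proof -
        obtain i where i: "lipschitz_graph_at S L r y i" using lg y P(2) unfolding lipschitz_graphs_def by blast
        have "emeasure lborel (T y) \<le> ennreal (4 ^ DIM('a) * packing_const TYPE('a) L * h * (3 * \<rho>) ^ ?n)"
          unfolding T_def using h \<rho> by (intro tube_volume[OF i L S]) auto
        also have "4 ^ DIM('a) * packing_const TYPE('a) L * h * (3 * \<rho>) ^ ?n = (K * h) * (cl * \<rho> ^ ?n)"
        proof -
          have "A * B * h * (C * D) = (A * B * C / c * h) * (c * D)" if "c > 0" for A B C D c :: real
            using that by (simp add: field_simps)
          from this[OF cl] show ?thesis unfolding K_def power_mult_distrib by blast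
        qed
        also have "ennreal ((K * h) * (cl * \<rho> ^ ?n)) = ennreal (K * h) * ennreal (cl * \<rho> ^ ?n)"
          using K cl h \<rho> by (intro ennreal_mult) auto
        also have "ennreal (cl * \<rho> ^ ?n) \<le> emeasure ?H (?S y)"
          using hausdorff_outer_graph_lower[OF i _ L1 \<rho>(1,3)] y P(2)
          unfolding cl_def by (subst emeasure_hausdorff_measure) auto
        finally show ?thesis by (simp add: mult_left_mono)
      qed
      have mono2: "ennreal (G y + e') * emeasure ?H (?S y) \<le> (\<integral>\<^sup>+x. ennreal (G x + 2 * e') * indicator (?S y) x \<partial>?H)"
        if y: "y \<in> P" for y
      proof -
        have "ennreal (G y + e') * emeasure ?H (?S y) = (\<integral>\<^sup>+x. ennreal (G y + e') * indicator (?S y) x \<partial>?H)"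
          by (rule nn_integral_cmult_indicator[symmetric]) simp
        also have "\<dots> \<le> (\<integral>\<^sup>+x. ennreal (G x + 2 * e') * indicator (?S y) x \<partial>?H)"
        proof (rule nn_integral_mono)
          fix x :: 'a
          show "ennreal (G y + e') * indicator (?S y) x \<le> ennreal (G x + 2 * e') * indicator (?S y) x"
          proof (cases "x \<in> ?S y")
            case True
            then have "\<bar>G y - G x\<bar> < e'" using y P(2) X(2) \<rho> by (intro \<delta>(2)) auto
            then have "G y + e' \<le> G x + 2 * e'" by linarith
            then show ?thesis by (intro mult_right_mono ennreal_leI) auto
          qed simp
        qed
        finally show ?thesis .
      qed
      have Gm [measurable]: "(\<lambda>x. ennreal (G x + c) * indicator (?S y) x) \<in> borel_measurable borel" for c y
      proof -
        have "continuous_on (?S y) (\<lambda>x. G x + c)"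
          by (intro continuous_intros continuous_on_subset[OF G(1)]) (use X(2) in auto)
        then have "(\<lambda>x. indicator (?S y) x *\<^sub>R (G x + c)) \<in> borel_measurable borel"
          by (intro borel_measurable_continuous_on_indicator) auto
        then have "(\<lambda>x. ennreal (indicator (?S y) x *\<^sub>R (G x + c))) \<in> borel_measurable borel" by measurable
        moreover have "(\<lambda>x. ennreal (indicator (?S y) x *\<^sub>R (G x + c))) = (\<lambda>x. ennreal (G x + c) * indicator (?S y) x)"
          by (auto simp: indicator_def)
        ultimately show ?thesis by simp
      qed
      have GmS [measurable]: "(\<lambda>x. ennreal (G x) * indicator S x) \<in> borel_measurable borel"
      proof -
        have "(\<lambda>x. indicator S x *\<^sub>R G x) \<in> borel_measurable borel"
          by (intro borel_measurable_continuous_on_indicator continuous_on_subset[OF G(1) X(2)]) auto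
        then have "(\<lambda>x. ennreal (indicator S x *\<^sub>R G x)) \<in> borel_measurable borel" by measurable
        moreover have "(\<lambda>x. ennreal (indicator S x *\<^sub>R G x)) = (\<lambda>x. ennreal (G x) * indicator S x)"
          by (auto simp: indicator_def)
        ultimately show ?thesis by simp
      qed
      have "(\<Sum>y\<in>P. \<integral>\<^sup>+x. ennreal (G x + 2 * e') * indicator (?S y) x \<partial>?H) =
          (\<integral>\<^sup>+x. (\<Sum>y\<in>P. ennreal (G x + 2 * e') * indicator (?S y) x) \<partial>?H)"
        by (rule nn_integral_sum[symmetric]) simp
      also have "\<dots> \<le> (\<integral>\<^sup>+x. ennreal (G x) * indicator S x + ennreal (2 * e') * indicator S x \<partial>?H)"
      proof (rule nn_integral_mono)
        fix x
        have "(\<Sum>y\<in>P. ennreal (G x + 2 * e') * indicator (?S y) x) = ennreal (G x + 2 * e') * indicator (\<Union>y\<in>P. ?S y) x"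
          by (simp only: sum_distrib_left[symmetric] indicator_UN_disjoint[OF P(1) disj])
        also have "\<dots> \<le> ennreal (G x + 2 * e') * indicator S x"
          by (intro mult_left_mono) (auto simp: indicator_def)
        also have "\<dots> = ennreal (G x) * indicator S x + ennreal (2 * e') * indicator S x"
          using e' G(2) X(2) by (auto simp: indicator_def ennreal_plus)
        finally show "(\<Sum>y\<in>P. ennreal (G x + 2 * e') * indicator (?S y) x) \<le> \<dots>" .
      qed
      also have "\<dots> = (\<integral>\<^sup>+x. ennreal (G x) * indicator S x \<partial>?H) + ennreal (2 * e') * emeasure ?H S"
        by (subst nn_integral_add) (auto simp: nn_integral_cmult_indicator)
      also have "\<dots> \<le> (\<integral>\<^sup>+x. ennreal (G x) * indicator S x \<partial>?H) + ennreal e"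
        using e'm e' m by (intro add_left_mono) (simp add: ennreal_mult[symmetric] ennreal_leI)
      finally have inner: "(\<Sum>y\<in>P. \<integral>\<^sup>+x. ennreal (G x + 2 * e') * indicator (?S y) x \<partial>?H) \<le>
          (\<integral>\<^sup>+x. ennreal (G x) * indicator S x \<partial>?H) + ennreal e" .
      have "(\<integral>\<^sup>+x. ennreal (G x) * indicator (X \<inter> {z. \<exists>y\<in>S. dist z y \<le> h}) x \<partial>lborel) \<le>
          (\<integral>\<^sup>+x. (\<Sum>y\<in>P. ennreal (G y + e') * indicator (T y) x) \<partial>lborel)"
        by (intro nn_integral_mono pw)
      also have "\<dots> = (\<Sum>y\<in>P. ennreal (G y + e') * emeasure lborel (T y))"
        by (subst nn_integral_sum) (auto simp: nn_integral_cmult_indicator)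
      also have "\<dots> \<le> (\<Sum>y\<in>P. ennreal (G y + e') * (ennreal (K * h) * emeasure ?H (?S y)))"
        by (intro sum_mono mult_left_mono vol) auto
      also have "\<dots> = ennreal (K * h) * (\<Sum>y\<in>P. ennreal (G y + e') * emeasure ?H (?S y))"
        by (simp add: sum_distrib_left mult_ac)
      also have "\<dots> \<le> ennreal (K * h) * (\<Sum>y\<in>P. \<integral>\<^sup>+x. ennreal (G x + 2 * e') * indicator (?S y) x \<partial>?H)"
        by (intro mult_left_mono sum_mono mono2) auto
      also have "\<dots> \<le> ennreal (K * h) * ((\<integral>\<^sup>+x. ennreal (G x) * indicator S x \<partial>?H) + ennreal e)"
        by (intro mult_left_mono inner) simp
      finally show ?thesis .
    qed
    then show "\<exists>h0>0. \<forall>h. 0 < h \<longrightarrow> h \<le> h0 \<longrightarrow>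
      (\<integral>\<^sup>+x. ennreal (G x) * indicator (X \<inter> {z. \<exists>y\<in>S. dist z y \<le> h}) x \<partial>lborel) \<le>
      ennreal (K * h) * ((\<integral>\<^sup>+x. ennreal (G x) * indicator S x \<partial>?H) + ennreal e)"
      using \<rho>(1) by blast
  qed
qed

section \<open>Integrals over the boundary\<close>

lemma finite_measure_surface_measure:
  fixes \<Omega> :: "'a::euclidean_space set"
  assumes "bounded_smooth_domain \<Omega>"
  shows "finite_measure (surface_measure \<Omega>)"
proof
  obtain L r where "lipschitz_graphs (frontier \<Omega>) L r"
    using bounded_smooth_domain_lipschitz_graphs[OF assms] by blast
  from hausdorff_outer_finite[OF this bounded_smooth_domain_compact_frontier[OF assms]]
  have "hausdorff_outer (DIM('a) - 1) (frontier \<Omega>) < \<infinity>" .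
  then show "emeasure (surface_measure \<Omega>) (space (surface_measure \<Omega>)) \<noteq> \<infinity>"
    by (simp add: surface_measure_def space_restrict_space emeasure_restrict_space emeasure_hausdorff_measure)
qed

lemma space_surface_measure [simp]: "space (surface_measure \<Omega>) = frontier \<Omega>"
  by (simp add: surface_measure_def space_restrict_space)

lemma sets_surface_measure: "sets (surface_measure \<Omega>) = sets (restrict_space borel (frontier \<Omega>))"
  by (simp add: surface_measure_def sets_restrict_space)

lemma borel_measurable_surface_measure_continuous:
  fixes f :: "'a::euclidean_space \<Rightarrow> 'b::topological_space"
  assumes "continuous_on (frontier \<Omega>) f"
  shows "f \<in> borel_measurable (surface_measure \<Omega>)"
  using borel_measurable_continuous_on_restrict[OF assms]
  by (simp cong: measurable_cong_sets add: sets_surface_measure)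

lemma integrable_surface_measure_bounded:
  fixes f :: "'a::euclidean_space \<Rightarrow> 'b::{banach,second_countable_topology}"
  assumes "bounded_smooth_domain \<Omega>" "f \<in> borel_measurable (surface_measure \<Omega>)"
    and "\<And>x. x \<in> frontier \<Omega> \<Longrightarrow> norm (f x) \<le> B"
  shows "integrable (surface_measure \<Omega>) f"
proof -
  interpret finite_measure "surface_measure \<Omega>" by (rule finite_measure_surface_measure[OF assms(1)])
  show ?thesis using assms by (intro integrable_const_bound[of _ B]) auto
qed

lemma nn_integral_surface_measure:
  fixes G :: "'a::euclidean_space \<Rightarrow> real"
  assumes \<Omega>: "bounded_smooth_domain \<Omega>" and G: "continuous_on (frontier \<Omega>) G" "\<And>x. x \<in> frontier \<Omega> \<Longrightarrow> G x \<ge> 0"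
  shows "(\<integral>\<^sup>+x. ennreal (G x) * indicator (frontier \<Omega>) x \<partial>hausdorff_measure (DIM('a) - 1)) =
    ennreal (LINT x|surface_measure \<Omega>. G x)"
proof -
  have "compact (G ` frontier \<Omega>)"
    by (intro compact_continuous_image G bounded_smooth_domain_compact_frontier \<Omega>)
  then obtain B where "\<And>x. x \<in> frontier \<Omega> \<Longrightarrow> norm (G x) \<le> B"
    using compact_imp_bounded by (metis bounded_iff imageI)
  then have "integrable (surface_measure \<Omega>) G"
    by (intro integrable_surface_measure_bounded \<Omega> borel_measurable_surface_measure_continuous G)
  then have "(\<integral>\<^sup>+x. ennreal (G x) \<partial>surface_measure \<Omega>) = ennreal (LINT x|surface_measure \<Omega>. G x)"
    by (intro nn_integral_eq_integral AE_I2) (auto intro: G)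
  then show ?thesis by (simp add: surface_measure_def nn_integral_restrict_space)
qed

section \<open>A divergence inequality\<close>

lemma Ck_closure_open_partial:
  assumes "Ck_closure k \<Omega> f" "set is \<subseteq> Basis" "length is \<le> k"
  obtains g where "continuous_on (closure \<Omega>) g" "\<And>x. x \<in> \<Omega> \<Longrightarrow> g x = iter_partial is f x"
proof -
  have "is \<in> lists Basis" using assms(2) by (simp add: in_lists_conv_set subset_eq)
  then show thesis using assms(1,3) that unfolding Ck_closure_def by blast
qed

lemma lborel_integral_shift:
  fixes f :: "'a::euclidean_space \<Rightarrow> real"
  assumes "f \<in> borel_measurable borel"
  shows "(LINT x|lborel. f (x + c)) = (LINT x|lborel. f x)"
proof -
  have "(LINT x|lborel. f x) = (LINT x|distr lborel borel ((+) c). f x)"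
    by (simp add: lborel_distr_plus)
  also have "\<dots> = (LINT x|lborel. f (c + x))"
    using assms by (intro integral_distr) auto
  finally show ?thesis by (simp add: add.commute)
qed

text \<open>Integration by parts against the distance cutoff. Only difference quotients of the Lipschitz
  function \<open>\<theta>\<close> occur, so that it need not be differentiated.\<close>

lemma cutoff_integral_partial_deriv_le:
  fixes \<Omega> :: "'a::euclidean_space set" and V :: "'a \<Rightarrow> real"
  assumes \<Omega>: "open \<Omega>" "bounded \<Omega>" "\<Omega> \<noteq> {}" and i: "i \<in> Basis"
    and V: "\<And>x. x \<in> \<Omega> \<Longrightarrow> V differentiable (at x)"
    and v: "continuous_on \<Omega> v" "\<And>x. x \<in> \<Omega> \<Longrightarrow> partial_deriv i V x = v x" "\<And>x. x \<in> \<Omega> \<Longrightarrow> \<bar>v x\<bar> \<le> B"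
    and G: "(\<lambda>x. indicator \<Omega> x * G x) \<in> borel_measurable borel" "\<And>x. x \<in> \<Omega> \<Longrightarrow> \<bar>V x\<bar> \<le> G x" "\<And>x. x \<in> \<Omega> \<Longrightarrow> G x \<le> BG"
    and h: "h > 0"
  defines "\<theta> \<equiv> \<lambda>x. max 0 (min 1 ((infdist x (- \<Omega>) - h) / h))"
  shows "\<bar>LINT x|lborel. indicator \<Omega> x * (\<theta> x * v x)\<bar> \<le>
     (1 / h) * (LINT x|lborel. indicator (\<Omega> \<inter> {x. infdist x (- \<Omega>) < 3 * h}) x * G x)"
proof -
  let ?D = "\<lambda>x. infdist x (- \<Omega>)"
  have C: "- \<Omega> \<noteq> {}"
  proof
    assume "- \<Omega> = {}"
    then have "\<Omega> = UNIV" by auto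
    with \<Omega>(2) show False by simp
  qed
  have Dcont: "continuous_on A ?D" for A by (intro continuous_intros)
  have D0: "?D x = 0" if "x \<notin> \<Omega>" for x using that by simp
  have Dlip: "\<bar>?D x - ?D y\<bar> \<le> dist x y" for x y
    using infdist_triangle[of x "- \<Omega>" y] infdist_triangle[of y "- \<Omega>" x] by (simp add: dist_commute abs_le_iff)
  have ball: "ball x h \<subseteq> \<Omega>" if "?D x \<ge> h" for x
  proof
    fix y assume "y \<in> ball x h"
    then have "?D y > 0" using Dlip[of x y] that by auto
    then show "y \<in> \<Omega>" using D0[of y] by fastforce
  qed
  have \<Omega>b [measurable]: "\<Omega> \<in> sets borel" using \<Omega>(1) by simp
  have \<theta>m [measurable]: "\<theta> \<in> borel_measurable borel"
    unfolding \<theta>_def by (intro borel_measurable_continuous_onI continuous_intros Dcont) (use h in auto)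
  have \<theta>01: "0 \<le> \<theta> x" "\<theta> x \<le> 1" for x by (auto simp: \<theta>_def)
  have \<theta>D: "?D x \<ge> h" if "\<theta> x \<noteq> 0" for x
  proof (rule ccontr)
    assume "\<not> h \<le> ?D x"
    then have "(?D x - h) / h \<le> 0" using h by (simp add: divide_le_0_iff)
    then show False using that by (simp add: \<theta>_def)
  qed
  have \<theta>1: "\<theta> x = 1" if "?D x \<ge> 2 * h" for x
  proof -
    have "(?D x - h) / h \<ge> 1" using that h by (simp add: le_divide_eq)
    then show ?thesis by (simp add: \<theta>_def)
  qed
  have \<theta>lip: "\<bar>\<theta> x - \<theta> y\<bar> \<le> dist x y / h" for x y
  proof -
    have "\<bar>\<theta> x - \<theta> y\<bar> \<le> \<bar>(?D x - h) / h - (?D y - h) / h\<bar>" unfolding \<theta>_def by linarith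
    also have "\<dots> = \<bar>?D x - ?D y\<bar> / h" using h by (simp add: diff_divide_distrib[symmetric])
    also have "\<dots> \<le> dist x y / h" using Dlip h by (intro divide_right_mono) auto
    finally show ?thesis .
  qed
  have fin\<Omega>: "emeasure lborel \<Omega> < \<infinity>" using \<Omega>(2) by (rule emeasure_bounded_finite)
  have Vc: "continuous_on \<Omega> V"
    using V by (auto intro!: continuous_at_imp_continuous_on differentiable_imp_continuous_within)
  \<comment> \<open>The zero extension may jump at the boundary, but \<open>\<theta>\<close>
    vanishes within distance \<open>h\<close> of the complement and all shifts are shorter than
    \<open>h\<close>, so the quotients in \<open>q\<close> compare values inside the domain
    only.\<close>
  define V0 where "V0 x = indicator \<Omega> x *\<^sub>R V x" for x
  have V0m [measurable]: "V0 \<in> borel_measurable borel" unfolding V0_def[abs_def]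
    by (intro borel_measurable_continuous_on_indicator Vc) auto
  have vm [measurable]: "(\<lambda>x. indicator \<Omega> x * v x) \<in> borel_measurable borel"
    using borel_measurable_continuous_on_indicator[OF _ v(1)] by simp
  have intb: "integrable lborel f" if "f \<in> borel_measurable borel" "\<And>x. x \<notin> \<Omega> \<Longrightarrow> f x = 0" "\<And>x. x \<in> \<Omega> \<Longrightarrow> \<bar>f x\<bar> \<le> c"
    for f :: "'a \<Rightarrow> real" and c
  proof (rule Bochner_Integration.integrable_bound)
    show "integrable lborel (\<lambda>x. indicator \<Omega> x *\<^sub>R c)" using fin\<Omega> by (intro integrable_scaleR_left integrable_real_indicator) auto
    show "AE x in lborel. norm (f x) \<le> norm (indicator \<Omega> x *\<^sub>R c)"
      using that(2,3) by (auto intro!: AE_I2 simp: indicator_def intro: order_trans[OF _ abs_ge_self])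
  qed (use that in simp)
  define I where "I = (LINT x|lborel. indicator (\<Omega> \<inter> {x. ?D x < 3 * h}) x * G x)"
  have setm [measurable]: "{x. ?D x < 3 * h} \<in> sets borel"
    by (intro borel_open open_Collect_less Dcont continuous_on_const)
  have intG: "integrable lborel (\<lambda>x. indicator (\<Omega> \<inter> {x. ?D x < 3 * h}) x * G x)"
  proof (rule intb[of _ BG])
    have "(\<lambda>x. indicator {x. ?D x < 3 * h} x * (indicator \<Omega> x * G x)) \<in> borel_measurable borel"
      using G(1) by measurable
    then show "(\<lambda>x. indicator (\<Omega> \<inter> {x. ?D x < 3 * h}) x * G x) \<in> borel_measurable borel"
      by (simp add: indicator_inter_arith mult_ac)
    fix x assume "x \<in> \<Omega>"
    moreover from this have "G x \<ge> 0" "G x \<le> BG" using G(2,3)[of x] by auto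
    ultimately show "\<bar>indicator (\<Omega> \<inter> {x. ?D x < 3 * h}) x * G x\<bar> \<le> BG" by (auto simp: indicator_def)
  qed auto
  define t where "t n = h / real (n + 2)" for n
  have t: "t n > 0" "t n < h" "t n \<le> h" for n
  proof -
    show "t n > 0" using h by (simp add: t_def)
    have "h / real (n + 2) < h / 1" using h by (intro divide_strict_left_mono) auto
    then show "t n < h" "t n \<le> h" by (auto simp: t_def)
  qed
  have t0: "t \<longlonglongrightarrow> 0"
    unfolding t_def using LIMSEQ_ignore_initial_segment[OF lim_const_over_n[of h], of 2] by simp
  define q where "q n x = \<theta> x * ((V0 (x + t n *\<^sub>R i) - V0 x) / t n)" for n x
  have qm [measurable]: "q n \<in> borel_measurable borel" for n unfolding q_def[abs_def] by measurable
  have mvt: "\<bar>V0 (x + s *\<^sub>R i) - V0 x\<bar> \<le> B * s" if x: "?D x \<ge> h" and s: "0 < s" "s < h" for x s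
  proof -
    have b: "x \<in> ball x h" "x + s *\<^sub>R i \<in> ball x h" using h s i by (auto simp: dist_norm)
    obtain y where y: "y \<in> ball x h" "V (x + s *\<^sub>R i) - V x = (\<Sum>j\<in>Basis. ((x + s *\<^sub>R i - x) \<bullet> j) * partial_deriv j V y)"
      using ball_mvt[of x h V "\<lambda>j. partial_deriv j V" x "x + s *\<^sub>R i", OF _ b] has_derivative_partial_deriv[OF V] ball[OF x]
      by (auto simp: subset_eq)
    have "(\<Sum>j\<in>Basis. ((x + s *\<^sub>R i - x) \<bullet> j) * partial_deriv j V y) = s * partial_deriv i V y"
      using i by (simp add: inner_Basis if_distrib if_distribR sum.delta cong: if_cong)
    moreover have "\<bar>partial_deriv i V y\<bar> \<le> B" using v(2,3)[of y] y(1) ball[OF x] by auto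
    moreover have "x \<in> \<Omega>" "x + s *\<^sub>R i \<in> \<Omega>" using b ball[OF x] by auto
    ultimately show ?thesis using y(2) s by (simp add: V0_def abs_mult mult.commute)
  qed
  \<comment> \<open>Dominated convergence: the mean value bound \<open>mvt\<close> bounds the
    quotients by \<open>B\<close> wherever \<open>\<theta>\<close> does not vanish.\<close>
  have lim: "(\<lambda>n. LINT x|lborel. q n x) \<longlonglongrightarrow> (LINT x|lborel. indicator \<Omega> x * (\<theta> x * v x))"
  proof (rule integral_dominated_convergence[where w = "\<lambda>x. indicator \<Omega> x *\<^sub>R \<bar>B\<bar>"])
    have "(\<lambda>x. \<theta> x * (indicator \<Omega> x * v x)) \<in> borel_measurable borel" by measurable
    then show "(\<lambda>x. indicator \<Omega> x * (\<theta> x * v x)) \<in> borel_measurable lborel" by (simp add: mult_ac)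
    show "integrable lborel (\<lambda>x. indicator \<Omega> x *\<^sub>R \<bar>B\<bar>)"
      using fin\<Omega> by (intro integrable_scaleR_left integrable_real_indicator) auto
    show "AE x in lborel. (\<lambda>n. q n x) \<longlonglongrightarrow> indicator \<Omega> x * (\<theta> x * v x)"
    proof (rule AE_I2)
      fix x
      show "(\<lambda>n. q n x) \<longlonglongrightarrow> indicator \<Omega> x * (\<theta> x * v x)"
      proof (cases "\<theta> x = 0")
        case False
        then have Dx: "?D x \<ge> h" by (rule \<theta>D)
        have x: "x \<in> \<Omega>" using ball[OF Dx] h by (auto simp: subset_eq)
        have xt: "x + t n *\<^sub>R i \<in> \<Omega>" for n using ball[OF Dx] t[of n] i by (auto simp: subset_eq dist_norm)
        have "((\<lambda>s. V (x + s *\<^sub>R i)) has_vector_derivative v x) (at 0)"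
        proof -
          have "((\<lambda>s. x + s *\<^sub>R i) has_derivative (\<lambda>s. s *\<^sub>R i)) (at 0)" by (auto intro!: derivative_eq_intros)
          moreover have "(V has_derivative (\<lambda>w. \<Sum>j\<in>Basis. (w \<bullet> j) *\<^sub>R partial_deriv j V x)) (at (x + 0 *\<^sub>R i))"
            using has_derivative_partial_deriv[OF V[OF x]] by simp
          ultimately have "((\<lambda>s. V (x + s *\<^sub>R i)) has_derivative (\<lambda>s. \<Sum>j\<in>Basis. ((s *\<^sub>R i) \<bullet> j) *\<^sub>R partial_deriv j V x)) (at 0)"
            by (rule has_derivative_compose)
          moreover have "(\<lambda>s. \<Sum>j\<in>Basis. ((s *\<^sub>R i) \<bullet> j) *\<^sub>R partial_deriv j V x) = (\<lambda>s. s *\<^sub>R v x)"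
            using i v(2)[OF x] by (simp add: inner_Basis if_distrib if_distribR sum.delta cong: if_cong)
          ultimately show ?thesis by (simp add: has_vector_derivative_def)
        qed
        then have "((\<lambda>s. (V (x + s *\<^sub>R i) - V x) / s) \<longlongrightarrow> v x) (at 0)"
          by (simp add: has_real_derivative_iff_has_vector_derivative[symmetric] DERIV_def)
        moreover have "filterlim t (at 0) sequentially"
          unfolding filterlim_at using t0 t(1) by (auto simp: less_imp_neq[symmetric])
        ultimately have "(\<lambda>n. (V (x + t n *\<^sub>R i) - V x) / t n) \<longlonglongrightarrow> v x"
          by (rule filterlim_compose)
        then have "(\<lambda>n. \<theta> x * ((V (x + t n *\<^sub>R i) - V x) / t n)) \<longlonglongrightarrow> \<theta> x * v x"
          by (intro tendsto_intros)
        then show ?thesis using x xt by (simp add: q_def V0_def)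
      qed (simp add: q_def)
    qed
    show "AE x in lborel. norm (q n x) \<le> indicator \<Omega> x *\<^sub>R \<bar>B\<bar>" for n
    proof (rule AE_I2)
      fix x
      show "norm (q n x) \<le> indicator \<Omega> x *\<^sub>R \<bar>B\<bar>"
      proof (cases "\<theta> x = 0")
        case False
        then have Dx: "?D x \<ge> h" by (rule \<theta>D)
        have x: "x \<in> \<Omega>" using ball[OF Dx] h by (auto simp: subset_eq)
        have "\<bar>V0 (x + t n *\<^sub>R i) - V0 x\<bar> / t n \<le> B" using mvt[OF Dx t(1,2)] t(1)[of n] by (simp add: divide_le_eq)
        then have "\<bar>\<theta> x\<bar> * (\<bar>V0 (x + t n *\<^sub>R i) - V0 x\<bar> / t n) \<le> 1 * \<bar>B\<bar>"
          using \<theta>01[of x] t(1)[of n] by (intro mult_mono) auto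
        then show ?thesis using x t(1)[of n] by (simp add: q_def abs_mult)
      qed (simp add: q_def)
    qed
  qed measurable
  \<comment> \<open>Translation invariance moves the difference quotient from \<open>V0\<close> to
    \<open>\<theta>\<close>. It is bounded by \<open>1 / h\<close>, and it vanishes where the
    distance to the complement is at least \<open>3 * h\<close>, because \<open>\<theta> = 1\<close>
    from distance \<open>2 * h\<close> on and the shift is shorter than \<open>h\<close>.\<close>
  have qI: "\<bar>LINT x|lborel. q n x\<bar> \<le> (1 / h) * I" for n
  proof -
    let ?p = "\<lambda>x. (\<theta> (x - t n *\<^sub>R i) - \<theta> x) / t n * V0 x"
    obtain BV where BV: "\<And>x. x \<in> \<Omega> \<Longrightarrow> \<bar>V x\<bar> \<le> BV" using G(2,3) by (meson order_trans)
    have int1: "integrable lborel (\<lambda>x. \<theta> (x - t n *\<^sub>R i) * V0 x)"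
    proof (rule intb[of _ "\<bar>BV\<bar>"])
      show "(\<lambda>x. \<theta> (x - t n *\<^sub>R i) * V0 x) \<in> borel_measurable borel" by measurable
      show "\<bar>\<theta> (x - t n *\<^sub>R i) * V0 x\<bar> \<le> \<bar>BV\<bar>" if "x \<in> \<Omega>" for x
      proof -
        have "\<bar>\<theta> (x - t n *\<^sub>R i)\<bar> * \<bar>V0 x\<bar> \<le> 1 * \<bar>BV\<bar>"
          using \<theta>01[of "x - t n *\<^sub>R i"] BV[OF that] that by (intro mult_mono) (auto simp: V0_def)
        then show ?thesis by (simp add: abs_mult)
      qed
    qed (simp add: V0_def)
    have int2: "integrable lborel (\<lambda>x. \<theta> x * V0 x)"
    proof (rule intb[of _ "\<bar>BV\<bar>"])
      show "(\<lambda>x. \<theta> x * V0 x) \<in> borel_measurable borel" by measurable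
      show "\<bar>\<theta> x * V0 x\<bar> \<le> \<bar>BV\<bar>" if "x \<in> \<Omega>" for x
      proof -
        have "\<bar>\<theta> x\<bar> * \<bar>V0 x\<bar> \<le> 1 * \<bar>BV\<bar>"
          using \<theta>01[of x] BV[OF that] that by (intro mult_mono) (auto simp: V0_def)
        then show ?thesis by (simp add: abs_mult)
      qed
    qed (simp add: V0_def)
    have int3: "integrable lborel (\<lambda>x. \<theta> x * V0 (x + t n *\<^sub>R i))"
    proof (rule intb[of _ "\<bar>BV\<bar>"])
      show "\<theta> x * V0 (x + t n *\<^sub>R i) = 0" if "x \<notin> \<Omega>" for x
        using \<theta>D[of x] D0[OF that] h by auto
      show "\<bar>\<theta> x * V0 (x + t n *\<^sub>R i)\<bar> \<le> \<bar>BV\<bar>" for x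
      proof -
        have "\<bar>V0 y\<bar> \<le> \<bar>BV\<bar>" for y using BV[of y] by (auto simp: V0_def indicator_def)
        then have "\<bar>\<theta> x\<bar> * \<bar>V0 (x + t n *\<^sub>R i)\<bar> \<le> 1 * \<bar>BV\<bar>"
          using \<theta>01[of x] by (intro mult_mono) auto
        then show ?thesis by (simp add: abs_mult)
      qed
    qed measurable
    have shift: "(LINT x|lborel. \<theta> x * V0 (x + t n *\<^sub>R i)) = (LINT x|lborel. \<theta> (x - t n *\<^sub>R i) * V0 x)"
      using lborel_integral_shift[of "\<lambda>x. \<theta> (x - t n *\<^sub>R i) * V0 x" "t n *\<^sub>R i"] by simp
    have "(LINT x|lborel. q n x) = (LINT x|lborel. (\<theta> x * V0 (x + t n *\<^sub>R i) - \<theta> x * V0 x) / t n)"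
      by (simp add: q_def algebra_simps)
    also have "\<dots> = ((LINT x|lborel. \<theta> (x - t n *\<^sub>R i) * V0 x) - (LINT x|lborel. \<theta> x * V0 x)) / t n"
      using int2 int3 by (simp add: shift)
    also have "\<dots> = (LINT x|lborel. (\<theta> (x - t n *\<^sub>R i) * V0 x - \<theta> x * V0 x) / t n)"
      using int1 int2 by simp
    finally have eq: "(LINT x|lborel. q n x) = (LINT x|lborel. (\<theta> (x - t n *\<^sub>R i) * V0 x - \<theta> x * V0 x) / t n)" .
    have "norm (LINT x|lborel. (\<theta> (x - t n *\<^sub>R i) * V0 x - \<theta> x * V0 x) / t n) \<le>
        (LINT x|lborel. (1 / h) * (indicator (\<Omega> \<inter> {x. ?D x < 3 * h}) x * G x))"
    proof (rule order_trans[OF integral_norm_bound Bochner_Integration.integral_mono])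
      show "integrable lborel (\<lambda>x. norm ((\<theta> (x - t n *\<^sub>R i) * V0 x - \<theta> x * V0 x) / t n))"
        using int1 int2 by (intro integrable_norm) simp
      show "integrable lborel (\<lambda>x. (1 / h) * (indicator (\<Omega> \<inter> {x. ?D x < 3 * h}) x * G x))" using intG by simp
      fix x
      show "norm ((\<theta> (x - t n *\<^sub>R i) * V0 x - \<theta> x * V0 x) / t n) \<le> (1 / h) * (indicator (\<Omega> \<inter> {x. ?D x < 3 * h}) x * G x)"
      proof (cases "x \<in> \<Omega>")
        case x: True
        have eqx: "(\<theta> (x - t n *\<^sub>R i) * V0 x - \<theta> x * V0 x) / t n = (\<theta> (x - t n *\<^sub>R i) - \<theta> x) / t n * V x"
          using x by (simp add: V0_def algebra_simps)
        have dt: "dist (x - t n *\<^sub>R i) x = t n" using t(1)[of n] i by (simp add: dist_norm)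
        show ?thesis
        proof (cases "?D x < 3 * h")
          case True
          have "\<bar>\<theta> (x - t n *\<^sub>R i) - \<theta> x\<bar> / t n \<le> 1 / h"
            using \<theta>lip[of "x - t n *\<^sub>R i" x] t(1)[of n] h unfolding dt by (simp add: divide_simps mult.commute)
          then have "\<bar>\<theta> (x - t n *\<^sub>R i) - \<theta> x\<bar> / t n * \<bar>V x\<bar> \<le> 1 / h * G x"
            using G(2)[OF x] h by (intro mult_mono) auto
          then show ?thesis unfolding eqx using x True t(1)[of n] by (simp add: abs_mult)
        next
          case False
          then have "?D (x - t n *\<^sub>R i) \<ge> 2 * h" using Dlip[of "x - t n *\<^sub>R i" x] t[of n] unfolding dt by linarith
          then have "\<theta> (x - t n *\<^sub>R i) = 1" "\<theta> x = 1" using False h by (auto intro!: \<theta>1)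
          then show ?thesis using False by simp
        qed
      qed (simp add: V0_def)
    qed
    then show ?thesis unfolding eq I_def by simp
  qed
  have "(\<lambda>n. \<bar>LINT x|lborel. q n x\<bar>) \<longlonglongrightarrow> \<bar>LINT x|lborel. indicator \<Omega> x * (\<theta> x * v x)\<bar>"
    by (intro tendsto_rabs lim)
  then show ?thesis unfolding I_def[symmetric] by (rule LIMSEQ_le_const2) (use qI in auto)
qed

text \<open>The segment to a close point of the complement crosses the frontier no later than at
  that point.\<close>

lemma infdist_complement_frontier:
  fixes \<Omega> :: "'a::euclidean_space set"
  assumes "x \<in> \<Omega>" "- \<Omega> \<noteq> {}" "infdist x (- \<Omega>) < h"
  shows "\<exists>y\<in>frontier \<Omega>. dist x y \<le> h"
proof -
  obtain z where z: "z \<in> - \<Omega>" "dist x z < h"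
    using assms(2,3) unfolding infdist_notempty[OF assms(2)]
    by (subst (asm) cINF_less_iff) auto
  have "closed_segment x z \<inter> frontier \<Omega> \<noteq> {}"
    by (rule connected_Int_frontier) (use assms(1) z(1) in auto)
  then obtain y where y: "y \<in> closed_segment x z" "y \<in> frontier \<Omega>" by blast
  have "dist x y \<le> dist x z" using segment_bound(1)[OF y(1)] by (simp add: dist_norm norm_minus_commute)
  with y z show ?thesis by (intro bexI[of _ y]) auto
qed

lemma differentiable_inner_left:
  fixes U :: "'a::euclidean_space \<Rightarrow> 'b::real_inner"
  assumes "U differentiable (at x)"
  shows "(\<lambda>x. U x \<bullet> i) differentiable (at x)" "partial_deriv j (\<lambda>x. U x \<bullet> i) x = partial_deriv j U x \<bullet> i"
proof -
  obtain U' where U': "(U has_derivative U') (at x)" using assms by (auto simp: differentiable_def)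
  have 1: "((\<lambda>x. U x \<bullet> i) has_derivative (\<lambda>v. U' v \<bullet> i)) (at x)"
    by (rule has_derivative_inner_left[OF U'])
  then show "(\<lambda>x. U x \<bullet> i) differentiable (at x)" by (auto simp: differentiable_def)
  show "partial_deriv j (\<lambda>x. U x \<bullet> i) x = partial_deriv j U x \<bullet> i"
    by (simp add: partial_deriv_eq[OF 1] partial_deriv_eq[OF U'])
qed

text \<open>Each coordinate of \<open>U\<close> is tested against the cutoff. The boundary layer of
  width \<open>3 * h\<close> has \<open>G\<close>-mass of order \<open>h\<close> by the tube
  estimate, which cancels the \<open>1 / h\<close> from the slope of the cutoff; letting
  \<open>h\<close> tend to 0 leaves the boundary integral of \<open>G\<close>.\<close>

lemma divergence_integral_ge:
  fixes \<Omega> :: "'a::euclidean_space set"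
  assumes \<Omega>: "bounded_smooth_domain \<Omega>"
  shows "\<exists>K>0. \<forall>U G. Ck_closure 1 \<Omega> U \<longrightarrow> continuous_on (closure \<Omega>) G \<longrightarrow> (\<forall>x\<in>\<Omega>. norm (U x) \<le> G x) \<longrightarrow>
     integrable lborel (\<lambda>x. indicator \<Omega> x * divergence U x) \<and>
     (LINT x|lborel. indicator \<Omega> x * divergence U x) \<ge> - K * (LINT x|surface_measure \<Omega>. G x)"
proof -
  let ?S = "frontier \<Omega>" and ?D = "\<lambda>x. infdist x (- \<Omega>)"
  have op: "open \<Omega>" "bounded \<Omega>" "\<Omega> \<noteq> {}" using \<Omega> by (auto simp: bounded_smooth_domain_def)
  have cS: "compact ?S" by (rule bounded_smooth_domain_compact_frontier[OF \<Omega>])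
  have cc: "compact (closure \<Omega>)" using op(2) by simp
  have Scl: "?S \<subseteq> closure \<Omega>" by (simp add: frontier_def)
  have C: "- \<Omega> \<noteq> {}"
  proof
    assume "- \<Omega> = {}"
    then have "\<Omega> = UNIV" by auto
    with op(2) show False by simp
  qed
  have \<Omega>b [measurable]: "\<Omega> \<in> sets borel" using op(1) by simp
  have fin\<Omega>: "emeasure lborel \<Omega> < \<infinity>" using op(2) by (rule emeasure_bounded_finite)
  obtain L r where lg: "lipschitz_graphs ?S L r" using bounded_smooth_domain_lipschitz_graphs[OF \<Omega>] by blast
  obtain K where K: "K > 0" "tube_bound ?S K" using tube_integral_le[OF lg cS] by blast
  note tube = K(2)[unfolded tube_bound_def, rule_format]
  \<comment> \<open>3 from the layer width \<open>3 * h\<close>, the dimension from the sum over the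
    coordinates.\<close>
  define K' where "K' = 3 * real DIM('a) * K"
  have K': "K' > 0" using K by (simp add: K'_def)
  show ?thesis
  proof (rule exI[of _ K'], intro conjI allI impI K')
    fix U :: "'a \<Rightarrow> 'a" and G :: "'a \<Rightarrow> real"
    assume U: "Ck_closure 1 \<Omega> U" and G: "continuous_on (closure \<Omega>) G" and UG: "\<forall>x\<in>\<Omega>. norm (U x) \<le> G x"
    have G0: "G x \<ge> 0" if "x \<in> closure \<Omega>" for x
    proof (rule continuous_ge_on_closure[OF G that])
      show "0 \<le> G x" if "x \<in> \<Omega>" for x using UG that norm_ge_zero order_trans by blast
    qed
    obtain BG where BG: "\<And>x. x \<in> closure \<Omega> \<Longrightarrow> \<bar>G x\<bar> \<le> BG"
      using compact_imp_bounded[OF compact_continuous_image[OF G cc]] by (auto simp: bounded_iff)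
    have Ud: "U differentiable (at x)" if "x \<in> \<Omega>" for x
    proof -
      have "[] \<in> lists (Basis :: 'a set)" by simp
      with U that have "iter_partial [] U differentiable (at x)" unfolding Ck_closure_def by (metis length_0_conv zero_less_one)
      then show ?thesis by simp
    qed
    have "\<exists>g. continuous_on (closure \<Omega>) g \<and> (\<forall>x\<in>\<Omega>. g x = partial_deriv i U x)" if i: "i \<in> Basis" for i
    proof -
      obtain g where "continuous_on (closure \<Omega>) g" "\<And>x. x \<in> \<Omega> \<Longrightarrow> g x = iter_partial [i] U x"
        using Ck_closure_open_partial[OF U, of "[i]"] i by auto
      then show ?thesis by auto
    qed
    then obtain g where g: "\<And>i. i \<in> Basis \<Longrightarrow> continuous_on (closure \<Omega>) (g i)"
        "\<And>i x. i \<in> Basis \<Longrightarrow> x \<in> \<Omega> \<Longrightarrow> g i x = partial_deriv i U x" by metis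
    define v where "v i x = g i x \<bullet> i" for i x
    have v: "continuous_on (closure \<Omega>) (v i)" if "i \<in> Basis" for i
      unfolding v_def[abs_def] by (intro continuous_intros g that)
    have vd: "divergence U x = (\<Sum>i\<in>Basis. v i x)" if "x \<in> \<Omega>" for x
      unfolding divergence_def v_def using g(2) that by (intro sum.cong) auto
    have "\<exists>B. \<forall>x\<in>closure \<Omega>. \<bar>v i x\<bar> \<le> B" if "i \<in> Basis" for i
      using compact_imp_bounded[OF compact_continuous_image[OF v[OF that] cc]] by (auto simp: bounded_iff)
    then obtain B where B: "\<And>i x. i \<in> Basis \<Longrightarrow> x \<in> closure \<Omega> \<Longrightarrow> \<bar>v i x\<bar> \<le> B i" by metis
    have v\<Omega>: "continuous_on \<Omega> (v i)" if "i \<in> Basis" for i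
      using v[OF that] closure_subset by (rule continuous_on_subset)
    have intv: "integrable lborel (\<lambda>x. indicator \<Omega> x * (c x * v i x))"
      if "i \<in> Basis" "c \<in> borel_measurable borel" "\<And>x. \<bar>c x\<bar> \<le> 1" for i and c :: "'a \<Rightarrow> real"
    proof (rule Bochner_Integration.integrable_bound)
      show "integrable lborel (\<lambda>x. indicator \<Omega> x *\<^sub>R B i)"
        using fin\<Omega> by (intro integrable_scaleR_left integrable_real_indicator) auto
      have "(\<lambda>x. c x * (indicator \<Omega> x * v i x)) \<in> borel_measurable borel"
        using borel_measurable_continuous_on_indicator[OF _ v\<Omega>[OF that(1)]] that(2) by simp
      then show "(\<lambda>x. indicator \<Omega> x * (c x * v i x)) \<in> borel_measurable lborel" by (simp add: mult_ac)
      show "AE x in lborel. norm (indicator \<Omega> x * (c x * v i x)) \<le> norm (indicator \<Omega> x *\<^sub>R B i)"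
      proof (rule AE_I2)
        fix x
        have "\<bar>c x\<bar> * \<bar>v i x\<bar> \<le> 1 * \<bar>B i\<bar>" if "x \<in> \<Omega>"
          using B[OF \<open>i \<in> Basis\<close>, of x] \<open>x \<in> \<Omega>\<close> closure_subset[of \<Omega>] \<open>\<bar>c x\<bar> \<le> 1\<close>
          by (intro mult_mono) auto
        then show "norm (indicator \<Omega> x * (c x * v i x)) \<le> norm (indicator \<Omega> x *\<^sub>R B i)"
          by (auto simp: indicator_def abs_mult)
      qed
    qed
    have eqdiv: "indicator \<Omega> x * divergence U x = (\<Sum>i\<in>Basis. indicator \<Omega> x * (1 * v i x))" for x
      using vd[of x] by (auto simp: indicator_def)
    show "integrable lborel (\<lambda>x. indicator \<Omega> x * divergence U x)"
      unfolding eqdiv by (intro Bochner_Integration.integrable_sum intv) auto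
    define \<theta> where "\<theta> h x = max 0 (min 1 ((?D x - h) / h))" for h x
    have \<theta>m: "\<theta> h \<in> borel_measurable borel" if "h > 0" for h
      unfolding \<theta>_def[abs_def] by (intro borel_measurable_continuous_onI continuous_intros) (use that in auto)
    have \<theta>01: "\<bar>\<theta> h x\<bar> \<le> 1" for h x by (auto simp: \<theta>_def)
    have Gm: "(\<lambda>x. indicator \<Omega> x * G x) \<in> borel_measurable borel"
      using borel_measurable_continuous_on_indicator[OF _ continuous_on_subset[OF G closure_subset]] by simp
    have part: "\<bar>LINT x|lborel. indicator \<Omega> x * (\<theta> h x * v i x)\<bar> \<le>
       (1 / h) * (LINT x|lborel. indicator (\<Omega> \<inter> {x. ?D x < 3 * h}) x * G x)" if i: "i \<in> Basis" and h: "h > 0" for i h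
      unfolding \<theta>_def
    proof (rule cutoff_integral_partial_deriv_le[OF op i, where V = "\<lambda>x. U x \<bullet> i" and B = "B i" and BG = BG])
      fix x assume x: "x \<in> \<Omega>"
      have xc: "x \<in> closure \<Omega>" using x closure_subset by blast
      show "(\<lambda>x. U x \<bullet> i) differentiable at x" by (rule differentiable_inner_left[OF Ud[OF x]])
      show "partial_deriv i (\<lambda>x. U x \<bullet> i) x = v i x"
        by (simp add: differentiable_inner_left[OF Ud[OF x]] v_def g(2)[OF i x])
      show "\<bar>v i x\<bar> \<le> B i" by (rule B[OF i xc])
      show "\<bar>U x \<bullet> i\<bar> \<le> G x" using Basis_le_norm[OF i, of "U x"] UG x by (meson order_trans)
      show "G x \<le> BG" using BG[OF xc] by auto
    qed (use v\<Omega>[OF i] Gm h in auto)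
    define I where "I h = (LINT x|lborel. indicator \<Omega> x * (\<Sum>i\<in>Basis. \<theta> h x * v i x))" for h
    have Ieq: "I h = (\<Sum>i\<in>Basis. LINT x|lborel. indicator \<Omega> x * (\<theta> h x * v i x))" if "h > 0" for h
    proof -
      have "I h = (LINT x|lborel. (\<Sum>i\<in>Basis. indicator \<Omega> x * (\<theta> h x * v i x)))"
        by (simp add: I_def sum_distrib_left)
      also have "\<dots> = (\<Sum>i\<in>Basis. LINT x|lborel. indicator \<Omega> x * (\<theta> h x * v i x))"
        by (intro Bochner_Integration.integral_sum intv \<theta>m \<theta>01 that)
      finally show ?thesis .
    qed
    define J where "J = (LINT x|surface_measure \<Omega>. G x)"
    have J: "(\<integral>\<^sup>+x. ennreal (G x) * indicator ?S x \<partial>hausdorff_measure (DIM('a) - 1)) = ennreal J"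
      unfolding J_def by (intro nn_integral_surface_measure \<Omega> continuous_on_subset[OF G Scl] G0) (use Scl in auto)
    have J0: "J \<ge> 0" unfolding J_def by (intro integral_nonneg_AE AE_I2) (use G0 Scl in auto)
    have Ilow: "\<exists>h0>0. \<forall>h. 0 < h \<longrightarrow> h \<le> h0 \<longrightarrow> \<bar>I h\<bar> \<le> K' * (J + e)" if e: "e > 0" for e
    proof -
      obtain h0 where h0: "h0 > 0" "\<And>h. 0 < h \<Longrightarrow> h \<le> h0 \<Longrightarrow>
        (\<integral>\<^sup>+x. ennreal (G x) * indicator (closure \<Omega> \<inter> {z. \<exists>y\<in>?S. dist z y \<le> h}) x \<partial>lborel) \<le>
        ennreal (K * h) * (ennreal J + ennreal e)"
        using tube[OF cc Scl G G0 e] unfolding J by auto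
      have "\<bar>I h\<bar> \<le> K' * (J + e)" if h: "0 < h" "h \<le> h0 / 3" for h
      proof -
        let ?T = "LINT x|lborel. indicator (\<Omega> \<inter> {x. ?D x < 3 * h}) x * G x"
        have setm [measurable]: "{x. ?D x < 3 * h} \<in> sets borel"
          by (intro borel_open open_Collect_less continuous_intros)
        have "(\<lambda>x. indicator {x. ?D x < 3 * h} x * (indicator \<Omega> x * G x)) \<in> borel_measurable borel"
          using Gm by measurable
        then have Tm: "(\<lambda>x. indicator (\<Omega> \<inter> {x. ?D x < 3 * h}) x * G x) \<in> borel_measurable borel"
          by (simp add: indicator_inter_arith mult_ac)
        have T0: "0 \<le> indicator (\<Omega> \<inter> {x. ?D x < 3 * h}) x * G x" for x
          using G0[of x] closure_subset[of \<Omega>] by (auto simp: indicator_def)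
        have "(\<integral>\<^sup>+x. ennreal (indicator (\<Omega> \<inter> {x. ?D x < 3 * h}) x * G x) \<partial>lborel) \<le>
           (\<integral>\<^sup>+x. ennreal (G x) * indicator (closure \<Omega> \<inter> {z. \<exists>y\<in>?S. dist z y \<le> 3 * h}) x \<partial>lborel)"
        proof (rule nn_integral_mono)
          fix x
          show "ennreal (indicator (\<Omega> \<inter> {x. ?D x < 3 * h}) x * G x) \<le>
             ennreal (G x) * indicator (closure \<Omega> \<inter> {z. \<exists>y\<in>?S. dist z y \<le> 3 * h}) x"
            using infdist_complement_frontier[of x \<Omega> "3 * h", OF _ C] closure_subset[of \<Omega>]
            by (auto simp: indicator_def)
        qed
        also have "\<dots> \<le> ennreal (K * (3 * h)) * (ennreal J + ennreal e)" using h by (intro h0(2)) auto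
        also have "\<dots> = ennreal (K * (3 * h) * (J + e))"
          using K h J0 e by (simp add: ennreal_mult ennreal_plus)
        finally have nn: "(\<integral>\<^sup>+x. ennreal (indicator (\<Omega> \<inter> {x. ?D x < 3 * h}) x * G x) \<partial>lborel) \<le> ennreal (K * (3 * h) * (J + e))" .
        have "?T = enn2real (\<integral>\<^sup>+x. ennreal (indicator (\<Omega> \<inter> {x. ?D x < 3 * h}) x * G x) \<partial>lborel)"
          using Tm T0 by (intro integral_eq_nn_integral) auto
        also have "\<dots> \<le> K * (3 * h) * (J + e)"
          using K h J0 e nn by (intro enn2real_leI) auto
        finally have T: "(1 / h) * ?T \<le> 3 * K * (J + e)" using h by (simp add: field_simps)
        have "\<bar>I h\<bar> \<le> (\<Sum>i\<in>Basis. \<bar>LINT x|lborel. indicator \<Omega> x * (\<theta> h x * v i x)\<bar>)"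
          unfolding Ieq[OF h(1)] by (rule sum_abs)
        also have "\<dots> \<le> (\<Sum>i\<in>(Basis :: 'a set). 3 * K * (J + e))"
          by (intro sum_mono order_trans[OF part[OF _ h(1)] T])
        also have "\<dots> = K' * (J + e)" by (simp add: K'_def)
        finally show ?thesis .
      qed
      then show ?thesis using h0(1) by (intro exI[of _ "h0 / 3"]) auto
    qed
    define t where "t n = 1 / real (Suc n)" for n
    have t: "t n > 0" for n by (simp add: t_def)
    have t0: "t \<longlonglongrightarrow> 0" unfolding t_def using LIMSEQ_inverse_real_of_nat by (simp add: inverse_eq_divide)
    \<comment> \<open>At each point of the open domain the cutoff equals 1 as soon as
      \<open>2 * t n\<close> is below the distance to the complement.\<close>
    have lim: "(\<lambda>n. I (t n)) \<longlonglongrightarrow> (LINT x|lborel. indicator \<Omega> x * divergence U x)"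
      unfolding I_def
    proof (rule integral_dominated_convergence[where w = "\<lambda>x. indicator \<Omega> x *\<^sub>R (\<Sum>i\<in>Basis. B i)"])
      show "(\<lambda>x. indicator \<Omega> x * divergence U x) \<in> borel_measurable lborel"
        using \<open>integrable lborel (\<lambda>x. indicator \<Omega> x * divergence U x)\<close> by (rule borel_measurable_integrable)
      show "(\<lambda>x. indicator \<Omega> x * (\<Sum>i\<in>Basis. \<theta> (t n) x * v i x)) \<in> borel_measurable lborel" for n
        unfolding sum_distrib_left
        by (intro borel_measurable_sum borel_measurable_integrable[OF intv] \<theta>m t \<theta>01)
      show "integrable lborel (\<lambda>x. indicator \<Omega> x *\<^sub>R (\<Sum>i\<in>Basis. B i))"
        using fin\<Omega> by (intro integrable_scaleR_left integrable_real_indicator) auto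
      show "AE x in lborel. (\<lambda>n. indicator \<Omega> x * (\<Sum>i\<in>Basis. \<theta> (t n) x * v i x)) \<longlonglongrightarrow> indicator \<Omega> x * divergence U x"
      proof (rule AE_I2)
        fix x
        show "(\<lambda>n. indicator \<Omega> x * (\<Sum>i\<in>Basis. \<theta> (t n) x * v i x)) \<longlonglongrightarrow> indicator \<Omega> x * divergence U x"
        proof (cases "x \<in> \<Omega>")
          case True
          have D: "?D x > 0" using True op(1) C by (intro infdist_pos_not_in_closed) auto
          have "eventually (\<lambda>n. t n < ?D x / 2) sequentially"
            using order_tendstoD(2)[OF t0, of "?D x / 2"] D by simp
          then have "eventually (\<lambda>n. \<theta> (t n) x = 1) sequentially"
          proof eventually_elim
            case (elim n)
            then have "(?D x - t n) / t n \<ge> 1" using t[of n] by (simp add: le_divide_eq)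
            then show ?case by (simp add: \<theta>_def)
          qed
          then have "(\<lambda>n. \<theta> (t n) x) \<longlonglongrightarrow> 1" by (rule tendsto_eventually)
          then have "(\<lambda>n. indicator \<Omega> x * (\<Sum>i\<in>Basis. \<theta> (t n) x * v i x)) \<longlonglongrightarrow> indicator \<Omega> x * (\<Sum>i\<in>Basis. 1 * v i x)"
            by (intro tendsto_intros)
          then show ?thesis using vd[OF True] by simp
        qed simp
      qed
      show "AE x in lborel. norm (indicator \<Omega> x * (\<Sum>i\<in>Basis. \<theta> (t n) x * v i x)) \<le> indicator \<Omega> x *\<^sub>R (\<Sum>i\<in>Basis. B i)" for n
      proof (rule AE_I2)
        fix x
        have "\<bar>\<Sum>i\<in>Basis. \<theta> (t n) x * v i x\<bar> \<le> (\<Sum>i\<in>Basis. B i)" if "x \<in> \<Omega>"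
        proof -
          have "\<bar>\<Sum>i\<in>Basis. \<theta> (t n) x * v i x\<bar> \<le> (\<Sum>i\<in>Basis. \<bar>\<theta> (t n) x * v i x\<bar>)" by (rule sum_abs)
          also have "\<dots> \<le> (\<Sum>i\<in>Basis. B i)"
          proof (rule sum_mono)
            fix i :: 'a assume i: "i \<in> Basis"
            have "\<bar>\<theta> (t n) x\<bar> * \<bar>v i x\<bar> \<le> 1 * B i"
              using B[OF i, of x] that closure_subset[of \<Omega>] \<theta>01 by (intro mult_mono) auto
            then show "\<bar>\<theta> (t n) x * v i x\<bar> \<le> B i" by (simp add: abs_mult)
          qed
          finally show ?thesis .
        qed
        then show "norm (indicator \<Omega> x * (\<Sum>i\<in>Basis. \<theta> (t n) x * v i x)) \<le> indicator \<Omega> x *\<^sub>R (\<Sum>i\<in>Basis. B i)"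
          by (auto simp: indicator_def)
      qed
    qed
    have "(LINT x|lborel. indicator \<Omega> x * divergence U x) \<ge> - (K' * J) - e" if e: "e > 0" for e
    proof (rule LIMSEQ_le_const[OF lim])
      obtain h0 where h0: "h0 > 0" "\<And>h. 0 < h \<Longrightarrow> h \<le> h0 \<Longrightarrow> \<bar>I h\<bar> \<le> K' * (J + e / K')"
        using Ilow[of "e / K'"] e K' by auto
      have "eventually (\<lambda>n. t n < h0) sequentially" using order_tendstoD(2)[OF t0 h0(1)] .
      then obtain N where "\<And>n. n \<ge> N \<Longrightarrow> t n < h0" by (auto simp: eventually_sequentially)
      then have "\<bar>I (t n)\<bar> \<le> K' * (J + e / K')" if "n \<ge> N" for n using h0(2)[OF t] that by (simp add: less_imp_le)
      moreover have "K' * (J + e / K') = K' * J + e" using K' by (simp add: distrib_left)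
      ultimately have "- (K' * J) - e \<le> I (t n)" if "n \<ge> N" for n
        using abs_le_D2[of "I (t n)" "K' * J + e"] that by fastforce
      then show "\<exists>N. \<forall>n\<ge>N. - (K' * J) - e \<le> I (t n)" by blast
    qed
    note low = this
    have "(LINT x|lborel. indicator \<Omega> x * divergence U x) \<ge> - (K' * J)"
    proof (rule field_le_epsilon)
      fix e :: real assume "0 < e"
      from low[OF this] show "- (K' * J) \<le> (LINT x|lborel. indicator \<Omega> x * divergence U x) + e" by linarith
    qed
    then show "- K' * (LINT x|surface_measure \<Omega>. G x) \<le> (LINT x|lborel. indicator \<Omega> x * divergence U x)"
      by (simp add: J_def)
  qed
qed

section \<open>The outward normal derivative\<close>

lemma gderiv_directional:
  assumes "GDERIV \<rho> x :> D"
  shows "((\<lambda>t. \<rho> (x + t *\<^sub>R v)) has_real_derivative (D \<bullet> v)) (at 0)"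
proof -
  have "((\<lambda>t. x + t *\<^sub>R v) has_derivative (\<lambda>s. s *\<^sub>R v)) (at 0)" by (auto intro!: derivative_eq_intros)
  moreover have "(\<rho> has_derivative (\<lambda>h. h \<bullet> D)) (at (x + 0 *\<^sub>R v))"
    using assms by (simp add: gderiv_def)
  ultimately have "((\<lambda>t. \<rho> (x + t *\<^sub>R v)) has_derivative (\<lambda>s. (s *\<^sub>R v) \<bullet> D)) (at 0)"
    by (rule has_derivative_compose)
  then show ?thesis
    by (simp add: has_field_derivative_def inner_commute mult.commute[of _ "D \<bullet> v"])
qed

lemma gderiv_pos_right:
  assumes "GDERIV \<rho> x :> D" "\<rho> x = 0" "D \<bullet> v > 0"
  shows "\<exists>d>0. \<forall>t>0. t < d \<longrightarrow> \<rho> (x + t *\<^sub>R v) > 0"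
  using DERIV_pos_inc_right[OF gderiv_directional[OF assms(1)] assms(3)] assms(2) by simp

lemma gderiv_neg_right:
  assumes "GDERIV \<rho> x :> D" "\<rho> x = 0" "D \<bullet> v < 0"
  shows "\<exists>d>0. \<forall>t>0. t < d \<longrightarrow> \<rho> (x + t *\<^sub>R v) < 0"
  using DERIV_neg_dec_right[OF gderiv_directional[OF assms(1)] assms(3)] assms(2) by simp

lemma ray_in_open:
  fixes x v :: "'a::real_normed_vector"
  assumes "open U" "x \<in> U"
  shows "\<exists>d>0. \<forall>t>0. t < d \<longrightarrow> x + t *\<^sub>R v \<in> U"
proof -
  obtain e where e: "e > 0" "ball x e \<subseteq> U" using assms open_contains_ball by blast
  show ?thesis
  proof (intro exI[of _ "e / (norm v + 1)"] conjI allI impI)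
    show "e / (norm v + 1) > 0" using e by (intro divide_pos_pos add_nonneg_pos) auto
    fix t :: real assume t: "t > 0" "t < e / (norm v + 1)"
    have "t * norm v \<le> t * (norm v + 1)" using t by (intro mult_left_mono) auto
    also have "\<dots> < e" using t(2) by (simp add: less_divide_eq add_nonneg_pos)
    finally show "x + t *\<^sub>R v \<in> U" using e(2) t(1) by (auto simp: subset_eq dist_norm)
  qed
qed

lemma local_defining_functionD:
  assumes "local_defining_function \<Omega> x U \<rho>"
  shows "open U" "x \<in> U" "smooth_on U \<rho>" "\<And>y. y \<in> U \<Longrightarrow> y \<in> \<Omega> \<longleftrightarrow> \<rho> y < 0"
    "\<And>y. y \<in> U \<Longrightarrow> y \<in> frontier \<Omega> \<longleftrightarrow> \<rho> y = 0"
  using assms unfolding local_defining_function_def by auto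

lemma local_defining_function_gderiv:
  assumes "local_defining_function \<Omega> x U \<rho>" "y \<in> U" "y \<in> frontier \<Omega>"
  obtains D where "GDERIV \<rho> y :> D" "D \<noteq> 0"
  using assms unfolding local_defining_function_def by blast

lemma gderiv_unique:
  fixes f :: "'a::euclidean_space \<Rightarrow> real"
  assumes "GDERIV f x :> D" "GDERIV f x :> D'" shows "D = D'"
proof (rule euclidean_eqI)
  show "D \<bullet> b = D' \<bullet> b" if "b \<in> Basis" for b
    using gderiv_inner_Basis[OF assms(1) that] gderiv_inner_Basis[OF assms(2) that] by simp
qed

text \<open>If the unit gradients \<open>a\<close> and \<open>b\<close> differed, the direction
  \<open>b - a\<close> would decrease the first defining function and increase the second, so nearby
  points on this ray would lie both inside and outside the domain.\<close>

lemma local_defining_function_gradient_parallel: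
  fixes \<Omega> :: "'a::euclidean_space set"
  assumes ldf1: "local_defining_function \<Omega> x U1 \<rho>1" and ldf2: "local_defining_function \<Omega> x U2 \<rho>2"
    and x: "x \<in> frontier \<Omega>" and D: "GDERIV \<rho>1 x :> D1" "GDERIV \<rho>2 x :> D2" "D1 \<noteq> 0" "D2 \<noteq> 0"
  shows "D1 /\<^sub>R norm D1 = D2 /\<^sub>R norm D2"
proof (rule ccontr)
  define a b where "a = D1 /\<^sub>R norm D1" and "b = D2 /\<^sub>R norm D2"
  assume "D1 /\<^sub>R norm D1 \<noteq> D2 /\<^sub>R norm D2"
  then have ab: "a \<noteq> b" by (simp add: a_def b_def)
  have n: "norm a = 1" "norm b = 1" using D by (simp_all add: a_def b_def)
  have "a \<bullet> a = 1" "b \<bullet> b = 1" using n by (simp_all add: norm_eq_1)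
  moreover have "(b - a) \<bullet> (b - a) > 0" using ab by simp
  moreover have "(b - a) \<bullet> (b - a) = b \<bullet> b - 2 * (a \<bullet> b) + a \<bullet> a"
    by (simp add: inner_diff_left inner_diff_right inner_commute[of b a])
  ultimately have abl: "a \<bullet> b < 1" by linarith
  have D1: "D1 = norm D1 *\<^sub>R a" and D2: "D2 = norm D2 *\<^sub>R b" using D by (simp_all add: a_def b_def)
  have "D1 \<bullet> (b - a) = (norm D1 *\<^sub>R a) \<bullet> (b - a)" using D1 by (rule arg_cong[where f = "\<lambda>w. w \<bullet> (b - a)"])
  also have "\<dots> = norm D1 * (a \<bullet> b - 1)"
    by (simp only: inner_scaleR_left inner_diff_right right_diff_distrib \<open>a \<bullet> a = 1\<close>)
  finally have "D1 \<bullet> (b - a) = norm D1 * (a \<bullet> b - 1)" .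
  then have neg: "D1 \<bullet> (b - a) < 0" using D(3) abl by (simp add: mult_less_0_iff)
  have "D2 \<bullet> (b - a) = (norm D2 *\<^sub>R b) \<bullet> (b - a)" using D2 by (rule arg_cong[where f = "\<lambda>w. w \<bullet> (b - a)"])
  also have "\<dots> = norm D2 * (1 - a \<bullet> b)"
    by (simp only: inner_scaleR_left inner_diff_right right_diff_distrib \<open>b \<bullet> b = 1\<close> inner_commute[of b a])
  finally have "D2 \<bullet> (b - a) = norm D2 * (1 - a \<bullet> b)" .
  then have pos: "D2 \<bullet> (b - a) > 0" using D(4) abl by simp
  have z: "\<rho>1 x = 0" "\<rho>2 x = 0"
    using local_defining_functionD(2,5)[OF ldf1] local_defining_functionD(2,5)[OF ldf2] x by auto
  obtain d1 where d1: "d1 > 0" "\<And>t. t > 0 \<Longrightarrow> t < d1 \<Longrightarrow> \<rho>1 (x + t *\<^sub>R (b - a)) < 0"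
    using gderiv_neg_right[OF D(1) z(1) neg] by blast
  obtain d2 where d2: "d2 > 0" "\<And>t. t > 0 \<Longrightarrow> t < d2 \<Longrightarrow> \<rho>2 (x + t *\<^sub>R (b - a)) > 0"
    using gderiv_pos_right[OF D(2) z(2) pos] by blast
  obtain d3 where d3: "d3 > 0" "\<And>t. t > 0 \<Longrightarrow> t < d3 \<Longrightarrow> x + t *\<^sub>R (b - a) \<in> U1 \<inter> U2"
    using ray_in_open[of "U1 \<inter> U2" x "b - a"] local_defining_functionD(1,2)[OF ldf1] local_defining_functionD(1,2)[OF ldf2] by auto
  define t where "t = min d1 (min d2 d3) / 2"
  have t: "t > 0" "t < d1" "t < d2" "t < d3" using d1(1) d2(1) d3(1) by (auto simp: t_def)
  let ?y = "x + t *\<^sub>R (b - a)"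
  have "?y \<in> \<Omega>" using local_defining_functionD(4)[OF ldf1, of ?y] d1(2)[OF t(1,2)] d3(2)[OF t(1,4)] by blast
  moreover have "?y \<notin> \<Omega>" using local_defining_functionD(4)[OF ldf2, of ?y] d2(2)[OF t(1,3)] d3(2)[OF t(1,4)] by force
  ultimately show False by simp
qed

lemma local_defining_function_move:
  "local_defining_function \<Omega> x U \<rho> \<Longrightarrow> y \<in> U \<Longrightarrow> local_defining_function \<Omega> y U \<rho>"
  by (auto simp: local_defining_function_def)

text \<open>Uniqueness makes the \<open>THE\<close> in \<open>outward_normal\<close> meaningful, so
  the normal may be computed from any defining function at hand.\<close>

lemma outward_normal_eq:
  fixes \<Omega> :: "'a::euclidean_space set"
  assumes ldf: "local_defining_function \<Omega> x U \<rho>" and x: "x \<in> frontier \<Omega>" and D: "GDERIV \<rho> x :> D"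
  shows "D \<noteq> 0" "outward_normal \<Omega> x = D /\<^sub>R norm D"
proof -
  have nz: "D' \<noteq> 0" if l: "local_defining_function \<Omega> x U' \<rho>'" and d: "GDERIV \<rho>' x :> D'" for U' \<rho>' D'
  proof -
    obtain D'' where "GDERIV \<rho>' x :> D''" "D'' \<noteq> 0"
      using local_defining_function_gderiv[OF l local_defining_functionD(2)[OF l] x] by blast
    with gderiv_unique[OF d] show ?thesis by blast
  qed
  show "D \<noteq> 0" by (rule nz[OF ldf D])
  show "outward_normal \<Omega> x = D /\<^sub>R norm D"
    unfolding outward_normal_def
  proof (rule the_equality)
    show "\<exists>U \<rho> D'. local_defining_function \<Omega> x U \<rho> \<and> (GDERIV \<rho> x :> D') \<and> D /\<^sub>R norm D = D' /\<^sub>R norm D'"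
      using ldf D by blast
    fix \<nu> assume "\<exists>U \<rho> D'. local_defining_function \<Omega> x U \<rho> \<and> (GDERIV \<rho> x :> D') \<and> \<nu> = D' /\<^sub>R norm D'"
    then obtain U' \<rho>' D' where *: "local_defining_function \<Omega> x U' \<rho>'" "GDERIV \<rho>' x :> D'" "\<nu> = D' /\<^sub>R norm D'"
      by blast
    show "\<nu> = D /\<^sub>R norm D"
      using local_defining_function_gradient_parallel[OF *(1) ldf x *(2) D nz[OF *(1,2)] nz[OF ldf D]] *(3) by simp
  qed
qed

lemma bounded_smooth_domain_ldf:
  fixes \<Omega> :: "'a::euclidean_space set"
  assumes "bounded_smooth_domain \<Omega>" "x \<in> frontier \<Omega>"
  obtains U \<rho> D where "local_defining_function \<Omega> x U \<rho>" "GDERIV \<rho> x :> D" "D \<noteq> 0"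
    "outward_normal \<Omega> x = D /\<^sub>R norm D"
proof -
  obtain U \<rho> where ldf: "local_defining_function \<Omega> x U \<rho>"
    using assms unfolding bounded_smooth_domain_def by blast
  obtain D where D: "GDERIV \<rho> x :> D"
    using local_defining_function_gderiv[OF ldf local_defining_functionD(2)[OF ldf] assms(2)] by blast
  show thesis by (rule that[OF ldf D outward_normal_eq[OF ldf assms(2) D]])
qed

lemma norm_outward_normal:
  assumes "bounded_smooth_domain \<Omega>" "x \<in> frontier \<Omega>"
  shows "norm (outward_normal \<Omega> x) = 1"
proof -
  obtain U \<rho> D where "D \<noteq> 0" "outward_normal \<Omega> x = D /\<^sub>R norm D"
    using bounded_smooth_domain_ldf[OF assms] .
  then show ?thesis by simp
qed

text \<open>One defining function serves all boundary points of a neighbourhood, so near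
  \<open>x\<close> the normal is the normalised gradient of a fixed smooth function.\<close>

lemma continuous_on_outward_normal:
  fixes \<Omega> :: "'a::euclidean_space set"
  assumes \<Omega>: "bounded_smooth_domain \<Omega>"
  shows "continuous_on (frontier \<Omega>) (outward_normal \<Omega>)"
  unfolding continuous_on_eq_continuous_within
proof
  fix x assume x: "x \<in> frontier \<Omega>"
  obtain U \<rho> D where ldf: "local_defining_function \<Omega> x U \<rho>" using bounded_smooth_domain_ldf[OF \<Omega> x] .
  note U = local_defining_functionD[OF ldf]
  define g where "g y = (\<Sum>j\<in>Basis. partial_deriv j \<rho> y *\<^sub>R j)" for y
  have gc: "continuous_on U g" unfolding g_def
    by (intro continuous_intros smooth_on_partial_deriv_continuous[OF U(3)])
  have g: "g y \<noteq> 0 \<and> outward_normal \<Omega> y = g y /\<^sub>R norm (g y)" if y: "y \<in> frontier \<Omega> \<inter> U" for y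
  proof -
    have ldfy: "local_defining_function \<Omega> y U \<rho>" using local_defining_function_move[OF ldf] y by blast
    obtain D where D: "GDERIV \<rho> y :> D" using local_defining_function_gderiv[OF ldfy] y by blast
    have "D = (\<Sum>j\<in>Basis. (D \<bullet> j) *\<^sub>R j)" by (simp add: euclidean_representation)
    also have "\<dots> = g y" unfolding g_def by (intro sum.cong) (auto simp: gderiv_inner_Basis[OF D])
    finally have "D = g y" .
    then show ?thesis using outward_normal_eq[OF ldfy _ D] y by blast
  qed
  have "continuous_on (frontier \<Omega> \<inter> U) (\<lambda>y. g y /\<^sub>R norm (g y))"
    using g by (intro continuous_intros continuous_on_subset[OF gc]) auto
  then have "continuous_on (frontier \<Omega> \<inter> U) (outward_normal \<Omega>)"
    using g by (subst continuous_on_cong[OF refl]) auto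
  then have "continuous (at x within frontier \<Omega> \<inter> U) (outward_normal \<Omega>)"
    using x U(2) by (simp add: continuous_on_eq_continuous_within)
  then show "continuous (at x within frontier \<Omega>) (outward_normal \<Omega>)"
    using at_within_nhd[of x U "frontier \<Omega> \<inter> U" "frontier \<Omega>"] U(1,2) by (simp add: Int_ac)
qed

text \<open>\<open>normal_deriv\<close> is a left derivative along the normal, hence sees the points
  \<open>x + t *\<^sub>R outward_normal \<Omega> x\<close> with \<open>t < 0\<close>. These must
  belong to the domain, since functions of \<open>Hs\<close> are set to 0 off its closure.\<close>

lemma outward_normal_ray:
  fixes \<Omega> :: "'a::euclidean_space set"
  assumes \<Omega>: "bounded_smooth_domain \<Omega>" and x: "x \<in> frontier \<Omega>"
  shows "\<exists>d>0. \<forall>t. -d < t \<and> t < 0 \<longrightarrow> x + t *\<^sub>R outward_normal \<Omega> x \<in> \<Omega>"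
proof -
  obtain U \<rho> D where ldf: "local_defining_function \<Omega> x U \<rho>" "GDERIV \<rho> x :> D" "D \<noteq> 0"
    and \<nu>: "outward_normal \<Omega> x = D /\<^sub>R norm D" using bounded_smooth_domain_ldf[OF \<Omega> x] .
  note U = local_defining_functionD[OF ldf(1)]
  let ?v = "- outward_normal \<Omega> x"
  have "D \<bullet> ?v < 0" using ldf(3) by (simp add: \<nu> divide_inverse)
  moreover have "\<rho> x = 0" using U(2,5) x by blast
  ultimately obtain d1 where d1: "d1 > 0" "\<And>t. t > 0 \<Longrightarrow> t < d1 \<Longrightarrow> \<rho> (x + t *\<^sub>R ?v) < 0"
    using gderiv_neg_right[OF ldf(2)] by blast
  obtain d2 where d2: "d2 > 0" "\<And>t. t > 0 \<Longrightarrow> t < d2 \<Longrightarrow> x + t *\<^sub>R ?v \<in> U"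
    using ray_in_open[OF U(1,2)] by blast
  show ?thesis
  proof (intro exI[of _ "min d1 d2"] conjI allI impI)
    fix t assume t: "- min d1 d2 < t \<and> t < 0"
    have "x + (-t) *\<^sub>R ?v \<in> \<Omega>" using U(4)[OF d2(2)[of "-t"]] d1(2)[of "-t"] t by auto
    then show "x + t *\<^sub>R outward_normal \<Omega> x \<in> \<Omega>" by simp
  qed (use d1 d2 in auto)
qed

text \<open>Only values on the closure enter the one-sided quotient, so any differentiable function
  agreeing with \<open>u\<close> there may be used.\<close>

lemma normal_deriv_eq:
  fixes \<Omega> :: "'a::euclidean_space set" and u :: "'a \<Rightarrow> complex"
  assumes \<Omega>: "bounded_smooth_domain \<Omega>" and x: "x \<in> frontier \<Omega>"
    and v: "(v has_derivative v') (at x)" and uv: "\<And>y. y \<in> closure \<Omega> \<Longrightarrow> u y = v y"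
  shows "normal_deriv \<Omega> u x = v' (outward_normal \<Omega> x)"
proof -
  let ?\<nu> = "outward_normal \<Omega> x"
  obtain d where d: "d > 0" "\<And>t. -d < t \<Longrightarrow> t < 0 \<Longrightarrow> x + t *\<^sub>R ?\<nu> \<in> \<Omega>"
    using outward_normal_ray[OF \<Omega> x] by blast
  have "((\<lambda>t. x + t *\<^sub>R ?\<nu>) has_derivative (\<lambda>s. s *\<^sub>R ?\<nu>)) (at_left 0)" by (auto intro!: derivative_eq_intros)
  moreover have "(v has_derivative v') (at (x + 0 *\<^sub>R ?\<nu>))" using v by simp
  ultimately have "((\<lambda>t. v (x + t *\<^sub>R ?\<nu>)) has_derivative (\<lambda>s. v' (s *\<^sub>R ?\<nu>))) (at_left 0)"
    by (rule has_derivative_compose)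
  moreover have "(\<lambda>s. v' (s *\<^sub>R ?\<nu>)) = (\<lambda>s. s *\<^sub>R v' ?\<nu>)"
    using has_derivative_linear[OF v] by (simp add: linear_cmul)
  ultimately have "((\<lambda>t. v (x + t *\<^sub>R ?\<nu>)) has_vector_derivative v' ?\<nu>) (at_left 0)"
    by (simp add: has_vector_derivative_def)
  moreover have eq: "v (x + t *\<^sub>R ?\<nu>) = u (x + t *\<^sub>R ?\<nu>)" if "-d < t" "t \<le> 0" for t
  proof -
    have "x + t *\<^sub>R ?\<nu> \<in> closure \<Omega>"
      using d(2)[of t] that x closure_subset[of \<Omega>] by (cases "t = 0") (auto simp: frontier_def)
    with uv show ?thesis by simp
  qed
  ultimately have "((\<lambda>t. u (x + t *\<^sub>R ?\<nu>)) has_vector_derivative v' ?\<nu>) (at_left 0)"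
  proof (subst has_vector_derivative_cong_ev)
    have "eventually (\<lambda>t. t \<in> {-d<..<d}) (nhds 0)" using d(1) by (intro eventually_nhds_in_open) auto
    then show "eventually (\<lambda>t. t \<in> {..<0} \<longrightarrow> u (x + t *\<^sub>R ?\<nu>) = v (x + t *\<^sub>R ?\<nu>)) (nhds 0)"
      by eventually_elim (simp add: eq)
    show "u (x + 0 *\<^sub>R ?\<nu>) = v (x + 0 *\<^sub>R ?\<nu>)" by (rule eq[symmetric]) (use d(1) in auto)
    show "((\<lambda>t. v (x + t *\<^sub>R ?\<nu>)) has_vector_derivative v' ?\<nu>) (at_left 0)" by fact
  qed
  then show ?thesis unfolding normal_deriv_def
    by (intro vector_derivative_within) auto
qed

text \<open>Along a tangential direction \<open>\<tau>\<close> the point \<open>x + t \<tau>\<close> lies within \<open>\<epsilon> t\<close> of the boundary,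
  by the intermediate value theorem on the normal segment through it.\<close>

lemma tangential_derivative_zero:
  fixes \<Omega> :: "'a::euclidean_space set" and v :: "'a \<Rightarrow> complex"
  assumes \<Omega>: "bounded_smooth_domain \<Omega>" and x: "x \<in> frontier \<Omega>"
    and v: "(v has_derivative v') (at x)" and v0: "\<And>y. y \<in> frontier \<Omega> \<Longrightarrow> v y = 0"
    and \<tau>: "\<tau> \<bullet> outward_normal \<Omega> x = 0"
  shows "v' \<tau> = 0"
proof -
  obtain U \<rho> D where ldf: "local_defining_function \<Omega> x U \<rho>" "GDERIV \<rho> x :> D" "D \<noteq> 0"
    and \<nu>D: "outward_normal \<Omega> x = D /\<^sub>R norm D" using bounded_smooth_domain_ldf[OF \<Omega> x] .
  note U = local_defining_functionD[OF ldf(1)]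
  define \<nu> where "\<nu> = outward_normal \<Omega> x"
  have n1: "norm \<nu> = 1" unfolding \<nu>_def by (rule norm_outward_normal[OF \<Omega> x])
  have D: "D = norm D *\<^sub>R \<nu>" using ldf(3) by (simp add: \<nu>_def \<nu>D)
  have "D \<bullet> w = norm D * (\<nu> \<bullet> w)" for w
    using arg_cong[where f = "\<lambda>u. u \<bullet> w", OF D] by (simp only: inner_scaleR_left)
  moreover have "\<nu> \<bullet> \<tau> = 0" "\<nu> \<bullet> \<nu> = 1" using \<tau> n1 by (simp_all add: \<nu>_def inner_commute norm_eq_1)
  ultimately have D\<tau>: "D \<bullet> \<tau> = 0" and D\<nu>: "D \<bullet> \<nu> = norm D" by simp_all
  have \<rho>x: "\<rho> x = 0" using U(2,5) x by blast
  have lin: "linear v'" by (rule has_derivative_linear[OF v])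
  obtain r where r: "r > 0" "ball x r \<subseteq> U" using U(1,2) open_contains_ball by blast
  have bound: "norm (v' \<tau>) \<le> \<epsilon> * (norm (v' \<nu>) + norm \<tau> + 1)" if \<epsilon>: "0 < \<epsilon>" "\<epsilon> \<le> 1" for \<epsilon>
  proof -
    obtain d0 where d0: "d0 > 0" "\<And>y. norm (y - x) < d0 \<Longrightarrow> norm (v y - v x - v' (y - x)) \<le> \<epsilon> * norm (y - x)"
      using v \<epsilon>(1) unfolding has_derivative_at_alt by blast
    \<comment> \<open>Tilting \<open>\<tau>\<close> by \<open>\<epsilon>\<close> to either side of
      the tangent plane gives directions of strict increase and strict decrease of
      \<open>\<rho>\<close>.\<close>
    have "D \<bullet> (\<tau> + \<epsilon> *\<^sub>R \<nu>) > 0" "D \<bullet> (\<tau> - \<epsilon> *\<^sub>R \<nu>) < 0"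
      using \<epsilon> ldf(3) by (simp_all add: inner_add_right inner_diff_right D\<tau> D\<nu>)
    note dir = this
    obtain d1 where d1: "d1 > 0" "\<And>t. t > 0 \<Longrightarrow> t < d1 \<Longrightarrow> \<rho> (x + t *\<^sub>R (\<tau> + \<epsilon> *\<^sub>R \<nu>)) > 0"
      using gderiv_pos_right[OF ldf(2) \<rho>x dir(1)] by blast
    obtain d2 where d2: "d2 > 0" "\<And>t. t > 0 \<Longrightarrow> t < d2 \<Longrightarrow> \<rho> (x + t *\<^sub>R (\<tau> - \<epsilon> *\<^sub>R \<nu>)) < 0"
      using gderiv_neg_right[OF ldf(2) \<rho>x dir(2)] by blast
    define c where "c = norm \<tau> + 1"
    have c: "c > 0" by (simp add: c_def add_nonneg_pos)
    have small: "\<exists>t>0. t < p1 \<and> t < p2 \<and> t < p3 \<and> t < p4" if "0 < p1" "0 < p2" "0 < p3" "0 < p4" for p1 p2 p3 p4 :: real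
      using that by (intro exI[of _ "min (min p1 p2) (min p3 p4) / 2"]) auto
    obtain t where t: "t > 0" "t < d1" "t < d2" "t < d0 / c" "t < r / c"
      using small[OF d1(1) d2(1) divide_pos_pos[OF d0(1) c] divide_pos_pos[OF r(1) c]] by blast
    then have tc: "t * c < d0" "t * c < r" using c by (simp_all add: less_divide_eq)
    have near: "norm (t *\<^sub>R \<tau> + s *\<^sub>R \<nu>) \<le> t * c" if "\<bar>s\<bar> \<le> \<epsilon> * t" for s
    proof -
      have "norm (t *\<^sub>R \<tau> + s *\<^sub>R \<nu>) \<le> t * norm \<tau> + \<bar>s\<bar>"
        using norm_triangle_ineq[of "t *\<^sub>R \<tau>" "s *\<^sub>R \<nu>"] t(1) n1 by simp
      also have "\<bar>s\<bar> \<le> 1 * t" using that \<epsilon>(2) t(1) by (meson mult_right_mono less_imp_le order_trans)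
      finally show ?thesis by (simp add: c_def algebra_simps)
    qed
    have "\<exists>s. -(\<epsilon> * t) \<le> s \<and> s \<le> \<epsilon> * t \<and> \<rho> (x + (t *\<^sub>R \<tau> + s *\<^sub>R \<nu>)) = 0"
    proof (rule IVT')
      show "\<rho> (x + (t *\<^sub>R \<tau> + (- (\<epsilon> * t)) *\<^sub>R \<nu>)) \<le> 0"
        using d2(2)[OF t(1,3)] by (simp add: algebra_simps)
      show "0 \<le> \<rho> (x + (t *\<^sub>R \<tau> + (\<epsilon> * t) *\<^sub>R \<nu>))"
        using d1(2)[OF t(1,2)] by (simp add: algebra_simps)
      show "- (\<epsilon> * t) \<le> \<epsilon> * t" using \<epsilon> t(1) by (simp add: mult_nonneg_nonneg)
      have \<rho>c: "continuous_on U \<rho>" using smooth_on_differentiable[OF U(3)]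
        by (auto intro!: continuous_at_imp_continuous_on differentiable_imp_continuous_within)
      show "continuous_on {- (\<epsilon> * t)..\<epsilon> * t} (\<lambda>s. \<rho> (x + (t *\<^sub>R \<tau> + s *\<^sub>R \<nu>)))"
      proof (rule continuous_on_compose2[OF \<rho>c])
        show "(\<lambda>s. x + (t *\<^sub>R \<tau> + s *\<^sub>R \<nu>)) ` {- (\<epsilon> * t)..\<epsilon> * t} \<subseteq> U"
        proof safe
          fix s assume "s \<in> {- (\<epsilon> * t)..\<epsilon> * t}"
          then have "\<bar>s\<bar> \<le> \<epsilon> * t" by (simp add: abs_le_iff)
          from near[OF this] have "norm (t *\<^sub>R \<tau> + s *\<^sub>R \<nu>) < r" using tc(2) by linarith
          moreover have "dist x (x + w) = norm w" for w by (simp add: dist_norm)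
          ultimately show "x + (t *\<^sub>R \<tau> + s *\<^sub>R \<nu>) \<in> U" using r(2) by (metis mem_ball subsetD)
        qed
      qed (intro continuous_intros)
    qed
    then obtain s where "-(\<epsilon> * t) \<le> s" "s \<le> \<epsilon> * t" "\<rho> (x + (t *\<^sub>R \<tau> + s *\<^sub>R \<nu>)) = 0" by blast
    then have s: "\<bar>s\<bar> \<le> \<epsilon> * t" "\<rho> (x + (t *\<^sub>R \<tau> + s *\<^sub>R \<nu>)) = 0" by (simp_all add: abs_le_iff)
    define w where "w = t *\<^sub>R \<tau> + s *\<^sub>R \<nu>"
    have nw: "norm w \<le> t * c" unfolding w_def by (rule near[OF s(1)])
    have "dist x (x + w) = norm w" by (simp add: dist_norm)
    then have "x + w \<in> U" using nw tc(2) r(2) by (auto simp: subset_eq)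
    then have "x + w \<in> frontier \<Omega>" using U(5) s(2) by (simp add: w_def)
    \<comment> \<open>\<open>v\<close> vanishes at \<open>x\<close> and at \<open>x + w\<close>, so
      the differential at \<open>w\<close> is nothing but the remainder of the linear
      approximation.\<close>
    then have "norm (v' w) \<le> \<epsilon> * norm w"
      using d0(2)[of "x + w"] nw tc(1) v0[of "x + w"] v0[OF x] by simp
    also have "\<dots> \<le> \<epsilon> * (t * c)" using nw \<epsilon>(1) by (intro mult_left_mono) auto
    finally have 1: "norm (v' w) \<le> \<epsilon> * (t * c)" .
    have "v' w = t *\<^sub>R v' \<tau> + s *\<^sub>R v' \<nu>" by (simp add: w_def linear_add[OF lin] linear_cmul[OF lin])
    then have "t *\<^sub>R v' \<tau> = v' w - s *\<^sub>R v' \<nu>" by simp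
    then have "norm (t *\<^sub>R v' \<tau>) \<le> norm (v' w) + norm (s *\<^sub>R v' \<nu>)" by (metis norm_triangle_ineq4)
    then have "t * norm (v' \<tau>) \<le> norm (v' w) + \<bar>s\<bar> * norm (v' \<nu>)" using t(1) by simp
    also have "\<dots> \<le> \<epsilon> * (t * c) + (\<epsilon> * t) * norm (v' \<nu>)"
      using 1 s(1) by (intro add_mono mult_right_mono) auto
    also have "\<dots> = t * (\<epsilon> * (norm (v' \<nu>) + norm \<tau> + 1))" by (simp add: c_def algebra_simps)
    finally show ?thesis using t(1) by simp
  qed
  have "norm (v' \<tau>) \<le> 0"
  proof (rule field_le_epsilon)
    fix e :: real assume e: "e > 0"
    let ?c = "norm (v' \<nu>) + norm \<tau> + 1"
    have c: "?c > 0" by (simp add: add_nonneg_pos)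
    define \<epsilon> where "\<epsilon> = min 1 (e / ?c)"
    have "\<epsilon> \<le> e / ?c" by (simp add: \<epsilon>_def)
    then have "\<epsilon> * ?c \<le> e" using c by (simp add: le_divide_eq)
    moreover have "\<epsilon> > 0" "\<epsilon> \<le> 1" using divide_pos_pos[OF e c] by (simp_all add: \<epsilon>_def)
    ultimately show "norm (v' \<tau>) \<le> 0 + e" using bound[of \<epsilon>] by linarith
  qed
  then show ?thesis by simp
qed

text \<open>Vanishing on the boundary kills the tangential part of each basis vector, leaving
  multiples of the normal derivative whose coefficients are the coordinates of a unit
  vector.\<close>

lemma boundary_gradient_eq_normal_deriv:
  fixes \<Omega> :: "'a::euclidean_space set" and v :: "'a \<Rightarrow> complex"
  assumes \<Omega>: "bounded_smooth_domain \<Omega>" and x: "x \<in> frontier \<Omega>"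
    and v: "(v has_derivative v') (at x)" and v0: "\<And>y. y \<in> frontier \<Omega> \<Longrightarrow> v y = 0"
  shows "(\<Sum>i\<in>Basis. (cmod (v' i))\<^sup>2) = (cmod (v' (outward_normal \<Omega> x)))\<^sup>2"
proof -
  let ?\<nu> = "outward_normal \<Omega> x"
  have lin: "linear v'" by (rule has_derivative_linear[OF v])
  have n1: "?\<nu> \<bullet> ?\<nu> = 1" using norm_outward_normal[OF \<Omega> x] by (simp add: norm_eq_1)
  have vi: "v' i = (i \<bullet> ?\<nu>) *\<^sub>R v' ?\<nu>" for i
  proof -
    have "v' (i - (i \<bullet> ?\<nu>) *\<^sub>R ?\<nu>) = 0"
      by (rule tangential_derivative_zero[OF \<Omega> x v v0]) (simp_all add: inner_diff_left n1)
    then show ?thesis by (simp add: linear_diff[OF lin] linear_cmul[OF lin])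
  qed
  have "(cmod (v' i))\<^sup>2 = (i \<bullet> ?\<nu>)\<^sup>2 * (cmod (v' ?\<nu>))\<^sup>2" for i
  proof -
    have "cmod (v' i) = \<bar>i \<bullet> ?\<nu>\<bar> * cmod (v' ?\<nu>)" using arg_cong[OF vi[of i], of norm] by (simp only: norm_scaleR)
    then show ?thesis by (simp only: power_mult_distrib power2_abs)
  qed
  then have "(\<Sum>i\<in>Basis. (cmod (v' i))\<^sup>2) = (\<Sum>i\<in>Basis. (i \<bullet> ?\<nu>)\<^sup>2 * (cmod (v' ?\<nu>))\<^sup>2)"
    by (rule sum.cong[OF refl])
  also have "\<dots> = (\<Sum>i\<in>Basis. (?\<nu> \<bullet> i) * (?\<nu> \<bullet> i)) * (cmod (v' ?\<nu>))\<^sup>2"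
    by (simp add: sum_distrib_right power2_eq_square inner_commute)
  also have "(\<Sum>i\<in>Basis. (?\<nu> \<bullet> i) * (?\<nu> \<bullet> i)) = 1" using n1 by (subst (asm) euclidean_inner) simp
  finally show ?thesis by simp
qed

section \<open>Sobolev functions\<close>

text \<open>Dyadic decomposition: where \<open>norm \<xi>\<close> is about \<open>2 ^ k\<close> the
  function is at most \<open>4 powr (- \<sigma> * k)\<close>, and the box has volume
  \<open>4 ^ d * 2 ^ (d * k)\<close>, \<open>d\<close> being the dimension. The resulting geometric
  series has ratio \<open>2 powr (d - 2 * \<sigma>) < 1\<close>.\<close>

lemma integrable_japanese_bracket:
  assumes \<sigma>: "2 * \<sigma> > real DIM('a::euclidean_space)"
  shows "integrable lborel (\<lambda>\<xi>::'a. (1 + (norm \<xi>)\<^sup>2) powr (- \<sigma>))"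
proof (rule integrableI_nonneg)
  let ?d = "real DIM('a)"
  have \<sigma>0: "\<sigma> > 0" using \<sigma> DIM_positive[where 'a='a] by linarith
  define a where "a = (4::real) powr (- \<sigma>)"
  have a: "a > 0" by (simp add: a_def)
  define \<rho> where "\<rho> = a * 2 ^ DIM('a)"
  have "\<rho> = 2 powr (?d - 2 * \<sigma>)"
  proof -
    have "(4::real) powr (- \<sigma>) = (2 powr 2) powr (- \<sigma>)" by simp
    also have "\<dots> = 2 powr (2 * (- \<sigma>))" by (simp only: powr_powr)
    finally have "a = 2 powr (- 2 * \<sigma>)" by (simp add: a_def)
    moreover have "(2::real) ^ DIM('a) = 2 powr ?d" by (simp add: powr_realpow)
    ultimately have "\<rho> = 2 powr (- 2 * \<sigma> + ?d)" unfolding \<rho>_def by (simp only: powr_add)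
    then show ?thesis by (simp add: add.commute)
  qed
  also have "\<dots> < 1" using \<sigma> by (intro powr_less_one) auto
  finally have \<rho>: "0 < \<rho>" "\<rho> < 1" using a by (auto simp: \<rho>_def)
  obtain i :: 'a where i: "i \<in> Basis" using nonempty_Basis by blast
  let ?B = "\<lambda>k::nat. slab i (0::'a) (2 ^ Suc k) (2 ^ Suc k)"
  have volB: "emeasure lborel (?B k) = ennreal ((2 * 2 ^ Suc k) ^ DIM('a))" for k
  proof -
    have "(2 * 2 ^ Suc k) ^ (DIM('a) - 1) * (2 * 2 ^ Suc k) = ((2 * 2 ^ Suc k) ^ Suc (DIM('a) - 1) :: real)"
      by (simp only: power_Suc mult.commute)
    then show ?thesis using emeasure_slab[OF i, of "2 ^ Suc k" "2 ^ Suc k" 0] by simp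
  qed
  have pw: "ennreal ((1 + (norm \<xi>)\<^sup>2) powr (- \<sigma>)) \<le> (\<Sum>k. ennreal (a ^ k) * indicator (?B k) \<xi>)" for \<xi> :: 'a
  proof -
    obtain n where "norm \<xi> < 2 ^ n" using real_arch_pow[of 2 "norm \<xi>"] by auto
    then have ex: "norm \<xi> < 2 ^ Suc n" by (simp add: order_less_le_trans)
    define k where "k = (LEAST k. norm \<xi> < 2 ^ Suc k)"
    have k: "norm \<xi> < 2 ^ Suc k" unfolding k_def by (rule LeastI[of _ n]) (rule ex)
    have "(4::real) ^ k \<le> 1 + (norm \<xi>)\<^sup>2"
    proof (cases k)
      case (Suc m)
      have "\<not> norm \<xi> < 2 ^ Suc m" using not_less_Least[of m "\<lambda>k. norm \<xi> < 2 ^ Suc k"] Suc by (simp add: k_def)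
      then have "(2 ^ k)\<^sup>2 \<le> (norm \<xi>)\<^sup>2" using Suc by (intro power_mono) auto
      moreover have "(2 ^ k)\<^sup>2 = (4::real) ^ k"
      proof -
        have "(2 ^ k)\<^sup>2 = ((2::real)\<^sup>2) ^ k" by (simp only: power_mult[symmetric] mult.commute)
        then show ?thesis by simp
      qed
      ultimately show ?thesis by linarith
    qed simp
    then have "(1 + (norm \<xi>)\<^sup>2) powr (- \<sigma>) \<le> (4 ^ k) powr (- \<sigma>)"
      using \<sigma>0 by (intro powr_mono2') auto
    also have "\<dots> = a ^ k"
      unfolding a_def by (simp add: powr_realpow[symmetric] powr_powr mult.commute)
    finally have le: "(1 + (norm \<xi>)\<^sup>2) powr (- \<sigma>) \<le> a ^ k" .
    have "\<bar>\<xi> \<bullet> j\<bar> \<le> 2 ^ Suc k" if "j \<in> Basis" for j using Basis_le_norm[OF that, of \<xi>] k by linarith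
    then have "\<xi> \<in> ?B k" using i by (simp add: slab_def)
    then have "ennreal ((1 + (norm \<xi>)\<^sup>2) powr (- \<sigma>)) \<le> (\<Sum>k\<in>{k}. ennreal (a ^ k) * indicator (?B k) \<xi>)"
      using le by (simp add: ennreal_leI)
    also have "\<dots> \<le> (\<Sum>k. ennreal (a ^ k) * indicator (?B k) \<xi>)" by (intro sum_le_suminf) auto
    finally show ?thesis .
  qed
  note [measurable] = sets_slab[OF i]
  have "(\<integral>\<^sup>+\<xi>. ennreal ((1 + (norm (\<xi>::'a))\<^sup>2) powr (- \<sigma>)) \<partial>lborel) \<le> (\<integral>\<^sup>+\<xi>. (\<Sum>k. ennreal (a ^ k) * indicator (?B k) \<xi>) \<partial>lborel)"
    by (intro nn_integral_mono pw)
  also have "\<dots> = (\<Sum>k. \<integral>\<^sup>+\<xi>. ennreal (a ^ k) * indicator (?B k) \<xi> \<partial>lborel)"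
    by (rule nn_integral_suminf) measurable
  also have "\<dots> = (\<Sum>k. ennreal (4 ^ DIM('a) * \<rho> ^ k))"
  proof (rule suminf_cong)
    fix k
    have "(2 * 2 ^ Suc k) ^ DIM('a) = (4 ^ DIM('a) * (2 ^ DIM('a)) ^ k :: real)"
    proof -
      have "2 * 2 ^ Suc k = (4 * 2 ^ k :: real)" by simp
      then show ?thesis by (simp only: power_mult_distrib power_mult[symmetric] mult.commute[of k])
    qed
    then have "a ^ k * (2 * 2 ^ Suc k) ^ DIM('a) = 4 ^ DIM('a) * \<rho> ^ k"
      by (simp only: \<rho>_def power_mult_distrib mult_ac)
    moreover have "(\<integral>\<^sup>+\<xi>. ennreal (a ^ k) * indicator (?B k) \<xi> \<partial>lborel) = ennreal (a ^ k) * emeasure lborel (?B k)"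
      by (rule nn_integral_cmult_indicator) measurable
    moreover have "ennreal (a ^ k) * ennreal ((2 * 2 ^ Suc k) ^ DIM('a)) = ennreal (a ^ k * (2 * 2 ^ Suc k) ^ DIM('a))"
      using a by (intro ennreal_mult[symmetric]) auto
    ultimately show "(\<integral>\<^sup>+\<xi>. ennreal (a ^ k) * indicator (?B k) \<xi> \<partial>lborel) = ennreal (4 ^ DIM('a) * \<rho> ^ k)"
      by (simp only: volB)
  qed
  also have "\<dots> = ennreal (\<Sum>k. 4 ^ DIM('a) * \<rho> ^ k)"
    using \<rho> by (intro suminf_ennreal2 summable_mult summable_geometric) auto
  also have "\<dots> < \<infinity>" by simp
  finally show "(\<integral>\<^sup>+\<xi>. ennreal ((1 + (norm (\<xi>::'a))\<^sup>2) powr (- \<sigma>)) \<partial>lborel) < \<infinity>" .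
qed auto

section \<open>Differentiating inverse Fourier integrals\<close>

definition moment_integrable :: "nat \<Rightarrow> ('a::euclidean_space \<Rightarrow> complex) \<Rightarrow> bool" where
  "moment_integrable k g \<longleftrightarrow> g \<in> borel_measurable borel \<and> integrable lborel (\<lambda>\<xi>. (1 + norm \<xi>) ^ k * cmod (g \<xi>))"

definition fourier_partial :: "'a::euclidean_space \<Rightarrow> ('a \<Rightarrow> complex) \<Rightarrow> 'a \<Rightarrow> complex" where
  "fourier_partial j g \<xi> = \<i> * of_real (\<xi> \<bullet> j) * g \<xi>"

lemma moment_integrable_weaken:
  assumes "moment_integrable k g" "h \<in> borel_measurable borel"
    "\<And>\<xi>. (1 + norm \<xi>) ^ l * cmod (h \<xi>) \<le> c * ((1 + norm \<xi>) ^ k * cmod (g \<xi>))"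
  shows "moment_integrable l h"
  unfolding moment_integrable_def
proof
  show "integrable lborel (\<lambda>\<xi>. (1 + norm \<xi>) ^ l * cmod (h \<xi>))"
  proof (rule Bochner_Integration.integrable_bound)
    show "integrable lborel (\<lambda>\<xi>. c * ((1 + norm \<xi>) ^ k * cmod (g \<xi>)))"
      using assms(1) by (simp add: moment_integrable_def)
    show "AE \<xi> in lborel. norm ((1 + norm \<xi>) ^ l * cmod (h \<xi>)) \<le> norm (c * ((1 + norm \<xi>) ^ k * cmod (g \<xi>)))"
      using assms(3) by (intro AE_I2) (simp, smt (verit) zero_le_mult_iff norm_ge_zero zero_le_power abs_ge_self)
  qed (use assms(2) in measurable)
qed fact

lemma moment_integrable_mono:
  assumes "moment_integrable k g" "l \<le> k"
  shows "moment_integrable l g"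
proof (rule moment_integrable_weaken[OF assms(1), where c = 1])
  show "g \<in> borel_measurable borel" using assms(1) by (simp add: moment_integrable_def)
qed (use assms(2) in \<open>auto intro!: mult_right_mono power_increasing\<close>)

lemma moment_integrable_partial:
  assumes "moment_integrable (Suc k) g" "j \<in> Basis"
  shows "moment_integrable k (fourier_partial j g)"
proof (rule moment_integrable_weaken[OF assms(1), where c = 1])
  show "fourier_partial j g \<in> borel_measurable borel"
  proof -
    have [measurable]: "g \<in> borel_measurable borel" using assms(1) by (simp add: moment_integrable_def)
    show ?thesis unfolding fourier_partial_def[abs_def] by measurable
  qed
  fix \<xi>
  have "\<bar>\<xi> \<bullet> j\<bar> \<le> 1 + norm \<xi>" using Basis_le_norm[OF assms(2), of \<xi>] by simp
  then have "\<bar>\<xi> \<bullet> j\<bar> * ((1 + norm \<xi>) ^ k * cmod (g \<xi>)) \<le> (1 + norm \<xi>) * ((1 + norm \<xi>) ^ k * cmod (g \<xi>))"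
    by (intro mult_right_mono mult_nonneg_nonneg) auto
  then show "(1 + norm \<xi>) ^ k * cmod (fourier_partial j g \<xi>) \<le> 1 * ((1 + norm \<xi>) ^ Suc k * cmod (g \<xi>))"
    by (simp add: fourier_partial_def norm_mult mult_ac)
qed

lemma moment_integrable_0:
  assumes "moment_integrable 0 g"
  shows "integrable lborel g"
proof (rule integrable_norm_cancel)
  show "integrable lborel (\<lambda>\<xi>. cmod (g \<xi>))" "g \<in> borel_measurable lborel"
    using assms by (simp_all add: moment_integrable_def)
qed

lemma borel_measurable_cis [measurable]: "cis \<in> borel_measurable borel"
  by (intro borel_measurable_continuous_onI continuous_intros)

lemma integrable_fourier_integrand:
  assumes "moment_integrable 0 g"
  shows "integrable lborel (\<lambda>\<xi>. cis (x \<bullet> \<xi>) * g \<xi>)"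
proof (rule Bochner_Integration.integrable_bound[OF moment_integrable_0[OF assms]])
  have [measurable]: "g \<in> borel_measurable borel" using assms by (simp add: moment_integrable_def)
  show "(\<lambda>\<xi>. cis (x \<bullet> \<xi>) * g \<xi>) \<in> borel_measurable lborel" by measurable
qed (simp add: norm_mult)

definition fourier_const :: "'a::euclidean_space itself \<Rightarrow> real" where
  "fourier_const _ = (2 * pi) powr (- real DIM('a) / 2)"

lemma fourier_const_pos: "fourier_const TYPE('a::euclidean_space) > 0"
  by (simp add: fourier_const_def)

lemma inverse_fourier_alt:
  fixes x :: "'a::euclidean_space"
  shows "inverse_fourier g x = of_real (fourier_const TYPE('a)) * (LINT \<xi>|lborel. cis (x \<bullet> \<xi>) * g \<xi>)"
  by (simp add: inverse_fourier_def fourier_const_def)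

lemma norm_inverse_fourier_le:
  fixes x :: "'a::euclidean_space"
  assumes "moment_integrable 0 g"
  shows "cmod (inverse_fourier g x) \<le> fourier_const TYPE('a) * (LINT \<xi>|lborel. cmod (g \<xi>))"
proof -
  have "cmod (LINT \<xi>|lborel. cis (x \<bullet> \<xi>) * g \<xi>) \<le> (LINT \<xi>|lborel. cmod (cis (x \<bullet> \<xi>) * g \<xi>))"
    by (rule integral_norm_bound)
  then show ?thesis using fourier_const_pos[where 'a='a]
    by (simp add: inverse_fourier_alt norm_mult mult_left_mono)
qed

lemma inverse_fourier_linear:
  assumes "moment_integrable 0 g" "moment_integrable 0 h"
  shows "inverse_fourier (\<lambda>\<xi>. a * g \<xi> + b * h \<xi>) x = a * inverse_fourier g x + b * inverse_fourier h x"
proof -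
  have "(LINT \<xi>|lborel. cis (x \<bullet> \<xi>) * (a * g \<xi> + b * h \<xi>)) =
     (LINT \<xi>|lborel. a * (cis (x \<bullet> \<xi>) * g \<xi>) + b * (cis (x \<bullet> \<xi>) * h \<xi>))"
    by (simp add: algebra_simps)
  also have "\<dots> = a * (LINT \<xi>|lborel. cis (x \<bullet> \<xi>) * g \<xi>) + b * (LINT \<xi>|lborel. cis (x \<bullet> \<xi>) * h \<xi>)"
    using assms[THEN integrable_fourier_integrand] by simp
  finally show ?thesis by (simp add: inverse_fourier_alt algebra_simps)
qed

lemma continuous_inverse_fourier:
  fixes g :: "'a::euclidean_space \<Rightarrow> complex"
  assumes g: "moment_integrable 0 g"
  shows "continuous_on UNIV (inverse_fourier g)"
  unfolding continuous_on_sequentially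
proof (intro allI ballI impI)
  fix X :: "nat \<Rightarrow> 'a" and x assume X: "(\<forall>n. X n \<in> UNIV) \<and> X \<longlonglongrightarrow> x"
  have [measurable]: "g \<in> borel_measurable borel" using g by (simp add: moment_integrable_def)
  have "(\<lambda>n. LINT \<xi>|lborel. cis (X n \<bullet> \<xi>) * g \<xi>) \<longlonglongrightarrow> (LINT \<xi>|lborel. cis (x \<bullet> \<xi>) * g \<xi>)"
  proof (rule integral_dominated_convergence[where w = "\<lambda>\<xi>. cmod (g \<xi>)"])
    show "integrable lborel (\<lambda>\<xi>. cmod (g \<xi>))" using moment_integrable_0[OF g] by simp
    show "AE \<xi> in lborel. (\<lambda>n. cis (X n \<bullet> \<xi>) * g \<xi>) \<longlonglongrightarrow> cis (x \<bullet> \<xi>) * g \<xi>"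
    proof (rule AE_I2)
      fix \<xi>
      have "(\<lambda>n. X n \<bullet> \<xi>) \<longlonglongrightarrow> x \<bullet> \<xi>" using X by (intro tendsto_intros) auto
      moreover have "isCont cis (x \<bullet> \<xi>)"
        using continuous_on_cis[OF continuous_on_id, of UNIV] by (simp add: continuous_on_eq_continuous_at)
      ultimately have "(\<lambda>n. cis (X n \<bullet> \<xi>)) \<longlonglongrightarrow> cis (x \<bullet> \<xi>)" by (intro isCont_tendsto_compose[where g = cis])
      then show "(\<lambda>n. cis (X n \<bullet> \<xi>) * g \<xi>) \<longlonglongrightarrow> cis (x \<bullet> \<xi>) * g \<xi>" by (rule tendsto_mult[OF _ tendsto_const])
    qed
  qed (auto simp: norm_mult)
  then show "(inverse_fourier g \<circ> X) \<longlonglongrightarrow> inverse_fourier g x"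
    unfolding inverse_fourier_alt[abs_def] comp_def by (rule tendsto_mult[OF tendsto_const])
qed

text \<open>The linear bound dominates the difference quotients using only a first moment of the
  integrand; the quadratic one makes them tend to 0 pointwise.\<close>

lemma cis_taylor_bounds:
  "cmod (cis b - 1 - \<i> * of_real b) \<le> 2 * \<bar>b\<bar>" "cmod (cis b - 1 - \<i> * of_real b) \<le> b\<^sup>2"
proof -
  have "(\<Sum>k\<le>1. (\<i> * complex_of_real b) ^ k / fact k) = 1 + \<i> * of_real b" by simp
  then show "cmod (cis b - 1 - \<i> * of_real b) \<le> 2 * \<bar>b\<bar>"
    using iexp_approx2[of b 1] by (simp add: cis_conv_exp diff_diff_eq)
  have "cmod (cis b - 1 - \<i> * of_real b) \<le> b\<^sup>2 / 2"
    using iexp_approx1[of b 1] by (simp add: cis_conv_exp diff_diff_eq power2_eq_square)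
  also have "\<dots> \<le> b\<^sup>2" by simp
  finally show "cmod (cis b - 1 - \<i> * of_real b) \<le> b\<^sup>2" .
qed

text \<open>All directions are handled at once: after division by \<open>norm (y - x)\<close> the
  Taylor remainder of \<open>cis\<close> is dominated by
  \<open>2 * (norm \<xi> * cmod (g \<xi>))\<close>, which is why one moment suffices for Frechet
  differentiability.\<close>

lemma has_derivative_inverse_fourier:
  fixes g :: "'a::euclidean_space \<Rightarrow> complex"
  assumes g: "moment_integrable 1 g"
  shows "(inverse_fourier g has_derivative
     (\<lambda>v. \<Sum>j\<in>Basis. (v \<bullet> j) *\<^sub>R inverse_fourier (fourier_partial j g) x)) (at x)"
proof -
  let ?c = "fourier_const TYPE('a)"
  let ?A = "\<lambda>v. \<Sum>j\<in>Basis. (v \<bullet> j) *\<^sub>R inverse_fourier (fourier_partial j g) x"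
  have gm [measurable]: "g \<in> borel_measurable borel" using g by (simp add: moment_integrable_def)
  have g0: "moment_integrable 0 g" using g by (rule moment_integrable_mono) simp
  have gj: "moment_integrable 0 (fourier_partial j g)" if "j \<in> Basis" for j
    using g that by (intro moment_integrable_partial) auto
  have int1: "integrable lborel (\<lambda>\<xi>. norm \<xi> * cmod (g \<xi>))"
  proof (rule Bochner_Integration.integrable_bound)
    show "integrable lborel (\<lambda>\<xi>. (1 + norm \<xi>) ^ 1 * cmod (g \<xi>))" using g by (simp add: moment_integrable_def)
  qed (auto intro!: AE_I2 mult_right_mono)
  have A: "?A v = of_real ?c * (LINT \<xi>|lborel. \<i> * of_real (v \<bullet> \<xi>) * (cis (x \<bullet> \<xi>) * g \<xi>))" for v
  proof -
    have "?A v = of_real ?c * (\<Sum>j\<in>Basis. of_real (v \<bullet> j) * (LINT \<xi>|lborel. cis (x \<bullet> \<xi>) * fourier_partial j g \<xi>))"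
      by (simp add: inverse_fourier_alt sum_distrib_left scaleR_conv_of_real mult_ac)
    also have "(\<Sum>j\<in>Basis. of_real (v \<bullet> j) * (LINT \<xi>|lborel. cis (x \<bullet> \<xi>) * fourier_partial j g \<xi>)) =
       (LINT \<xi>|lborel. (\<Sum>j\<in>Basis. of_real (v \<bullet> j) * (cis (x \<bullet> \<xi>) * fourier_partial j g \<xi>)))"
      using gj[THEN integrable_fourier_integrand] by (subst Bochner_Integration.integral_sum) auto
    also have "\<dots> = (LINT \<xi>|lborel. \<i> * of_real (v \<bullet> \<xi>) * (cis (x \<bullet> \<xi>) * g \<xi>))"
    proof (rule Bochner_Integration.integral_cong[OF refl])
      fix \<xi> :: 'a
      have "of_real (v \<bullet> \<xi>) = (\<Sum>j\<in>Basis. complex_of_real (v \<bullet> j) * of_real (\<xi> \<bullet> j))"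
        by (subst euclidean_inner) simp
      then show "(\<Sum>j\<in>Basis. of_real (v \<bullet> j) * (cis (x \<bullet> \<xi>) * fourier_partial j g \<xi>)) =
          \<i> * of_real (v \<bullet> \<xi>) * (cis (x \<bullet> \<xi>) * g \<xi>)"
        by (simp add: fourier_partial_def sum_distrib_left sum_distrib_right mult_ac)
    qed
    finally show ?thesis .
  qed
  have intA: "integrable lborel (\<lambda>\<xi>. \<i> * of_real (v \<bullet> \<xi>) * (cis (x \<bullet> \<xi>) * g \<xi>))" for v
  proof (rule Bochner_Integration.integrable_bound)
    show "integrable lborel (\<lambda>\<xi>. norm v * (norm \<xi> * cmod (g \<xi>)))" using int1 by simp
    show "AE \<xi> in lborel. norm (\<i> * of_real (v \<bullet> \<xi>) * (cis (x \<bullet> \<xi>) * g \<xi>)) \<le> norm (norm v * (norm \<xi> * cmod (g \<xi>)))"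
    proof (rule AE_I2)
      fix \<xi> :: 'a
      have "\<bar>v \<bullet> \<xi>\<bar> * cmod (g \<xi>) \<le> (norm v * norm \<xi>) * cmod (g \<xi>)"
        by (intro mult_right_mono Cauchy_Schwarz_ineq2) auto
      then show "norm (\<i> * of_real (v \<bullet> \<xi>) * (cis (x \<bullet> \<xi>) * g \<xi>)) \<le> norm (norm v * (norm \<xi> * cmod (g \<xi>)))"
        by (simp add: norm_mult mult_ac)
    qed
  qed measurable
  have "((\<lambda>y. norm (inverse_fourier g y - inverse_fourier g x - ?A (y - x)) / norm (y - x)) \<longlongrightarrow> 0) (at x)"
    unfolding tendsto_at_iff_sequentially comp_def
  proof (intro allI impI)
    fix X assume X: "\<forall>n. X n \<in> UNIV - {x}" "X \<longlonglongrightarrow> x"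
    define R where "R n \<xi> = cmod (cis ((X n - x) \<bullet> \<xi>) - 1 - \<i> * of_real ((X n - x) \<bullet> \<xi>)) * cmod (g \<xi>) / norm (X n - x)" for n \<xi>
    have Xn: "norm (X n - x) > 0" for n using X(1) by simp
    have Rm [measurable]: "R n \<in> borel_measurable borel" for n unfolding R_def[abs_def] by measurable
    have R0: "R n \<xi> \<ge> 0" for n \<xi> by (simp add: R_def)
    have R1: "R n \<xi> \<le> 2 * (norm \<xi> * cmod (g \<xi>))" for n \<xi>
    proof -
      let ?b = "(X n - x) \<bullet> \<xi>"
      have "cmod (cis ?b - 1 - \<i> * of_real ?b) \<le> 2 * (norm (X n - x) * norm \<xi>)"
        using cis_taylor_bounds(1)[of ?b] Cauchy_Schwarz_ineq2[of "X n - x" \<xi>] by linarith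
      then have "cmod (cis ?b - 1 - \<i> * of_real ?b) * cmod (g \<xi>) \<le> 2 * (norm (X n - x) * norm \<xi>) * cmod (g \<xi>)"
        by (intro mult_right_mono) auto
      then show ?thesis using Xn[of n] unfolding R_def by (simp add: divide_le_eq mult_ac)
    qed
    have R2: "R n \<xi> \<le> norm (X n - x) * ((norm \<xi>)\<^sup>2 * cmod (g \<xi>))" for n \<xi>
    proof -
      let ?b = "(X n - x) \<bullet> \<xi>"
      have "?b\<^sup>2 \<le> (norm (X n - x) * norm \<xi>)\<^sup>2"
        using Cauchy_Schwarz_ineq2[of "X n - x" \<xi>] by (simp add: abs_le_square_iff[symmetric])
      then have "cmod (cis ?b - 1 - \<i> * of_real ?b) \<le> (norm (X n - x) * norm \<xi>)\<^sup>2"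
        using cis_taylor_bounds(2)[of ?b] by linarith
      then have "cmod (cis ?b - 1 - \<i> * of_real ?b) * cmod (g \<xi>) \<le> (norm (X n - x) * norm \<xi>)\<^sup>2 * cmod (g \<xi>)"
        by (intro mult_right_mono) auto
      then show ?thesis using Xn[of n] unfolding R_def by (simp add: divide_le_eq power2_eq_square mult_ac)
    qed
    have nX: "(\<lambda>n. norm (X n - x)) \<longlonglongrightarrow> 0" using X(2) by (simp add: LIM_zero_iff tendsto_norm_zero_iff)
    have "(\<lambda>n. LINT \<xi>|lborel. R n \<xi>) \<longlonglongrightarrow> (LINT \<xi>|(lborel :: 'a measure). 0)"
    proof (rule integral_dominated_convergence[where w = "\<lambda>\<xi>. 2 * (norm \<xi> * cmod (g \<xi>))"])
      show "integrable lborel (\<lambda>\<xi>. 2 * (norm \<xi> * cmod (g \<xi>)))" using int1 by simp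
      show "AE \<xi> in lborel. norm (R n \<xi>) \<le> 2 * (norm \<xi> * cmod (g \<xi>))" for n
        using R0 R1 by (intro AE_I2) simp
      show "AE \<xi> in lborel. (\<lambda>n. R n \<xi>) \<longlonglongrightarrow> 0"
      proof (rule AE_I2)
        fix \<xi>
        have "(\<lambda>n. norm (X n - x) * ((norm \<xi>)\<^sup>2 * cmod (g \<xi>))) \<longlonglongrightarrow> 0 * ((norm \<xi>)\<^sup>2 * cmod (g \<xi>))"
          by (intro tendsto_intros nX)
        then have up: "(\<lambda>n. norm (X n - x) * ((norm \<xi>)\<^sup>2 * cmod (g \<xi>))) \<longlonglongrightarrow> 0" by simp
        show "(\<lambda>n. R n \<xi>) \<longlonglongrightarrow> 0"
          by (rule tendsto_sandwich[OF _ _ tendsto_const up]) (auto simp: R0 R2)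
      qed
    qed auto
    then have lim: "(\<lambda>n. ?c * (LINT \<xi>|lborel. R n \<xi>)) \<longlonglongrightarrow> 0"
      using tendsto_mult_right_zero by fastforce
    have le: "norm (inverse_fourier g (X n) - inverse_fourier g x - ?A (X n - x)) / norm (X n - x) \<le> ?c * (LINT \<xi>|lborel. R n \<xi>)" for n
    proof -
      let ?rem = "\<lambda>\<xi>. (cis ((X n - x) \<bullet> \<xi>) - 1 - \<i> * of_real ((X n - x) \<bullet> \<xi>)) * (cis (x \<bullet> \<xi>) * g \<xi>)"
      have "inverse_fourier g (X n) - inverse_fourier g x - ?A (X n - x) =
          of_real ?c * ((LINT \<xi>|lborel. cis (X n \<bullet> \<xi>) * g \<xi>) - (LINT \<xi>|lborel. cis (x \<bullet> \<xi>) * g \<xi>) -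
           (LINT \<xi>|lborel. \<i> * of_real ((X n - x) \<bullet> \<xi>) * (cis (x \<bullet> \<xi>) * g \<xi>)))"
        unfolding A unfolding inverse_fourier_alt by (simp only: right_diff_distrib)
      also have "\<dots> = of_real ?c * (LINT \<xi>|lborel. cis (X n \<bullet> \<xi>) * g \<xi> - cis (x \<bullet> \<xi>) * g \<xi> -
            \<i> * of_real ((X n - x) \<bullet> \<xi>) * (cis (x \<bullet> \<xi>) * g \<xi>))"
        using integrable_fourier_integrand[OF g0] intA[of "X n - x"]
        by (simp only: Bochner_Integration.integral_diff Bochner_Integration.integrable_diff)
      also have "(\<lambda>\<xi>. cis (X n \<bullet> \<xi>) * g \<xi> - cis (x \<bullet> \<xi>) * g \<xi> -
            \<i> * of_real ((X n - x) \<bullet> \<xi>) * (cis (x \<bullet> \<xi>) * g \<xi>)) = ?rem"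
      proof
        fix \<xi>
        have "cis (X n \<bullet> \<xi>) = cis ((X n - x) \<bullet> \<xi>) * cis (x \<bullet> \<xi>)" by (simp add: cis_mult inner_diff_left)
        then show "cis (X n \<bullet> \<xi>) * g \<xi> - cis (x \<bullet> \<xi>) * g \<xi> -
            \<i> * of_real ((X n - x) \<bullet> \<xi>) * (cis (x \<bullet> \<xi>) * g \<xi>) = ?rem \<xi>" by (simp only: left_diff_distrib mult_1_left mult.assoc)
      qed
      finally have "norm (inverse_fourier g (X n) - inverse_fourier g x - ?A (X n - x)) = ?c * cmod (LINT \<xi>|lborel. ?rem \<xi>)"
        using fourier_const_pos[where 'a='a] by (simp add: norm_mult)
      also have "\<dots> \<le> ?c * (LINT \<xi>|lborel. cmod (?rem \<xi>))"
        using fourier_const_pos[where 'a='a] by (intro mult_left_mono integral_norm_bound) auto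
      finally have "norm (inverse_fourier g (X n) - inverse_fourier g x - ?A (X n - x)) / norm (X n - x) \<le>
          ?c * (LINT \<xi>|lborel. cmod (?rem \<xi>)) / norm (X n - x)" by (rule divide_right_mono) simp
      also have "\<dots> = ?c * (LINT \<xi>|lborel. R n \<xi>)" by (simp add: R_def norm_mult)
      finally show ?thesis .
    qed
    show "(\<lambda>n. norm (inverse_fourier g (X n) - inverse_fourier g x - ?A (X n - x)) / norm (X n - x)) \<longlonglongrightarrow> 0"
      by (rule tendsto_sandwich[OF _ _ tendsto_const lim]) (auto simp: le)
  qed
  moreover have "bounded_linear ?A"
    by (intro bounded_linear_sum bounded_linear_scaleR_left[THEN bounded_linear_compose] bounded_linear_inner_left)
  ultimately show ?thesis unfolding has_derivative_iff_norm by blast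
qed

definition C2_function :: "('a::euclidean_space \<Rightarrow> complex) \<Rightarrow> bool" where
  "C2_function V \<longleftrightarrow> (\<forall>x. V differentiable (at x)) \<and>
     (\<forall>j\<in>Basis. (\<forall>x. partial_deriv j V differentiable (at x)) \<and>
        (\<forall>k\<in>Basis. continuous_on UNIV (partial_deriv k (partial_deriv j V))))"

lemma partial_deriv_inverse_fourier:
  assumes "moment_integrable 1 g" "j \<in> Basis"
  shows "partial_deriv j (inverse_fourier g) = inverse_fourier (fourier_partial j g)"
proof
  fix x
  show "partial_deriv j (inverse_fourier g) x = inverse_fourier (fourier_partial j g) x"
    using assms(2) by (simp add: partial_deriv_eq[OF has_derivative_inverse_fourier[OF assms(1)]]
        inner_Basis if_distrib if_distribR sum.delta cong: if_cong)
qed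

lemma C2_function_inverse_fourier:
  assumes g: "moment_integrable 2 g"
  shows "C2_function (inverse_fourier g)"
  unfolding C2_function_def
proof (intro conjI allI ballI)
  have g1: "moment_integrable 1 g" using g by (rule moment_integrable_mono) simp
  show "inverse_fourier g differentiable (at x)" for x
    using has_derivative_inverse_fourier[OF g1] by (auto simp: differentiable_def)
  fix j :: 'a assume j: "j \<in> Basis"
  have gj: "moment_integrable 1 (fourier_partial j g)"
    using g j by (intro moment_integrable_partial) (simp_all add: numeral_2_eq_2)
  show "partial_deriv j (inverse_fourier g) differentiable (at x)" for x
    unfolding partial_deriv_inverse_fourier[OF g1 j]
    using has_derivative_inverse_fourier[OF gj] by (auto simp: differentiable_def)
  fix k :: 'a assume k: "k \<in> Basis"
  show "continuous_on UNIV (partial_deriv k (partial_deriv j (inverse_fourier g)))"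
    unfolding partial_deriv_inverse_fourier[OF g1 j] partial_deriv_inverse_fourier[OF gj k]
    by (rule continuous_inverse_fourier, rule moment_integrable_partial) (use gj k in simp_all)
qed

text \<open>Sobolev embedding on the Fourier side: a weighted arithmetic-geometric mean inequality
  splits the integrand into \<open>?f\<close>, integrable because \<open>2 * (s - 2)\<close> exceeds
  the dimension, and the density of the H^s norm. Choosing the weight \<open>a\<close> equal to the
  norm makes the bound linear in it.\<close>

lemma fourier_Hs_moment_integrable:
  fixes g :: "'a::euclidean_space \<Rightarrow> complex"
  assumes s: "s > real DIM('a) / 2 + 2"
  shows "\<exists>K>0. \<forall>g\<in>fourier_Hs s. moment_integrable 2 (g :: 'a \<Rightarrow> complex) \<and>
     (LINT \<xi>|lborel. (1 + norm \<xi>)\<^sup>2 * cmod (g \<xi>)) \<le> K * fourier_Hs_norm s g"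
proof -
  let ?w = "\<lambda>\<xi>::'a. 1 + (norm \<xi>)\<^sup>2"
  let ?f = "\<lambda>\<xi>. ?w \<xi> powr (2 - s)"
  have intf: "integrable lborel ?f"
    using integrable_japanese_bracket[where 'a='a, of "s - 2"] s by simp
  define I where "I = (LINT \<xi>|lborel. ?f \<xi>)"
  have I0: "I \<ge> 0" unfolding I_def by (intro integral_nonneg_AE AE_I2) simp
  have w2: "(1 + norm \<xi>)\<^sup>2 \<le> 2 * ?w \<xi>" for \<xi> :: 'a
    using sum_squares_ge_zero[of "1 - norm \<xi>" 0] by (simp add: power2_eq_square algebra_simps)
  have main: "moment_integrable 2 g \<and> (LINT \<xi>|lborel. (1 + norm \<xi>)\<^sup>2 * cmod (g \<xi>)) \<le> (I + 1) * fourier_Hs_norm s g"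
    if g: "g \<in> fourier_Hs s" for g :: "'a \<Rightarrow> complex"
  proof -
    have gm [measurable]: "g \<in> borel_measurable borel" and gi: "integrable lborel (\<lambda>\<xi>. ?w \<xi> powr s * (cmod (g \<xi>))\<^sup>2)"
      using g by (auto simp: fourier_Hs_def)
    define N where "N = fourier_Hs_norm s g"
    have N2: "(LINT \<xi>|lborel. ?w \<xi> powr s * (cmod (g \<xi>))\<^sup>2) = N\<^sup>2"
      unfolding N_def fourier_Hs_norm_def by (simp add: integral_nonneg_AE)
    have N0: "N \<ge> 0" unfolding N_def fourier_Hs_norm_def by (simp add: integral_nonneg_AE)
    have pw: "(1 + norm \<xi>)\<^sup>2 * cmod (g \<xi>) \<le> a * ?f \<xi> + 1 / a * (?w \<xi> powr s * (cmod (g \<xi>))\<^sup>2)" if a: "a > 0" for a \<xi>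
    proof -
      \<comment> \<open>\<open>p * q\<close> is \<open>?w \<xi> * cmod (g \<xi>)\<close>; the factor
        2 lost in \<open>w2\<close> is regained from
        \<open>2 * (p * q) \<le> p\<^sup>2 + q\<^sup>2\<close>.\<close>
      define p q where "p = sqrt a * ?w \<xi> powr (1 - s / 2)" and "q = 1 / sqrt a * (?w \<xi> powr (s / 2) * cmod (g \<xi>))"
      have wpos: "?w \<xi> > 0" by (simp add: add_pos_nonneg)
      have "2 * (p * q) \<le> p\<^sup>2 + q\<^sup>2" using sum_squares_ge_zero[of "p - q" 0] by (simp add: power2_eq_square algebra_simps)
      moreover have "p * q = ?w \<xi> * cmod (g \<xi>)"
      proof -
        have "p * q = (?w \<xi> powr (1 - s / 2) * ?w \<xi> powr (s / 2)) * cmod (g \<xi>)" using a by (simp add: p_def q_def)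
        also have "?w \<xi> powr (1 - s / 2) * ?w \<xi> powr (s / 2) = ?w \<xi>" using wpos by (simp add: powr_add[symmetric])
        finally show ?thesis .
      qed
      moreover have "p\<^sup>2 = a * ?f \<xi>"
        using a wpos by (simp add: p_def power_mult_distrib powr_power algebra_simps)
      moreover have "q\<^sup>2 = 1 / a * (?w \<xi> powr s * (cmod (g \<xi>))\<^sup>2)"
        using a wpos by (simp add: q_def power_mult_distrib power_divide powr_power)
      moreover have "(1 + norm \<xi>)\<^sup>2 * cmod (g \<xi>) \<le> 2 * ?w \<xi> * cmod (g \<xi>)" by (intro mult_right_mono w2) auto
      ultimately show ?thesis by linarith
    qed
    have intR: "integrable lborel (\<lambda>\<xi>. a * ?f \<xi> + 1 / a * (?w \<xi> powr s * (cmod (g \<xi>))\<^sup>2))" for a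
      by (intro Bochner_Integration.integrable_add integrable_mult_right intf gi)
    have int: "integrable lborel (\<lambda>\<xi>. (1 + norm \<xi>)\<^sup>2 * cmod (g \<xi>))"
    proof (rule Bochner_Integration.integrable_bound[OF intR[of 1]])
      show "AE \<xi> in lborel. norm ((1 + norm \<xi>)\<^sup>2 * cmod (g \<xi>)) \<le> norm (1 * ?f \<xi> + 1 / 1 * (?w \<xi> powr s * (cmod (g \<xi>))\<^sup>2))"
      proof (rule AE_I2)
        fix \<xi>
        show "norm ((1 + norm \<xi>)\<^sup>2 * cmod (g \<xi>)) \<le> norm (1 * ?f \<xi> + 1 / 1 * (?w \<xi> powr s * (cmod (g \<xi>))\<^sup>2))"
          using pw[of 1 \<xi>] by simp
      qed
    qed measurable
    have le: "(LINT \<xi>|lborel. (1 + norm \<xi>)\<^sup>2 * cmod (g \<xi>)) \<le> a * I + 1 / a * N\<^sup>2" if a: "a > 0" for a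
    proof -
      have "(LINT \<xi>|lborel. (1 + norm \<xi>)\<^sup>2 * cmod (g \<xi>)) \<le> (LINT \<xi>|lborel. a * ?f \<xi> + 1 / a * (?w \<xi> powr s * (cmod (g \<xi>))\<^sup>2))"
        by (intro Bochner_Integration.integral_mono int intR pw a)
      also have "\<dots> = a * I + 1 / a * N\<^sup>2"
        unfolding I_def N2[symmetric] using intf gi by (subst Bochner_Integration.integral_add) auto
      finally show ?thesis .
    qed
    have "(LINT \<xi>|lborel. (1 + norm \<xi>)\<^sup>2 * cmod (g \<xi>)) \<le> (I + 1) * N"
    proof (cases "N = 0")
      case True
      have "(LINT \<xi>|lborel. (1 + norm \<xi>)\<^sup>2 * cmod (g \<xi>)) \<le> 0"
      proof (rule field_le_epsilon)
        fix e :: real assume e: "e > 0"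
        have "e / (I + 1) * I \<le> e" using e I0 by (simp add: divide_simps)
        then show "(LINT \<xi>|lborel. (1 + norm \<xi>)\<^sup>2 * cmod (g \<xi>)) \<le> 0 + e"
          using le[of "e / (I + 1)"] e I0 True by simp
      qed
      then show ?thesis using True by simp
    next
      case False
      then have N: "N > 0" using N0 by simp
      have "N * I + 1 / N * N\<^sup>2 = (I + 1) * N" using N by (simp add: power2_eq_square algebra_simps)
      then show ?thesis using le[OF N] by linarith
    qed
    then show ?thesis using int gm by (simp add: moment_integrable_def N_def)
  qed
  show ?thesis by (rule exI[of _ "I + 1"]) (use I0 main in auto)
qed

text \<open>An exact identity with quadratic defect. Integrated, it makes every squared L2 term
  strongly convex with its own quadratic part as modulus.\<close>

lemma cmod_convex_combination:
  "(cmod (of_real (1 - \<theta>) * a + of_real \<theta> * b))\<^sup>2 =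
     (1 - \<theta>) * (cmod a)\<^sup>2 + \<theta> * (cmod b)\<^sup>2 - \<theta> * (1 - \<theta>) * (cmod (a - b))\<^sup>2"
  unfolding cmod_power2 by (simp add: power2_eq_square algebra_simps)

text \<open>Young's inequality. With \<open>\<theta> = 1\<close> it gives the usual factor 2; with
  \<open>\<theta>\<close> tending to 0 it becomes a continuity statement, which is how minimising
  sequences use it.\<close>

lemma cmod_add_sq_le:
  assumes "\<theta> > 0"
  shows "(cmod (a + b))\<^sup>2 \<le> (1 + \<theta>) * (cmod a)\<^sup>2 + (1 + 1 / \<theta>) * (cmod b)\<^sup>2"
proof -
  have "0 \<le> (sqrt \<theta> * cmod a - cmod b / sqrt \<theta>)\<^sup>2" by simp
  also have "\<dots> = \<theta> * (cmod a)\<^sup>2 + (cmod b)\<^sup>2 / \<theta> - 2 * (cmod a * cmod b)"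
    using assms by (simp add: power2_diff power_mult_distrib power_divide)
  finally have 1: "2 * (cmod a * cmod b) \<le> \<theta> * (cmod a)\<^sup>2 + (cmod b)\<^sup>2 / \<theta>" by simp
  have "(cmod (a + b))\<^sup>2 \<le> (cmod a + cmod b)\<^sup>2" by (intro power_mono norm_triangle_ineq) auto
  also have "\<dots> = (cmod a)\<^sup>2 + (cmod b)\<^sup>2 + 2 * (cmod a * cmod b)" by (simp add: power2_sum)
  also have "\<dots> \<le> (1 + \<theta>) * (cmod a)\<^sup>2 + (1 + 1 / \<theta>) * (cmod b)\<^sup>2" using 1 by (simp add: algebra_simps)
  finally show ?thesis .
qed

section \<open>The squared H^s norm on the Fourier side\<close>

lemma fourier_Hs_D:
  assumes "g \<in> fourier_Hs s"
  shows "g \<in> borel_measurable borel" "integrable lborel (\<lambda>\<xi>. (1 + (norm \<xi>)\<^sup>2) powr s * (cmod (g \<xi>))\<^sup>2)"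
  using assms by (auto simp: fourier_Hs_def)

lemma fourier_Hs_norm_sq:
  "(fourier_Hs_norm s g)\<^sup>2 = (LINT \<xi>|lborel. (1 + (norm \<xi>)\<^sup>2) powr s * (cmod (g \<xi>))\<^sup>2)"
  unfolding fourier_Hs_norm_def by (simp add: integral_nonneg_AE)

lemma fourier_Hs_norm_nonneg: "fourier_Hs_norm s g \<ge> 0"
  unfolding fourier_Hs_norm_def by (simp add: integral_nonneg_AE)

lemma fourier_Hs_linear:
  assumes g: "g \<in> fourier_Hs s" and h: "h \<in> fourier_Hs s"
  shows "(\<lambda>\<xi>. a * g \<xi> + b * h \<xi>) \<in> fourier_Hs s"
  unfolding fourier_Hs_def
proof safe
  note [measurable] = fourier_Hs_D(1)[OF g] fourier_Hs_D(1)[OF h]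
  show "(\<lambda>\<xi>. a * g \<xi> + b * h \<xi>) \<in> borel_measurable borel" by measurable
  show "integrable lborel (\<lambda>\<xi>. (1 + (norm \<xi>)\<^sup>2) powr s * (cmod (a * g \<xi> + b * h \<xi>))\<^sup>2)"
  proof (rule Bochner_Integration.integrable_bound)
    show "integrable lborel (\<lambda>\<xi>. 2 * (cmod a)\<^sup>2 * ((1 + (norm \<xi>)\<^sup>2) powr s * (cmod (g \<xi>))\<^sup>2) +
        2 * (cmod b)\<^sup>2 * ((1 + (norm \<xi>)\<^sup>2) powr s * (cmod (h \<xi>))\<^sup>2))"
      by (intro Bochner_Integration.integrable_add integrable_mult_right fourier_Hs_D g h)
    show "AE \<xi> in lborel. norm ((1 + (norm \<xi>)\<^sup>2) powr s * (cmod (a * g \<xi> + b * h \<xi>))\<^sup>2) \<le>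
       norm (2 * (cmod a)\<^sup>2 * ((1 + (norm \<xi>)\<^sup>2) powr s * (cmod (g \<xi>))\<^sup>2) +
        2 * (cmod b)\<^sup>2 * ((1 + (norm \<xi>)\<^sup>2) powr s * (cmod (h \<xi>))\<^sup>2))"
    proof (rule AE_I2)
      fix \<xi> :: 'a
      let ?w = "(1 + (norm \<xi>)\<^sup>2) powr s"
      have "?w * (cmod (a * g \<xi> + b * h \<xi>))\<^sup>2 \<le> ?w * (2 * (cmod (a * g \<xi>))\<^sup>2 + 2 * (cmod (b * h \<xi>))\<^sup>2)"
        using cmod_add_sq_le[of 1 "a * g \<xi>" "b * h \<xi>"] by (intro mult_left_mono) auto
      also have "\<dots> = 2 * (cmod a)\<^sup>2 * (?w * (cmod (g \<xi>))\<^sup>2) + 2 * (cmod b)\<^sup>2 * (?w * (cmod (h \<xi>))\<^sup>2)"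
        by (simp add: norm_mult power_mult_distrib algebra_simps)
      finally show "norm (?w * (cmod (a * g \<xi> + b * h \<xi>))\<^sup>2) \<le>
         norm (2 * (cmod a)\<^sup>2 * (?w * (cmod (g \<xi>))\<^sup>2) + 2 * (cmod b)\<^sup>2 * (?w * (cmod (h \<xi>))\<^sup>2))" by simp
    qed
  qed measurable
qed

lemma fourier_Hs_norm_convex:
  assumes g: "g \<in> fourier_Hs s" and h: "h \<in> fourier_Hs s"
  shows "(fourier_Hs_norm s (\<lambda>\<xi>. of_real (1 - \<theta>) * g \<xi> + of_real \<theta> * h \<xi>))\<^sup>2 =
    (1 - \<theta>) * (fourier_Hs_norm s g)\<^sup>2 + \<theta> * (fourier_Hs_norm s h)\<^sup>2 -
    \<theta> * (1 - \<theta>) * (fourier_Hs_norm s (\<lambda>\<xi>. 1 * g \<xi> + (-1) * h \<xi>))\<^sup>2"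
proof -
  have d: "(\<lambda>\<xi>. 1 * g \<xi> + (-1) * h \<xi>) \<in> fourier_Hs s" by (rule fourier_Hs_linear[OF g h])
  have "(LINT \<xi>|lborel. (1 + (norm \<xi>)\<^sup>2) powr s * (cmod (of_real (1 - \<theta>) * g \<xi> + of_real \<theta> * h \<xi>))\<^sup>2) =
     (LINT \<xi>|lborel. (1 - \<theta>) * ((1 + (norm \<xi>)\<^sup>2) powr s * (cmod (g \<xi>))\<^sup>2) + \<theta> * ((1 + (norm \<xi>)\<^sup>2) powr s * (cmod (h \<xi>))\<^sup>2)
       - \<theta> * (1 - \<theta>) * ((1 + (norm \<xi>)\<^sup>2) powr s * (cmod (1 * g \<xi> + (-1) * h \<xi>))\<^sup>2))"
    by (intro Bochner_Integration.integral_cong refl) (simp only: cmod_convex_combination, simp add: algebra_simps)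
  also have "\<dots> = (1 - \<theta>) * (fourier_Hs_norm s g)\<^sup>2 + \<theta> * (fourier_Hs_norm s h)\<^sup>2 -
    \<theta> * (1 - \<theta>) * (fourier_Hs_norm s (\<lambda>\<xi>. 1 * g \<xi> + (-1) * h \<xi>))\<^sup>2"
    unfolding fourier_Hs_norm_sq
    by (simp only: Bochner_Integration.integral_diff Bochner_Integration.integral_add integral_mult_right
      Bochner_Integration.integrable_add integrable_mult_right fourier_Hs_D(2)[OF g] fourier_Hs_D(2)[OF h] fourier_Hs_D(2)[OF d]
      integral_mult_right_zero)
  finally show ?thesis unfolding fourier_Hs_norm_sq .
qed

lemma fourier_Hs_norm_add_le:
  assumes g: "g \<in> fourier_Hs s" and h: "h \<in> fourier_Hs s" and \<theta>: "\<theta> > 0"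
  shows "(fourier_Hs_norm s (\<lambda>\<xi>. 1 * g \<xi> + 1 * h \<xi>))\<^sup>2 \<le>
    (1 + \<theta>) * (fourier_Hs_norm s g)\<^sup>2 + (1 + 1 / \<theta>) * (fourier_Hs_norm s h)\<^sup>2"
proof -
  have "(LINT \<xi>|lborel. (1 + (norm \<xi>)\<^sup>2) powr s * (cmod (1 * g \<xi> + 1 * h \<xi>))\<^sup>2) \<le>
     (LINT \<xi>|lborel. (1 + \<theta>) * ((1 + (norm \<xi>)\<^sup>2) powr s * (cmod (g \<xi>))\<^sup>2) + (1 + 1 / \<theta>) * ((1 + (norm \<xi>)\<^sup>2) powr s * (cmod (h \<xi>))\<^sup>2))"
  proof (rule Bochner_Integration.integral_mono)
    show "integrable lborel (\<lambda>\<xi>. (1 + (norm \<xi>)\<^sup>2) powr s * (cmod (1 * g \<xi> + 1 * h \<xi>))\<^sup>2)"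
      by (rule fourier_Hs_D(2)[OF fourier_Hs_linear[OF g h]])
    show "integrable lborel (\<lambda>\<xi>. (1 + \<theta>) * ((1 + (norm \<xi>)\<^sup>2) powr s * (cmod (g \<xi>))\<^sup>2) + (1 + 1 / \<theta>) * ((1 + (norm \<xi>)\<^sup>2) powr s * (cmod (h \<xi>))\<^sup>2))"
      by (intro Bochner_Integration.integrable_add integrable_mult_right fourier_Hs_D g h)
    fix \<xi> :: 'a
    let ?w = "(1 + (norm \<xi>)\<^sup>2) powr s"
    have "?w * (cmod (g \<xi> + h \<xi>))\<^sup>2 \<le> ?w * ((1 + \<theta>) * (cmod (g \<xi>))\<^sup>2 + (1 + 1 / \<theta>) * (cmod (h \<xi>))\<^sup>2)"
      by (intro mult_left_mono cmod_add_sq_le \<theta>) auto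
    then show "?w * (cmod (1 * g \<xi> + 1 * h \<xi>))\<^sup>2 \<le>
      (1 + \<theta>) * (?w * (cmod (g \<xi>))\<^sup>2) + (1 + 1 / \<theta>) * (?w * (cmod (h \<xi>))\<^sup>2)"
      by (simp add: algebra_simps)
  qed
  also have "\<dots> = (1 + \<theta>) * (fourier_Hs_norm s g)\<^sup>2 + (1 + 1 / \<theta>) * (fourier_Hs_norm s h)\<^sup>2"
    unfolding fourier_Hs_norm_sq
    by (simp only: Bochner_Integration.integral_add integrable_mult_right fourier_Hs_D(2)[OF g] fourier_Hs_D(2)[OF h]
      integral_mult_right_zero)
  finally show ?thesis unfolding fourier_Hs_norm_sq .
qed

section \<open>The quotient norm of restrictions\<close>

lemma Hs_extensionsD:
  assumes "g \<in> Hs_extensions \<Omega> s u"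
  shows "g \<in> fourier_Hs s" "\<And>x. x \<in> closure \<Omega> \<Longrightarrow> u x = inverse_fourier g x"
  using assms by (auto simp: Hs_extensions_def)

lemma Hs_norm_le:
  assumes "g \<in> Hs_extensions \<Omega> s u"
  shows "Hs_norm \<Omega> s u \<le> fourier_Hs_norm s g"
  unfolding Hs_norm_def using assms by (intro cINF_lower bdd_belowI2[of _ 0] fourier_Hs_norm_nonneg)

lemma Hs_norm_nonneg: "u \<in> Hs \<Omega> s \<Longrightarrow> Hs_norm \<Omega> s u \<ge> 0"
  unfolding Hs_norm_def by (intro cINF_greatest fourier_Hs_norm_nonneg) (simp add: Hs_def)

text \<open>A sequence stands in for an extension of minimal norm: identities for
  \<open>fourier_Hs_norm\<close> pass along it to the quotient norm as inequalities, and attainment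
  of the infimum need not be discussed.\<close>

lemma Hs_norm_approx:
  assumes "u \<in> Hs \<Omega> s"
  shows "\<exists>G. (\<forall>n. G n \<in> Hs_extensions \<Omega> s u) \<and> (\<lambda>n. fourier_Hs_norm s (G n)) \<longlonglongrightarrow> Hs_norm \<Omega> s u"
proof -
  have ne: "Hs_extensions \<Omega> s u \<noteq> {}" using assms by (simp add: Hs_def)
  have "\<exists>g\<in>Hs_extensions \<Omega> s u. fourier_Hs_norm s g < Hs_norm \<Omega> s u + 1 / real (Suc n)" for n
  proof -
    have "Hs_norm \<Omega> s u < Hs_norm \<Omega> s u + 1 / real (Suc n)" by simp
    then show ?thesis unfolding Hs_norm_def
      by (subst (asm) cINF_less_iff[OF ne]) (auto intro: bdd_belowI2[of _ 0] fourier_Hs_norm_nonneg)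
  qed
  then obtain G where G: "\<And>n. G n \<in> Hs_extensions \<Omega> s u" "\<And>n. fourier_Hs_norm s (G n) < Hs_norm \<Omega> s u + 1 / real (Suc n)"
    by metis
  have up: "(\<lambda>n. Hs_norm \<Omega> s u + 1 / real (Suc n)) \<longlonglongrightarrow> Hs_norm \<Omega> s u"
    using tendsto_add[OF tendsto_const LIMSEQ_inverse_real_of_nat] by (simp add: inverse_eq_divide)
  have "(\<lambda>n. fourier_Hs_norm s (G n)) \<longlonglongrightarrow> Hs_norm \<Omega> s u"
    by (rule tendsto_sandwich[OF _ _ tendsto_const up])
      (use Hs_norm_le[OF G(1)] less_imp_le[OF G(2)] in \<open>auto intro!: always_eventually\<close>)
  with G(1) show ?thesis by blast
qed

lemma Hs_extensions_linear:
  fixes \<Omega> :: "'a::euclidean_space set"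
  assumes s: "s > real DIM('a) / 2 + 2"
    and g: "g \<in> Hs_extensions \<Omega> s u" and h: "h \<in> Hs_extensions \<Omega> s v"
    and w: "\<And>x. x \<in> closure \<Omega> \<Longrightarrow> w x = a * u x + b * v x"
  shows "(\<lambda>\<xi>. a * g \<xi> + b * h \<xi>) \<in> Hs_extensions \<Omega> s w"
proof -
  have m: "moment_integrable 0 k" if "k \<in> fourier_Hs s" for k :: "'a \<Rightarrow> complex"
    using fourier_Hs_moment_integrable[OF s] that moment_integrable_mono[of 2 k 0] by auto
  show ?thesis
    unfolding Hs_extensions_def
    using fourier_Hs_linear[OF Hs_extensionsD(1)[OF g] Hs_extensionsD(1)[OF h]]
      inverse_fourier_linear[OF m[OF Hs_extensionsD(1)[OF g]] m[OF Hs_extensionsD(1)[OF h]]]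
      Hs_extensionsD(2)[OF g] Hs_extensionsD(2)[OF h] w
    by auto
qed

lemma Hs_linear:
  fixes \<Omega> :: "'a::euclidean_space set"
  assumes s: "s > real DIM('a) / 2 + 2" and u: "u \<in> Hs \<Omega> s" and v: "v \<in> Hs \<Omega> s"
  shows "(\<lambda>x. a * u x + b * v x) \<in> Hs \<Omega> s"
proof -
  obtain g h where "g \<in> Hs_extensions \<Omega> s u" "h \<in> Hs_extensions \<Omega> s v" using u v by (auto simp: Hs_def)
  from Hs_extensions_linear[OF s this, of "\<lambda>x. a * u x + b * v x"] have "Hs_extensions \<Omega> s (\<lambda>x. a * u x + b * v x) \<noteq> {}" by auto
  then show ?thesis using u v by (auto simp: Hs_def)
qed

lemma Hs_diff:
  fixes \<Omega> :: "'a::euclidean_space set"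
  assumes "s > real DIM('a) / 2 + 2" "u \<in> Hs \<Omega> s" "v \<in> Hs \<Omega> s"
  shows "(\<lambda>x. u x - v x) \<in> Hs \<Omega> s"
  using Hs_linear[OF assms, of 1 "-1"] by simp

text \<open>Convex combinations and differences of extensions extend the convex combination and the
  difference. Hence the identity for near-optimal extensions of \<open>u\<close> and
  \<open>v\<close> survives as an inequality in the right direction: once the defect is moved to the
  left, both terms with combined functions stand on the smaller side.\<close>

lemma Hs_norm_convex:
  fixes \<Omega> :: "'a::euclidean_space set"
  assumes s: "s > real DIM('a) / 2 + 2" and u: "u \<in> Hs \<Omega> s" and v: "v \<in> Hs \<Omega> s" and \<theta>: "0 \<le> \<theta>" "\<theta> \<le> 1"
  shows "(Hs_norm \<Omega> s (\<lambda>x. of_real (1 - \<theta>) * u x + of_real \<theta> * v x))\<^sup>2 \<le>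
    (1 - \<theta>) * (Hs_norm \<Omega> s u)\<^sup>2 + \<theta> * (Hs_norm \<Omega> s v)\<^sup>2 - \<theta> * (1 - \<theta>) * (Hs_norm \<Omega> s (\<lambda>x. u x - v x))\<^sup>2"
proof -
  let ?w = "\<lambda>x. of_real (1 - \<theta>) * u x + of_real \<theta> * v x"
  obtain G where G: "\<And>n. G n \<in> Hs_extensions \<Omega> s u" "(\<lambda>n. fourier_Hs_norm s (G n)) \<longlonglongrightarrow> Hs_norm \<Omega> s u"
    using Hs_norm_approx[OF u] by blast
  obtain H where H: "\<And>n. H n \<in> Hs_extensions \<Omega> s v" "(\<lambda>n. fourier_Hs_norm s (H n)) \<longlonglongrightarrow> Hs_norm \<Omega> s v"
    using Hs_norm_approx[OF v] by blast
  have "(Hs_norm \<Omega> s ?w)\<^sup>2 + \<theta> * (1 - \<theta>) * (Hs_norm \<Omega> s (\<lambda>x. u x - v x))\<^sup>2 \<le>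
      (1 - \<theta>) * (Hs_norm \<Omega> s u)\<^sup>2 + \<theta> * (Hs_norm \<Omega> s v)\<^sup>2"
  proof (rule LIMSEQ_le_const)
    show "(\<lambda>n. (1 - \<theta>) * (fourier_Hs_norm s (G n))\<^sup>2 + \<theta> * (fourier_Hs_norm s (H n))\<^sup>2) \<longlonglongrightarrow>
       (1 - \<theta>) * (Hs_norm \<Omega> s u)\<^sup>2 + \<theta> * (Hs_norm \<Omega> s v)\<^sup>2"
      by (intro tendsto_intros G H)
    have "(Hs_norm \<Omega> s ?w)\<^sup>2 + \<theta> * (1 - \<theta>) * (Hs_norm \<Omega> s (\<lambda>x. u x - v x))\<^sup>2 \<le>
        (1 - \<theta>) * (fourier_Hs_norm s (G n))\<^sup>2 + \<theta> * (fourier_Hs_norm s (H n))\<^sup>2" for n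
    proof -
      have "Hs_norm \<Omega> s ?w \<le> fourier_Hs_norm s (\<lambda>\<xi>. of_real (1 - \<theta>) * G n \<xi> + of_real \<theta> * H n \<xi>)"
        by (intro Hs_norm_le Hs_extensions_linear[OF s G(1) H(1)]) simp
      then have 1: "(Hs_norm \<Omega> s ?w)\<^sup>2 \<le> (fourier_Hs_norm s (\<lambda>\<xi>. of_real (1 - \<theta>) * G n \<xi> + of_real \<theta> * H n \<xi>))\<^sup>2"
        by (intro power_mono Hs_norm_nonneg Hs_linear s u v)
      have "Hs_norm \<Omega> s (\<lambda>x. u x - v x) \<le> fourier_Hs_norm s (\<lambda>\<xi>. 1 * G n \<xi> + (-1) * H n \<xi>)"
        by (intro Hs_norm_le Hs_extensions_linear[OF s G(1) H(1)]) simp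
      then have "(Hs_norm \<Omega> s (\<lambda>x. u x - v x))\<^sup>2 \<le> (fourier_Hs_norm s (\<lambda>\<xi>. 1 * G n \<xi> + (-1) * H n \<xi>))\<^sup>2"
        by (intro power_mono Hs_norm_nonneg Hs_diff s u v)
      then have "\<theta> * (1 - \<theta>) * (Hs_norm \<Omega> s (\<lambda>x. u x - v x))\<^sup>2 \<le> \<theta> * (1 - \<theta>) * (fourier_Hs_norm s (\<lambda>\<xi>. 1 * G n \<xi> + (-1) * H n \<xi>))\<^sup>2"
        using \<theta> by (intro mult_left_mono) auto
      with 1 show ?thesis
        using fourier_Hs_norm_convex[OF Hs_extensionsD(1)[OF G(1)] Hs_extensionsD(1)[OF H(1)], of \<theta> n n] by linarith
    qed
    then show "\<exists>N. \<forall>n\<ge>N. (Hs_norm \<Omega> s ?w)\<^sup>2 + \<theta> * (1 - \<theta>) * (Hs_norm \<Omega> s (\<lambda>x. u x - v x))\<^sup>2 \<le>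
        (1 - \<theta>) * (fourier_Hs_norm s (G n))\<^sup>2 + \<theta> * (fourier_Hs_norm s (H n))\<^sup>2" by blast
  qed
  then show ?thesis by linarith
qed

lemma Hs_norm_add_le:
  fixes \<Omega> :: "'a::euclidean_space set"
  assumes s: "s > real DIM('a) / 2 + 2" and u: "u \<in> Hs \<Omega> s" and v: "v \<in> Hs \<Omega> s" and \<theta>: "\<theta> > 0"
  shows "(Hs_norm \<Omega> s (\<lambda>x. u x + v x))\<^sup>2 \<le> (1 + \<theta>) * (Hs_norm \<Omega> s u)\<^sup>2 + (1 + 1 / \<theta>) * (Hs_norm \<Omega> s v)\<^sup>2"
proof -
  obtain G where G: "\<And>n. G n \<in> Hs_extensions \<Omega> s u" "(\<lambda>n. fourier_Hs_norm s (G n)) \<longlonglongrightarrow> Hs_norm \<Omega> s u"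
    using Hs_norm_approx[OF u] by blast
  obtain H where H: "\<And>n. H n \<in> Hs_extensions \<Omega> s v" "(\<lambda>n. fourier_Hs_norm s (H n)) \<longlonglongrightarrow> Hs_norm \<Omega> s v"
    using Hs_norm_approx[OF v] by blast
  show ?thesis
  proof (rule LIMSEQ_le_const)
    show "(\<lambda>n. (1 + \<theta>) * (fourier_Hs_norm s (G n))\<^sup>2 + (1 + 1 / \<theta>) * (fourier_Hs_norm s (H n))\<^sup>2) \<longlonglongrightarrow>
       (1 + \<theta>) * (Hs_norm \<Omega> s u)\<^sup>2 + (1 + 1 / \<theta>) * (Hs_norm \<Omega> s v)\<^sup>2"
      by (intro tendsto_intros G H)
    have "(Hs_norm \<Omega> s (\<lambda>x. u x + v x))\<^sup>2 \<le> (1 + \<theta>) * (fourier_Hs_norm s (G n))\<^sup>2 + (1 + 1 / \<theta>) * (fourier_Hs_norm s (H n))\<^sup>2" for n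
    proof -
      have "Hs_norm \<Omega> s (\<lambda>x. u x + v x) \<le> fourier_Hs_norm s (\<lambda>\<xi>. 1 * G n \<xi> + 1 * H n \<xi>)"
        by (intro Hs_norm_le Hs_extensions_linear[OF s G(1) H(1)]) simp
      moreover have "(\<lambda>x. u x + v x) \<in> Hs \<Omega> s" using Hs_linear[OF s u v, of 1 1] by simp
      ultimately have "(Hs_norm \<Omega> s (\<lambda>x. u x + v x))\<^sup>2 \<le> (fourier_Hs_norm s (\<lambda>\<xi>. 1 * G n \<xi> + 1 * H n \<xi>))\<^sup>2"
        by (intro power_mono Hs_norm_nonneg)
      also note fourier_Hs_norm_add_le[OF Hs_extensionsD(1)[OF G(1)] Hs_extensionsD(1)[OF H(1)] \<theta>]
      finally show ?thesis .
    qed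
    then show "\<exists>N. \<forall>n\<ge>N. (Hs_norm \<Omega> s (\<lambda>x. u x + v x))\<^sup>2 \<le>
       (1 + \<theta>) * (fourier_Hs_norm s (G n))\<^sup>2 + (1 + 1 / \<theta>) * (fourier_Hs_norm s (H n))\<^sup>2" by blast
  qed
qed

section \<open>Completeness of H^s\<close>

lemma ennreal_suminf_lt_top_bound:
  fixes f :: "nat \<Rightarrow> real"
  assumes "\<And>k. f k \<ge> 0" "(\<Sum>k. ennreal (f k)) < \<infinity>"
  shows "ennreal (f k) \<le> (\<Sum>k. ennreal (f k))"
proof -
  have "(\<Sum>k\<in>{k}. ennreal (f k)) \<le> (\<Sum>k. ennreal (f k))" by (intro sum_le_suminf) auto
  then show ?thesis by simp
qed

text \<open>Completeness of the weighted \<open>L\<^sup>2\<close> space in the form needed: the series converges pointwise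
  almost everywhere because \<open>4\<^sup>k |\<gamma>\<^sub>k|\<^sup>2\<close> is summable after integration.\<close>

lemma fourier_Hs_series:
  fixes \<gamma> :: "nat \<Rightarrow> 'a::euclidean_space \<Rightarrow> complex"
  assumes \<gamma>: "\<And>k. \<gamma> k \<in> fourier_Hs s" and le: "\<And>k. (fourier_Hs_norm s (\<gamma> k))\<^sup>2 \<le> (1 / 16) ^ k"
  shows "\<exists>T. (\<forall>J. T J \<in> fourier_Hs s \<and> (fourier_Hs_norm s (T J))\<^sup>2 \<le> 8 * (1 / 4) ^ J) \<and>
     (\<forall>J. AE \<xi> in lborel. T J \<xi> = \<gamma> J \<xi> + T (Suc J) \<xi>)"
proof -
  let ?W = "\<lambda>\<xi>::'a. (1 + (norm \<xi>)\<^sup>2) powr s"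
  have Wp: "?W \<xi> > 0" for \<xi> by (simp add: add_pos_nonneg order_less_imp_not_eq2)
  note [measurable] = fourier_Hs_D(1)[OF \<gamma>]
  \<comment> \<open>The squared norms decay like \<open>(1 / 16) ^ k\<close>, so the weight
    \<open>4 ^ k\<close> still leaves \<open>S\<close> integrable, while finiteness of
    \<open>S \<xi>\<close> forces \<open>\<gamma> k \<xi>\<close> to decay like
    \<open>(1 / 2) ^ k\<close>.\<close>
  define S where "S \<xi> = (\<Sum>k. ennreal (4 ^ k * (?W \<xi> * (cmod (\<gamma> k \<xi>))\<^sup>2)))" for \<xi>
  have Sm [measurable]: "S \<in> borel_measurable borel" unfolding S_def[abs_def] by measurable
  have "(\<integral>\<^sup>+\<xi>. S \<xi> \<partial>lborel) = (\<Sum>k. \<integral>\<^sup>+\<xi>. ennreal (4 ^ k * (?W \<xi> * (cmod (\<gamma> k \<xi>))\<^sup>2)) \<partial>lborel)"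
    unfolding S_def by (rule nn_integral_suminf) measurable
  also have "\<dots> \<le> (\<Sum>k. ennreal ((1 / 4) ^ k))"
  proof (intro suminf_le summableI)
    fix k
    have "(\<integral>\<^sup>+\<xi>. ennreal (4 ^ k * (?W \<xi> * (cmod (\<gamma> k \<xi>))\<^sup>2)) \<partial>lborel) = ennreal (LINT \<xi>|lborel. 4 ^ k * (?W \<xi> * (cmod (\<gamma> k \<xi>))\<^sup>2))"
      by (intro nn_integral_eq_integral integrable_mult_right fourier_Hs_D \<gamma> AE_I2) simp
    also have "\<dots> = ennreal (4 ^ k * (fourier_Hs_norm s (\<gamma> k))\<^sup>2)" by (simp add: fourier_Hs_norm_sq)
    also have "\<dots> \<le> ennreal (4 ^ k * (1 / 16) ^ k)" by (intro ennreal_leI mult_left_mono le) simp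
    also have "(4 ^ k * (1 / 16) ^ k :: real) = (1 / 4) ^ k" by (simp add: power_mult_distrib[symmetric])
    finally show "(\<integral>\<^sup>+\<xi>. ennreal (4 ^ k * (?W \<xi> * (cmod (\<gamma> k \<xi>))\<^sup>2)) \<partial>lborel) \<le> ennreal ((1 / 4) ^ k)" .
  qed
  also have "\<dots> = ennreal (\<Sum>k. (1 / 4) ^ k)" by (intro suminf_ennreal2 summable_geometric) auto
  also have "(\<Sum>k. (1 / 4 :: real) ^ k) = 4 / 3" by (subst suminf_geometric) auto
  finally have SI: "(\<integral>\<^sup>+\<xi>. S \<xi> \<partial>lborel) \<le> ennreal (4 / 3)" .
  have Sfin: "AE \<xi> in lborel. S \<xi> \<noteq> \<infinity>"
    using SI by (intro nn_integral_PInf_AE) (auto simp: top_unique)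
  \<comment> \<open>Tails rather than partial sums, because in \<open>Hs_complete\<close> the tail
    \<open>T J\<close> is to extend the limit minus the \<open>J\<close>-th chosen term.\<close>
  define T where "T J \<xi> = (\<Sum>k. \<gamma> (k + J) \<xi>)" for J \<xi>
  have Tm [measurable]: "T J \<in> borel_measurable borel" for J unfolding T_def[abs_def] by measurable
  have point: "summable (\<lambda>k. \<gamma> (k + J) \<xi>) \<and> ?W \<xi> * (cmod (T J \<xi>))\<^sup>2 \<le> 4 * (1 / 4) ^ J * enn2real (S \<xi>)"
    if fin: "S \<xi> \<noteq> \<infinity>" for \<xi> J
  proof -
    define c where "c = sqrt (enn2real (S \<xi>) / ?W \<xi>)"
    have c0: "c \<ge> 0" using Wp[of \<xi>] by (simp add: c_def less_imp_le)
    have each: "cmod (\<gamma> k \<xi>) \<le> c * (1 / 2) ^ k" for k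
    proof -
      have "ennreal (4 ^ k * (?W \<xi> * (cmod (\<gamma> k \<xi>))\<^sup>2)) \<le> S \<xi>"
        unfolding S_def by (rule ennreal_suminf_lt_top_bound) (use fin in \<open>auto simp: S_def less_top\<close>)
      then have "4 ^ k * (?W \<xi> * (cmod (\<gamma> k \<xi>))\<^sup>2) \<le> enn2real (S \<xi>)"
        using fin by (cases "S \<xi>") auto
      then have "(cmod (\<gamma> k \<xi>))\<^sup>2 \<le> enn2real (S \<xi>) / ?W \<xi> / 4 ^ k"
        using Wp[of \<xi>] by (simp add: le_divide_eq mult_ac)
      also have "\<dots> = (c * (1 / 2) ^ k)\<^sup>2"
      proof -
        have "((1 / 2 :: real) ^ k)\<^sup>2 = (1 / 4) ^ k" by (simp add: power2_eq_square power_mult_distrib[symmetric])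
        moreover have "c\<^sup>2 = enn2real (S \<xi>) / ?W \<xi>" using Wp[of \<xi>] by (simp add: c_def less_imp_le)
        ultimately show ?thesis by (simp add: power_mult_distrib power_divide)
      qed
      finally show ?thesis by (rule power2_le_imp_le) (use c0 in simp)
    qed
    have geo: "summable (\<lambda>k. c * (1 / 2) ^ J * (1 / 2) ^ k)" by (intro summable_mult summable_geometric) simp
    have eachJ: "cmod (\<gamma> (k + J) \<xi>) \<le> c * (1 / 2) ^ J * (1 / 2) ^ k" for k
      using each[of "k + J"] by (simp add: power_add mult_ac)
    have sumn: "summable (\<lambda>k. cmod (\<gamma> (k + J) \<xi>))"
      by (rule summable_comparison_test'[OF geo, of 0]) (simp add: eachJ)
    have "cmod (T J \<xi>) \<le> (\<Sum>k. cmod (\<gamma> (k + J) \<xi>))" unfolding T_def by (rule summable_norm[OF sumn])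
    also have "\<dots> \<le> (\<Sum>k. c * (1 / 2) ^ J * (1 / 2) ^ k)" by (intro suminf_le eachJ sumn geo)
    also have "\<dots> = c * (1 / 2) ^ J * 2"
      by (subst suminf_mult) (auto simp: suminf_geometric)
    finally have "(cmod (T J \<xi>))\<^sup>2 \<le> (c * (1 / 2) ^ J * 2)\<^sup>2" by (intro power_mono) auto
    also have "\<dots> = 4 * (1 / 4) ^ J * (enn2real (S \<xi>) / ?W \<xi>)"
    proof -
      have "((1 / 2 :: real) ^ J)\<^sup>2 = (1 / 4) ^ J" by (simp add: power2_eq_square power_mult_distrib[symmetric])
      moreover have "c\<^sup>2 = enn2real (S \<xi>) / ?W \<xi>" using Wp[of \<xi>] by (simp add: c_def less_imp_le)
      ultimately show ?thesis by (simp add: power_mult_distrib)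
    qed
    finally have "?W \<xi> * (cmod (T J \<xi>))\<^sup>2 \<le> ?W \<xi> * (4 * (1 / 4) ^ J * (enn2real (S \<xi>) / ?W \<xi>))"
      using Wp[of \<xi>] by (intro mult_left_mono) auto
    also have "\<dots> = 4 * (1 / 4) ^ J * enn2real (S \<xi>)" using Wp[of \<xi>] by simp
    finally show ?thesis using summable_norm_cancel[OF sumn] by simp
  qed
  have TI: "(\<integral>\<^sup>+\<xi>. ennreal (?W \<xi> * (cmod (T J \<xi>))\<^sup>2) \<partial>lborel) \<le> ennreal (8 * (1 / 4) ^ J)" for J
  proof -
    have "(\<integral>\<^sup>+\<xi>. ennreal (?W \<xi> * (cmod (T J \<xi>))\<^sup>2) \<partial>lborel) \<le> (\<integral>\<^sup>+\<xi>. ennreal (4 * (1 / 4) ^ J) * S \<xi> \<partial>lborel)"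
    proof (rule nn_integral_mono_AE, use Sfin in eventually_elim)
      fix \<xi> assume fin: "S \<xi> \<noteq> \<infinity>"
      then have "ennreal (?W \<xi> * (cmod (T J \<xi>))\<^sup>2) \<le> ennreal (4 * (1 / 4) ^ J * enn2real (S \<xi>))"
        using point[OF fin] by (intro ennreal_leI) auto
      also have "\<dots> = ennreal (4 * (1 / 4) ^ J) * ennreal (enn2real (S \<xi>))"
        by (intro ennreal_mult) auto
      also have "ennreal (enn2real (S \<xi>)) = S \<xi>" using fin by (simp add: less_top)
      finally show "ennreal (?W \<xi> * (cmod (T J \<xi>))\<^sup>2) \<le> ennreal (4 * (1 / 4) ^ J) * S \<xi>" .
    qed
    also have "\<dots> = ennreal (4 * (1 / 4) ^ J) * (\<integral>\<^sup>+\<xi>. S \<xi> \<partial>lborel)" by (rule nn_integral_cmult) measurable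
    also have "\<dots> \<le> ennreal (4 * (1 / 4) ^ J) * ennreal (4 / 3)" by (intro mult_left_mono SI) simp
    also have "\<dots> = ennreal (4 * (1 / 4) ^ J * (4 / 3))" by (intro ennreal_mult[symmetric]) auto
    \<comment> \<open>\<open>4 * (4 / 3) = 16 / 3\<close>, rounded up.\<close>
    also have "\<dots> \<le> ennreal (8 * (1 / 4) ^ J)" by (intro ennreal_leI) simp
    finally show ?thesis .
  qed
  have THs: "T J \<in> fourier_Hs s" for J
    unfolding fourier_Hs_def
  proof safe
    show "integrable lborel (\<lambda>\<xi>. ?W \<xi> * (cmod (T J \<xi>))\<^sup>2)"
      by (rule integrableI_nonneg) (use TI[of J] in \<open>auto intro: le_less_trans\<close>)
  qed measurable
  moreover have "(fourier_Hs_norm s (T J))\<^sup>2 \<le> 8 * (1 / 4) ^ J" for J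
  proof -
    have "ennreal ((fourier_Hs_norm s (T J))\<^sup>2) \<le> ennreal (8 * (1 / 4) ^ J)"
      unfolding fourier_Hs_norm_sq
      using TI[of J] by (subst nn_integral_eq_integral[symmetric]) (auto intro!: fourier_Hs_D THs)
    then show ?thesis by (subst (asm) ennreal_le_iff) auto
  qed
  moreover have "AE \<xi> in lborel. T J \<xi> = \<gamma> J \<xi> + T (Suc J) \<xi>" for J
    using Sfin
  proof eventually_elim
    fix \<xi> assume "S \<xi> \<noteq> \<infinity>"
    then have "summable (\<lambda>k. \<gamma> (k + J) \<xi>)" using point by blast
    from suminf_split_initial_segment[OF this, of 1] show "T J \<xi> = \<gamma> J \<xi> + T (Suc J) \<xi>"
      unfolding T_def by simp
  qed
  ultimately show ?thesis by blast
qed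

lemma inverse_fourier_cong_AE:
  assumes "g \<in> borel_measurable borel" "h \<in> borel_measurable borel" "AE \<xi> in lborel. g \<xi> = h \<xi>"
  shows "inverse_fourier g x = inverse_fourier h x"
proof -
  have "(LINT \<xi>|lborel. cis (x \<bullet> \<xi>) * g \<xi>) = (LINT \<xi>|lborel. cis (x \<bullet> \<xi>) * h \<xi>)"
    using assms by (intro integral_cong_AE) (auto elim: eventually_mono)
  then show ?thesis by (simp add: inverse_fourier_def)
qed

text \<open>A subsequence with differences below \<open>(1 / 4) ^ j\<close> is chosen and each
  difference, rather than each term, is extended almost optimally; the sum of these extensions added
  to an extension of the first term represents the limit. The Cauchy property carries convergence
  from the subsequence to the whole sequence.\<close>

lemma Hs_complete:
  fixes \<Omega> :: "'a::euclidean_space set" and u :: "nat \<Rightarrow> 'a \<Rightarrow> complex"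
  assumes s: "s > real DIM('a) / 2 + 2" and u: "\<And>k. u k \<in> Hs \<Omega> s"
    and cau: "\<And>e. e > 0 \<Longrightarrow> \<exists>N. \<forall>k\<ge>N. \<forall>l\<ge>N. Hs_norm \<Omega> s (\<lambda>x. u k x - u l x) < e"
  shows "\<exists>v\<in>Hs \<Omega> s. (\<lambda>k. Hs_norm \<Omega> s (\<lambda>x. u k x - v x)) \<longlonglongrightarrow> 0"
proof -
  have "\<forall>j. \<exists>N. \<forall>k\<ge>N. \<forall>l\<ge>N. Hs_norm \<Omega> s (\<lambda>x. u k x - u l x) < (1 / 4) ^ j"
    using cau by simp
  then obtain N where N: "\<And>j k l. k \<ge> N j \<Longrightarrow> l \<ge> N j \<Longrightarrow> Hs_norm \<Omega> s (\<lambda>x. u k x - u l x) < (1 / 4) ^ j" by metis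
  \<comment> \<open>Partial sums of \<open>N\<close> are monotone and dominate
    \<open>N j\<close>.\<close>
  define r where "r j = (\<Sum>i\<le>j. N i)" for j
  have rN: "r j \<ge> N j" for j unfolding r_def by (rule member_le_sum) auto
  have rSuc: "r (Suc j) \<ge> r j" for j by (simp add: r_def)
  have "\<exists>g\<in>Hs_extensions \<Omega> s (\<lambda>x. u (r (Suc j)) x - u (r j) x). fourier_Hs_norm s g < (1 / 4) ^ j" for j
  proof -
    have "(\<lambda>x. u (r (Suc j)) x - u (r j) x) \<in> Hs \<Omega> s" by (intro Hs_diff s u)
    then have ne: "Hs_extensions \<Omega> s (\<lambda>x. u (r (Suc j)) x - u (r j) x) \<noteq> {}" by (simp add: Hs_def)
    have "Hs_norm \<Omega> s (\<lambda>x. u (r (Suc j)) x - u (r j) x) < (1 / 4) ^ j"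
      by (rule N) (use rN[of j] rSuc[of j] in auto)
    then show ?thesis unfolding Hs_norm_def
      by (subst (asm) cINF_less_iff[OF ne]) (auto intro: bdd_belowI2[of _ 0] fourier_Hs_norm_nonneg)
  qed
  then obtain \<gamma> where \<gamma>: "\<And>j. \<gamma> j \<in> Hs_extensions \<Omega> s (\<lambda>x. u (r (Suc j)) x - u (r j) x)"
    and \<gamma>n: "\<And>j. fourier_Hs_norm s (\<gamma> j) < (1 / 4) ^ j" by metis
  have \<gamma>Hs: "\<gamma> j \<in> fourier_Hs s" for j by (rule Hs_extensionsD(1)[OF \<gamma>])
  have "(fourier_Hs_norm s (\<gamma> j))\<^sup>2 \<le> (1 / 16) ^ j" for j
  proof -
    have "(fourier_Hs_norm s (\<gamma> j))\<^sup>2 \<le> ((1 / 4) ^ j)\<^sup>2"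
      using \<gamma>n[of j] by (intro power_mono fourier_Hs_norm_nonneg) auto
    also have "\<dots> = (1 / 16) ^ j" by (simp add: power2_eq_square power_mult_distrib[symmetric])
    finally show ?thesis .
  qed
  from fourier_Hs_series[OF \<gamma>Hs this] obtain T where T: "\<And>J. T J \<in> fourier_Hs s"
    "\<And>J. (fourier_Hs_norm s (T J))\<^sup>2 \<le> 8 * (1 / 4) ^ J"
    and TS: "\<And>J. AE \<xi> in lborel. T J \<xi> = \<gamma> J \<xi> + T (Suc J) \<xi>" by blast
  have m0: "moment_integrable 0 k" if "k \<in> fourier_Hs s" for k :: "'a \<Rightarrow> complex"
    using fourier_Hs_moment_integrable[OF s] that moment_integrable_mono[of 2 k 0] by auto
  obtain G where G: "G \<in> Hs_extensions \<Omega> s (u (r 0))" using u[of "r 0"] by (auto simp: Hs_def)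
  define v where "v x = (if x \<in> closure \<Omega> then u (r 0) x + inverse_fourier (T 0) x else 0)" for x
  have step: "inverse_fourier (T J) x = inverse_fourier (\<gamma> J) x + inverse_fourier (T (Suc J)) x" for J x
  proof -
    have "inverse_fourier (T J) x = inverse_fourier (\<lambda>\<xi>. 1 * \<gamma> J \<xi> + 1 * T (Suc J) \<xi>) x"
      by (rule inverse_fourier_cong_AE[OF fourier_Hs_D(1)[OF T(1)] fourier_Hs_D(1)[OF fourier_Hs_linear[OF \<gamma>Hs T(1)]]])
        (use TS[of J] in simp)
    also have "\<dots> = 1 * inverse_fourier (\<gamma> J) x + 1 * inverse_fourier (T (Suc J)) x"
      by (intro inverse_fourier_linear m0 \<gamma>Hs T)
    finally show ?thesis by simp
  qed
  have tel: "v x = u (r J) x + inverse_fourier (T J) x" if x: "x \<in> closure \<Omega>" for J x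
  proof (induction J)
    case (Suc J)
    have "inverse_fourier (\<gamma> J) x = u (r (Suc J)) x - u (r J) x" using Hs_extensionsD(2)[OF \<gamma> x, of J] by simp
    with Suc step[of J x] show ?case by simp
  qed (use x in \<open>simp add: v_def\<close>)
  have vext: "T J \<in> Hs_extensions \<Omega> s (\<lambda>x. v x - u (r J) x)" for J
    using T(1)[of J] tel[of _ J] by (auto simp: Hs_extensions_def)
  have v: "v \<in> Hs \<Omega> s"
  proof -
    have "(\<lambda>\<xi>. 1 * G \<xi> + 1 * T 0 \<xi>) \<in> Hs_extensions \<Omega> s v"
      by (rule Hs_extensions_linear[OF s G vext[of 0]]) (simp add: algebra_simps)
    then show ?thesis by (auto simp: Hs_def v_def)
  qed
  have close: "(Hs_norm \<Omega> s (\<lambda>x. u (r J) x - v x))\<^sup>2 \<le> 8 * (1 / 4) ^ J" for J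
  proof -
    have "(\<lambda>\<xi>. (-1) * T J \<xi> + 0 * T J \<xi>) \<in> Hs_extensions \<Omega> s (\<lambda>x. u (r J) x - v x)"
      by (rule Hs_extensions_linear[OF s vext vext]) simp
    from Hs_norm_le[OF this] have "Hs_norm \<Omega> s (\<lambda>x. u (r J) x - v x) \<le> fourier_Hs_norm s (\<lambda>\<xi>. (-1) * T J \<xi> + 0 * T J \<xi>)" .
    also have "\<dots> = fourier_Hs_norm s (T J)" by (simp add: fourier_Hs_norm_def)
    finally have "(Hs_norm \<Omega> s (\<lambda>x. u (r J) x - v x))\<^sup>2 \<le> (fourier_Hs_norm s (T J))\<^sup>2"
      by (intro power_mono Hs_norm_nonneg Hs_diff s u v)
    with T(2)[of J] show ?thesis by linarith
  qed
  have "(\<lambda>k. Hs_norm \<Omega> s (\<lambda>x. u k x - v x)) \<longlonglongrightarrow> 0"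
  proof (rule LIMSEQ_I)
    fix e :: real assume e: "e > 0"
    have "(\<lambda>J. 2 * ((1 / 16) ^ J) + 16 * (1 / 4) ^ J :: real) \<longlonglongrightarrow> 2 * 0 + 16 * 0"
      by (intro tendsto_intros LIMSEQ_realpow_zero) auto
    then have "eventually (\<lambda>J. 2 * ((1 / 16) ^ J) + 16 * (1 / 4) ^ J < e\<^sup>2) sequentially"
      using e by (intro order_tendstoD) auto
    then obtain J where J: "2 * ((1 / 16) ^ J) + 16 * (1 / 4) ^ J < e\<^sup>2" by (auto simp: eventually_sequentially)
    have "Hs_norm \<Omega> s (\<lambda>x. u k x - v x) < e" if k: "k \<ge> N J" for k
    proof -
      have "Hs_norm \<Omega> s (\<lambda>x. u k x - u (r J) x) < (1 / 4) ^ J" by (rule N) (use k rN in auto)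
      then have "(Hs_norm \<Omega> s (\<lambda>x. u k x - u (r J) x))\<^sup>2 \<le> ((1 / 4) ^ J)\<^sup>2"
        by (intro power_mono Hs_norm_nonneg Hs_diff s u) auto
      also have "((1 / 4 :: real) ^ J)\<^sup>2 = (1 / 16) ^ J" by (simp add: power2_eq_square power_mult_distrib[symmetric])
      finally have 1: "(Hs_norm \<Omega> s (\<lambda>x. u k x - u (r J) x))\<^sup>2 \<le> (1 / 16) ^ J" .
      have "(Hs_norm \<Omega> s (\<lambda>x. (u k x - u (r J) x) + (u (r J) x - v x)))\<^sup>2 \<le>
         (1 + 1) * (Hs_norm \<Omega> s (\<lambda>x. u k x - u (r J) x))\<^sup>2 + (1 + 1 / 1) * (Hs_norm \<Omega> s (\<lambda>x. u (r J) x - v x))\<^sup>2"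
        by (intro Hs_norm_add_le Hs_diff s u v) simp
      then have "(Hs_norm \<Omega> s (\<lambda>x. u k x - v x))\<^sup>2 < e\<^sup>2" using 1 close[of J] J by simp
      then show ?thesis by (rule power2_less_imp_less) (use e in simp)
    qed
    then show "\<exists>no. \<forall>k\<ge>no. norm (Hs_norm \<Omega> s (\<lambda>x. u k x - v x) - 0) < e"
      using Hs_norm_nonneg[OF Hs_diff[OF s u v]] by (intro exI[of _ "N J"]) auto
  qed
  with v show ?thesis by blast
qed

section \<open>Laplacian and boundary values of Sobolev functions\<close>

text \<open>Functions of \<open>Hs\<close> are set to 0 off the closed domain; this locality lets
  their derivatives inside be computed from a C2 extension.\<close>

lemma partial_deriv_cong_open:
  assumes "open S" "x \<in> S" "\<And>y. y \<in> S \<Longrightarrow> u y = v y"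
  shows "partial_deriv i u x = partial_deriv i v x"
proof -
  have "((\<lambda>t. x + t *\<^sub>R i) \<longlongrightarrow> x + 0 *\<^sub>R i) (nhds (0::real))"
    by (intro tendsto_intros filterlim_ident)
  then have "eventually (\<lambda>t. x + t *\<^sub>R i \<in> S) (nhds (0::real))"
    using assms(1,2) by (intro topological_tendstoD) auto
  then have "eventually (\<lambda>t. t \<in> UNIV \<longrightarrow> u (x + t *\<^sub>R i) = v (x + t *\<^sub>R i)) (nhds 0)"
    by eventually_elim (simp add: assms(3))
  then show ?thesis unfolding partial_deriv_def
    by (rule vector_derivative_cong_eq[where A = UNIV and B = UNIV and x = 0 and y = 0]) auto
qed

lemma iter_partial_cong_open:
  assumes "open S" "\<And>y. y \<in> S \<Longrightarrow> u y = v y" "x \<in> S"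
  shows "iter_partial is u x = iter_partial is v x"
  using assms(3)
proof (induction "is" arbitrary: x)
  case (Cons i "is")
  have "partial_deriv i (iter_partial is u) x = partial_deriv i (iter_partial is v) x"
    by (rule partial_deriv_cong_open[OF assms(1) Cons.prems]) (rule Cons.IH)
  then show ?case by simp
qed (simp add: assms(2))

lemma laplacian_cong_open:
  fixes x :: "'a::euclidean_space"
  assumes "open S" "\<And>y. y \<in> S \<Longrightarrow> u y = v y" "x \<in> S"
  shows "laplacian u x = laplacian v x"
  unfolding laplacian_def
proof (rule sum.cong[OF refl])
  fix i :: 'a
  have "iter_partial [i, i] u x = iter_partial [i, i] v x" by (rule iter_partial_cong_open[OF assms])
  then show "partial_deriv i (partial_deriv i u) x = partial_deriv i (partial_deriv i v) x" by simp
qed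

lemma differentiable_cong_open:
  assumes "open S" "x \<in> S" "\<And>y. y \<in> S \<Longrightarrow> u y = v y" "v differentiable (at x)"
  shows "u differentiable (at x)"
  using assms has_derivative_transform_within_open[of v _ x UNIV S u] unfolding differentiable_def by auto

lemma C2_functionD:
  assumes "C2_function V"
  shows "V differentiable (at x)" "j \<in> Basis \<Longrightarrow> partial_deriv j V differentiable (at x)"
    "continuous_on A V" "j \<in> Basis \<Longrightarrow> continuous_on A (partial_deriv j V)"
    "j \<in> Basis \<Longrightarrow> k \<in> Basis \<Longrightarrow> continuous_on A (partial_deriv k (partial_deriv j V))"
proof -
  show 1: "V differentiable (at x)" for x using assms by (simp add: C2_function_def)
  show 2: "partial_deriv j V differentiable (at x)" if "j \<in> Basis" for x using assms that by (simp add: C2_function_def)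
  show "continuous_on A V"
    using 1 by (auto intro!: continuous_at_imp_continuous_on differentiable_imp_continuous_within)
  show "continuous_on A (partial_deriv j V)" if "j \<in> Basis"
    using 2[OF that] by (auto intro!: continuous_at_imp_continuous_on differentiable_imp_continuous_within)
  show "continuous_on A (partial_deriv k (partial_deriv j V))" if "j \<in> Basis" "k \<in> Basis"
  proof -
    have "continuous_on UNIV (partial_deriv k (partial_deriv j V))" using assms that by (simp add: C2_function_def)
    then show ?thesis by (rule continuous_on_subset) simp
  qed
qed

lemma C2_function_has_derivative:
  "C2_function V \<Longrightarrow> (V has_derivative (\<lambda>v. \<Sum>j\<in>Basis. (v \<bullet> j) *\<^sub>R partial_deriv j V x)) (at x)"
  by (intro has_derivative_partial_deriv C2_functionD)

lemma partial_deriv_linear: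
  fixes U V :: "'a::euclidean_space \<Rightarrow> complex"
  assumes "U differentiable (at x)" "V differentiable (at x)"
  shows "partial_deriv j (\<lambda>x. a * U x + b * V x) x = a * partial_deriv j U x + b * partial_deriv j V x"
proof -
  obtain U' V' where d: "(U has_derivative U') (at x)" "(V has_derivative V') (at x)"
    using assms by (auto simp: differentiable_def)
  have "((\<lambda>x. a * U x + b * V x) has_derivative (\<lambda>h. a * U' h + b * V' h)) (at x)"
    by (intro has_derivative_add has_derivative_mult_right d)
  from partial_deriv_eq[OF this] partial_deriv_eq[OF d(1)] partial_deriv_eq[OF d(2)] show ?thesis by simp
qed

lemma laplacian_linear:
  assumes U: "C2_function U" and V: "C2_function V"
  shows "laplacian (\<lambda>x. a * U x + b * V x) x = a * laplacian U x + b * laplacian V x"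
proof -
  have "partial_deriv i (partial_deriv i (\<lambda>x. a * U x + b * V x)) x =
      a * partial_deriv i (partial_deriv i U) x + b * partial_deriv i (partial_deriv i V) x" if i: "i \<in> Basis" for i
  proof -
    have "partial_deriv i (\<lambda>x. a * U x + b * V x) = (\<lambda>x. a * partial_deriv i U x + b * partial_deriv i V x)"
      by (intro ext partial_deriv_linear C2_functionD U V)
    then show ?thesis by (simp add: partial_deriv_linear[OF C2_functionD(2)[OF U i] C2_functionD(2)[OF V i]])
  qed
  then show ?thesis by (simp add: laplacian_def sum.distrib sum_distrib_left)
qed

lemma C2_function_laplacian_continuous: "C2_function V \<Longrightarrow> continuous_on A (laplacian V)"
  unfolding laplacian_def[abs_def] by (intro continuous_intros C2_functionD)

text \<open>Admits functions of \<open>Hs\<close> to the Carleman estimate: the derivatives of a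
  global C2 extension are the required continuous extensions to the closure.\<close>

lemma Ck_closure_C2_function:
  assumes V: "C2_function V" and \<Omega>: "open \<Omega>" "\<And>x. x \<in> closure \<Omega> \<Longrightarrow> u x = V x"
  shows "Ck_closure 2 \<Omega> u"
proof -
  have uV: "\<And>x. x \<in> \<Omega> \<Longrightarrow> u x = V x" using \<Omega>(2) closure_subset by blast
  have cases: "is = [] \<or> (\<exists>j\<in>Basis. is = [j]) \<or> (\<exists>j\<in>Basis. \<exists>k\<in>Basis. is = [k, j])"
    if "is \<in> lists Basis" "length is \<le> 2" for "is" :: "'a list"
  proof (cases "is")
    case (Cons k l)
    then show ?thesis using that by (cases l) auto
  qed simp
  have cont: "continuous_on (closure \<Omega>) (iter_partial is V)" if "is \<in> lists Basis" "length is \<le> 2" for "is"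
    using cases[OF that] C2_functionD(3-5)[OF V, where A = "closure \<Omega>"] by auto
  have diff: "iter_partial is V differentiable (at x)" if "is \<in> lists Basis" "length is < 2" for "is" x
  proof -
    have "length is \<le> 2" using that(2) by simp
    from cases[OF that(1) this] that(2) show ?thesis using C2_functionD(1,2)[OF V, where x = x] by auto
  qed
  show ?thesis unfolding Ck_closure_def
  proof (intro conjI ballI impI)
    fix "is" :: "'a list" and x assume l: "is \<in> lists Basis" "length is < 2" and x: "x \<in> \<Omega>"
    show "iter_partial is u differentiable (at x)"
      by (rule differentiable_cong_open[OF \<Omega>(1) x _ diff[OF l]]) (rule iter_partial_cong_open[OF \<Omega>(1) uV])
  next
    fix "is" :: "'a list" assume l: "is \<in> lists Basis" "length is \<le> 2"
    show "\<exists>g. continuous_on (closure \<Omega>) g \<and> (\<forall>x\<in>\<Omega>. g x = iter_partial is u x)"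
      by (intro exI[of _ "iter_partial is V"] conjI cont l ballI iter_partial_cong_open[OF \<Omega>(1) uV, symmetric])
  qed
qed

lemma Hs_extension_C2:
  fixes \<Omega> :: "'a::euclidean_space set"
  assumes s: "s > real DIM('a) / 2 + 2" and u: "u \<in> Hs \<Omega> s"
  obtains V where "C2_function V" "\<And>x. x \<in> closure \<Omega> \<Longrightarrow> u x = V x"
proof -
  obtain g where g: "g \<in> Hs_extensions \<Omega> s u" using u by (auto simp: Hs_def)
  have "moment_integrable 2 g" using fourier_Hs_moment_integrable[OF s] Hs_extensionsD(1)[OF g] by blast
  from that[OF C2_function_inverse_fourier[OF this] Hs_extensionsD(2)[OF g]] show thesis .
qed

lemma normal_deriv_C2:
  assumes \<Omega>: "bounded_smooth_domain \<Omega>" and x: "x \<in> frontier \<Omega>"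
    and V: "C2_function V" "\<And>y. y \<in> closure \<Omega> \<Longrightarrow> u y = V y"
  shows "normal_deriv \<Omega> u x = (\<Sum>j\<in>Basis. (outward_normal \<Omega> x \<bullet> j) *\<^sub>R partial_deriv j V x)"
  by (rule normal_deriv_eq[OF \<Omega> x C2_function_has_derivative[OF V(1)] V(2)])

lemma bounded_smooth_domainD:
  assumes "bounded_smooth_domain \<Omega>"
  shows "open \<Omega>" "bounded \<Omega>" "\<Omega> \<noteq> {}" "\<Omega> \<in> sets borel" "compact (closure \<Omega>)"
  using assms by (auto simp: bounded_smooth_domain_def)

section \<open>Traces and uniform bounds of Sobolev functions\<close>

context
  fixes \<Omega> :: "'a::euclidean_space set" and s :: real
  assumes \<Omega>: "bounded_smooth_domain \<Omega>" and s: "s > real DIM('a) / 2 + 2"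
begin

lemma Hs_continuous_on: "u \<in> Hs \<Omega> s \<Longrightarrow> continuous_on (closure \<Omega>) u"
  by (erule Hs_extension_C2[OF s]) (metis C2_functionD(3) continuous_on_cong)

lemma Hs_laplacian_continuous_extension:
  assumes u: "u \<in> Hs \<Omega> s"
  shows "\<exists>f. continuous_on (closure \<Omega>) f \<and> (\<forall>x\<in>\<Omega>. laplacian u x = f x)"
proof -
  obtain V where V: "C2_function V" "\<And>x. x \<in> closure \<Omega> \<Longrightarrow> u x = V x" using Hs_extension_C2[OF s u] by blast
  have "laplacian u x = laplacian V x" if "x \<in> \<Omega>" for x
    using V(2) closure_subset that by (intro laplacian_cong_open[OF bounded_smooth_domainD(1)[OF \<Omega>]]) auto
  then show ?thesis using C2_function_laplacian_continuous[OF V(1)] by blast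
qed

lemma Hs_laplacian_linear:
  assumes u: "u \<in> Hs \<Omega> s" and v: "v \<in> Hs \<Omega> s" and x: "x \<in> \<Omega>"
  shows "laplacian (\<lambda>x. a * u x + b * v x) x = a * laplacian u x + b * laplacian v x"
proof -
  obtain U where U: "C2_function U" "\<And>x. x \<in> closure \<Omega> \<Longrightarrow> u x = U x" using Hs_extension_C2[OF s u] by blast
  obtain V where V: "C2_function V" "\<And>x. x \<in> closure \<Omega> \<Longrightarrow> v x = V x" using Hs_extension_C2[OF s v] by blast
  note lc = laplacian_cong_open[OF bounded_smooth_domainD(1)[OF \<Omega>] _ x]
  have sub: "y \<in> \<Omega> \<Longrightarrow> y \<in> closure \<Omega>" for y using closure_subset by blast
  have "laplacian u x = laplacian U x" "laplacian v x = laplacian V x"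
    "laplacian (\<lambda>x. a * u x + b * v x) x = laplacian (\<lambda>x. a * U x + b * V x) x"
    by (rule lc, simp add: U(2) V(2) sub)+
  then show ?thesis by (simp add: laplacian_linear[OF U(1) V(1)])
qed

lemma Hs_normal_deriv_linear:
  assumes u: "u \<in> Hs \<Omega> s" and v: "v \<in> Hs \<Omega> s" and x: "x \<in> frontier \<Omega>"
  shows "normal_deriv \<Omega> (\<lambda>x. a * u x + b * v x) x = a * normal_deriv \<Omega> u x + b * normal_deriv \<Omega> v x"
proof -
  obtain U where U: "C2_function U" "\<And>x. x \<in> closure \<Omega> \<Longrightarrow> u x = U x" using Hs_extension_C2[OF s u] by blast
  obtain V where V: "C2_function V" "\<And>x. x \<in> closure \<Omega> \<Longrightarrow> v x = V x" using Hs_extension_C2[OF s v] by blast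
  have d: "((\<lambda>x. a * U x + b * V x) has_derivative
     (\<lambda>h. a * (\<Sum>j\<in>Basis. (h \<bullet> j) *\<^sub>R partial_deriv j U x) + b * (\<Sum>j\<in>Basis. (h \<bullet> j) *\<^sub>R partial_deriv j V x))) (at x)"
    by (intro has_derivative_add has_derivative_mult_right C2_function_has_derivative U V)
  show ?thesis
    by (subst normal_deriv_eq[OF \<Omega> x d]) (simp_all add: U(2) V(2) normal_deriv_C2[OF \<Omega> x U] normal_deriv_C2[OF \<Omega> x V])
qed

lemma Hs_normal_deriv_continuous:
  assumes u: "u \<in> Hs \<Omega> s"
  shows "continuous_on (frontier \<Omega>) (normal_deriv \<Omega> u)"
proof -
  obtain V where V: "C2_function V" "\<And>x. x \<in> closure \<Omega> \<Longrightarrow> u x = V x" using Hs_extension_C2[OF s u] by blast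
  have "continuous_on (frontier \<Omega>) (\<lambda>x. \<Sum>j\<in>Basis. (outward_normal \<Omega> x \<bullet> j) *\<^sub>R partial_deriv j V x)"
    by (intro continuous_intros continuous_on_outward_normal[OF \<Omega>] C2_functionD[OF V(1)])
  then show ?thesis by (rule continuous_on_eq) (simp add: normal_deriv_C2[OF \<Omega> _ V])
qed

lemma fourier_partial_L1_le:
  fixes g :: "'a \<Rightarrow> complex"
  assumes "moment_integrable 2 g" "j \<in> Basis" "k \<in> Basis"
  shows "(LINT \<xi>|lborel. cmod (g \<xi>)) \<le> (LINT \<xi>|lborel. (1 + norm \<xi>)\<^sup>2 * cmod (g \<xi>))"
    "(LINT \<xi>|lborel. cmod (fourier_partial j g \<xi>)) \<le> (LINT \<xi>|lborel. (1 + norm \<xi>)\<^sup>2 * cmod (g \<xi>))"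
    "(LINT \<xi>|lborel. cmod (fourier_partial k (fourier_partial j g) \<xi>)) \<le> (LINT \<xi>|lborel. (1 + norm \<xi>)\<^sup>2 * cmod (g \<xi>))"
proof -
  have i2: "integrable lborel (\<lambda>\<xi>. (1 + norm \<xi>)\<^sup>2 * cmod (g \<xi>))" using assms(1) by (simp add: moment_integrable_def)
  have g1: "moment_integrable 1 (fourier_partial j g)"
    by (rule moment_integrable_partial) (use assms in \<open>simp_all add: numeral_2_eq_2\<close>)
  have g2: "moment_integrable 0 (fourier_partial k (fourier_partial j g))"
    by (rule moment_integrable_partial) (use g1 assms in simp_all)
  have i0: "integrable lborel (\<lambda>\<xi>. cmod (h \<xi>))" if "moment_integrable n h" for n h
    using moment_integrable_0[OF moment_integrable_mono[OF that]] by simp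
  have b: "\<bar>\<xi> \<bullet> j\<bar> \<le> 1 + norm \<xi>" "\<bar>\<xi> \<bullet> k\<bar> \<le> 1 + norm \<xi>" for \<xi> :: 'a
    using Basis_le_norm[OF assms(2), of \<xi>] Basis_le_norm[OF assms(3), of \<xi>] by simp_all
  show "(LINT \<xi>|lborel. cmod (g \<xi>)) \<le> (LINT \<xi>|lborel. (1 + norm \<xi>)\<^sup>2 * cmod (g \<xi>))"
  proof (intro Bochner_Integration.integral_mono i0[OF assms(1)] i2)
    fix \<xi> :: 'a
    have "1 * cmod (g \<xi>) \<le> (1 + norm \<xi>)\<^sup>2 * cmod (g \<xi>)" by (intro mult_right_mono) (auto simp: power2_eq_square algebra_simps)
    then show "cmod (g \<xi>) \<le> (1 + norm \<xi>)\<^sup>2 * cmod (g \<xi>)" by simp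
  qed
  show "(LINT \<xi>|lborel. cmod (fourier_partial j g \<xi>)) \<le> (LINT \<xi>|lborel. (1 + norm \<xi>)\<^sup>2 * cmod (g \<xi>))"
  proof (intro Bochner_Integration.integral_mono i0[OF g1] i2)
    fix \<xi> :: 'a
    have "(1 + norm \<xi>) * 1 \<le> (1 + norm \<xi>) * (1 + norm \<xi>)" by (intro mult_left_mono) auto
    then have "\<bar>\<xi> \<bullet> j\<bar> \<le> (1 + norm \<xi>)\<^sup>2" using b(1)[of \<xi>] by (simp add: power2_eq_square)
    then show "cmod (fourier_partial j g \<xi>) \<le> (1 + norm \<xi>)\<^sup>2 * cmod (g \<xi>)"
      by (simp add: fourier_partial_def norm_mult mult_right_mono)
  qed
  show "(LINT \<xi>|lborel. cmod (fourier_partial k (fourier_partial j g) \<xi>)) \<le> (LINT \<xi>|lborel. (1 + norm \<xi>)\<^sup>2 * cmod (g \<xi>))"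
  proof (intro Bochner_Integration.integral_mono i0[OF g2] i2)
    fix \<xi> :: 'a
    have "\<bar>\<xi> \<bullet> k\<bar> * \<bar>\<xi> \<bullet> j\<bar> \<le> (1 + norm \<xi>) * (1 + norm \<xi>)" by (intro mult_mono b) auto
    then have "\<bar>\<xi> \<bullet> k\<bar> * \<bar>\<xi> \<bullet> j\<bar> * cmod (g \<xi>) \<le> (1 + norm \<xi>)\<^sup>2 * cmod (g \<xi>)"
      unfolding power2_eq_square by (rule mult_right_mono) simp
    then show "cmod (fourier_partial k (fourier_partial j g) \<xi>) \<le> (1 + norm \<xi>)\<^sup>2 * cmod (g \<xi>)"
      by (simp add: fourier_partial_def norm_mult mult_ac)
  qed
qed

text \<open>Every extension \<open>g\<close> bounds value, Laplacian and normal derivative by the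
  second moment of \<open>g\<close>, hence by its norm; the infimum is taken afterwards. Convergence
  in H^s thereby becomes uniform convergence of all quantities in the functional.\<close>

lemma Hs_sup_bounds:
  "\<exists>K>0. \<forall>u\<in>Hs \<Omega> s. (\<forall>x\<in>closure \<Omega>. cmod (u x) \<le> K * Hs_norm \<Omega> s u) \<and>
     (\<forall>x\<in>\<Omega>. cmod (laplacian u x) \<le> K * Hs_norm \<Omega> s u) \<and>
     (\<forall>x\<in>frontier \<Omega>. cmod (normal_deriv \<Omega> u x) \<le> K * Hs_norm \<Omega> s u)"
proof -
  obtain K0 where K0: "K0 > 0" "\<And>g :: 'a \<Rightarrow> complex. g \<in> fourier_Hs s \<Longrightarrow> moment_integrable 2 g"
     "\<And>g :: 'a \<Rightarrow> complex. g \<in> fourier_Hs s \<Longrightarrow> (LINT \<xi>|lborel. (1 + norm \<xi>)\<^sup>2 * cmod (g \<xi>)) \<le> K0 * fourier_Hs_norm s g"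
    using fourier_Hs_moment_integrable[OF s] by blast
  define c where "c = fourier_const TYPE('a) * K0"
  have c: "c > 0" using fourier_const_pos[where 'a='a] K0 by (simp add: c_def)
  \<comment> \<open>The dimension counts the coordinate terms in the Laplacian and in the normal
    derivative.\<close>
  define K where "K = real DIM('a) * c"
  have d1: "real DIM('a) \<ge> 1" using DIM_positive[where 'a='a] by linarith
  then have K: "K \<ge> c" "K > 0" using c by (auto simp: K_def)
  have ext: "(x \<in> closure \<Omega> \<longrightarrow> cmod (u x) \<le> K * fourier_Hs_norm s g) \<and>
     (x \<in> \<Omega> \<longrightarrow> cmod (laplacian u x) \<le> K * fourier_Hs_norm s g) \<and>
     (x \<in> frontier \<Omega> \<longrightarrow> cmod (normal_deriv \<Omega> u x) \<le> K * fourier_Hs_norm s g)"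
    if g: "g \<in> Hs_extensions \<Omega> s u" for g u x
  proof -
    note gH = Hs_extensionsD(1)[OF g]
    have g2: "moment_integrable 2 g" by (rule K0(2)[OF gH])
    have g1: "moment_integrable 1 g" and g0: "moment_integrable 0 g" using g2 by (auto intro: moment_integrable_mono)
    let ?V = "inverse_fourier g"
    have V: "C2_function ?V" by (rule C2_function_inverse_fourier[OF g2])
    have uV: "\<And>y. y \<in> closure \<Omega> \<Longrightarrow> u y = ?V y" by (rule Hs_extensionsD(2)[OF g])
    have gj: "moment_integrable 1 (fourier_partial j g)" if "j \<in> Basis" for j
      by (rule moment_integrable_partial) (use g2 that in \<open>simp_all add: numeral_2_eq_2\<close>)
    have gjk: "moment_integrable 0 (fourier_partial k (fourier_partial j g))" if "j \<in> Basis" "k \<in> Basis" for j k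
      by (rule moment_integrable_partial) (use gj that in simp_all)
    have bd: "cmod (inverse_fourier h y) \<le> c * fourier_Hs_norm s g"
      if "moment_integrable 0 h" "(LINT \<xi>|lborel. cmod (h \<xi>)) \<le> (LINT \<xi>|lborel. (1 + norm \<xi>)\<^sup>2 * cmod (g \<xi>))" for h and y :: 'a
    proof -
      have "cmod (inverse_fourier h y) \<le> fourier_const TYPE('a) * (LINT \<xi>|lborel. cmod (h \<xi>))"
        by (rule norm_inverse_fourier_le[OF that(1)])
      also have "\<dots> \<le> fourier_const TYPE('a) * (K0 * fourier_Hs_norm s g)"
        using that(2) K0(3)[OF gH] fourier_const_pos[where 'a='a] by (intro mult_left_mono) auto
      finally show ?thesis by (simp add: c_def mult_ac)
    qed
    obtain b :: 'a where b: "b \<in> Basis" using nonempty_Basis by blast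
    have cK: "c * fourier_Hs_norm s g \<le> K * fourier_Hs_norm s g" using K by (intro mult_right_mono fourier_Hs_norm_nonneg)
    have "cmod (u x) \<le> K * fourier_Hs_norm s g" if "x \<in> closure \<Omega>"
      using bd[OF g0 fourier_partial_L1_le(1)[OF g2 b b], of x] uV[OF that] cK by simp
    moreover have "cmod (laplacian u x) \<le> K * fourier_Hs_norm s g" if x: "x \<in> \<Omega>"
    proof -
      have "laplacian u x = laplacian ?V x"
        using uV closure_subset x by (intro laplacian_cong_open[OF bounded_smooth_domainD(1)[OF \<Omega>]]) auto
      also have "\<dots> = (\<Sum>j\<in>Basis. inverse_fourier (fourier_partial j (fourier_partial j g)) x)"
        unfolding laplacian_def
        by (intro sum.cong refl) (simp add: partial_deriv_inverse_fourier[OF g1] partial_deriv_inverse_fourier[OF gj])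
      finally have "cmod (laplacian u x) \<le> (\<Sum>j\<in>Basis. cmod (inverse_fourier (fourier_partial j (fourier_partial j g)) x))"
        by (simp add: norm_sum)
      also have "\<dots> \<le> (\<Sum>j\<in>(Basis::'a set). c * fourier_Hs_norm s g)"
        by (intro sum_mono bd gjk fourier_partial_L1_le(3)[OF g2])
      finally show ?thesis by (simp add: K_def mult_ac)
    qed
    moreover have "cmod (normal_deriv \<Omega> u x) \<le> K * fourier_Hs_norm s g" if x: "x \<in> frontier \<Omega>"
    proof -
      have "cmod (normal_deriv \<Omega> u x) \<le> (\<Sum>j\<in>Basis. cmod ((outward_normal \<Omega> x \<bullet> j) *\<^sub>R partial_deriv j ?V x))"
      proof -
        have "normal_deriv \<Omega> u x = (\<Sum>j\<in>Basis. (outward_normal \<Omega> x \<bullet> j) *\<^sub>R partial_deriv j ?V x)"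
          by (rule normal_deriv_C2[OF \<Omega> x V uV])
        then show ?thesis by (simp only: norm_sum)
      qed
      also have "\<dots> \<le> (\<Sum>j\<in>(Basis::'a set). c * fourier_Hs_norm s g)"
      proof (rule sum_mono)
        fix j :: 'a assume j: "j \<in> Basis"
        have "\<bar>outward_normal \<Omega> x \<bullet> j\<bar> \<le> 1" using Basis_le_norm[OF j, of "outward_normal \<Omega> x"] norm_outward_normal[OF \<Omega> x] by simp
        moreover have "cmod (partial_deriv j ?V x) \<le> c * fourier_Hs_norm s g"
          unfolding partial_deriv_inverse_fourier[OF g1 j]
          by (intro bd moment_integrable_mono[OF gj[OF j]] fourier_partial_L1_le(2)[OF g2 j j]) simp
        ultimately have "\<bar>outward_normal \<Omega> x \<bullet> j\<bar> * cmod (partial_deriv j ?V x) \<le> 1 * (c * fourier_Hs_norm s g)"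
          by (intro mult_mono) auto
        then show "cmod ((outward_normal \<Omega> x \<bullet> j) *\<^sub>R partial_deriv j ?V x) \<le> c * fourier_Hs_norm s g" by simp
      qed
      finally show ?thesis by (simp add: K_def mult_ac)
    qed
    ultimately show ?thesis by blast
  qed
  show ?thesis
  proof (intro exI[of _ K] conjI K ballI)
    fix u x assume u: "u \<in> Hs \<Omega> s"
    obtain G where G: "\<And>n. G n \<in> Hs_extensions \<Omega> s u" "(\<lambda>n. fourier_Hs_norm s (G n)) \<longlonglongrightarrow> Hs_norm \<Omega> s u"
      using Hs_norm_approx[OF u] by blast
    have lim: "(\<lambda>n. K * fourier_Hs_norm s (G n)) \<longlonglongrightarrow> K * Hs_norm \<Omega> s u" by (intro tendsto_intros G)
    note E = ext[OF G(1)]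
    show "x \<in> closure \<Omega> \<Longrightarrow> cmod (u x) \<le> K * Hs_norm \<Omega> s u"
      by (rule LIMSEQ_le_const[OF lim]) (use E in blast)
    show "x \<in> \<Omega> \<Longrightarrow> cmod (laplacian u x) \<le> K * Hs_norm \<Omega> s u"
      by (rule LIMSEQ_le_const[OF lim]) (use E in blast)
    show "x \<in> frontier \<Omega> \<Longrightarrow> cmod (normal_deriv \<Omega> u x) \<le> K * Hs_norm \<Omega> s u"
      by (rule LIMSEQ_le_const[OF lim]) (use E in blast)
  qed
qed

end

lemma Hs_norm_minus_commute:
  fixes \<Omega> :: "'a::euclidean_space set"
  assumes s: "s > real DIM('a) / 2 + 2" and u: "u \<in> Hs \<Omega> s" and v: "v \<in> Hs \<Omega> s"
  shows "Hs_norm \<Omega> s (\<lambda>x. u x - v x) = Hs_norm \<Omega> s (\<lambda>x. v x - u x)"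
proof -
  have "Hs_norm \<Omega> s (\<lambda>x. a x - b x) \<le> Hs_norm \<Omega> s (\<lambda>x. b x - a x)" if ab: "a \<in> Hs \<Omega> s" "b \<in> Hs \<Omega> s" for a b
  proof -
    have "(\<lambda>x. b x - a x) \<in> Hs \<Omega> s" using Hs_diff[OF s] ab by blast
    then obtain G where G: "\<And>n. G n \<in> Hs_extensions \<Omega> s (\<lambda>x. b x - a x)"
        "(\<lambda>n. fourier_Hs_norm s (G n)) \<longlonglongrightarrow> Hs_norm \<Omega> s (\<lambda>x. b x - a x)"
      using Hs_norm_approx by blast
    have "Hs_norm \<Omega> s (\<lambda>x. a x - b x) \<le> fourier_Hs_norm s (G n)" for n
    proof -
      have "(\<lambda>\<xi>. (-1) * G n \<xi> + 0 * G n \<xi>) \<in> Hs_extensions \<Omega> s (\<lambda>x. a x - b x)"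
        by (rule Hs_extensions_linear[OF s G(1) G(1)]) simp
      from Hs_norm_le[OF this] show ?thesis by (simp add: fourier_Hs_norm_def)
    qed
    then show ?thesis by (intro LIMSEQ_le_const[OF G(2)]) blast
  qed
  then show ?thesis using u v by (intro antisym) auto
qed

section \<open>The integrated Carleman estimate\<close>

lemma lebesgue_on_integral_borel:
  fixes f :: "'a::euclidean_space \<Rightarrow> real"
  assumes "\<Omega> \<in> sets borel" "(\<lambda>x. indicator \<Omega> x * f x) \<in> borel_measurable borel"
  shows "(LINT x|lebesgue_on \<Omega>. f x) = (LINT x|lborel. indicator \<Omega> x * f x)"
    "integrable (lebesgue_on \<Omega>) f \<longleftrightarrow> integrable lborel (\<lambda>x. indicator \<Omega> x * f x)"
  using assms by (simp_all add: integral_restrict_space integrable_restrict_space integral_completion integrable_completion)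

context
  fixes \<Omega> :: "'a::euclidean_space set"
  assumes \<Omega>: "bounded_smooth_domain \<Omega>"
begin

lemma \<Omega>_leb: "\<Omega> \<in> sets lebesgue" "\<Omega> \<inter> space lebesgue \<in> sets lebesgue"
  using bounded_smooth_domainD(4)[OF \<Omega>] by auto

lemma finite_measure_lebesgue_on: "finite_measure (lebesgue_on \<Omega>)"
proof
  have "emeasure lebesgue \<Omega> = emeasure lborel \<Omega>" using bounded_smooth_domainD(4)[OF \<Omega>] by simp
  also have "\<dots> < \<infinity>" by (rule emeasure_bounded_finite[OF bounded_smooth_domainD(2)[OF \<Omega>]])
  finally show "emeasure (lebesgue_on \<Omega>) (space (lebesgue_on \<Omega>)) \<noteq> \<infinity>"
    using \<Omega>_leb by (simp add: emeasure_restrict_space)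
qed

lemma integrable_lebesgue_on_continuous:
  fixes f F :: "'a \<Rightarrow> 'b::euclidean_space"
  assumes F: "continuous_on (closure \<Omega>) F" and fF: "\<And>x. x \<in> \<Omega> \<Longrightarrow> f x = F x"
  shows "f \<in> borel_measurable (lebesgue_on \<Omega>)" "\<exists>B. \<forall>x\<in>\<Omega>. norm (f x) \<le> B" "integrable (lebesgue_on \<Omega>) f"
proof -
  interpret finite_measure "lebesgue_on \<Omega>" by (rule finite_measure_lebesgue_on)
  have "F \<in> borel_measurable (lebesgue_on \<Omega>)"
    by (intro continuous_imp_measurable_on_sets_lebesgue \<Omega>_leb continuous_on_subset[OF F closure_subset])
  then show m: "f \<in> borel_measurable (lebesgue_on \<Omega>)"
    by (subst measurable_cong[where g = F]) (auto simp: fF)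
  have "compact (F ` closure \<Omega>)" by (intro compact_continuous_image F bounded_smooth_domainD(5) \<Omega>)
  then obtain B where B: "\<And>x. x \<in> closure \<Omega> \<Longrightarrow> norm (F x) \<le> B" using compact_imp_bounded by (metis bounded_iff imageI)
  then have fB: "norm (f x) \<le> B" if "x \<in> \<Omega>" for x using fF[OF that] that closure_subset[of \<Omega>] by auto
  then show "\<exists>B. \<forall>x\<in>\<Omega>. norm (f x) \<le> B" by blast
  show "integrable (lebesgue_on \<Omega>) f"
    by (rule integrable_const_bound[of _ B]) (use m fB in \<open>auto intro!: AE_I2\<close>)
qed

section \<open>Bounds for the distance and the weight\<close>

context
  fixes x0 :: 'a and \<beta> :: real
  assumes x0: "x0 \<notin> closure \<Omega>"
begin

definition "rmax = (SUP x\<in>closure \<Omega>. dist x x0)"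

lemma dist_bounds:
  assumes "x \<in> closure \<Omega>"
  shows "0 < dist x x0" "dist x x0 \<le> rmax"
proof -
  show "0 < dist x x0" using assms x0 by auto
  have "bdd_above ((\<lambda>x. dist x x0) ` closure \<Omega>)"
    by (intro compact_imp_bounded[THEN bounded_imp_bdd_above] compact_continuous_image continuous_intros bounded_smooth_domainD(5) \<Omega>)
  then show "dist x x0 \<le> rmax" unfolding rmax_def using assms by (intro cSUP_upper)
qed

lemma rmax_pos: "rmax > 0"
proof -
  obtain x where "x \<in> \<Omega>" using bounded_smooth_domainD(3)[OF \<Omega>] by auto
  then have "x \<in> closure \<Omega>" using closure_subset by blast
  from dist_bounds[OF this] show ?thesis by linarith
qed

lemma dist_powr_continuous: "continuous_on (closure \<Omega>) (\<lambda>x. dist x x0 powr a)"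
  by (intro continuous_intros) (use x0 in auto)

lemma carleman_weight_continuous: "continuous_on (closure \<Omega>) (carleman_weight x0 \<beta> lam)"
  unfolding carleman_weight_def[abs_def] by (intro continuous_intros dist_powr_continuous)

lemma carleman_weight_pos: "carleman_weight x0 \<beta> lam x > 0"
  by (simp add: carleman_weight_def)

text \<open>The pointwise estimate is integrated. The gradient term is nonnegative and dropped, the
  powers of the distance are replaced by those of its maximum, and the divergence integral is
  bounded below through a bound for \<open>U\<close>. On the boundary \<open>u = 0\<close> reduces
  that bound to the normal derivative.\<close>

lemma carleman_integrated:
  fixes s :: real
  assumes s: "s > real DIM('a) / 2 + 2" and \<beta>: "\<beta>0 > 0" "carleman_estimate \<Omega> x0 \<beta>0" "\<beta> \<ge> \<beta>0"
  shows "\<exists>K>0. \<forall>lam\<ge>max 1 (carleman_lambda0 \<Omega> x0 \<beta>). \<forall>u\<in>Hs \<Omega> s. (\<forall>x\<in>frontier \<Omega>. u x = 0) \<longrightarrow>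
    lam ^ 3 * (LINT x|lebesgue_on \<Omega>. carleman_weight x0 \<beta> lam x * (cmod (u x))\<^sup>2) \<le>
    K * ((LINT x|lebesgue_on \<Omega>. carleman_weight x0 \<beta> lam x * (cmod (laplacian u x))\<^sup>2) +
      lam ^ 3 * (LINT x|surface_measure \<Omega>. carleman_weight x0 \<beta> lam x * (cmod (normal_deriv \<Omega> u x))\<^sup>2))"
proof -
  have \<beta>pos: "\<beta> > 0" using \<beta> by linarith
  obtain C where C: "C > 0" and CE: "\<And>lam u. lam \<ge> carleman_lambda0 \<Omega> x0 \<beta> \<Longrightarrow> Ck_closure 2 \<Omega> (u :: 'a \<Rightarrow> complex) \<Longrightarrow>
       (\<exists>U :: 'a \<Rightarrow> 'a. Ck_closure 1 \<Omega> U \<and>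
         (\<forall>x\<in>\<Omega>.
            dist x x0 powr (\<beta> + 2) * carleman_weight x0 \<beta> lam x * (cmod (laplacian u x))\<^sup>2
            \<ge> C * (divergence U x
                 + lam ^ 3 * \<beta> ^ 4 * carleman_weight x0 \<beta> lam x *
                     dist x x0 powr (- 2 * \<beta> - 2) * (cmod (u x))\<^sup>2
                 + lam * \<beta> * carleman_weight x0 \<beta> lam x * grad_norm_sq u x)) \<and>
         (\<forall>x\<in>\<Omega>.
            norm (U x) \<le> C * carleman_weight x0 \<beta> lam x *
              (lam ^ 3 * \<beta> ^ 3 * dist x x0 powr (- 2 * \<beta> - 2) * (cmod (u x))\<^sup>2
               + lam * \<beta> * grad_norm_sq u x)))"
    using \<beta>(2,3) unfolding carleman_estimate_def by blast
  obtain Kd where Kd: "Kd > 0" and div: "\<And>U G. Ck_closure 1 \<Omega> U \<Longrightarrow> continuous_on (closure \<Omega>) G \<Longrightarrow> (\<forall>x\<in>\<Omega>. norm (U x) \<le> G x) \<Longrightarrow>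
     integrable lborel (\<lambda>x. indicator \<Omega> x * divergence U x) \<and>
     (LINT x|lborel. indicator \<Omega> x * divergence U x) \<ge> - Kd * (LINT x|surface_measure \<Omega>. G x)"
    using divergence_integral_ge[OF \<Omega>] by blast
  define c1 where "c1 = \<beta> ^ 4 * rmax powr (- 2 * \<beta> - 2)"
  define c2 where "c2 = rmax powr (\<beta> + 2)"
  have c12: "c1 > 0" "c2 > 0" using \<beta>pos rmax_pos by (simp_all add: c1_def c2_def)
  \<comment> \<open>\<open>C * Kd * (C * \<beta>)\<close> is the flux constant: one \<open>C\<close>
    multiplies the divergence, the other comes with \<open>\<beta>\<close> from the bound on
    \<open>U\<close>. The denominator is the coefficient of the \<open>lam ^ 3\<close> term on the
    left.\<close>
  define K where "K = (c2 + C * Kd * (C * \<beta>)) / (C * c1)"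
  have K: "K > 0" using C Kd c12 \<beta>pos by (simp add: K_def add_pos_pos)
  have op: "open \<Omega>" and \<Omega>b: "\<Omega> \<in> sets borel" using bounded_smooth_domainD[OF \<Omega>] by auto
  have sub: "x \<in> \<Omega> \<Longrightarrow> x \<in> closure \<Omega>" for x using closure_subset by blast
  have Scl: "x \<in> frontier \<Omega> \<Longrightarrow> x \<in> closure \<Omega>" for x by (simp add: frontier_def)
  show ?thesis
  proof (rule exI[of _ K], intro conjI K allI ballI impI)
    fix lam u assume lam: "lam \<ge> max 1 (carleman_lambda0 \<Omega> x0 \<beta>)" and u: "u \<in> Hs \<Omega> s" and u0: "\<forall>x\<in>frontier \<Omega>. u x = 0"
    let ?w = "carleman_weight x0 \<beta> lam"
    have lam1: "lam \<ge> 1" and lam0: "lam \<ge> carleman_lambda0 \<Omega> x0 \<beta>" using lam by auto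
    note wp = carleman_weight_pos[of lam]
    obtain V where V: "C2_function V" "\<And>x. x \<in> closure \<Omega> \<Longrightarrow> u x = V x" using Hs_extension_C2[OF s u] by blast
    have Ck: "Ck_closure 2 \<Omega> u" by (rule Ck_closure_C2_function[OF V(1) op V(2)])
    obtain U where U: "Ck_closure 1 \<Omega> U"
      and lower: "\<And>x. x \<in> \<Omega> \<Longrightarrow> dist x x0 powr (\<beta> + 2) * ?w x * (cmod (laplacian u x))\<^sup>2
            \<ge> C * (divergence U x + lam ^ 3 * \<beta> ^ 4 * ?w x * dist x x0 powr (- 2 * \<beta> - 2) * (cmod (u x))\<^sup>2
                 + lam * \<beta> * ?w x * grad_norm_sq u x)"
      and upper: "\<And>x. x \<in> \<Omega> \<Longrightarrow> norm (U x) \<le> C * ?w x *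
              (lam ^ 3 * \<beta> ^ 3 * dist x x0 powr (- 2 * \<beta> - 2) * (cmod (u x))\<^sup>2 + lam * \<beta> * grad_norm_sq u x)"
      using CE[OF lam0 Ck] by blast
    define gr where "gr x = (\<Sum>j\<in>Basis. (cmod (partial_deriv j V x))\<^sup>2)" for x
    have gr: "grad_norm_sq u x = gr x" if "x \<in> \<Omega>" for x
      unfolding grad_norm_sq_def gr_def
    proof (rule sum.cong[OF refl])
      fix j :: 'a
      have "partial_deriv j u x = partial_deriv j V x" by (rule partial_deriv_cong_open[OF op that]) (simp add: V(2) sub)
      then show "(cmod (partial_deriv j u x))\<^sup>2 = (cmod (partial_deriv j V x))\<^sup>2" by simp
    qed
    have grc: "continuous_on A gr" for A unfolding gr_def[abs_def] by (intro continuous_intros C2_functionD[OF V(1)])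
    \<comment> \<open>Written with the global extension \<open>V\<close>, hence continuous up to the
      boundary, where derivatives of \<open>u\<close> would see the cutoff to 0.\<close>
    define G where "G x = C * ?w x * (lam ^ 3 * \<beta> ^ 3 * dist x x0 powr (- 2 * \<beta> - 2) * (cmod (V x))\<^sup>2 + lam * \<beta> * gr x)" for x
    have Gc: "continuous_on (closure \<Omega>) G" unfolding G_def[abs_def]
      by (intro continuous_intros carleman_weight_continuous dist_powr_continuous grc C2_functionD[OF V(1)])
    have UG: "\<forall>x\<in>\<Omega>. norm (U x) \<le> G x" using upper V(2) gr sub by (simp add: G_def)
    have GS: "G x = C * \<beta> * lam * (?w x * (cmod (normal_deriv \<Omega> u x))\<^sup>2)" if x: "x \<in> frontier \<Omega>" for x
    proof -
      have "V x = 0" using V(2)[OF Scl[OF x]] u0 x by simp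
      moreover have "gr x = (cmod (normal_deriv \<Omega> u x))\<^sup>2"
      proof -
        let ?V' = "\<lambda>v. \<Sum>j\<in>Basis. (v \<bullet> j) *\<^sub>R partial_deriv j V x"
        note hd = C2_function_has_derivative[OF V(1), of x]
        have "(\<Sum>i\<in>Basis. (cmod (?V' i))\<^sup>2) = (cmod (?V' (outward_normal \<Omega> x)))\<^sup>2"
          by (rule boundary_gradient_eq_normal_deriv[OF \<Omega> x hd]) (metis V(2) Scl u0)
        moreover have "?V' i = partial_deriv i V x" for i using partial_deriv_eq[OF hd, of i] by simp
        moreover have "normal_deriv \<Omega> u x = ?V' (outward_normal \<Omega> x)" by (rule normal_deriv_C2[OF \<Omega> x V])
        ultimately show ?thesis by (simp only: gr_def)
      qed
      ultimately show ?thesis by (simp add: G_def mult_ac)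
    qed
    define I0 where "I0 = (LINT x|lebesgue_on \<Omega>. ?w x * (cmod (u x))\<^sup>2)"
    define I2 where "I2 = (LINT x|lebesgue_on \<Omega>. ?w x * (cmod (laplacian u x))\<^sup>2)"
    define B where "B = (LINT x|surface_measure \<Omega>. ?w x * (cmod (normal_deriv \<Omega> u x))\<^sup>2)"
    have "(LINT x|surface_measure \<Omega>. G x) = (LINT x|surface_measure \<Omega>. C * \<beta> * lam * (?w x * (cmod (normal_deriv \<Omega> u x))\<^sup>2))"
      by (intro Bochner_Integration.integral_cong refl GS) simp
    then have GB: "(LINT x|surface_measure \<Omega>. G x) = C * \<beta> * lam * B" by (simp add: B_def)
    have B0: "B \<ge> 0" unfolding B_def by (intro integral_nonneg_AE AE_I2) (simp add: wp less_imp_le)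
    have I20: "I2 \<ge> 0" unfolding I2_def by (intro integral_nonneg_AE AE_I2) (simp add: wp less_imp_le)
    note D = div[OF U Gc UG, unfolded GB]
    have dm: "(\<lambda>x. indicator \<Omega> x * divergence U x) \<in> borel_measurable borel"
      using borel_measurable_integrable[OF conjunct1[OF D]] by simp
    have divi: "integrable (lebesgue_on \<Omega>) (divergence U)" and divI: "(LINT x|lebesgue_on \<Omega>. divergence U x) \<ge> - Kd * (C * \<beta> * lam * B)"
      using D lebesgue_on_integral_borel[OF \<Omega>b dm] by simp_all
    obtain F where F: "continuous_on (closure \<Omega>) F" "\<And>x. x \<in> \<Omega> \<Longrightarrow> laplacian u x = F x"
      using Hs_laplacian_continuous_extension[OF \<Omega> s u] by blast
    have i2: "integrable (lebesgue_on \<Omega>) (\<lambda>x. ?w x * (cmod (laplacian u x))\<^sup>2)"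
      by (rule integrable_lebesgue_on_continuous(3)[where F = "\<lambda>x. ?w x * (cmod (F x))\<^sup>2"])
        (auto simp: F(2) intro!: continuous_intros carleman_weight_continuous F(1))
    have i0: "integrable (lebesgue_on \<Omega>) (\<lambda>x. ?w x * (cmod (u x))\<^sup>2)"
      by (rule integrable_lebesgue_on_continuous(3)[where F = "\<lambda>x. ?w x * (cmod (u x))\<^sup>2"])
        (auto intro!: continuous_intros carleman_weight_continuous Hs_continuous_on[OF \<Omega> s u])
    have pw: "C * divergence U x + C * c1 * lam ^ 3 * (?w x * (cmod (u x))\<^sup>2) \<le> c2 * (?w x * (cmod (laplacian u x))\<^sup>2)" if x: "x \<in> \<Omega>" for x
    proof -
      note d = dist_bounds[OF sub[OF x]]
      have w0: "0 \<le> ?w x * (cmod (u x))\<^sup>2" "0 \<le> ?w x * (cmod (laplacian u x))\<^sup>2" using wp[of x] by simp_all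
      have "dist x x0 powr (\<beta> + 2) \<le> c2" unfolding c2_def using d \<beta>pos by (intro powr_mono2) auto
      then have 1: "dist x x0 powr (\<beta> + 2) * (?w x * (cmod (laplacian u x))\<^sup>2) \<le> c2 * (?w x * (cmod (laplacian u x))\<^sup>2)"
        using w0 by (intro mult_right_mono)
      have "rmax powr (- 2 * \<beta> - 2) \<le> dist x x0 powr (- 2 * \<beta> - 2)" using d \<beta>pos by (intro powr_mono2') auto
      then have "c1 \<le> \<beta> ^ 4 * dist x x0 powr (- 2 * \<beta> - 2)" unfolding c1_def using \<beta>pos by (intro mult_left_mono) auto
      then have "c1 * (lam ^ 3 * (?w x * (cmod (u x))\<^sup>2)) \<le> \<beta> ^ 4 * dist x x0 powr (- 2 * \<beta> - 2) * (lam ^ 3 * (?w x * (cmod (u x))\<^sup>2))"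
        using w0 lam1 by (intro mult_right_mono) auto
      moreover have "0 \<le> lam * \<beta> * ?w x * grad_norm_sq u x"
        using lam1 \<beta>pos wp[of x] by (auto simp: grad_norm_sq_def intro!: mult_nonneg_nonneg sum_nonneg)
      ultimately have "divergence U x + c1 * (lam ^ 3 * (?w x * (cmod (u x))\<^sup>2)) \<le>
          divergence U x + lam ^ 3 * \<beta> ^ 4 * ?w x * dist x x0 powr (- 2 * \<beta> - 2) * (cmod (u x))\<^sup>2 + lam * \<beta> * ?w x * grad_norm_sq u x"
        by (simp add: mult_ac)
      then have "C * (divergence U x + c1 * (lam ^ 3 * (?w x * (cmod (u x))\<^sup>2))) \<le>
          C * (divergence U x + lam ^ 3 * \<beta> ^ 4 * ?w x * dist x x0 powr (- 2 * \<beta> - 2) * (cmod (u x))\<^sup>2 + lam * \<beta> * ?w x * grad_norm_sq u x)"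
        using C by (intro mult_left_mono) auto
      with 1 lower[OF x] show ?thesis by (simp add: distrib_left mult.assoc)
    qed
    have "(LINT x|lebesgue_on \<Omega>. C * divergence U x + C * c1 * lam ^ 3 * (?w x * (cmod (u x))\<^sup>2)) \<le>
        (LINT x|lebesgue_on \<Omega>. c2 * (?w x * (cmod (laplacian u x))\<^sup>2))"
      by (intro Bochner_Integration.integral_mono Bochner_Integration.integrable_add integrable_mult_right divi i0 i2 pw) simp
    then have "C * (LINT x|lebesgue_on \<Omega>. divergence U x) + C * c1 * lam ^ 3 * I0 \<le> c2 * I2"
      using divi i0 i2 by (simp add: I0_def I2_def)
    moreover have "C * (- Kd * (C * \<beta> * lam * B)) \<le> C * (LINT x|lebesgue_on \<Omega>. divergence U x)"
      using divI C by (intro mult_left_mono) auto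
    \<comment> \<open>The flux grows only like \<open>lam\<close>; \<open>lam \<ge> 1\<close> raises
      it to the power used in the functional.\<close>
    moreover have "C * Kd * (C * \<beta>) * (lam * B) \<le> C * Kd * (C * \<beta>) * (lam ^ 3 * B)"
    proof -
      have "lam ^ 1 \<le> lam ^ 3" using lam1 by (intro power_increasing) auto
      then have "lam * B \<le> lam ^ 3 * B" using B0 by (intro mult_right_mono) auto
      then show ?thesis using C Kd \<beta>pos by (intro mult_left_mono) auto
    qed
    ultimately have "C * c1 * (lam ^ 3 * I0) \<le> c2 * I2 + C * Kd * (C * \<beta>) * (lam ^ 3 * B)"
      by (simp add: mult_ac)
    also have "\<dots> \<le> (c2 + C * Kd * (C * \<beta>)) * (I2 + lam ^ 3 * B)"
      using c12 C Kd \<beta>pos I20 B0 lam1 by (simp add: algebra_simps add_nonneg_nonneg)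
    finally have "lam ^ 3 * I0 \<le> K * (I2 + lam ^ 3 * B)"
      unfolding K_def using C c12 by (simp add: pos_le_divide_eq mult.commute)
    then show "lam ^ 3 * (LINT x|lebesgue_on \<Omega>. ?w x * (cmod (u x))\<^sup>2) \<le>
      K * ((LINT x|lebesgue_on \<Omega>. ?w x * (cmod (laplacian u x))\<^sup>2) +
        lam ^ 3 * (LINT x|surface_measure \<Omega>. ?w x * (cmod (normal_deriv \<Omega> u x))\<^sup>2))"
      by (simp only: I0_def I2_def B_def)
  qed
qed

end

end

section \<open>The nonlinear term\<close>

text \<open>\<open>legendre\<close> iterates \<open>deriv\<close> by Rodrigues' formula; identifying
  the result with a formal derivative gives continuity of \<open>Psi\<close> and hence its
  boundedness on the time interval.\<close>

lemma legendre_eq_poly: "\<exists>P. legendre n = poly P"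
proof -
  have d: "(deriv ^^ k) (poly P) = poly ((pderiv ^^ k) P)" for k and P :: "real poly"
  proof (induction k)
    case (Suc k)
    have "deriv (poly Q) = poly (pderiv Q)" for Q :: "real poly"
      by (intro ext DERIV_imp_deriv poly_DERIV)
    then show ?case using Suc by simp
  qed simp
  have "(\<lambda>y::real. (y\<^sup>2 - 1) ^ n) = poly (([:-1, 0, 1:]) ^ n)"
    by (rule ext) (simp add: poly_power power2_eq_square algebra_simps)
  then have "legendre n = poly (smult (1 / (2 ^ n * fact n)) ((pderiv ^^ n) ([:-1, 0, 1:] ^ n)))"
    by (intro ext) (simp add: legendre_def d)
  then show ?thesis by blast
qed

lemma continuous_on_Psi: "continuous_on A (Psi T n)"
proof -
  obtain P where P: "legendre n = poly P" using legendre_eq_poly by blast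
  have "Psi T n = (\<lambda>t. exp t * (sqrt ((2 * real n + 1) / T) * poly P ((2 / T) * t - 1)))"
    by (rule ext) (simp add: Psi_def Q_basis_def P)
  then show ?thesis by (simp only:) (intro continuous_intros)
qed

lemma Psi_bounded: "\<exists>K\<ge>1. \<forall>l\<le>N. \<forall>t\<in>{0..T}. \<bar>Psi T l t\<bar> \<le> K"
proof -
  have "\<exists>B. \<forall>t\<in>{0..T}. \<bar>Psi T l t\<bar> \<le> B" for l
    using compact_imp_bounded[OF compact_continuous_image[OF continuous_on_Psi compact_Icc]] by (auto simp: bounded_iff)
  then obtain B where B: "\<And>l t. t \<in> {0..T} \<Longrightarrow> \<bar>Psi T l t\<bar> \<le> B l" by metis
  show ?thesis
  proof (intro exI[of _ "1 + (\<Sum>l\<le>N. \<bar>B l\<bar>)"] conjI allI impI ballI)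
    fix l t assume l: "l \<le> N" and t: "t \<in> {0..T}"
    have "\<bar>B l\<bar> \<le> (\<Sum>l\<le>N. \<bar>B l\<bar>)" using l by (intro member_le_sum) auto
    with B[OF t, of l] show "\<bar>Psi T l t\<bar> \<le> 1 + (\<Sum>l\<le>N. \<bar>B l\<bar>)" by linarith
  qed (simp add: sum_nonneg)
qed

text \<open>The map |z|^(p-1) z. Summing the coefficients against the components reassembles it, so
  Lipschitz continuity is needed only for this product and not for the power \<open>p - 1\<close>
  alone, which fails to be Lipschitz at 0 for \<open>p < 2\<close>.\<close>

definition power_nl :: "real \<Rightarrow> complex \<Rightarrow> complex" where
  "power_nl p z = of_real (cmod z powr (p - 1)) * z"

text \<open>The factor \<open>b\<close> tames the derivative of the power, singular at 0 for
  \<open>q < 1\<close>: with an intermediate point \<open>c > b\<close> one has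
  \<open>c powr (q - 1) * b \<le> c powr q\<close>.\<close>

lemma powr_diff_mult_le:
  fixes a b q :: real
  assumes "q > 0" "0 \<le> b" "b \<le> a"
  shows "(a powr q - b powr q) * b \<le> q * a powr q * (a - b)"
proof (cases "b = 0 \<or> a = b")
  case False
  then have b: "0 < b" "b < a" using assms by auto
  have "\<exists>c>b. c < a \<and> a powr q - b powr q = (a - b) * (q * c powr (q - 1))"
    using b by (intro MVT2) (auto intro!: derivative_eq_intros simp: powr_diff)
  then obtain c where c: "b < c" "c < a" "a powr q - b powr q = (a - b) * (q * c powr (q - 1))" by blast
  have "c powr (q - 1) * b \<le> c powr (q - 1) * c" using c by (intro mult_left_mono) auto
  also have "\<dots> = c powr q" using c b by (simp add: powr_diff)
  also have "\<dots> \<le> a powr q" using c b assms by (intro powr_mono2) auto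
  finally have "(a - b) * q * (c powr (q - 1) * b) \<le> (a - b) * q * a powr q"
    using assms b by (intro mult_left_mono) auto
  then show ?thesis using c(3) by (simp add: mult_ac)
qed (use assms in auto)

text \<open>By symmetry let \<open>cmod w \<le> cmod z\<close> and split off the larger power: the
  term with \<open>z - w\<close> contributes the coefficient 1, the difference of the powers
  contributes \<open>p - 1\<close>, together \<open>p\<close>.\<close>

lemma power_nl_lipschitz:
  assumes p: "p > 1" and R: "cmod z \<le> R" "cmod w \<le> R"
  shows "cmod (power_nl p z - power_nl p w) \<le> p * R powr (p - 1) * cmod (z - w)"
proof -
  have main: "cmod (power_nl p z - power_nl p w) \<le> p * R powr (p - 1) * cmod (z - w)"
    if R: "cmod z \<le> R" and wz: "cmod w \<le> cmod z" for z w
  proof -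
    let ?a = "cmod z" and ?b = "cmod w" and ?q = "p - 1"
    have q: "?q > 0" using p by simp
    have ba: "?b powr ?q \<le> ?a powr ?q" using q wz by (intro powr_mono2) auto
    have "power_nl p z - power_nl p w = of_real (?a powr ?q) * (z - w) + of_real (?a powr ?q - ?b powr ?q) * w"
      by (simp add: power_nl_def algebra_simps)
    then have "cmod (power_nl p z - power_nl p w) \<le> cmod (of_real (?a powr ?q) * (z - w)) + cmod (of_real (?a powr ?q - ?b powr ?q) * w)"
      by (metis norm_triangle_ineq)
    also have "\<dots> = ?a powr ?q * cmod (z - w) + (?a powr ?q - ?b powr ?q) * ?b"
      using ba by (simp only: norm_mult norm_of_real) simp
    also have "\<dots> \<le> ?a powr ?q * cmod (z - w) + ?q * ?a powr ?q * (?a - ?b)"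
      using powr_diff_mult_le[OF q _ wz] by simp
    also have "\<dots> \<le> ?a powr ?q * cmod (z - w) + ?q * ?a powr ?q * cmod (z - w)"
      using q by (intro add_left_mono mult_left_mono norm_triangle_ineq2) auto
    also have "\<dots> = (p * ?a powr ?q) * cmod (z - w)" by (simp add: algebra_simps)
    also have "\<dots> \<le> (p * R powr ?q) * cmod (z - w)"
      using p q R by (intro mult_right_mono mult_left_mono powr_mono2) auto
    finally show ?thesis .
  qed
  show ?thesis
  proof (cases "cmod w \<le> cmod z")
    case False
    then show ?thesis using main[OF R(2), of z] by (simp add: norm_minus_commute)
  qed (rule main[OF R(1)])
qed

lemma L2_set_coordinate_le: "finite A \<Longrightarrow> i \<in> A \<Longrightarrow> \<bar>f i\<bar> \<le> L2_set f A"
  using member_le_L2_set[of A i "\<lambda>i. \<bar>f i\<bar>"] by (simp add: L2_set_def)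

section \<open>The nonlinear term at a fixed point of the domain\<close>

lemma integrable_lborel_bounded_support:
  fixes f :: "'a::euclidean_space \<Rightarrow> 'b::{banach,second_countable_topology}"
  assumes "f \<in> borel_measurable borel" "A \<in> sets borel" "emeasure lborel A < \<infinity>"
    "\<And>t. t \<in> A \<Longrightarrow> norm (f t) \<le> c" "\<And>t. t \<notin> A \<Longrightarrow> f t = 0"
  shows "integrable lborel f"
  by (rule integrableI_bounded_set[where A = A and B = c]) (use assms in auto)

definition nl_comb :: "real \<Rightarrow> nat \<Rightarrow> (nat \<Rightarrow> complex) \<Rightarrow> real \<Rightarrow> complex" where
  "nl_comb T N z t = (\<Sum>l\<le>N. z l * of_real (Psi T l t))"

text \<open>\<open>T\<close> is the length of the time interval, \<open>Q * K\<close> bounds all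
  factors besides the nonlinearity, \<open>K * (real (N + 1) * M)\<close> bounds
  \<open>nl_comb\<close>, and the last \<open>K\<close> is the Lipschitz constant of
  \<open>nl_comb\<close> in the sum of the component moduli.\<close>

definition nl_const :: "real \<Rightarrow> real \<Rightarrow> nat \<Rightarrow> real \<Rightarrow> real \<Rightarrow> real \<Rightarrow> real" where
  "nl_const T p N M Q K = T * (Q * K * (p * (K * (real (N + 1) * M)) powr (p - 1) * K))"

text \<open>The coefficient \<open>h\<close> plays the role of \<open>q\<close> at a fixed point of the domain.\<close>

lemma nonlinear_term_lipschitz:
  fixes h :: "real \<Rightarrow> real" and z w :: "nat \<Rightarrow> complex"
  assumes T: "T > 0" and p: "p > 1" and m: "m \<le> N"
    and hm: "h \<in> borel_measurable lborel" and hQ: "\<And>t. \<bar>h t\<bar> \<le> Q"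
    and K: "K \<ge> 1" "\<And>l t. l \<le> N \<Longrightarrow> t \<in> {0..T} \<Longrightarrow> \<bar>Psi T l t\<bar> \<le> K"
    and z: "\<And>l. l \<le> N \<Longrightarrow> cmod (z l) \<le> M" and w: "\<And>l. l \<le> N \<Longrightarrow> cmod (w l) \<le> M"
  defines "B \<equiv> \<lambda>z. (\<Sum>n\<le>N. of_real (LINT t|lborel. indicator {0<..<T} t * (exp (- 2 * t) * h t *
        cmod (nl_comb T N z t) powr (p - 1) * Psi T n t * Psi T m t)) * z n)"
  shows "cmod (B z - B w) \<le> nl_const T p N M Q K * (\<Sum>l\<le>N. cmod (z l - w l))"
proof -
  let ?I = "indicator {0<..<T} :: real \<Rightarrow> real"
  let ?R = "K * (real (N + 1) * M)"
  have Q0: "Q \<ge> 0" using hQ[of 0] by linarith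
  have M0: "M \<ge> 0" using z[of 0] norm_ge_zero[of "z 0"] by linarith
  have Pm [measurable]: "Psi T l \<in> borel_measurable borel" for l
    by (intro borel_measurable_continuous_onI continuous_on_Psi)
  have hm' [measurable]: "h \<in> borel_measurable borel" using hm by simp
  have cm [measurable]: "nl_comb T N z \<in> borel_measurable borel" for z unfolding nl_comb_def[abs_def] by measurable
  have comb: "cmod (nl_comb T N v t) \<le> K * (\<Sum>l\<le>N. cmod (v l))" if "t \<in> {0..T}" for v t
  proof -
    have "cmod (nl_comb T N v t) \<le> (\<Sum>l\<le>N. cmod (v l * of_real (Psi T l t)))" unfolding nl_comb_def by (rule norm_sum)
    also have "\<dots> \<le> (\<Sum>l\<le>N. K * cmod (v l))"
    proof (rule sum_mono)
      fix l assume "l \<in> {..N}"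
      then have "cmod (v l) * \<bar>Psi T l t\<bar> \<le> cmod (v l) * K" using K(2) that by (intro mult_left_mono) auto
      then show "cmod (v l * of_real (Psi T l t)) \<le> K * cmod (v l)" by (simp add: norm_mult mult.commute)
    qed
    finally show ?thesis by (simp add: sum_distrib_left)
  qed
  have combR: "cmod (nl_comb T N v t) \<le> ?R" if v: "\<And>l. l \<le> N \<Longrightarrow> cmod (v l) \<le> M" and t: "t \<in> {0..T}" for v t
  proof -
    have "(\<Sum>l\<le>N. cmod (v l)) \<le> (\<Sum>l\<le>N. M)" using v by (intro sum_mono) auto
    then have "K * (\<Sum>l\<le>N. cmod (v l)) \<le> ?R" using K(1) by (intro mult_left_mono) auto
    with comb[OF t, of v] show ?thesis by linarith
  qed
  \<comment> \<open>All factors of the integrand that depend neither on the unknown nor on the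
    summation index.\<close>
  define k where "k t = ?I t * (exp (- 2 * t) * h t * Psi T m t)" for t
  have km [measurable]: "k \<in> borel_measurable borel" unfolding k_def[abs_def] by measurable
  have k0: "k t = 0" if "t \<notin> {0<..<T}" for t using that by (simp add: k_def)
  have kb: "\<bar>k t\<bar> \<le> Q * K" if t: "t \<in> {0<..<T}" for t
  proof -
    have "exp (- 2 * t) * \<bar>h t\<bar> * \<bar>Psi T m t\<bar> \<le> 1 * Q * K"
      using t hQ[of t] K(2)[OF m, of t] Q0 by (intro mult_mono) auto
    then show ?thesis using t by (simp add: k_def abs_mult)
  qed
  have real: "integrable lborel (\<lambda>t. ?I t * (exp (- 2 * t) * h t * cmod (nl_comb T N v t) powr (p - 1) * Psi T n t * Psi T m t))"
    if v: "\<And>l. l \<le> N \<Longrightarrow> cmod (v l) \<le> M" and n: "n \<le> N" for v n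
  proof (rule integrable_lborel_bounded_support[where A = "{0<..<T}" and c = "Q * K * (?R powr (p - 1) * K)"])
    show "(\<lambda>t. ?I t * (exp (- 2 * t) * h t * cmod (nl_comb T N v t) powr (p - 1) * Psi T n t * Psi T m t)) \<in> borel_measurable borel"
      by measurable
    fix t assume t: "t \<in> {0<..<T}"
    have "\<bar>k t\<bar> * (cmod (nl_comb T N v t) powr (p - 1) * \<bar>Psi T n t\<bar>) \<le> Q * K * (?R powr (p - 1) * K)"
      using kb[OF t] combR[where v = v and t = t, OF v] K(2)[OF n, of t] t p Q0 K(1) by (intro mult_mono powr_mono2) auto
    then show "norm (?I t * (exp (- 2 * t) * h t * cmod (nl_comb T N v t) powr (p - 1) * Psi T n t * Psi T m t)) \<le> Q * K * (?R powr (p - 1) * K)"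
      using t by (simp add: k_def abs_mult mult_ac)
  qed (use T in auto)
  \<comment> \<open>Interchanging sum and integral reassembles \<open>nl_comb\<close>, so that
    \<open>B v\<close> is a single time integral of \<open>power_nl\<close>.\<close>
  have Bv: "B v = (LINT t|lborel. of_real (k t) * power_nl p (nl_comb T N v t))"
    and iB: "integrable lborel (\<lambda>t. of_real (k t) * power_nl p (nl_comb T N v t))"
    if v: "\<And>l. l \<le> N \<Longrightarrow> cmod (v l) \<le> M" for v
  proof -
    let ?f = "\<lambda>n t. of_real (?I t * (exp (- 2 * t) * h t * cmod (nl_comb T N v t) powr (p - 1) * Psi T n t * Psi T m t)) * v n"
    have f: "integrable lborel (?f n)" if "n \<le> N" for n
      using real[OF v that] by (intro integrable_mult_left integrable_of_real)
    have sum: "(\<Sum>n\<le>N. ?f n t) = of_real (k t) * power_nl p (nl_comb T N v t)" for t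
    proof -
      have "?f n t = of_real (k t * cmod (nl_comb T N v t) powr (p - 1)) * (v n * of_real (Psi T n t))" for n
        by (simp add: k_def mult_ac)
      then have "(\<Sum>n\<le>N. ?f n t) = of_real (k t * cmod (nl_comb T N v t) powr (p - 1)) * nl_comb T N v t"
        unfolding nl_comb_def[of T N v t] by (simp only: sum_distrib_left)
      then show ?thesis by (simp add: power_nl_def)
    qed
    have "B v = (\<Sum>n\<le>N. LINT t|lborel. ?f n t)"
      unfolding B_def by (intro sum.cong refl) (use real[OF v] in \<open>simp del: of_real_mult\<close>)
    also have "\<dots> = (LINT t|lborel. (\<Sum>n\<le>N. ?f n t))"
      by (rule Bochner_Integration.integral_sum[symmetric]) (use f in auto)
    finally show "B v = (LINT t|lborel. of_real (k t) * power_nl p (nl_comb T N v t))" by (simp only: sum)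
    have "integrable lborel (\<lambda>t. \<Sum>n\<le>N. ?f n t)" by (intro Bochner_Integration.integrable_sum f) simp
    then show "integrable lborel (\<lambda>t. of_real (k t) * power_nl p (nl_comb T N v t))" by (simp only: sum)
  qed
  let ?S = "\<Sum>l\<le>N. cmod (z l - w l)"
  let ?c = "Q * K * (p * ?R powr (p - 1) * (K * ?S))"
  have "B z - B w = (LINT t|lborel. of_real (k t) * power_nl p (nl_comb T N z t) - of_real (k t) * power_nl p (nl_comb T N w t))"
  proof -
    have "B z = (LINT t|lborel. of_real (k t) * power_nl p (nl_comb T N z t))" by (rule Bv) (rule z)
    moreover have "B w = (LINT t|lborel. of_real (k t) * power_nl p (nl_comb T N w t))" by (rule Bv) (rule w)
    moreover have "integrable lborel (\<lambda>t. of_real (k t) * power_nl p (nl_comb T N z t))" by (rule iB) (rule z)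
    moreover have "integrable lborel (\<lambda>t. of_real (k t) * power_nl p (nl_comb T N w t))" by (rule iB) (rule w)
    ultimately show ?thesis by (simp only: Bochner_Integration.integral_diff)
  qed
  also have "cmod \<dots> \<le> (LINT t|lborel. cmod (of_real (k t) * power_nl p (nl_comb T N z t) - of_real (k t) * power_nl p (nl_comb T N w t)))"
    by (rule integral_norm_bound)
  also have "\<dots> \<le> (LINT t|lborel. ?I t * ?c)"
  proof (rule Bochner_Integration.integral_mono)
    show "integrable lborel (\<lambda>t. cmod (of_real (k t) * power_nl p (nl_comb T N z t) - of_real (k t) * power_nl p (nl_comb T N w t)))"
      by (intro integrable_norm Bochner_Integration.integrable_diff iB z w)
    show "integrable lborel (\<lambda>t. ?I t * ?c)" using T by (intro integrable_mult_left integrable_real_indicator) auto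
    fix t
    show "cmod (of_real (k t) * power_nl p (nl_comb T N z t) - of_real (k t) * power_nl p (nl_comb T N w t)) \<le> ?I t * ?c"
    proof (cases "t \<in> {0<..<T}")
      case True
      then have t: "t \<in> {0..T}" by auto
      have diff: "nl_comb T N z t - nl_comb T N w t = nl_comb T N (\<lambda>l. z l - w l) t"
        by (simp add: nl_comb_def sum_subtractf[symmetric] algebra_simps)
      have "cmod (power_nl p (nl_comb T N z t) - power_nl p (nl_comb T N w t)) \<le>
         p * ?R powr (p - 1) * cmod (nl_comb T N z t - nl_comb T N w t)"
        by (intro power_nl_lipschitz p combR z w t)
      also have "\<dots> \<le> p * ?R powr (p - 1) * (K * ?S)"
        unfolding diff using p by (intro mult_left_mono comb t) auto
      finally have 1: "cmod (power_nl p (nl_comb T N z t) - power_nl p (nl_comb T N w t)) \<le> p * ?R powr (p - 1) * (K * ?S)" .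
      have "cmod (of_real (k t) * power_nl p (nl_comb T N z t) - of_real (k t) * power_nl p (nl_comb T N w t)) =
         \<bar>k t\<bar> * cmod (power_nl p (nl_comb T N z t) - power_nl p (nl_comb T N w t))"
        by (simp only: right_diff_distrib[symmetric] norm_mult norm_of_real)
      also have "\<dots> \<le> (Q * K) * (p * ?R powr (p - 1) * (K * ?S))"
        using kb[OF True] 1 Q0 K(1) by (intro mult_mono) auto
      finally show ?thesis using True by simp
    qed (simp add: k0)
  qed
  also have "\<dots> = T * ?c" using T by simp
  also have "\<dots> = nl_const T p N M Q K * ?S" by (simp add: nl_const_def)
  finally show ?thesis .
qed

section \<open>Measurability in space and uniform bounds\<close>

definition nl_term ::
    "real \<Rightarrow> real \<Rightarrow> nat \<Rightarrow> ('a \<Rightarrow> real \<Rightarrow> real) \<Rightarrow> (nat \<Rightarrow> 'a \<Rightarrow> complex) \<Rightarrow> nat \<Rightarrow> 'a \<Rightarrow> complex" where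
  "nl_term T p N q \<phi> m x = (\<Sum>n\<le>N. of_real (b_coeff T p N q \<phi> x m n) * \<phi> n x)"

text \<open>\<open>q\<close> is jointly Lebesgue measurable, so an individual time slice need not be
  measurable. A Borel function agreeing with the slice almost everywhere makes the coefficient an
  ordinary Borel integral.\<close>

lemma b_coeff_cong_AE:
  fixes h :: "real \<Rightarrow> real"
  assumes h: "h \<in> borel_measurable borel" and ae: "AE t in lborel. t \<in> {0<..<T} \<longrightarrow> q x t = h t"
  shows "b_coeff T p N q \<phi> x m n = (LINT t|lborel. indicator {0<..<T} t * (exp (- 2 * t) * h t *
        cmod (nl_comb T N (\<lambda>l. \<phi> l x) t) powr (p - 1) * Psi T n t * Psi T m t))"
proof -
  let ?f = "\<lambda>h t. indicator {0<..<T} t * (exp (- 2 * t) * h t * cmod (nl_comb T N (\<lambda>l. \<phi> l x) t) powr (p - 1) * Psi T n t * Psi T m t)"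
  have [measurable]: "Psi T l \<in> borel_measurable borel" for l
    by (intro borel_measurable_continuous_onI continuous_on_Psi)
  have [measurable]: "nl_comb T N (\<lambda>l. \<phi> l x) \<in> borel_measurable borel" unfolding nl_comb_def[abs_def] by measurable
  have fm: "?f h \<in> borel_measurable lborel" using h by measurable
  have aef: "AE t in lebesgue. ?f h t = ?f (q x) t"
    unfolding AE_completion_iff using ae by eventually_elim (auto simp: indicator_def)
  have fm': "?f h \<in> borel_measurable lebesgue" using fm by (rule measurable_completion)
  have "b_coeff T p N q \<phi> x m n = (LINT t|lebesgue. ?f (q x) t)"
    by (simp add: b_coeff_def set_lebesgue_integral_def nl_comb_def)
  also have "\<dots> = (LINT t|lebesgue. ?f h t)"
    using borel_measurable_AE[OF fm' aef] fm' aef by (intro integral_cong_AE) (auto elim: eventually_mono)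
  also have "\<dots> = (LINT t|lborel. ?f h t)" by (rule integral_completion[OF fm])
  finally show ?thesis .
qed

text \<open>Fubini is applied to the null set where \<open>q\<close> and \<open>h\<close> differ.
  Truncation makes the bound on \<open>h\<close> hold everywhere, and \<open>\<bar>Q\<bar>\<close>
  keeps the truncation interval nonempty for either sign of \<open>Q\<close>.\<close>

lemma essentially_bounded_borel_representative:
  fixes q :: "'a::euclidean_space \<Rightarrow> real \<Rightarrow> real"
  assumes S: "S \<in> sets borel" and q: "(\<lambda>(x, t). q x t) \<in> borel_measurable (lebesgue_on S)"
    and b: "AE z in lebesgue_on S. \<bar>(case z of (x, t) \<Rightarrow> q x t)\<bar> \<le> Q"
  shows "\<exists>h. h \<in> borel_measurable borel \<and> (\<forall>z. \<bar>h z\<bar> \<le> \<bar>Q\<bar>) \<and>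
    (AE x in lborel. AE t in lborel. (x, t) \<in> S \<longrightarrow> q x t = h (x, t))"
proof -
  have Sl: "S \<inter> space lebesgue \<in> sets lebesgue" using S by simp
  let ?q = "\<lambda>z. indicator S z *\<^sub>R (case z of (x, t) \<Rightarrow> q x t)"
  have qm: "?q \<in> borel_measurable lebesgue"
    using q by (simp only: borel_measurable_restrict_space_iff[OF Sl])
  then obtain h0 where h0: "h0 \<in> borel_measurable lborel" "AE z in lborel. ?q z = h0 z"
    using completion_ex_borel_measurable_real by blast
  define h where "h z = max (- \<bar>Q\<bar>) (min \<bar>Q\<bar> (h0 z))" for z
  have hm: "h \<in> borel_measurable borel" using h0(1) unfolding h_def[abs_def] by measurable
  have hb: "\<bar>h z\<bar> \<le> \<bar>Q\<bar>" for z by (auto simp: h_def)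
  have "AE z in lebesgue. z \<in> S \<longrightarrow> \<bar>(case z of (x, t) \<Rightarrow> q x t)\<bar> \<le> Q"
    using b by (simp only: AE_restrict_space_iff[OF Sl])
  then have "AE z in lborel. z \<in> S \<longrightarrow> \<bar>(case z of (x, t) \<Rightarrow> q x t)\<bar> \<le> Q" by (simp only: AE_completion_iff)
  with h0(2) have "AE z in lborel. z \<in> S \<longrightarrow> (case z of (x, t) \<Rightarrow> q x t) = h z"
  proof eventually_elim
    case (elim z)
    then show ?case by (auto simp: h_def split: prod.splits)
  qed
  then have "AE z in lborel \<Otimes>\<^sub>M lborel. z \<in> S \<longrightarrow> (case z of (x, t) \<Rightarrow> q x t) = h z" by (simp only: lborel_prod)
  then have "AE x in lborel. AE t in lborel. (x, t) \<in> S \<longrightarrow> (case (x, t) of (x, t) \<Rightarrow> q x t) = h (x, t)"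
    by (rule lborel_pair.AE_pair)
  then show ?thesis using hm hb by auto
qed

text \<open>\<open>L\<close> is fixed before \<open>q\<close>, which enters only through its
  essential supremum \<open>Q\<close>; this uniformity becomes the claimed dependence of the
  constants.\<close>

lemma nonlinear_term_properties:
  fixes \<Omega> :: "'a::euclidean_space set"
  assumes T: "T > 0" and p: "p > 1" and \<Omega>: "\<Omega> \<in> sets borel"
  shows "\<exists>L>0. \<forall>q. (\<lambda>(x, t). q x t) \<in> borel_measurable (lebesgue_on (\<Omega> \<times> {0<..<T})) \<longrightarrow>
    esssup (lebesgue_on (\<Omega> \<times> {0<..<T})) (\<lambda>(x, t). ereal \<bar>q x t\<bar>) = ereal Q \<longrightarrow>
    (\<forall>\<phi> m. m \<le> N \<longrightarrow> (\<forall>n\<le>N. \<phi> n \<in> borel_measurable borel) \<longrightarrow> (\<forall>n\<le>N. \<forall>x\<in>\<Omega>. cmod (\<phi> n x) \<le> M) \<longrightarrow>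
       nl_term T p N q \<phi> m \<in> borel_measurable (lebesgue_on \<Omega>) \<and>
       (AE x in lebesgue_on \<Omega>. (cmod (nl_term T p N q \<phi> m x))\<^sup>2 \<le> L)) \<and>
    (\<forall>\<phi> \<psi> m. m \<le> N \<longrightarrow> (\<forall>n\<le>N. \<forall>x\<in>\<Omega>. cmod (\<phi> n x) \<le> M) \<longrightarrow> (\<forall>n\<le>N. \<forall>x\<in>\<Omega>. cmod (\<psi> n x) \<le> M) \<longrightarrow>
       (AE x in lebesgue_on \<Omega>. (cmod (nl_term T p N q \<phi> m x - nl_term T p N q \<psi> m x))\<^sup>2 \<le>
           L * (\<Sum>n\<le>N. (cmod (\<phi> n x - \<psi> n x))\<^sup>2)))"
proof -
  obtain K where K: "K \<ge> 1" "\<And>l t. l \<le> N \<Longrightarrow> t \<in> {0..T} \<Longrightarrow> \<bar>Psi T l t\<bar> \<le> K"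
    using Psi_bounded[of N T] by blast
  define c where "c = nl_const T p N M \<bar>Q\<bar> K"
  \<comment> \<open>\<open>real (N + 1)\<close> comes from Cauchy-Schwarz between a sum and the sum
    of squares; the factor with \<open>M\<close> covers the size bound, obtained by comparison with
    the zero vector; \<open>+ 1\<close> keeps \<open>L\<close> positive.\<close>
  define L where "L = c\<^sup>2 * real (N + 1) * (1 + real (N + 1) * M\<^sup>2) + 1"
  have L: "L > 0" unfolding L_def by (intro add_nonneg_pos mult_nonneg_nonneg) auto
  let ?S = "\<Omega> \<times> {0<..<T}"
  have \<Omega>l: "\<Omega> \<inter> space lebesgue \<in> sets lebesgue" using \<Omega> by simp
  show ?thesis
  proof (rule exI[of _ L], intro conjI L allI impI)
    fix q :: "'a \<Rightarrow> real \<Rightarrow> real"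
    assume qm: "(\<lambda>(x, t). q x t) \<in> borel_measurable (lebesgue_on ?S)"
      and qe: "esssup (lebesgue_on ?S) (\<lambda>(x, t). ereal \<bar>q x t\<bar>) = ereal Q"
    have "AE z in lebesgue_on ?S. (case z of (x, t) \<Rightarrow> ereal \<bar>q x t\<bar>) \<le> ereal Q"
      using esssup_AE[of "\<lambda>(x, t). ereal \<bar>q x t\<bar>" "lebesgue_on ?S"] by (simp only: qe)
    then have qb: "AE z in lebesgue_on ?S. \<bar>(case z of (x, t) \<Rightarrow> q x t)\<bar> \<le> Q"
      by eventually_elim (auto split: prod.splits)
    have Sb: "?S \<in> sets borel" using \<Omega> by (simp add: borel_Times)
    obtain h where h: "h \<in> borel_measurable borel" "\<And>z. \<bar>h z\<bar> \<le> \<bar>Q\<bar>"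
      and hq: "AE x in lborel. AE t in lborel. (x, t) \<in> ?S \<longrightarrow> q x t = h (x, t)"
      using essentially_bounded_borel_representative[OF Sb qm qb] by blast
    define B where "B \<phi> m x = (\<Sum>n\<le>N. of_real (LINT t|lborel. indicator {0<..<T} t * (exp (- 2 * t) * h (x, t) *
        cmod (nl_comb T N (\<lambda>l. \<phi> l x) t) powr (p - 1) * Psi T n t * Psi T m t)) * \<phi> n x)" for \<phi> m x
    have hx: "(\<lambda>t. h (x, t)) \<in> borel_measurable borel" for x
      by (rule measurable_compose[OF _ h(1)]) (simp add: borel_prod[symmetric])
    \<comment> \<open>The exceptional null set depends on \<open>q\<close> alone, so the quantifiers
      over \<open>\<phi>\<close> and \<open>m\<close> can stand inside.\<close>
    have rep: "AE x in lebesgue_on \<Omega>. \<forall>\<phi> m. nl_term T p N q \<phi> m x = B \<phi> m x"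
    proof -
      have "AE x in lborel. x \<in> \<Omega> \<longrightarrow> (\<forall>\<phi> m. nl_term T p N q \<phi> m x = B \<phi> m x)"
        using hq
      proof eventually_elim
        case (elim x)
        show ?case
        proof (intro impI allI)
          fix \<phi> m assume x: "x \<in> \<Omega>"
          have "AE t in lborel. t \<in> {0<..<T} \<longrightarrow> q x t = h (x, t)" using elim by eventually_elim (use x in auto)
          from b_coeff_cong_AE[where h = "\<lambda>t. h (x, t)" and q = q and x = x, OF hx this] show "nl_term T p N q \<phi> m x = B \<phi> m x"
            unfolding nl_term_def B_def by simp
        qed
      qed
      then have "AE x in lebesgue. x \<in> \<Omega> \<longrightarrow> (\<forall>\<phi> m. nl_term T p N q \<phi> m x = B \<phi> m x)" by (simp only: AE_completion_iff)
      then show ?thesis by (simp only: AE_restrict_space_iff[OF \<Omega>l])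
    qed
    have lip: "(cmod (B \<phi> m x - B \<psi> m x))\<^sup>2 \<le> c\<^sup>2 * real (N + 1) * (\<Sum>n\<le>N. (cmod (\<phi> n x - \<psi> n x))\<^sup>2)"
      if m: "m \<le> N" and \<phi>: "\<forall>n\<le>N. cmod (\<phi> n x) \<le> M" and \<psi>: "\<forall>n\<le>N. cmod (\<psi> n x) \<le> M" for \<phi> \<psi> :: "nat \<Rightarrow> 'a \<Rightarrow> complex" and m x
    proof -
      have hxl: "(\<lambda>t. h (x, t)) \<in> borel_measurable lborel" using hx by simp
      have "cmod (B \<phi> m x - B \<psi> m x) \<le> c * (\<Sum>l\<le>N. cmod (\<phi> l x - \<psi> l x))"
        unfolding B_def c_def
        by (rule nonlinear_term_lipschitz[OF T p m hxl h(2) K]) (use \<phi> \<psi> in auto)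
      then have "(cmod (B \<phi> m x - B \<psi> m x))\<^sup>2 \<le> (c * (\<Sum>l\<le>N. cmod (\<phi> l x - \<psi> l x)))\<^sup>2"
        by (intro power_mono) auto
      also have "\<dots> = c\<^sup>2 * (\<Sum>l\<le>N. cmod (\<phi> l x - \<psi> l x))\<^sup>2" by (rule power_mult_distrib)
      also have "\<dots> \<le> c\<^sup>2 * ((\<Sum>l\<le>N. (cmod (\<phi> l x - \<psi> l x))\<^sup>2) * card {..N})"
        by (intro mult_left_mono sum_squared_le_sum_of_squares) auto
      finally show ?thesis by (simp add: mult_ac)
    qed
    have cL: "c\<^sup>2 * real (N + 1) * 1 \<le> L"
    proof -
      have "c\<^sup>2 * real (N + 1) * 1 \<le> c\<^sup>2 * real (N + 1) * (1 + real (N + 1) * M\<^sup>2)"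
        by (intro mult_left_mono) auto
      then show ?thesis by (simp add: L_def)
    qed
    {
      fix \<phi> :: "nat \<Rightarrow> 'a \<Rightarrow> complex" and m
      assume m: "m \<le> N" and \<phi>m: "\<forall>n\<le>N. \<phi> n \<in> borel_measurable borel" and \<phi>: "\<forall>n\<le>N. \<forall>x\<in>\<Omega>. cmod (\<phi> n x) \<le> M"
      have Bm: "B \<phi> m \<in> borel_measurable borel"
      proof -
        have [measurable]: "Psi T l \<in> borel_measurable borel" for l
          by (intro borel_measurable_continuous_onI continuous_on_Psi)
        have \<phi>mm: "\<And>n. n \<in> {..N} \<Longrightarrow> \<phi> n \<in> borel_measurable borel" using \<phi>m by simp
        have cmb [measurable]: "(\<lambda>(x, t). nl_comb T N (\<lambda>l. \<phi> l x) t) \<in> borel_measurable (borel \<Otimes>\<^sub>M lborel)"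
          unfolding nl_comb_def split_beta'
          by (intro borel_measurable_sum borel_measurable_times measurable_compose[OF measurable_fst \<phi>mm]
            measurable_compose[OF measurable_snd]) (auto intro!: borel_measurable_of_real)
        have hh [measurable]: "(\<lambda>(x, t). h (x, t)) \<in> borel_measurable (borel \<Otimes>\<^sub>M lborel)"
        proof -
          have "sets (borel \<Otimes>\<^sub>M lborel) = sets (borel :: ('a \<times> real) measure)"
            by (metis borel_prod sets_lborel sets_pair_measure_cong)
          then show ?thesis using h(1) by (simp cong: measurable_cong_sets)
        qed
        have "(\<lambda>x. LINT t|lborel. indicator {0<..<T} t * (exp (- 2 * t) * h (x, t) *
           cmod (nl_comb T N (\<lambda>l. \<phi> l x) t) powr (p - 1) * Psi T n t * Psi T m t)) \<in> borel_measurable borel" for n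
        proof (rule lborel.borel_measurable_lebesgue_integral)
          have "(\<lambda>z. indicator {0<..<T} (snd z) * (exp (- 2 * snd z) * (case z of (x, t) \<Rightarrow> h (x, t)) *
            cmod (case z of (x, t) \<Rightarrow> nl_comb T N (\<lambda>l. \<phi> l x) t) powr (p - 1) * Psi T n (snd z) * Psi T m (snd z)))
            \<in> borel_measurable (borel \<Otimes>\<^sub>M lborel)" by measurable
          then show "(\<lambda>(x, t). indicator {0<..<T} t * (exp (- 2 * t) * h (x, t) *
            cmod (nl_comb T N (\<lambda>l. \<phi> l x) t) powr (p - 1) * Psi T n t * Psi T m t)) \<in> borel_measurable (borel \<Otimes>\<^sub>M lborel)"
            by (simp add: split_beta')
        qed
        note coeff = this
        have "(\<lambda>x. complex_of_real (LINT t|lborel. indicator {0<..<T} t * (exp (- 2 * t) * h (x, t) *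
           cmod (nl_comb T N (\<lambda>l. \<phi> l x) t) powr (p - 1) * Psi T n t * Psi T m t))) \<in> borel_measurable borel" for n
          by (rule measurable_compose[OF coeff borel_measurable_of_real])
        then show ?thesis unfolding B_def[abs_def]
          by (intro borel_measurable_sum borel_measurable_times \<phi>mm)
      qed
      have "(\<lambda>x. indicator \<Omega> x *\<^sub>R B \<phi> m x) \<in> borel_measurable lebesgue"
        using Bm \<Omega> by (intro measurable_completion) simp
      moreover have "AE x in lebesgue. indicator \<Omega> x *\<^sub>R B \<phi> m x = indicator \<Omega> x *\<^sub>R nl_term T p N q \<phi> m x"
        using rep unfolding AE_restrict_space_iff[OF \<Omega>l] by eventually_elim (auto simp: indicator_def)
      ultimately have "(\<lambda>x. indicator \<Omega> x *\<^sub>R nl_term T p N q \<phi> m x) \<in> borel_measurable lebesgue"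
        by (rule borel_measurable_AE)
      then show "nl_term T p N q \<phi> m \<in> borel_measurable (lebesgue_on \<Omega>)"
        by (simp only: borel_measurable_restrict_space_iff[OF \<Omega>l])
      have "AE x in lebesgue_on \<Omega>. x \<in> \<Omega>" by (rule AE_I2) simp
      with rep show "AE x in lebesgue_on \<Omega>. (cmod (nl_term T p N q \<phi> m x))\<^sup>2 \<le> L"
      proof eventually_elim
        case (elim x)
        have \<phi>x: "\<forall>n\<le>N. cmod (\<phi> n x) \<le> M" using \<phi> elim by blast
        have M0: "M \<ge> 0" using \<phi>x norm_ge_zero[of "\<phi> 0 x"] by (meson le0 order_trans)
        have "B (\<lambda>n x. 0) m x = 0" by (simp add: B_def)
        then have "(cmod (B \<phi> m x))\<^sup>2 \<le> c\<^sup>2 * real (N + 1) * (\<Sum>n\<le>N. (cmod (\<phi> n x))\<^sup>2)"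
          using lip[where \<phi> = \<phi> and x = x and \<psi> = "\<lambda>n x. 0", OF m \<phi>x] M0 by simp
        also have "\<dots> \<le> c\<^sup>2 * real (N + 1) * (\<Sum>n\<le>N. M\<^sup>2)"
          using \<phi>x by (intro mult_left_mono sum_mono power_mono) auto
        also have "\<dots> = c\<^sup>2 * real (N + 1) * (real (N + 1) * M\<^sup>2)" by simp
        also have "\<dots> \<le> c\<^sup>2 * real (N + 1) * (1 + real (N + 1) * M\<^sup>2)" by (intro mult_left_mono) auto
        also have "\<dots> \<le> L" by (simp add: L_def)
        finally show ?case using elim by simp
      qed
    next
      fix \<phi> \<psi> :: "nat \<Rightarrow> 'a \<Rightarrow> complex" and m
      assume m: "m \<le> N" and \<phi>: "\<forall>n\<le>N. \<forall>x\<in>\<Omega>. cmod (\<phi> n x) \<le> M" and \<psi>: "\<forall>n\<le>N. \<forall>x\<in>\<Omega>. cmod (\<psi> n x) \<le> M"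
      have "AE x in lebesgue_on \<Omega>. x \<in> \<Omega>" by (rule AE_I2) simp
      with rep show "AE x in lebesgue_on \<Omega>. (cmod (nl_term T p N q \<phi> m x - nl_term T p N q \<psi> m x))\<^sup>2 \<le>
           L * (\<Sum>n\<le>N. (cmod (\<phi> n x - \<psi> n x))\<^sup>2)"
      proof eventually_elim
        case (elim x)
        have "(cmod (B \<phi> m x - B \<psi> m x))\<^sup>2 \<le> c\<^sup>2 * real (N + 1) * (\<Sum>n\<le>N. (cmod (\<phi> n x - \<psi> n x))\<^sup>2)"
          by (rule lip[OF m]) (use \<phi> \<psi> elim in auto)
        also have "\<dots> \<le> L * (\<Sum>n\<le>N. (cmod (\<phi> n x - \<psi> n x))\<^sup>2)"
          using cL by (intro mult_right_mono sum_nonneg) auto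
        finally show ?case using elim by simp
      qed
    }
  qed
qed

section \<open>Weighted norms and strong convexity\<close>

text \<open>Kept general in the measure, as is \<open>wint\<close>, because the same calculus serves
  the Lebesgue measure on the domain and the surface measure.\<close>

definition wsq :: "'a measure \<Rightarrow> ('a \<Rightarrow> real) \<Rightarrow> ('a \<Rightarrow> complex) \<Rightarrow> bool" where
  "wsq M w f \<longleftrightarrow> f \<in> borel_measurable M \<and> integrable M (\<lambda>x. w x * (cmod (f x))\<^sup>2)"

definition wint :: "'a measure \<Rightarrow> ('a \<Rightarrow> real) \<Rightarrow> ('a \<Rightarrow> complex) \<Rightarrow> real" where
  "wint M w f = (LINT x|M. w x * (cmod (f x))\<^sup>2)"

lemma wint_nonneg: "(\<And>x. w x \<ge> 0) \<Longrightarrow> wint M w f \<ge> 0"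
  unfolding wint_def by (intro integral_nonneg_AE AE_I2) simp

lemma wint_cong: "(\<And>x. x \<in> space M \<Longrightarrow> cmod (f x) = cmod (g x)) \<Longrightarrow> wint M w f = wint M w g"
  unfolding wint_def by (intro Bochner_Integration.integral_cong) auto

context
  fixes M :: "'a measure" and w :: "'a \<Rightarrow> real"
  assumes w: "w \<in> borel_measurable M" "\<And>x. w x \<ge> 0"
begin

lemma wint_mono_AE:
  assumes "wsq M w f" "integrable M (\<lambda>x. w x * g x)" "AE x in M. (cmod (f x))\<^sup>2 \<le> g x"
  shows "wint M w f \<le> (LINT x|M. w x * g x)"
  unfolding wint_def
proof (rule integral_mono_AE)
  show "AE x in M. w x * (cmod (f x))\<^sup>2 \<le> w x * g x"
    using assms(3) by eventually_elim (intro mult_left_mono w)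
qed (use assms in \<open>auto simp: wsq_def\<close>)

lemma wsq_linear:
  assumes f: "wsq M w f" and g: "wsq M w g"
  shows "wsq M w (\<lambda>x. a * f x + b * g x)"
  unfolding wsq_def
proof
  have [measurable]: "f \<in> borel_measurable M" "g \<in> borel_measurable M" using f g by (auto simp: wsq_def)
  note w(1)[measurable]
  show "(\<lambda>x. a * f x + b * g x) \<in> borel_measurable M" by measurable
  show "integrable M (\<lambda>x. w x * (cmod (a * f x + b * g x))\<^sup>2)"
  proof (rule Bochner_Integration.integrable_bound)
    show "integrable M (\<lambda>x. 2 * (cmod a)\<^sup>2 * (w x * (cmod (f x))\<^sup>2) + 2 * (cmod b)\<^sup>2 * (w x * (cmod (g x))\<^sup>2))"
      using f g by (intro Bochner_Integration.integrable_add integrable_mult_right) (auto simp: wsq_def)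
    show "AE x in M. norm (w x * (cmod (a * f x + b * g x))\<^sup>2) \<le>
       norm (2 * (cmod a)\<^sup>2 * (w x * (cmod (f x))\<^sup>2) + 2 * (cmod b)\<^sup>2 * (w x * (cmod (g x))\<^sup>2))"
    proof (rule AE_I2)
      fix x
      have "w x * (cmod (a * f x + b * g x))\<^sup>2 \<le> w x * (2 * (cmod (a * f x))\<^sup>2 + 2 * (cmod (b * g x))\<^sup>2)"
        using cmod_add_sq_le[of 1 "a * f x" "b * g x"] w(2)[of x] by (intro mult_left_mono) auto
      also have "\<dots> = 2 * (cmod a)\<^sup>2 * (w x * (cmod (f x))\<^sup>2) + 2 * (cmod b)\<^sup>2 * (w x * (cmod (g x))\<^sup>2)"
        by (simp add: norm_mult power_mult_distrib algebra_simps)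
      finally show "norm (w x * (cmod (a * f x + b * g x))\<^sup>2) \<le>
         norm (2 * (cmod a)\<^sup>2 * (w x * (cmod (f x))\<^sup>2) + 2 * (cmod b)\<^sup>2 * (w x * (cmod (g x))\<^sup>2))"
        using w(2)[of x] by simp
    qed
  qed measurable
qed

lemma wsq_add: "wsq M w f \<Longrightarrow> wsq M w g \<Longrightarrow> wsq M w (\<lambda>x. f x + g x)"
  using wsq_linear[of f g 1 1] by simp

lemma wsq_diff: "wsq M w f \<Longrightarrow> wsq M w g \<Longrightarrow> wsq M w (\<lambda>x. f x - g x)"
  using wsq_linear[of f g 1 "-1"] by simp

lemma wint_convex:
  assumes f: "wsq M w f" and g: "wsq M w g"
  shows "wint M w (\<lambda>x. of_real (1 - \<theta>) * f x + of_real \<theta> * g x) =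
    (1 - \<theta>) * wint M w f + \<theta> * wint M w g - \<theta> * (1 - \<theta>) * wint M w (\<lambda>x. f x - g x)"
proof -
  have i: "integrable M (\<lambda>x. w x * (cmod (f x))\<^sup>2)" "integrable M (\<lambda>x. w x * (cmod (g x))\<^sup>2)"
    "integrable M (\<lambda>x. w x * (cmod (f x - g x))\<^sup>2)"
    using f g wsq_diff[OF f g] by (auto simp: wsq_def)
  have "wint M w (\<lambda>x. of_real (1 - \<theta>) * f x + of_real \<theta> * g x) =
    (LINT x|M. (1 - \<theta>) * (w x * (cmod (f x))\<^sup>2) + \<theta> * (w x * (cmod (g x))\<^sup>2) - \<theta> * (1 - \<theta>) * (w x * (cmod (f x - g x))\<^sup>2))"
    unfolding wint_def by (intro Bochner_Integration.integral_cong refl) (simp only: cmod_convex_combination, simp add: algebra_simps)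
  also have "\<dots> = (1 - \<theta>) * wint M w f + \<theta> * wint M w g - \<theta> * (1 - \<theta>) * wint M w (\<lambda>x. f x - g x)"
    unfolding wint_def
    by (simp only: Bochner_Integration.integral_diff Bochner_Integration.integral_add
      Bochner_Integration.integrable_add integrable_mult_right i integral_mult_right_zero)
  finally show ?thesis .
qed

lemma wint_add_le:
  assumes f: "wsq M w f" and g: "wsq M w g" and \<theta>: "\<theta> > 0"
  shows "wint M w (\<lambda>x. f x + g x) \<le> (1 + \<theta>) * wint M w f + (1 + 1 / \<theta>) * wint M w g"
proof -
  have i: "integrable M (\<lambda>x. w x * (cmod (f x))\<^sup>2)" "integrable M (\<lambda>x. w x * (cmod (g x))\<^sup>2)"
    using f g by (auto simp: wsq_def)
  have ir: "integrable M (\<lambda>x. (1 + \<theta>) * (w x * (cmod (f x))\<^sup>2) + (1 + 1 / \<theta>) * (w x * (cmod (g x))\<^sup>2))"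
    by (intro Bochner_Integration.integrable_add integrable_mult_right i)
  have "wint M w (\<lambda>x. f x + g x) \<le> (LINT x|M. (1 + \<theta>) * (w x * (cmod (f x))\<^sup>2) + (1 + 1 / \<theta>) * (w x * (cmod (g x))\<^sup>2))"
    unfolding wint_def
  proof (rule Bochner_Integration.integral_mono[OF _ ir])
    show "integrable M (\<lambda>x. w x * (cmod (f x + g x))\<^sup>2)" using wsq_add[OF f g] by (simp add: wsq_def)
    fix x
    have "w x * (cmod (f x + g x))\<^sup>2 \<le> w x * ((1 + \<theta>) * (cmod (f x))\<^sup>2 + (1 + 1 / \<theta>) * (cmod (g x))\<^sup>2)"
      by (intro mult_left_mono cmod_add_sq_le \<theta> w)
    then show "w x * (cmod (f x + g x))\<^sup>2 \<le> (1 + \<theta>) * (w x * (cmod (f x))\<^sup>2) + (1 + 1 / \<theta>) * (w x * (cmod (g x))\<^sup>2)"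
      by (simp add: algebra_simps)
  qed
  also have "\<dots> = (1 + \<theta>) * wint M w f + (1 + 1 / \<theta>) * wint M w g"
    unfolding wint_def by (simp only: Bochner_Integration.integral_add integrable_mult_right i integral_mult_right_zero)
  finally show ?thesis .
qed

text \<open>Replaces the variational inequalities satisfied by two minimisers, hence no derivative of the
  functional is needed.\<close>

lemma wint_parallelogram_cross:
  assumes "wsq M w a1" "wsq M w a2" "wsq M w g1" "wsq M w g2"
  shows "wint M w (\<lambda>x. a2 x + g1 x) - wint M w (\<lambda>x. a2 x + g2 x) + wint M w (\<lambda>x. a1 x + g2 x) - wint M w (\<lambda>x. a1 x + g1 x)
    \<le> wint M w (\<lambda>x. a1 x - a2 x) + wint M w (\<lambda>x. g1 x - g2 x)"
proof -
  have pw: "(cmod (b2 + h1))\<^sup>2 - (cmod (b2 + h2))\<^sup>2 + (cmod (b1 + h2))\<^sup>2 - (cmod (b1 + h1))\<^sup>2 \<le> (cmod (b1 - b2))\<^sup>2 + (cmod (h1 - h2))\<^sup>2"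
    for b1 b2 h1 h2
  proof -
    have "(cmod (b1 - b2))\<^sup>2 + (cmod (h1 - h2))\<^sup>2 -
      ((cmod (b2 + h1))\<^sup>2 - (cmod (b2 + h2))\<^sup>2 + (cmod (b1 + h2))\<^sup>2 - (cmod (b1 + h1))\<^sup>2) = (cmod (b1 - b2 + (h1 - h2)))\<^sup>2"
      unfolding cmod_power2 by (simp add: power2_eq_square algebra_simps)
    then show ?thesis using zero_le_power2[of "cmod (b1 - b2 + (h1 - h2))"] by linarith
  qed
  have i: "integrable M (\<lambda>x. w x * (cmod (a2 x + g1 x))\<^sup>2)" "integrable M (\<lambda>x. w x * (cmod (a2 x + g2 x))\<^sup>2)"
    "integrable M (\<lambda>x. w x * (cmod (a1 x + g2 x))\<^sup>2)" "integrable M (\<lambda>x. w x * (cmod (a1 x + g1 x))\<^sup>2)"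
    "integrable M (\<lambda>x. w x * (cmod (a1 x - a2 x))\<^sup>2)" "integrable M (\<lambda>x. w x * (cmod (g1 x - g2 x))\<^sup>2)"
    using wsq_add wsq_diff assms by (auto simp: wsq_def)
  have "(LINT x|M. w x * (cmod (a2 x + g1 x))\<^sup>2 - w x * (cmod (a2 x + g2 x))\<^sup>2 + w x * (cmod (a1 x + g2 x))\<^sup>2 - w x * (cmod (a1 x + g1 x))\<^sup>2)
    \<le> (LINT x|M. w x * (cmod (a1 x - a2 x))\<^sup>2 + w x * (cmod (g1 x - g2 x))\<^sup>2)"
  proof (rule Bochner_Integration.integral_mono)
    fix x
    show "w x * (cmod (a2 x + g1 x))\<^sup>2 - w x * (cmod (a2 x + g2 x))\<^sup>2 + w x * (cmod (a1 x + g2 x))\<^sup>2 - w x * (cmod (a1 x + g1 x))\<^sup>2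
      \<le> w x * (cmod (a1 x - a2 x))\<^sup>2 + w x * (cmod (g1 x - g2 x))\<^sup>2"
    proof -
      have "w x * ((cmod (a2 x + g1 x))\<^sup>2 - (cmod (a2 x + g2 x))\<^sup>2 + (cmod (a1 x + g2 x))\<^sup>2 - (cmod (a1 x + g1 x))\<^sup>2)
        \<le> w x * ((cmod (a1 x - a2 x))\<^sup>2 + (cmod (g1 x - g2 x))\<^sup>2)"
        by (intro mult_left_mono pw w(2))
      then show ?thesis by (simp add: algebra_simps)
    qed
  qed (intro Bochner_Integration.integrable_add Bochner_Integration.integrable_diff i)+
  then show ?thesis unfolding wint_def
    by (simp only: Bochner_Integration.integral_add Bochner_Integration.integral_diff
      Bochner_Integration.integrable_add Bochner_Integration.integrable_diff i)
qed

end

text \<open>A functional that is strongly convex with modulus \<open>D\<close> on a set closed under convex combinations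
  has a minimiser, and grows at least like \<open>D\<close> away from it; no inner product is needed.\<close>

lemma strongly_convex_minimizer:
  fixes J :: "'c \<Rightarrow> real" and D :: "'c \<Rightarrow> 'c \<Rightarrow> real" and comb :: "real \<Rightarrow> 'c \<Rightarrow> 'c \<Rightarrow> 'c"
  assumes ne: "H \<noteq> {}" and J0: "\<And>u. u \<in> H \<Longrightarrow> J u \<ge> 0" and D0: "\<And>u v. u \<in> H \<Longrightarrow> v \<in> H \<Longrightarrow> D u v \<ge> 0"
    and comb: "\<And>u v \<theta>. u \<in> H \<Longrightarrow> v \<in> H \<Longrightarrow> 0 < \<theta> \<Longrightarrow> \<theta> < 1 \<Longrightarrow> comb \<theta> u v \<in> H"
    and convex: "\<And>u v \<theta>. u \<in> H \<Longrightarrow> v \<in> H \<Longrightarrow> 0 < \<theta> \<Longrightarrow> \<theta> < 1 \<Longrightarrow>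
        J (comb \<theta> u v) \<le> (1 - \<theta>) * J u + \<theta> * J v - \<theta> * (1 - \<theta>) * D u v"
    and complete: "\<And>U. (\<And>k. U k \<in> H) \<Longrightarrow> (\<And>e. e > 0 \<Longrightarrow> \<exists>n. \<forall>k\<ge>n. \<forall>l\<ge>n. D (U k) (U l) < e) \<Longrightarrow> \<exists>u\<in>H. (\<lambda>k. D u (U k)) \<longlonglongrightarrow> 0"
    and cont: "\<And>u v \<theta>. u \<in> H \<Longrightarrow> v \<in> H \<Longrightarrow> \<theta> > 0 \<Longrightarrow> J u \<le> (1 + \<theta>) * J v + (1 + 1 / \<theta>) * D u v"
  obtains u where "u \<in> H" "\<And>v. v \<in> H \<Longrightarrow> J v \<ge> J u + D u v"
proof -
  define m where "m = (INF u\<in>H. J u)"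
  have bdd: "bdd_below (J ` H)" using J0 by (intro bdd_belowI2[of _ 0])
  have mle: "m \<le> J u" if "u \<in> H" for u unfolding m_def using bdd that by (intro cINF_lower)
  have "\<exists>u\<in>H. J u < m + 1 / real (Suc k)" for k
  proof -
    have "m < m + 1 / real (Suc k)" by simp
    then show ?thesis unfolding m_def by (subst (asm) cINF_less_iff[OF ne bdd])
  qed
  then obtain U where U: "\<And>k. U k \<in> H" "\<And>k. J (U k) < m + 1 / real (Suc k)" by metis
  \<comment> \<open>At the midpoint the value of \<open>J\<close> is at least \<open>m\<close>, so
    \<open>D u v / 4\<close> is at most the mean excess of \<open>J u\<close> and \<open>J v\<close>
    over \<open>m\<close>; minimising sequences are therefore Cauchy.\<close>
  have half: "D u v \<le> 2 * (J u - m) + 2 * (J v - m)" if "u \<in> H" "v \<in> H" for u v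
    using convex[of u v "1/2"] mle[OF comb[of u v "1/2"]] that by simp
  have "\<exists>n. \<forall>k\<ge>n. \<forall>l\<ge>n. D (U k) (U l) < e" if e: "e > 0" for e
  proof -
    obtain n where "1 / real (Suc n) < e / 4" using nat_approx_posE[of "e / 4"] e by auto
    then have n: "4 * (1 / real (Suc n)) < e" by linarith
    have small: "4 * (J (U k) - m) < e" if "k \<ge> n" for k
    proof -
      have "1 / real (Suc k) \<le> 1 / real (Suc n)" using that by (intro divide_left_mono) auto
      moreover have "4 * (x - m) < e" if "a \<le> b" "x < m + a" "4 * b < e" for a b x using that by argo
      ultimately show ?thesis using U(2)[of k] n by blast
    qed
    have "D (U k) (U l) < e" if "k \<ge> n" "l \<ge> n" for k l
      using half[OF U(1) U(1), of k l] small[OF that(1)] small[OF that(2)] by linarith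
    then show ?thesis by blast
  qed
  from complete[OF U(1) this] obtain u where u: "u \<in> H" "(\<lambda>k. D u (U k)) \<longlonglongrightarrow> 0" by blast
  have JU: "(\<lambda>k. J (U k)) \<longlonglongrightarrow> m"
  proof (rule tendsto_sandwich[OF _ _ tendsto_const])
    show "(\<lambda>k. m + 1 / real (Suc k)) \<longlonglongrightarrow> m"
      using tendsto_add[OF tendsto_const LIMSEQ_inverse_real_of_nat, of m] by (simp add: inverse_eq_divide)
    show "eventually (\<lambda>k. m \<le> J (U k)) sequentially" using mle[OF U(1)] by (intro always_eventually allI)
    show "eventually (\<lambda>k. J (U k) \<le> m + 1 / real (Suc k)) sequentially"
      using less_imp_le[OF U(2)] by (intro always_eventually allI)
  qed
  \<comment> \<open>In \<open>cont\<close> the index \<open>k\<close> tends to infinity first, which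
    removes the term with the large factor \<open>1 + 1 / \<theta>\<close>; only then may
    \<open>\<theta>\<close> tend to 0.\<close>
  have le\<theta>: "J u \<le> (1 + \<theta>) * m" if \<theta>: "\<theta> > 0" for \<theta>
  proof (rule LIMSEQ_le_const)
    have "(\<lambda>k. (1 + \<theta>) * J (U k) + (1 + 1 / \<theta>) * D u (U k)) \<longlonglongrightarrow> (1 + \<theta>) * m + (1 + 1 / \<theta>) * 0"
      by (intro tendsto_intros JU u)
    then show "(\<lambda>k. (1 + \<theta>) * J (U k) + (1 + 1 / \<theta>) * D u (U k)) \<longlonglongrightarrow> (1 + \<theta>) * m" by simp
    show "\<exists>N. \<forall>k\<ge>N. J u \<le> (1 + \<theta>) * J (U k) + (1 + 1 / \<theta>) * D u (U k)"
      using cont[OF u(1) U(1) \<theta>] by blast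
  qed
  have Ju: "J u \<le> m"
  proof (rule tendsto_lowerbound)
    have "((\<lambda>\<theta>. (1 + \<theta>) * m) \<longlongrightarrow> (1 + 0) * m) (at_right (0::real))" by (intro tendsto_intros)
    then show "((\<lambda>\<theta>. (1 + \<theta>) * m) \<longlongrightarrow> m) (at_right (0::real))" by simp
    show "eventually (\<lambda>\<theta>. J u \<le> (1 + \<theta>) * m) (at_right (0::real))"
      unfolding eventually_at_right_field using le\<theta> by (intro exI[of _ 1]) auto
  qed simp
  \<comment> \<open>Minimality along the segment towards \<open>v\<close>, divided by
    \<open>\<theta>\<close>, and then \<open>\<theta>\<close> tending to 0.\<close>
  have "J v \<ge> J u + D u v" if v: "v \<in> H" for v
  proof (rule tendsto_upperbound)
    have "((\<lambda>\<theta>. J u + (1 - \<theta>) * D u v) \<longlongrightarrow> J u + (1 - 0) * D u v) (at_right (0::real))" by (intro tendsto_intros)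
    then show "((\<lambda>\<theta>. J u + (1 - \<theta>) * D u v) \<longlongrightarrow> J u + D u v) (at_right (0::real))" by simp
    have "J u + (1 - \<theta>) * D u v \<le> J v" if \<theta>: "0 < \<theta>" "\<theta> < 1" for \<theta>
    proof -
      have "J u \<le> (1 - \<theta>) * J u + \<theta> * J v - \<theta> * (1 - \<theta>) * D u v"
        using convex[OF u(1) v \<theta>] mle[OF comb[OF u(1) v \<theta>]] Ju by linarith
      then have "\<theta> * (J u + (1 - \<theta>) * D u v) \<le> \<theta> * J v" by (simp add: algebra_simps)
      then show ?thesis using \<theta>(1) by simp
    qed
    then show "eventually (\<lambda>\<theta>. J u + (1 - \<theta>) * D u v \<le> J v) (at_right (0::real))"
      unfolding eventually_at_right_field by (intro exI[of _ 1]) auto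
  qed simp
  with u(1) show thesis by (rule that)
qed

section \<open>Fixed point and error estimate\<close>

text \<open>The set where \<open>F\<close> exceeds \<open>c\<close> is open, and a nonempty open set
  is not a null set.\<close>

lemma continuous_AE_le_imp_le:
  fixes F :: "'a::euclidean_space \<Rightarrow> real"
  assumes \<Omega>: "open \<Omega>" and F: "continuous_on \<Omega> F" and ae: "AE x in lebesgue_on \<Omega>. F x \<le> c" and x: "x \<in> \<Omega>"
  shows "F x \<le> c"
proof (rule ccontr)
  assume "\<not> F x \<le> c"
  define O' where "O' = \<Omega> \<inter> F -` {c<..}"
  have "open O'" unfolding O'_def by (rule continuous_open_preimage[OF F \<Omega>]) simp
  moreover have "x \<in> O'" using x \<open>\<not> F x \<le> c\<close> by (simp add: O'_def)
  ultimately have "\<not> negligible O'" using open_not_negligible by blast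
  moreover have "AE x in lebesgue. x \<notin> O'"
  proof -
    have "AE x in lebesgue. x \<in> \<Omega> \<longrightarrow> F x \<le> c" using ae \<Omega> by (simp add: AE_restrict_space_iff)
    then show ?thesis by eventually_elim (auto simp: O'_def)
  qed
  then have "O' \<in> null_sets lebesgue" using \<open>open O'\<close> by (subst AE_iff_null_sets) auto
  then have "negligible O'" by (simp add: negligible_iff_null_sets)
  ultimately show False by simp
qed

text \<open>Representatives are continuous, so the essential supremum bound is a pointwise one; in
  this form the admissible set is visibly convex and stable under pointwise limits of its
  bounds.\<close>

lemma admissible_iff:
  fixes \<Omega> :: "'a::euclidean_space set"
  assumes \<Omega>: "bounded_smooth_domain \<Omega>" and s: "s > real DIM('a) / 2 + 2"
  shows "u \<in> admissible \<Omega> s N M \<longleftrightarrow> u \<in> {..N} \<rightarrow>\<^sub>E Hs \<Omega> s \<and> (\<forall>n\<le>N. \<forall>x\<in>frontier \<Omega>. u n x = 0) \<and>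
     (\<forall>x\<in>\<Omega>. L2_set (\<lambda>n. cmod (u n x)) {..N} \<le> M)"
proof (cases "u \<in> {..N} \<rightarrow>\<^sub>E Hs \<Omega> s")
  case True
  let ?F = "\<lambda>x. L2_set (\<lambda>n. cmod (u n x)) {..N}"
  have op: "open \<Omega>" by (rule bounded_smooth_domainD(1)[OF \<Omega>])
  have "continuous_on \<Omega> (u n)" if "n \<le> N" for n
    using Hs_continuous_on[OF \<Omega> s] True that closure_subset by (blast intro: continuous_on_subset)
  then have F: "continuous_on \<Omega> ?F" unfolding L2_set_def by (intro continuous_intros) auto
  then have "?F \<in> borel_measurable (lebesgue_on \<Omega>)"
    using bounded_smooth_domainD(4)[OF \<Omega>] by (intro continuous_imp_measurable_on_sets_lebesgue) auto
  then have Fm: "(\<lambda>x. ereal (?F x)) \<in> borel_measurable (lebesgue_on \<Omega>)" by measurable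
  have "esssup (lebesgue_on \<Omega>) (\<lambda>x. ereal (?F x)) \<le> ereal M \<longleftrightarrow> (\<forall>x\<in>\<Omega>. ?F x \<le> M)"
  proof
    assume le: "esssup (lebesgue_on \<Omega>) (\<lambda>x. ereal (?F x)) \<le> ereal M"
    have "AE x in lebesgue_on \<Omega>. ?F x \<le> M"
      using esssup_AE[of "\<lambda>x. ereal (?F x)" "lebesgue_on \<Omega>"] by eventually_elim (use le in \<open>simp add: order_trans flip: ereal_less_eq(3)\<close>)
    then show "\<forall>x\<in>\<Omega>. ?F x \<le> M" using continuous_AE_le_imp_le[OF op F] by blast
  qed (auto intro!: esssup_I Fm AE_I2)
  then show ?thesis using True by (auto simp: admissible_def)
qed (auto simp: admissible_def)

lemma set_lebesgue_integral_lebesgue_on: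
  fixes f :: "'a::euclidean_space \<Rightarrow> real"
  assumes "\<Omega> \<in> sets lebesgue"
  shows "(LINT x:\<Omega>|lebesgue. f x) = (LINT x|lebesgue_on \<Omega>. f x)"
  using assms by (simp add: set_lebesgue_integral_def integral_restrict_space)

lemma cmod_sum_of_real_mult_sq_le:
  "(cmod (\<Sum>n\<in>A. of_real (a n) * z n))\<^sup>2 \<le> (\<Sum>n\<in>A. (a n)\<^sup>2) * (\<Sum>n\<in>A. (cmod (z n))\<^sup>2)"
proof -
  have "cmod (\<Sum>n\<in>A. of_real (a n) * z n) \<le> (\<Sum>n\<in>A. \<bar>a n\<bar> * \<bar>cmod (z n)\<bar>)"
    by (rule order_trans[OF norm_sum]) (simp add: norm_mult)
  also have "\<dots> \<le> L2_set a A * L2_set (\<lambda>n. cmod (z n)) A" by (rule L2_set_mult_ineq)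
  finally have "(cmod (\<Sum>n\<in>A. of_real (a n) * z n))\<^sup>2 \<le> (L2_set a A * L2_set (\<lambda>n. cmod (z n)) A)\<^sup>2"
    by (intro power_mono) auto
  also have "\<dots> = (\<Sum>n\<in>A. (a n)\<^sup>2) * (\<Sum>n\<in>A. (cmod (z n))\<^sup>2)"
    by (simp add: power_mult_distrib L2_set_def sum_nonneg)
  finally show ?thesis .
qed

text \<open>\<open>lam_s\<close> absorbs the coupling by the \<open>s\<^sub>m\<^sub>n\<close> into the Carleman estimate, \<open>lam_L\<close> makes the
  contraction factor \<open>1/4\<close>.\<close>

locale regularized_system =
  fixes \<Omega> :: "'a::euclidean_space set" and x0 :: 'a and \<beta> s T p M lam \<epsilon> L K :: real and N :: nat
    and q :: "'a \<Rightarrow> real \<Rightarrow> real" and f :: "nat \<Rightarrow> 'a \<Rightarrow> complex"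
  assumes \<Omega>: "bounded_smooth_domain \<Omega>" and x0: "x0 \<notin> closure \<Omega>" and s: "s > real DIM('a) / 2 + 2"
    and M: "M > 0" and \<epsilon>: "\<epsilon> > 0" and lam1: "lam \<ge> 1" and LK: "L > 0" "K > 0"
    and f: "\<And>m. m \<le> N \<Longrightarrow> f m \<in> L2_boundary \<Omega>"
    and nl_bounded: "\<And>\<phi> m. m \<le> N \<Longrightarrow> (\<forall>n\<le>N. \<phi> n \<in> borel_measurable borel) \<Longrightarrow> (\<forall>n\<le>N. \<forall>x\<in>\<Omega>. cmod (\<phi> n x) \<le> M) \<Longrightarrow>
       nl_term T p N q \<phi> m \<in> borel_measurable (lebesgue_on \<Omega>) \<and>
       (AE x in lebesgue_on \<Omega>. (cmod (nl_term T p N q \<phi> m x))\<^sup>2 \<le> L)"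
    and nl_lipschitz: "\<And>\<phi> \<psi> m. m \<le> N \<Longrightarrow> (\<forall>n\<le>N. \<forall>x\<in>\<Omega>. cmod (\<phi> n x) \<le> M) \<Longrightarrow> (\<forall>n\<le>N. \<forall>x\<in>\<Omega>. cmod (\<psi> n x) \<le> M) \<Longrightarrow>
       AE x in lebesgue_on \<Omega>. (cmod (nl_term T p N q \<phi> m x - nl_term T p N q \<psi> m x))\<^sup>2 \<le>
           L * (\<Sum>n\<le>N. (cmod (\<phi> n x - \<psi> n x))\<^sup>2)"
    and carleman: "\<And>u. u \<in> Hs \<Omega> s \<Longrightarrow> (\<forall>x\<in>frontier \<Omega>. u x = 0) \<Longrightarrow>
       lam ^ 3 * (LINT x|lebesgue_on \<Omega>. carleman_weight x0 \<beta> lam x * (cmod (u x))\<^sup>2) \<le>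
       K * ((LINT x|lebesgue_on \<Omega>. carleman_weight x0 \<beta> lam x * (cmod (laplacian u x))\<^sup>2) +
         lam ^ 3 * (LINT x|surface_measure \<Omega>. carleman_weight x0 \<beta> lam x * (cmod (normal_deriv \<Omega> u x))\<^sup>2))"
    and lam_s: "lam ^ 3 \<ge> 4 * K * real (N + 1) * (\<Sum>m\<le>N. \<Sum>n\<le>N. (s_coeff T m n)\<^sup>2)"
    and lam_L: "lam ^ 3 \<ge> 16 * K * (L * real (N + 1))"
begin

abbreviation "M1 \<equiv> lebesgue_on \<Omega>"
abbreviation "M2 \<equiv> surface_measure \<Omega>"
abbreviation "w \<equiv> carleman_weight x0 \<beta> lam"
abbreviation "H \<equiv> admissible \<Omega> s N M"
abbreviation "nd \<equiv> normal_deriv \<Omega>"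
abbreviation "nl \<equiv> nl_term T p N q"
abbreviation "J \<equiv> J_functional \<Omega> x0 \<beta> s T p N q f lam \<epsilon>"
abbreviation "F \<equiv> F_map \<Omega> x0 \<beta> s T p N M q f lam \<epsilon>"

definition lin_op :: "nat \<Rightarrow> (nat \<Rightarrow> 'a \<Rightarrow> complex) \<Rightarrow> 'a \<Rightarrow> complex" where
  "lin_op m h x = \<i> * (\<Sum>n\<le>N. of_real (s_coeff T m n) * h n x) + laplacian (h m) x"

definition Q :: "(nat \<Rightarrow> 'a \<Rightarrow> complex) \<Rightarrow> real" where
  "Q h = (\<Sum>m\<le>N. wint M1 w (lin_op m h) + lam ^ 3 * wint M2 w (nd (h m)) + \<epsilon> * (Hs_norm \<Omega> s (h m))\<^sup>2)"

definition P :: "(nat \<Rightarrow> 'a \<Rightarrow> complex) \<Rightarrow> real" where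
  "P h = (\<Sum>n\<le>N. wint M1 w (h n))"

definition Hs_sq :: "(nat \<Rightarrow> 'a \<Rightarrow> complex) \<Rightarrow> real" where
  "Hs_sq h = (\<Sum>n\<le>N. (Hs_norm \<Omega> s (h n))\<^sup>2)"

text \<open>Not restricted to the indices \<open>{..N}\<close>, unlike admissible vectors: it has
  the form of the difference in the final estimate, and the quantities applied to it read these
  indices alone.\<close>

definition vdiff :: "(nat \<Rightarrow> 'a \<Rightarrow> complex) \<Rightarrow> (nat \<Rightarrow> 'a \<Rightarrow> complex) \<Rightarrow> nat \<Rightarrow> 'a \<Rightarrow> complex" where
  "vdiff u v = (\<lambda>n x. u n x - v n x)"

definition convex_comb :: "real \<Rightarrow> (nat \<Rightarrow> 'a \<Rightarrow> complex) \<Rightarrow> (nat \<Rightarrow> 'a \<Rightarrow> complex) \<Rightarrow> nat \<Rightarrow> 'a \<Rightarrow> complex" where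
  "convex_comb \<theta> u v = restrict (\<lambda>n x. of_real (1 - \<theta>) * u n x + of_real \<theta> * v n x) {..N}"

definition Hs_vec :: "(nat \<Rightarrow> 'a \<Rightarrow> complex) \<Rightarrow> bool" where
  "Hs_vec h \<longleftrightarrow> (\<forall>n\<le>N. h n \<in> Hs \<Omega> s)"

text \<open>The residual is a linear operator in \<open>u\<close> plus a term in
  \<open>\<phi>\<close> only: freezing \<open>\<phi>\<close> is what makes the functional quadratic
  in \<open>u\<close>.\<close>

lemma J_eq: "J \<phi> u = (\<Sum>m\<le>N. wint M1 w (\<lambda>x. lin_op m u x + nl \<phi> m x) +
    lam ^ 3 * wint M2 w (\<lambda>x. nd (u m) x - f m x) + \<epsilon> * (Hs_norm \<Omega> s (u m))\<^sup>2)"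
  unfolding J_functional_def wint_def set_lebesgue_integral_lebesgue_on[OF \<Omega>_leb(1)[OF \<Omega>]]
  by (simp add: residual_def lin_op_def nl_term_def)

section \<open>Square integrability of the terms\<close>

lemma w0: "w x \<ge> 0"
  by (auto simp: carleman_weight_def)

lemma wcont: "continuous_on (closure \<Omega>) w"
  by (rule carleman_weight_continuous[OF \<Omega> x0])

lemma w1: "w \<in> borel_measurable M1"
  by (rule integrable_lebesgue_on_continuous(1)[OF \<Omega> wcont]) simp

lemma w2: "w \<in> borel_measurable M2"
  by (intro borel_measurable_surface_measure_continuous continuous_on_subset[OF wcont]) (simp add: frontier_def)

lemma wbound: "\<exists>B. \<forall>x\<in>closure \<Omega>. w x \<le> B"
proof -
  have "compact (w ` closure \<Omega>)" by (intro compact_continuous_image wcont bounded_smooth_domainD(5) \<Omega>)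
  then show ?thesis using compact_imp_bounded[of "w ` closure \<Omega>"] by (auto simp: bounded_iff abs_le_iff)
qed

lemma wsq1I:
  assumes g: "g \<in> borel_measurable M1" and B: "AE x in M1. (cmod (g x))\<^sup>2 \<le> B"
  shows "wsq M1 w g"
proof -
  interpret finite_measure M1 by (rule finite_measure_lebesgue_on[OF \<Omega>])
  obtain W where W: "\<And>x. x \<in> closure \<Omega> \<Longrightarrow> w x \<le> W" using wbound by blast
  have "AE x in M1. x \<in> \<Omega>" by (rule AE_I2) simp
  with B have "AE x in M1. norm (w x * (cmod (g x))\<^sup>2) \<le> W * B"
  proof eventually_elim
    case (elim x)
    have "w x \<le> W" using elim closure_subset by (intro W) blast
    then have "w x * (cmod (g x))\<^sup>2 \<le> W * B" using elim w0[of x] by (intro mult_mono) auto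
    then show ?case using w0[of x] by simp
  qed
  moreover have "(\<lambda>x. w x * (cmod (g x))\<^sup>2) \<in> borel_measurable M1" using w1 g by measurable
  ultimately have "integrable M1 (\<lambda>x. w x * (cmod (g x))\<^sup>2)" by (rule integrable_const_bound)
  with g show ?thesis by (simp add: wsq_def)
qed

lemma wsq2I:
  assumes g: "continuous_on (frontier \<Omega>) g"
  shows "wsq M2 w g"
proof -
  have cont: "continuous_on (frontier \<Omega>) (\<lambda>x. w x * (cmod (g x))\<^sup>2)"
    by (intro continuous_intros g continuous_on_subset[OF wcont]) (simp add: frontier_def)
  have "compact ((\<lambda>x. w x * (cmod (g x))\<^sup>2) ` frontier \<Omega>)"
    by (intro compact_continuous_image cont bounded_smooth_domain_compact_frontier \<Omega>)
  then have "bounded ((\<lambda>x. w x * (cmod (g x))\<^sup>2) ` frontier \<Omega>)" by (rule compact_imp_bounded)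
  then obtain B where B: "\<And>x. x \<in> frontier \<Omega> \<Longrightarrow> norm (w x * (cmod (g x))\<^sup>2) \<le> B"
    unfolding bounded_iff by auto
  have "integrable M2 (\<lambda>x. w x * (cmod (g x))\<^sup>2)"
    by (rule integrable_surface_measure_bounded[OF \<Omega> borel_measurable_surface_measure_continuous[OF cont] B])
  then show ?thesis using borel_measurable_surface_measure_continuous[OF g] by (simp add: wsq_def)
qed

lemma wsq2_L2:
  assumes g: "g \<in> L2_boundary \<Omega>"
  shows "wsq M2 w g"
proof -
  have gm: "g \<in> borel_measurable M2" and gi: "integrable M2 (\<lambda>x. (cmod (g x))\<^sup>2)" using g by (auto simp: L2_boundary_def)
  obtain W where W: "\<And>x. x \<in> closure \<Omega> \<Longrightarrow> w x \<le> W" using wbound by blast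
  have "integrable M2 (\<lambda>x. w x * (cmod (g x))\<^sup>2)"
  proof (rule Bochner_Integration.integrable_bound)
    show "integrable M2 (\<lambda>x. W * (cmod (g x))\<^sup>2)" using gi by simp
    show "(\<lambda>x. w x * (cmod (g x))\<^sup>2) \<in> borel_measurable M2" using w2 gm by measurable
    show "AE x in M2. norm (w x * (cmod (g x))\<^sup>2) \<le> norm (W * (cmod (g x))\<^sup>2)"
    proof (rule AE_I2)
      fix x assume "x \<in> space M2"
      then have "w x \<le> W" by (intro W) (simp add: frontier_def)
      then have "w x * (cmod (g x))\<^sup>2 \<le> W * (cmod (g x))\<^sup>2" by (intro mult_right_mono) auto
      then show "norm (w x * (cmod (g x))\<^sup>2) \<le> norm (W * (cmod (g x))\<^sup>2)" using w0[of x] by simp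
    qed
  qed
  with gm show ?thesis by (simp add: wsq_def)
qed

lemma wsq1_continuous:
  assumes "continuous_on (closure \<Omega>) g0" "\<And>x. x \<in> \<Omega> \<Longrightarrow> g x = g0 x"
  shows "wsq M1 w g"
proof -
  obtain B where B: "\<forall>x\<in>\<Omega>. norm (g x) \<le> B" using integrable_lebesgue_on_continuous(2)[OF \<Omega> assms] by blast
  show ?thesis
    by (rule wsq1I[OF integrable_lebesgue_on_continuous(1)[OF \<Omega> assms], of "B\<^sup>2"])
      (use B in \<open>auto intro!: AE_I2 power_mono\<close>)
qed

lemma wsq_Hs: "u \<in> Hs \<Omega> s \<Longrightarrow> wsq M1 w u"
  by (rule wsq1_continuous[OF Hs_continuous_on[OF \<Omega> s]]) auto

lemma wsq_laplacian: "u \<in> Hs \<Omega> s \<Longrightarrow> wsq M1 w (laplacian u)"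
  by (erule Hs_laplacian_continuous_extension[OF \<Omega> s, THEN exE]) (auto intro: wsq1_continuous)

lemma wsq_nd: "u \<in> Hs \<Omega> s \<Longrightarrow> wsq M2 w (nd u)"
  by (intro wsq2I Hs_normal_deriv_continuous[OF \<Omega> s])

lemma Hs_vec_D: "Hs_vec h \<Longrightarrow> n \<le> N \<Longrightarrow> h n \<in> Hs \<Omega> s"
  by (simp add: Hs_vec_def)

lemma wsq_lin_op:
  assumes h: "Hs_vec h" and m: "m \<le> N"
  shows "wsq M1 w (lin_op m h)"
proof -
  obtain F where F: "continuous_on (closure \<Omega>) F" "\<And>x. x \<in> \<Omega> \<Longrightarrow> laplacian (h m) x = F x"
    using Hs_laplacian_continuous_extension[OF \<Omega> s Hs_vec_D[OF h m]] by blast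
  show ?thesis
  proof (rule wsq1_continuous)
    show "continuous_on (closure \<Omega>) (\<lambda>x. \<i> * (\<Sum>n\<le>N. of_real (s_coeff T m n) * h n x) + F x)"
      by (intro continuous_intros F(1) Hs_continuous_on[OF \<Omega> s] Hs_vec_D[OF h]) simp
  qed (simp add: lin_op_def F(2))
qed

lemma lin_op_linear:
  assumes "Hs_vec u" "Hs_vec v" "m \<le> N" "x \<in> \<Omega>" and z: "\<And>n. n \<le> N \<Longrightarrow> z n = (\<lambda>x. a * u n x + b * v n x)"
  shows "lin_op m z x = a * lin_op m u x + b * lin_op m v x"
proof -
  have "laplacian (z m) x = a * laplacian (u m) x + b * laplacian (v m) x"
    unfolding z[OF assms(3)] by (intro Hs_laplacian_linear[OF \<Omega> s] Hs_vec_D assms)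
  moreover have "(\<Sum>n\<le>N. of_real (s_coeff T m n) * z n x) =
     a * (\<Sum>n\<le>N. of_real (s_coeff T m n) * u n x) + b * (\<Sum>n\<le>N. of_real (s_coeff T m n) * v n x)"
    by (simp add: z sum.distrib[symmetric] sum_distrib_left algebra_simps)
  ultimately show ?thesis by (simp add: lin_op_def algebra_simps)
qed

lemma Hs_vec_vdiff: "Hs_vec u \<Longrightarrow> Hs_vec v \<Longrightarrow> Hs_vec (vdiff u v)"
  by (auto simp: Hs_vec_def vdiff_def intro: Hs_diff[OF s])

lemma lin_op_vdiff: "Hs_vec u \<Longrightarrow> Hs_vec v \<Longrightarrow> m \<le> N \<Longrightarrow> x \<in> \<Omega> \<Longrightarrow> lin_op m (vdiff u v) x = lin_op m u x - lin_op m v x"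
  using lin_op_linear[of u v m x "vdiff u v" 1 "-1"] by (simp add: vdiff_def)

lemma nd_vdiff: "Hs_vec u \<Longrightarrow> Hs_vec v \<Longrightarrow> m \<le> N \<Longrightarrow> x \<in> frontier \<Omega> \<Longrightarrow> nd (vdiff u v m) x = nd (u m) x - nd (v m) x"
  using Hs_normal_deriv_linear[OF \<Omega> s Hs_vec_D Hs_vec_D, of u m v m x 1 "-1"] by (simp add: vdiff_def)

section \<open>The admissible set and convexity of the functional\<close>

lemma admissibleD:
  assumes "u \<in> H"
  shows "Hs_vec u" "\<And>n x. n \<le> N \<Longrightarrow> x \<in> frontier \<Omega> \<Longrightarrow> u n x = 0" "\<And>x. x \<in> \<Omega> \<Longrightarrow> L2_set (\<lambda>n. cmod (u n x)) {..N} \<le> M"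
    "\<forall>n\<le>N. \<forall>x\<in>\<Omega>. cmod (u n x) \<le> M" "u \<in> extensional {..N}" "\<forall>n\<le>N. u n \<in> borel_measurable borel"
proof -
  note u = assms[unfolded admissible_iff[OF \<Omega> s]]
  show H: "Hs_vec u" using u by (auto simp: Hs_vec_def)
  show "\<And>n x. n \<le> N \<Longrightarrow> x \<in> frontier \<Omega> \<Longrightarrow> u n x = 0" using u by blast
  show l2: "\<And>x. x \<in> \<Omega> \<Longrightarrow> L2_set (\<lambda>n. cmod (u n x)) {..N} \<le> M" using u by blast
  show "\<forall>n\<le>N. \<forall>x\<in>\<Omega>. cmod (u n x) \<le> M"
  proof (intro allI impI ballI)
    fix n x assume "n \<le> N" "x \<in> \<Omega>"
    then show "cmod (u n x) \<le> M" using L2_set_coordinate_le[of "{..N}" n "\<lambda>n. cmod (u n x)"] l2[of x] by simp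
  qed
  show "u \<in> extensional {..N}" using u by (auto simp: PiE_def)
  show "\<forall>n\<le>N. u n \<in> borel_measurable borel"
  proof (intro allI impI)
    fix n assume n: "n \<le> N"
    have "(\<lambda>x. indicator (closure \<Omega>) x *\<^sub>R u n x) \<in> borel_measurable borel"
      by (intro borel_measurable_continuous_on_indicator Hs_continuous_on[OF \<Omega> s] Hs_vec_D[OF H n]) simp
    moreover have "(\<lambda>x. indicator (closure \<Omega>) x *\<^sub>R u n x) = u n"
      using Hs_vec_D[OF H n] by (auto simp: Hs_def indicator_def)
    ultimately show "u n \<in> borel_measurable borel" by simp
  qed
qed

lemma wsq_nl:
  assumes "\<phi> \<in> H" "m \<le> N"
  shows "wsq M1 w (nl \<phi> m)"
  using nl_bounded[OF assms(2) admissibleD(6,4)[OF assms(1)]] wsq1I by blast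

lemma admissible_convex_comb:
  assumes u: "u \<in> H" and v: "v \<in> H" and \<theta>: "0 < \<theta>" "\<theta> < 1"
  shows "convex_comb \<theta> u v \<in> H"
  unfolding admissible_iff[OF \<Omega> s]
proof (intro conjI allI ballI impI)
  show "convex_comb \<theta> u v \<in> {..N} \<rightarrow>\<^sub>E Hs \<Omega> s"
    unfolding convex_comb_def by (auto simp del: of_real_diff intro!: Hs_linear[OF s] Hs_vec_D[OF admissibleD(1)[OF u]] Hs_vec_D[OF admissibleD(1)[OF v]])
  show "\<And>n x. n \<le> N \<Longrightarrow> x \<in> frontier \<Omega> \<Longrightarrow> convex_comb \<theta> u v n x = 0"
    by (simp add: convex_comb_def admissibleD(2)[OF u] admissibleD(2)[OF v])
  fix x assume x: "x \<in> \<Omega>"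
  have "L2_set (\<lambda>n. cmod (convex_comb \<theta> u v n x)) {..N} \<le> L2_set (\<lambda>n. (1 - \<theta>) * cmod (u n x) + \<theta> * cmod (v n x)) {..N}"
  proof (rule L2_set_mono)
    fix n assume "n \<in> {..N}"
    then have "cmod (convex_comb \<theta> u v n x) \<le> cmod (of_real (1 - \<theta>) * u n x) + cmod (of_real \<theta> * v n x)"
      by (simp add: convex_comb_def norm_triangle_ineq del: of_real_diff)
    also have "\<dots> = (1 - \<theta>) * cmod (u n x) + \<theta> * cmod (v n x)"
      using \<theta> by (simp only: norm_mult norm_of_real)
    finally show "cmod (convex_comb \<theta> u v n x) \<le> (1 - \<theta>) * cmod (u n x) + \<theta> * cmod (v n x)" .
  qed simp
  also have "\<dots> \<le> L2_set (\<lambda>n. (1 - \<theta>) * cmod (u n x)) {..N} + L2_set (\<lambda>n. \<theta> * cmod (v n x)) {..N}"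
    by (rule L2_set_triangle_ineq)
  also have "\<dots> = (1 - \<theta>) * L2_set (\<lambda>n. cmod (u n x)) {..N} + \<theta> * L2_set (\<lambda>n. cmod (v n x)) {..N}"
    using \<theta> by (simp add: L2_set_right_distrib)
  also have "\<dots> \<le> (1 - \<theta>) * M + \<theta> * M"
    using \<theta> admissibleD(3)[OF u x] admissibleD(3)[OF v x] by (intro add_mono mult_left_mono) auto
  finally show "L2_set (\<lambda>n. cmod (convex_comb \<theta> u v n x)) {..N} \<le> M" by (simp add: algebra_simps)
qed

lemma zero_admissible: "restrict (\<lambda>n x. 0) {..N} \<in> H"
proof -
  have "(\<lambda>x. 0) \<in> Hs \<Omega> s"
  proof -
    have "(\<lambda>\<xi>. 0) \<in> Hs_extensions \<Omega> s (\<lambda>x. 0)"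
      by (simp add: Hs_extensions_def fourier_Hs_def inverse_fourier_def)
    then show ?thesis by (auto simp: Hs_def)
  qed
  then show ?thesis using M by (auto simp: admissible_iff[OF \<Omega> s] L2_set_0')
qed

lemma J_convex:
  assumes \<phi>: "\<phi> \<in> H" and u: "u \<in> H" and v: "v \<in> H" and \<theta>: "0 < \<theta>" "\<theta> < 1"
  shows "J \<phi> (convex_comb \<theta> u v) \<le> (1 - \<theta>) * J \<phi> u + \<theta> * J \<phi> v - \<theta> * (1 - \<theta>) * Q (vdiff u v)"
proof -
  note uH = admissibleD(1)[OF u] and vH = admissibleD(1)[OF v]
  let ?t = "\<lambda>u m. wint M1 w (\<lambda>x. lin_op m u x + nl \<phi> m x) + lam ^ 3 * wint M2 w (\<lambda>x. nd (u m) x - f m x) + \<epsilon> * (Hs_norm \<Omega> s (u m))\<^sup>2"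
  let ?r = "\<lambda>h m. wint M1 w (lin_op m h) + lam ^ 3 * wint M2 w (nd (h m)) + \<epsilon> * (Hs_norm \<Omega> s (h m))\<^sup>2"
  have "?t (convex_comb \<theta> u v) m \<le> (1 - \<theta>) * ?t u m + \<theta> * ?t v m - \<theta> * (1 - \<theta>) * ?r (vdiff u v) m" if m: "m \<le> N" for m
  proof -
    have cm: "convex_comb \<theta> u v m = (\<lambda>x. of_real (1 - \<theta>) * u m x + of_real \<theta> * v m x)" if "m \<le> N" for m
      using that by (simp add: convex_comb_def)
    have A: "wint M1 w (\<lambda>x. lin_op m (convex_comb \<theta> u v) x + nl \<phi> m x) =
       wint M1 w (\<lambda>x. of_real (1 - \<theta>) * (lin_op m u x + nl \<phi> m x) + of_real \<theta> * (lin_op m v x + nl \<phi> m x))"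
    proof (rule wint_cong)
      fix x assume "x \<in> space M1"
      then have e: "lin_op m (convex_comb \<theta> u v) x = of_real (1 - \<theta>) * lin_op m u x + of_real \<theta> * lin_op m v x"
        by (intro lin_op_linear uH vH m cm) auto
      show "cmod (lin_op m (convex_comb \<theta> u v) x + nl \<phi> m x) =
        cmod (of_real (1 - \<theta>) * (lin_op m u x + nl \<phi> m x) + of_real \<theta> * (lin_op m v x + nl \<phi> m x))"
        unfolding e by (simp add: algebra_simps)
    qed
    have A': "wint M1 w (\<lambda>x. (lin_op m u x + nl \<phi> m x) - (lin_op m v x + nl \<phi> m x)) = wint M1 w (lin_op m (vdiff u v))"
      by (rule wint_cong) (simp add: lin_op_vdiff[OF uH vH m])
    have B: "wint M2 w (\<lambda>x. nd (convex_comb \<theta> u v m) x - f m x) =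
       wint M2 w (\<lambda>x. of_real (1 - \<theta>) * (nd (u m) x - f m x) + of_real \<theta> * (nd (v m) x - f m x))"
    proof (rule wint_cong)
      fix x assume "x \<in> space M2"
      then have e: "nd (convex_comb \<theta> u v m) x = of_real (1 - \<theta>) * nd (u m) x + of_real \<theta> * nd (v m) x"
        unfolding cm[OF m] by (intro Hs_normal_deriv_linear[OF \<Omega> s] Hs_vec_D[OF uH m] Hs_vec_D[OF vH m]) simp
      show "cmod (nd (convex_comb \<theta> u v m) x - f m x) =
        cmod (of_real (1 - \<theta>) * (nd (u m) x - f m x) + of_real \<theta> * (nd (v m) x - f m x))"
        unfolding e by (simp add: algebra_simps)
    qed
    have B': "wint M2 w (\<lambda>x. (nd (u m) x - f m x) - (nd (v m) x - f m x)) = wint M2 w (nd (vdiff u v m))"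
      by (rule wint_cong) (simp add: nd_vdiff[OF uH vH m])
    have C: "(Hs_norm \<Omega> s (convex_comb \<theta> u v m))\<^sup>2 \<le> (1 - \<theta>) * (Hs_norm \<Omega> s (u m))\<^sup>2 + \<theta> * (Hs_norm \<Omega> s (v m))\<^sup>2
        - \<theta> * (1 - \<theta>) * (Hs_norm \<Omega> s (vdiff u v m))\<^sup>2"
      unfolding cm[OF m] vdiff_def using \<theta> by (intro Hs_norm_convex[OF s] Hs_vec_D[OF uH m] Hs_vec_D[OF vH m]) auto
    note Aw = wsq_add[OF w1 w0 wsq_lin_op[OF uH m] wsq_nl[OF \<phi> m]] wsq_add[OF w1 w0 wsq_lin_op[OF vH m] wsq_nl[OF \<phi> m]]
    note Bw = wsq_diff[OF w2 w0 wsq_nd[OF Hs_vec_D[OF uH m]] wsq2_L2[OF f[OF m]]] wsq_diff[OF w2 w0 wsq_nd[OF Hs_vec_D[OF vH m]] wsq2_L2[OF f[OF m]]]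
    have "\<epsilon> * (Hs_norm \<Omega> s (convex_comb \<theta> u v m))\<^sup>2 \<le> \<epsilon> * ((1 - \<theta>) * (Hs_norm \<Omega> s (u m))\<^sup>2 + \<theta> * (Hs_norm \<Omega> s (v m))\<^sup>2
        - \<theta> * (1 - \<theta>) * (Hs_norm \<Omega> s (vdiff u v m))\<^sup>2)"
      using C \<epsilon> by (intro mult_left_mono) auto
    then show ?thesis
      unfolding A B wint_convex[OF w1 w0 Aw] wint_convex[OF w2 w0 Bw] A' B' by (simp add: algebra_simps)
  qed
  then have "(\<Sum>m\<le>N. ?t (convex_comb \<theta> u v) m) \<le> (\<Sum>m\<le>N. (1 - \<theta>) * ?t u m + \<theta> * ?t v m - \<theta> * (1 - \<theta>) * ?r (vdiff u v) m)"
    by (intro sum_mono) auto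
  also have "\<dots> = (1 - \<theta>) * J \<phi> u + \<theta> * J \<phi> v - \<theta> * (1 - \<theta>) * Q (vdiff u v)"
    unfolding J_eq Q_def by (simp only: sum.distrib[symmetric] sum_subtractf[symmetric] sum_distrib_left)
  finally show ?thesis unfolding J_eq .
qed

lemma J_continuity:
  assumes \<phi>: "\<phi> \<in> H" and u: "u \<in> H" and v: "v \<in> H" and \<theta>: "\<theta> > 0"
  shows "J \<phi> u \<le> (1 + \<theta>) * J \<phi> v + (1 + 1 / \<theta>) * Q (vdiff u v)"
proof -
  note uH = admissibleD(1)[OF u] and vH = admissibleD(1)[OF v]
  note dH = Hs_vec_vdiff[OF uH vH]
  let ?t = "\<lambda>u m. wint M1 w (\<lambda>x. lin_op m u x + nl \<phi> m x) + lam ^ 3 * wint M2 w (\<lambda>x. nd (u m) x - f m x) + \<epsilon> * (Hs_norm \<Omega> s (u m))\<^sup>2"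
  let ?r = "\<lambda>h m. wint M1 w (lin_op m h) + lam ^ 3 * wint M2 w (nd (h m)) + \<epsilon> * (Hs_norm \<Omega> s (h m))\<^sup>2"
  have "?t u m \<le> (1 + \<theta>) * ?t v m + (1 + 1 / \<theta>) * ?r (vdiff u v) m" if m: "m \<le> N" for m
  proof -
    have "wint M1 w (\<lambda>x. lin_op m u x + nl \<phi> m x) = wint M1 w (\<lambda>x. (lin_op m v x + nl \<phi> m x) + lin_op m (vdiff u v) x)"
      by (rule wint_cong) (simp add: lin_op_vdiff[OF uH vH m] add.commute)
    also have "\<dots> \<le> (1 + \<theta>) * wint M1 w (\<lambda>x. lin_op m v x + nl \<phi> m x) + (1 + 1 / \<theta>) * wint M1 w (lin_op m (vdiff u v))"
      by (intro wint_add_le[OF w1 w0] wsq_add[OF w1 w0] wsq_lin_op vH dH m wsq_nl \<phi> \<theta>)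
    finally have A: "wint M1 w (\<lambda>x. lin_op m u x + nl \<phi> m x) \<le> (1 + \<theta>) * wint M1 w (\<lambda>x. lin_op m v x + nl \<phi> m x) + (1 + 1 / \<theta>) * wint M1 w (lin_op m (vdiff u v))" .
    have "wint M2 w (\<lambda>x. nd (u m) x - f m x) = wint M2 w (\<lambda>x. (nd (v m) x - f m x) + nd (vdiff u v m) x)"
      by (rule wint_cong) (simp add: nd_vdiff[OF uH vH m])
    also have "\<dots> \<le> (1 + \<theta>) * wint M2 w (\<lambda>x. nd (v m) x - f m x) + (1 + 1 / \<theta>) * wint M2 w (nd (vdiff u v m))"
      by (intro wint_add_le[OF w2 w0] wsq_diff[OF w2 w0] wsq_nd Hs_vec_D[OF vH m] Hs_vec_D[OF dH m] wsq2_L2 f m \<theta>)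
    finally have "lam ^ 3 * wint M2 w (\<lambda>x. nd (u m) x - f m x) \<le>
        lam ^ 3 * ((1 + \<theta>) * wint M2 w (\<lambda>x. nd (v m) x - f m x) + (1 + 1 / \<theta>) * wint M2 w (nd (vdiff u v m)))"
      using lam1 by (intro mult_left_mono) auto
    then have B: "lam ^ 3 * wint M2 w (\<lambda>x. nd (u m) x - f m x) \<le>
        (1 + \<theta>) * (lam ^ 3 * wint M2 w (\<lambda>x. nd (v m) x - f m x)) + (1 + 1 / \<theta>) * (lam ^ 3 * wint M2 w (nd (vdiff u v m)))"
      by (simp only: distrib_left mult.left_commute)
    have "(Hs_norm \<Omega> s (\<lambda>x. v m x + vdiff u v m x))\<^sup>2 \<le> (1 + \<theta>) * (Hs_norm \<Omega> s (v m))\<^sup>2 + (1 + 1 / \<theta>) * (Hs_norm \<Omega> s (vdiff u v m))\<^sup>2"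
      by (intro Hs_norm_add_le[OF s] Hs_vec_D[OF vH m] Hs_vec_D[OF dH m] \<theta>)
    moreover have "(\<lambda>x. v m x + vdiff u v m x) = u m" by (simp add: vdiff_def)
    ultimately have "\<epsilon> * (Hs_norm \<Omega> s (u m))\<^sup>2 \<le> \<epsilon> * ((1 + \<theta>) * (Hs_norm \<Omega> s (v m))\<^sup>2 + (1 + 1 / \<theta>) * (Hs_norm \<Omega> s (vdiff u v m))\<^sup>2)"
      using \<epsilon> by (intro mult_left_mono) auto
    then have C: "\<epsilon> * (Hs_norm \<Omega> s (u m))\<^sup>2 \<le> (1 + \<theta>) * (\<epsilon> * (Hs_norm \<Omega> s (v m))\<^sup>2) + (1 + 1 / \<theta>) * (\<epsilon> * (Hs_norm \<Omega> s (vdiff u v m))\<^sup>2)"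
      by (simp only: distrib_left mult.left_commute)
    show ?thesis using A B C by (simp only: distrib_left)
  qed
  then have "(\<Sum>m\<le>N. ?t u m) \<le> (\<Sum>m\<le>N. (1 + \<theta>) * ?t v m + (1 + 1 / \<theta>) * ?r (vdiff u v) m)"
    by (intro sum_mono) auto
  also have "\<dots> = (1 + \<theta>) * J \<phi> v + (1 + 1 / \<theta>) * Q (vdiff u v)"
    unfolding J_eq Q_def by (simp only: sum.distrib[symmetric] sum_distrib_left)
  finally show ?thesis unfolding J_eq .
qed

section \<open>Comparing P, Q and the H^s norm\<close>

abbreviation "S \<equiv> (\<Sum>m\<le>N. \<Sum>n\<le>N. (s_coeff T m n)\<^sup>2)"

lemma lam3: "lam ^ 3 > 0"
  using lam1 by simp

lemma row_le_S: "m \<le> N \<Longrightarrow> (\<Sum>n\<le>N. (s_coeff T m n)\<^sup>2) \<le> S"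
  by (rule member_le_sum[of m "{..N}" "\<lambda>m. \<Sum>n\<le>N. (s_coeff T m n)\<^sup>2"]) (auto intro: sum_nonneg)

lemma S_nonneg: "S \<ge> 0"
  by (intro sum_nonneg) auto

lemma Hs_sq_nonneg: "Hs_sq h \<ge> 0"
  by (simp add: Hs_sq_def sum_nonneg)

lemma P_nonneg: "P h \<ge> 0"
  unfolding P_def by (intro sum_nonneg wint_nonneg w0)

lemma Q_split: "Q h = (\<Sum>m\<le>N. wint M1 w (lin_op m h)) + lam ^ 3 * (\<Sum>m\<le>N. wint M2 w (nd (h m))) + \<epsilon> * Hs_sq h"
  by (simp add: Q_def Hs_sq_def sum.distrib sum_distrib_left)

lemma sum_wint_nonneg: "(\<Sum>m\<le>N. wint M' w (g m)) \<ge> 0"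
  by (intro sum_nonneg wint_nonneg w0)

lemma Q_parts:
  "(\<Sum>m\<le>N. wint M1 w (lin_op m h)) \<le> Q h" "\<epsilon> * Hs_sq h \<le> Q h"
  "lam ^ 3 * (\<Sum>m\<le>N. wint M2 w (nd (h m))) + \<epsilon> * Hs_sq h \<le> Q h" "Q h \<ge> 0"
  "(\<Sum>m\<le>N. wint M1 w (lin_op m h)) + lam ^ 3 * (\<Sum>m\<le>N. wint M2 w (nd (h m))) \<le> Q h"
proof -
  have 1: "(\<Sum>m\<le>N. wint M1 w (lin_op m h)) \<ge> 0" by (rule sum_wint_nonneg)
  have 2: "lam ^ 3 * (\<Sum>m\<le>N. wint M2 w (nd (h m))) \<ge> 0"
    using lam3 by (intro mult_nonneg_nonneg sum_wint_nonneg) simp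
  have 3: "\<epsilon> * Hs_sq h \<ge> 0" using \<epsilon> Hs_sq_nonneg[of h] by simp
  show "(\<Sum>m\<le>N. wint M1 w (lin_op m h)) \<le> Q h" "\<epsilon> * Hs_sq h \<le> Q h"
    "lam ^ 3 * (\<Sum>m\<le>N. wint M2 w (nd (h m))) + \<epsilon> * Hs_sq h \<le> Q h" "Q h \<ge> 0"
    "(\<Sum>m\<le>N. wint M1 w (lin_op m h)) + lam ^ 3 * (\<Sum>m\<le>N. wint M2 w (nd (h m))) \<le> Q h"
    unfolding Q_split using 1 2 3 by linarith+
qed

lemma J_nonneg: "J \<phi> u \<ge> 0"
proof -
  have "lam ^ 3 * wint M2 w g \<ge> 0" for g using lam3 by (intro mult_nonneg_nonneg wint_nonneg w0) simp
  moreover have "\<epsilon> * (Hs_norm \<Omega> s (u m))\<^sup>2 \<ge> 0" for m using \<epsilon> by simp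
  ultimately show ?thesis unfolding J_eq by (intro sum_nonneg add_nonneg_nonneg wint_nonneg w0)
qed

lemma w1_integrable: "integrable M1 w"
proof -
  have "wsq M1 w (\<lambda>x. 1)" by (rule wsq1_continuous[of "\<lambda>x. 1"]) auto
  then show ?thesis by (simp add: wsq_def)
qed

lemma w2_integrable: "integrable M2 w"
proof -
  have "wsq M2 w (\<lambda>x. 1)" by (rule wsq2I) auto
  then show ?thesis by (simp add: wsq_def)
qed

lemma wint1_le:
  assumes g: "wsq M1 w g" and B: "\<And>x. x \<in> \<Omega> \<Longrightarrow> (cmod (g x))\<^sup>2 \<le> B"
  shows "wint M1 w g \<le> B * (LINT x|M1. w x)"
proof -
  have "AE x in M1. (cmod (g x))\<^sup>2 \<le> B" by (rule AE_I2) (simp add: B)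
  from wint_mono_AE[OF w1 w0 g _ this] w1_integrable show ?thesis by (simp add: mult.commute)
qed

lemma wint2_le:
  assumes g: "wsq M2 w g" and B: "\<And>x. x \<in> frontier \<Omega> \<Longrightarrow> (cmod (g x))\<^sup>2 \<le> B"
  shows "wint M2 w g \<le> B * (LINT x|M2. w x)"
proof -
  have "AE x in M2. (cmod (g x))\<^sup>2 \<le> B" by (rule AE_I2) (simp add: B)
  from wint_mono_AE[OF w2 w0 g _ this] w2_integrable show ?thesis by (simp add: mult.commute)
qed

lemma Hs_norm_sq_le_Hs_sq: "n \<le> N \<Longrightarrow> (Hs_norm \<Omega> s (h n))\<^sup>2 \<le> Hs_sq h"
  unfolding Hs_sq_def by (rule member_le_sum[of n "{..N}" "\<lambda>n. (Hs_norm \<Omega> s (h n))\<^sup>2"]) auto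

text \<open>Used in both directions: forward to bound \<open>Q\<close> by the H^s norm, backward to
  insert \<open>lin_op\<close> into the Carleman estimate.\<close>

lemma lin_op_laplacian:
  assumes m: "m \<le> N"
  shows "(cmod (lin_op m h x))\<^sup>2 \<le> 2 * (cmod (laplacian (h m) x))\<^sup>2 + 2 * (S * (\<Sum>n\<le>N. (cmod (h n x))\<^sup>2))"
    and "(cmod (laplacian (h m) x))\<^sup>2 \<le>
      2 * (cmod (lin_op m h x))\<^sup>2 + 2 * ((\<Sum>n\<le>N. (s_coeff T m n)\<^sup>2) * (\<Sum>n\<le>N. (cmod (h n x))\<^sup>2))"
proof -
  let ?z = "\<i> * (\<Sum>n\<le>N. of_real (s_coeff T m n) * h n x)"
  have z: "(cmod ?z)\<^sup>2 \<le> (\<Sum>n\<le>N. (s_coeff T m n)\<^sup>2) * (\<Sum>n\<le>N. (cmod (h n x))\<^sup>2)"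
    using cmod_sum_of_real_mult_sq_le[of "s_coeff T m" "\<lambda>n. h n x" "{..N}"] by (simp add: norm_mult)
  also have "\<dots> \<le> S * (\<Sum>n\<le>N. (cmod (h n x))\<^sup>2)"
    by (intro mult_right_mono row_le_S m sum_nonneg) auto
  finally have zS: "(cmod ?z)\<^sup>2 \<le> S * (\<Sum>n\<le>N. (cmod (h n x))\<^sup>2)" .
  have "(cmod (laplacian (h m) x + ?z))\<^sup>2 \<le> 2 * (cmod (laplacian (h m) x))\<^sup>2 + 2 * (cmod ?z)\<^sup>2"
    using cmod_add_sq_le[of 1 "laplacian (h m) x" ?z] by simp
  moreover have "laplacian (h m) x + ?z = lin_op m h x" by (simp add: lin_op_def)
  ultimately show "(cmod (lin_op m h x))\<^sup>2 \<le> 2 * (cmod (laplacian (h m) x))\<^sup>2 + 2 * (S * (\<Sum>n\<le>N. (cmod (h n x))\<^sup>2))"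
    using zS by simp
  have "(cmod (lin_op m h x + - ?z))\<^sup>2 \<le> 2 * (cmod (lin_op m h x))\<^sup>2 + 2 * (cmod (- ?z))\<^sup>2"
    using cmod_add_sq_le[of 1 "lin_op m h x" "- ?z"] by simp
  moreover have "lin_op m h x + - ?z = laplacian (h m) x" by (simp add: lin_op_def)
  moreover have "cmod (- ?z) = cmod ?z" by (rule norm_minus_cancel)
  ultimately show "(cmod (laplacian (h m) x))\<^sup>2 \<le>
      2 * (cmod (lin_op m h x))\<^sup>2 + 2 * ((\<Sum>n\<le>N. (s_coeff T m n)\<^sup>2) * (\<Sum>n\<le>N. (cmod (h n x))\<^sup>2))"
    using z by simp
qed

text \<open>Continuity of both forms for the H^s norm. The constants may depend on
  \<open>lam\<close> and \<open>\<epsilon>\<close>, since only limits are taken with them.\<close>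

lemma P_upper: "\<exists>B\<ge>0. \<forall>h. Hs_vec h \<longrightarrow> P h \<le> B * Hs_sq h"
  and Q_upper: "\<exists>B\<ge>0. \<forall>h. Hs_vec h \<longrightarrow> Q h \<le> B * Hs_sq h"
proof -
  obtain k where k: "k > 0" "\<And>u x. u \<in> Hs \<Omega> s \<Longrightarrow> x \<in> closure \<Omega> \<Longrightarrow> cmod (u x) \<le> k * Hs_norm \<Omega> s u"
     "\<And>u x. u \<in> Hs \<Omega> s \<Longrightarrow> x \<in> \<Omega> \<Longrightarrow> cmod (laplacian u x) \<le> k * Hs_norm \<Omega> s u"
     "\<And>u x. u \<in> Hs \<Omega> s \<Longrightarrow> x \<in> frontier \<Omega> \<Longrightarrow> cmod (nd u x) \<le> k * Hs_norm \<Omega> s u"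
    using Hs_sup_bounds[OF \<Omega> s] by blast
  define I1 where "I1 = (LINT x|M1. w x)"
  define I2 where "I2 = (LINT x|M2. w x)"
  have I: "I1 \<ge> 0" "I2 \<ge> 0" unfolding I1_def I2_def by (auto intro!: integral_nonneg_AE AE_I2 w0)
  have sq: "a\<^sup>2 \<le> k\<^sup>2 * Hs_sq h" if "n \<le> N" "0 \<le> a" "a \<le> k * Hs_norm \<Omega> s (h n)" for a n h
  proof -
    have "a\<^sup>2 \<le> (k * Hs_norm \<Omega> s (h n))\<^sup>2" using that by (intro power_mono) auto
    also have "\<dots> = k\<^sup>2 * (Hs_norm \<Omega> s (h n))\<^sup>2" by (simp add: power_mult_distrib)
    also have "\<dots> \<le> k\<^sup>2 * Hs_sq h" by (intro mult_left_mono Hs_norm_sq_le_Hs_sq that) auto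
    finally show ?thesis .
  qed
  have pt: "(cmod (h n x))\<^sup>2 \<le> k\<^sup>2 * Hs_sq h" if "Hs_vec h" "n \<le> N" "x \<in> \<Omega>" for h n x
    using that closure_subset by (intro sq[of n] k Hs_vec_D) auto
  have Pn: "P h \<le> (real (N + 1) * (k\<^sup>2 * I1)) * Hs_sq h" if h: "Hs_vec h" for h
  proof -
    have "P h \<le> (\<Sum>n\<le>N. k\<^sup>2 * Hs_sq h * I1)"
      unfolding P_def I1_def by (intro sum_mono wint1_le wsq_Hs Hs_vec_D[OF h] pt[OF h]) auto
    then show ?thesis by (simp add: algebra_simps)
  qed
  show "\<exists>B\<ge>0. \<forall>h. Hs_vec h \<longrightarrow> P h \<le> B * Hs_sq h"
  proof (intro exI[of _ "real (N + 1) * (k\<^sup>2 * I1)"] conjI allI impI Pn)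
    show "0 \<le> real (N + 1) * (k\<^sup>2 * I1)" using I by simp
  qed
  define A where "A = 2 * k\<^sup>2 + 2 * (S * (real (N + 1) * k\<^sup>2))"
  have A0: "A \<ge> 0" unfolding A_def using S_nonneg by (intro add_nonneg_nonneg mult_nonneg_nonneg) auto
  have Qn: "Q h \<le> (real (N + 1) * (A * I1) + lam ^ 3 * (real (N + 1) * (k\<^sup>2 * I2)) + \<epsilon>) * Hs_sq h" if h: "Hs_vec h" for h
  proof -
    have Apt: "(cmod (lin_op m h x))\<^sup>2 \<le> A * Hs_sq h" if m: "m \<le> N" and x: "x \<in> \<Omega>" for m x
    proof -
      have "(\<Sum>n\<le>N. (cmod (h n x))\<^sup>2) \<le> (\<Sum>n\<le>N. k\<^sup>2 * Hs_sq h)" by (intro sum_mono pt h x) simp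
      also have "\<dots> = real (N + 1) * k\<^sup>2 * Hs_sq h" by simp
      finally have "S * (\<Sum>n\<le>N. (cmod (h n x))\<^sup>2) \<le> S * (real (N + 1) * k\<^sup>2 * Hs_sq h)"
        by (rule mult_left_mono[OF _ S_nonneg])
      moreover have "(cmod (laplacian (h m) x))\<^sup>2 \<le> k\<^sup>2 * Hs_sq h"
        by (rule sq[where n=m and h=h]) (simp_all add: m k(3)[OF Hs_vec_D[OF h m] x])
      ultimately have "(cmod (lin_op m h x))\<^sup>2 \<le> 2 * (k\<^sup>2 * Hs_sq h) + 2 * (S * (real (N + 1) * k\<^sup>2 * Hs_sq h))"
        using lin_op_laplacian(1)[OF m, of h x] by linarith
      also have "\<dots> = A * Hs_sq h" unfolding A_def by (simp only: distrib_right mult.assoc)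
      finally show ?thesis .
    qed
    have 1: "(\<Sum>m\<le>N. wint M1 w (lin_op m h)) \<le> (\<Sum>m\<le>N. A * Hs_sq h * I1)"
      unfolding I1_def by (intro sum_mono wint1_le wsq_lin_op h Apt) auto
    have 2: "(\<Sum>m\<le>N. wint M2 w (nd (h m))) \<le> (\<Sum>m\<le>N. k\<^sup>2 * Hs_sq h * I2)"
      unfolding I2_def
    proof (intro sum_mono wint2_le)
      fix m x assume m: "m \<in> {..N}" and x: "x \<in> frontier \<Omega>"
      then have m: "m \<le> N" by simp
      show "(cmod (nd (h m) x))\<^sup>2 \<le> k\<^sup>2 * Hs_sq h" by (rule sq[where n=m and h=h]) (simp_all add: m k(4)[OF Hs_vec_D[OF h m] x])
    qed (auto intro!: wsq_nd Hs_vec_D[OF h])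
    have "lam ^ 3 * (\<Sum>m\<le>N. wint M2 w (nd (h m))) \<le> lam ^ 3 * (\<Sum>m\<le>N. k\<^sup>2 * Hs_sq h * I2)"
      using 2 lam3 by (intro mult_left_mono) auto
    with 1 have "Q h \<le> (\<Sum>m\<le>N. A * Hs_sq h * I1) + lam ^ 3 * (\<Sum>m\<le>N. k\<^sup>2 * Hs_sq h * I2) + \<epsilon> * Hs_sq h"
      unfolding Q_split by linarith
    also have "\<dots> = (real (N + 1) * (A * I1) + lam ^ 3 * (real (N + 1) * (k\<^sup>2 * I2)) + \<epsilon>) * Hs_sq h"
      by (simp add: algebra_simps)
    finally show ?thesis .
  qed
  show "\<exists>B\<ge>0. \<forall>h. Hs_vec h \<longrightarrow> Q h \<le> B * Hs_sq h"
  proof (intro exI[of _ "real (N + 1) * (A * I1) + lam ^ 3 * (real (N + 1) * (k\<^sup>2 * I2)) + \<epsilon>"] conjI allI impI Qn)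
    show "0 \<le> real (N + 1) * (A * I1) + lam ^ 3 * (real (N + 1) * (k\<^sup>2 * I2)) + \<epsilon>"
      using I A0 lam3 \<epsilon> by (intro add_nonneg_nonneg mult_nonneg_nonneg) auto
  qed
qed

lemma Hs_sq_sym: "Hs_vec u \<Longrightarrow> Hs_vec v \<Longrightarrow> Hs_sq (vdiff u v) = Hs_sq (vdiff v u)"
  unfolding Hs_sq_def vdiff_def by (intro sum.cong refl) (simp add: Hs_norm_minus_commute[OF s Hs_vec_D Hs_vec_D])

lemma Q_sym:
  assumes u: "Hs_vec u" and v: "Hs_vec v"
  shows "Q (vdiff u v) = Q (vdiff v u)"
proof -
  have "wint M1 w (lin_op m (vdiff u v)) = wint M1 w (lin_op m (vdiff v u))" if "m \<le> N" for m
    using that by (intro wint_cong) (simp add: lin_op_vdiff[OF u v] lin_op_vdiff[OF v u] norm_minus_commute)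
  moreover have "wint M2 w (nd (vdiff u v m)) = wint M2 w (nd (vdiff v u m))" if "m \<le> N" for m
    using that by (intro wint_cong) (simp add: nd_vdiff[OF u v] nd_vdiff[OF v u] norm_minus_commute)
  ultimately show ?thesis unfolding Q_split by (simp add: Hs_sq_sym[OF u v])
qed

lemma Hs_sq_triangle:
  assumes "Hs_vec u" "Hs_vec v" "Hs_vec z"
  shows "Hs_sq (vdiff u z) \<le> 2 * Hs_sq (vdiff u v) + 2 * Hs_sq (vdiff v z)"
proof -
  have "Hs_sq (vdiff u z) \<le> (\<Sum>n\<le>N. 2 * (Hs_norm \<Omega> s (vdiff u v n))\<^sup>2 + 2 * (Hs_norm \<Omega> s (vdiff v z n))\<^sup>2)"
    unfolding Hs_sq_def
  proof (rule sum_mono)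
    fix n assume "n \<in> {..N}"
    then have n: "n \<le> N" by simp
    have "vdiff u z n = (\<lambda>x. vdiff u v n x + vdiff v z n x)" by (simp add: vdiff_def)
    then show "(Hs_norm \<Omega> s (vdiff u z n))\<^sup>2 \<le> 2 * (Hs_norm \<Omega> s (vdiff u v n))\<^sup>2 + 2 * (Hs_norm \<Omega> s (vdiff v z n))\<^sup>2"
      using Hs_norm_add_le[OF s Hs_vec_D[OF Hs_vec_vdiff n] Hs_vec_D[OF Hs_vec_vdiff n], of u v v z 1] assms by simp
  qed
  then show ?thesis by (simp add: Hs_sq_def sum.distrib sum_distrib_left)
qed

text \<open>Equality as functions: admissible vectors are extensional in the index and vanish off
  the closed domain, so the sup bound on the closure decides everything.\<close>

lemma Hs_sq_zero_imp_eq: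
  assumes u: "u \<in> H" and v: "v \<in> H" and "Hs_sq (vdiff u v) \<le> 0"
  shows "u = v"
proof (intro ext)
  fix n x
  note uH = admissibleD(1)[OF u] and vH = admissibleD(1)[OF v]
  show "u n x = v n x"
  proof (cases "n \<le> N")
    case n: True
    have "(Hs_norm \<Omega> s (vdiff u v n))\<^sup>2 \<le> 0" using Hs_norm_sq_le_Hs_sq[OF n, of "vdiff u v"] assms(3) by linarith
    then have 0: "Hs_norm \<Omega> s (vdiff u v n) = 0" by simp
    obtain k where k: "\<forall>u\<in>Hs \<Omega> s. \<forall>x\<in>closure \<Omega>. cmod (u x) \<le> k * Hs_norm \<Omega> s u"
      using Hs_sup_bounds[OF \<Omega> s] by blast
    show ?thesis
    proof (cases "x \<in> closure \<Omega>")
      case True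
      then have "cmod (vdiff u v n x) \<le> k * Hs_norm \<Omega> s (vdiff u v n)"
        using k Hs_vec_D[OF Hs_vec_vdiff[OF uH vH] n] by blast
      then show ?thesis using 0 by (simp add: vdiff_def)
    next
      case False
      then show ?thesis using Hs_vec_D[OF uH n] Hs_vec_D[OF vH n] by (simp add: Hs_def)
    qed
  next
    case False
    then show ?thesis using admissibleD(5)[OF u] admissibleD(5)[OF v] by (simp add: extensional_def)
  qed
qed

text \<open>H^s convergence is uniform on the closure, so the boundary condition and the bound by
  \<open>M\<close> pass to the limit; restriction to \<open>{..N}\<close> restores
  extensionality.\<close>

lemma admissible_complete:
  assumes U: "\<And>k. U k \<in> H" and cau: "\<And>e. e > 0 \<Longrightarrow> \<exists>n. \<forall>k\<ge>n. \<forall>l\<ge>n. Hs_sq (vdiff (U k) (U l)) < e"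
  shows "\<exists>u\<in>H. (\<lambda>k. Hs_sq (vdiff (U k) u)) \<longlonglongrightarrow> 0"
proof -
  note UH = admissibleD(1)[OF U]
  have "\<exists>v\<in>Hs \<Omega> s. (\<lambda>k. Hs_norm \<Omega> s (\<lambda>x. U k n x - v x)) \<longlonglongrightarrow> 0" if n: "n \<le> N" for n
  proof (rule Hs_complete[OF s])
    show "U k n \<in> Hs \<Omega> s" for k by (rule Hs_vec_D[OF UH n])
    fix e :: real assume e: "e > 0"
    then obtain j where j: "\<And>k l. k \<ge> j \<Longrightarrow> l \<ge> j \<Longrightarrow> Hs_sq (vdiff (U k) (U l)) < e\<^sup>2" using cau[of "e\<^sup>2"] by auto
    have "Hs_norm \<Omega> s (\<lambda>x. U k n x - U l n x) < e" if kl: "k \<ge> j" "l \<ge> j" for k l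
    proof -
      have "(Hs_norm \<Omega> s (vdiff (U k) (U l) n))\<^sup>2 < e\<^sup>2"
        using Hs_norm_sq_le_Hs_sq[OF n, of "vdiff (U k) (U l)"] j[OF kl] by linarith
      then show ?thesis using e by (simp add: vdiff_def power_less_imp_less_base)
    qed
    then show "\<exists>j. \<forall>k\<ge>j. \<forall>l\<ge>j. Hs_norm \<Omega> s (\<lambda>x. U k n x - U l n x) < e" by blast
  qed
  then obtain v where v: "\<And>n. n \<le> N \<Longrightarrow> v n \<in> Hs \<Omega> s"
    and lim: "\<And>n. n \<le> N \<Longrightarrow> (\<lambda>k. Hs_norm \<Omega> s (\<lambda>x. U k n x - v n x)) \<longlonglongrightarrow> 0" by metis
  define u where "u = restrict v {..N}"
  obtain c where c: "\<forall>u\<in>Hs \<Omega> s. \<forall>x\<in>closure \<Omega>. cmod (u x) \<le> c * Hs_norm \<Omega> s u"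
    using Hs_sup_bounds[OF \<Omega> s] by blast
  have pt: "(\<lambda>k. U k n x) \<longlonglongrightarrow> v n x" if n: "n \<le> N" and x: "x \<in> closure \<Omega>" for n x
  proof (rule LIM_zero_cancel, rule Lim_null_comparison)
    show "eventually (\<lambda>k. norm (U k n x - v n x) \<le> c * Hs_norm \<Omega> s (\<lambda>x. U k n x - v n x)) sequentially"
    proof (intro always_eventually allI)
      fix k
      have "(\<lambda>x. U k n x - v n x) \<in> Hs \<Omega> s" by (rule Hs_diff[OF s Hs_vec_D[OF UH n] v[OF n]])
      with c x show "norm (U k n x - v n x) \<le> c * Hs_norm \<Omega> s (\<lambda>x. U k n x - v n x)" by fast
    qed
    show "(\<lambda>k. c * Hs_norm \<Omega> s (\<lambda>x. U k n x - v n x)) \<longlonglongrightarrow> 0"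
      using tendsto_mult_right_zero[OF lim[OF n]] by simp
  qed
  have "u \<in> H"
    unfolding admissible_iff[OF \<Omega> s]
  proof (intro conjI allI ballI impI)
    show "u \<in> {..N} \<rightarrow>\<^sub>E Hs \<Omega> s" using v by (auto simp: u_def)
    show "u n x = 0" if n: "n \<le> N" and x: "x \<in> frontier \<Omega>" for n x
    proof -
      have "(\<lambda>k. U k n x) \<longlonglongrightarrow> v n x" using x by (intro pt n) (simp add: frontier_def)
      then have "(\<lambda>k. 0 :: complex) \<longlonglongrightarrow> v n x" by (simp add: admissibleD(2)[OF U n x])
      from LIMSEQ_unique[OF this tendsto_const] show ?thesis using n by (simp add: u_def)
    qed
    fix x assume x: "x \<in> \<Omega>"
    then have xc: "x \<in> closure \<Omega>" using closure_subset by blast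
    have "(\<lambda>k. L2_set (\<lambda>n. cmod (U k n x)) {..N}) \<longlonglongrightarrow> L2_set (\<lambda>n. cmod (v n x)) {..N}"
      unfolding L2_set_def by (intro tendsto_intros pt xc) auto
    then have "L2_set (\<lambda>n. cmod (v n x)) {..N} \<le> M"
      by (rule LIMSEQ_le_const2) (use admissibleD(3)[OF U x] in blast)
    moreover have "L2_set (\<lambda>n. cmod (u n x)) {..N} = L2_set (\<lambda>n. cmod (v n x)) {..N}"
      by (intro L2_set_cong) (auto simp: u_def)
    ultimately show "L2_set (\<lambda>n. cmod (u n x)) {..N} \<le> M" by simp
  qed
  moreover have "(\<lambda>k. Hs_sq (vdiff (U k) u)) \<longlonglongrightarrow> (\<Sum>n\<le>N. 0\<^sup>2)"
    unfolding Hs_sq_def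
  proof (intro tendsto_sum tendsto_power)
    fix n assume "n \<in> {..N}"
    then show "(\<lambda>k. Hs_norm \<Omega> s (vdiff (U k) u n)) \<longlonglongrightarrow> 0" using lim[of n] by (simp add: vdiff_def u_def)
  qed
  ultimately show ?thesis by auto
qed

text \<open>\<open>arg_min_on\<close> chooses some minimiser. Growth like \<open>Q\<close> away from
  the one constructed, together with \<open>Q h \<ge> \<epsilon> * Hs_sq h\<close>, shows that there
  is no other.\<close>

lemma F_minimizer:
  assumes \<phi>: "\<phi> \<in> H"
  shows "F \<phi> \<in> H" "\<And>v. v \<in> H \<Longrightarrow> J \<phi> (F \<phi>) + Q (vdiff (F \<phi>) v) \<le> J \<phi> v"
proof -
  obtain B where B: "B \<ge> 0" "\<And>h. Hs_vec h \<Longrightarrow> Q h \<le> B * Hs_sq h" using Q_upper by blast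
  have complete: "\<exists>u\<in>H. (\<lambda>k. Q (vdiff u (U k))) \<longlonglongrightarrow> 0"
    if U: "\<And>k. U k \<in> H" and cau: "\<And>e. e > 0 \<Longrightarrow> \<exists>n. \<forall>k\<ge>n. \<forall>l\<ge>n. Q (vdiff (U k) (U l)) < e" for U
  proof -
    have "\<exists>n. \<forall>k\<ge>n. \<forall>l\<ge>n. Hs_sq (vdiff (U k) (U l)) < e" if e: "e > 0" for e
    proof -
      obtain n where n: "\<forall>k\<ge>n. \<forall>l\<ge>n. Q (vdiff (U k) (U l)) < \<epsilon> * e" using cau[of "\<epsilon> * e"] e \<epsilon> by auto
      have "Hs_sq (vdiff (U k) (U l)) < e" if "k \<ge> n" "l \<ge> n" for k l
      proof -
        have "\<epsilon> * Hs_sq (vdiff (U k) (U l)) < \<epsilon> * e" using n that Q_parts(2)[of "vdiff (U k) (U l)"] by (meson le_less_trans)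
        then show ?thesis using \<epsilon> by simp
      qed
      then show ?thesis by blast
    qed
    from admissible_complete[OF U this] obtain u where u: "u \<in> H" "(\<lambda>k. Hs_sq (vdiff (U k) u)) \<longlonglongrightarrow> 0" by blast
    note uH = admissibleD(1)[OF u(1)] and UH = admissibleD(1)[OF U]
    have "(\<lambda>k. Q (vdiff u (U k))) \<longlonglongrightarrow> 0"
    proof (rule tendsto_sandwich[OF _ _ tendsto_const])
      show "(\<lambda>k. B * Hs_sq (vdiff (U k) u)) \<longlonglongrightarrow> 0" using tendsto_mult_right_zero[OF u(2)] by simp
      show "eventually (\<lambda>k. Q (vdiff u (U k)) \<le> B * Hs_sq (vdiff (U k) u)) sequentially"
        using B(2)[OF Hs_vec_vdiff[OF UH uH]] Q_sym[OF UH uH] by (intro always_eventually allI) simp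
    qed (simp add: Q_parts(4))
    with u(1) show ?thesis by blast
  qed
  have ne: "H \<noteq> {}" using zero_admissible by blast
  obtain u where u: "u \<in> H" "\<And>v. v \<in> H \<Longrightarrow> J \<phi> v \<ge> J \<phi> u + Q (vdiff u v)"
    by (rule strongly_convex_minimizer[where H=H and J="J \<phi>" and D="\<lambda>u v. Q (vdiff u v)" and comb=convex_comb,
       OF ne J_nonneg Q_parts(4) admissible_convex_comb J_convex[OF \<phi>] complete J_continuity[OF \<phi>]]) auto
  have "is_arg_min (J \<phi>) (\<lambda>x. x \<in> H) u"
    unfolding is_arg_min_def
  proof (intro conjI notI u(1))
    assume "\<exists>y. y \<in> H \<and> J \<phi> y < J \<phi> u"
    then obtain y where y: "y \<in> H" "J \<phi> y < J \<phi> u" by blast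
    from u(2)[OF y(1)] y(2) Q_parts(4)[of "vdiff u y"] show False by linarith
  qed
  then have F: "is_arg_min (J \<phi>) (\<lambda>x. x \<in> H) (F \<phi>)"
    unfolding F_map_def arg_min_on_def arg_min_def by (rule someI[where P="is_arg_min (J \<phi>) (\<lambda>x. x \<in> H)"])
  then have FH: "F \<phi> \<in> H" and "\<not> J \<phi> u < J \<phi> (F \<phi>)" using u(1) by (auto simp: is_arg_min_def)
  then have "Q (vdiff u (F \<phi>)) \<le> 0" using u(2)[OF FH] by linarith
  then have "\<epsilon> * Hs_sq (vdiff u (F \<phi>)) \<le> 0" using Q_parts(2)[of "vdiff u (F \<phi>)"] by linarith
  then have "Hs_sq (vdiff u (F \<phi>)) \<le> 0" using \<epsilon> by (simp add: mult_le_0_iff)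
  then have "u = F \<phi>" by (rule Hs_sq_zero_imp_eq[OF u(1) FH])
  with u show "F \<phi> \<in> H" "\<And>v. v \<in> H \<Longrightarrow> J \<phi> (F \<phi>) + Q (vdiff (F \<phi>) v) \<le> J \<phi> v" by auto
qed

section \<open>Contraction and coercivity\<close>

lemma P_integral:
  assumes h: "Hs_vec h"
  shows "integrable M1 (\<lambda>x. w x * (\<Sum>n\<le>N. (cmod (h n x))\<^sup>2))"
    and "P h = (LINT x|M1. w x * (\<Sum>n\<le>N. (cmod (h n x))\<^sup>2))"
proof -
  have i: "integrable M1 (\<lambda>x. w x * (cmod (h n x))\<^sup>2)" if "n \<in> {..N}" for n
    using wsq_Hs[OF Hs_vec_D[OF h]] that by (simp add: wsq_def)
  show "integrable M1 (\<lambda>x. w x * (\<Sum>n\<le>N. (cmod (h n x))\<^sup>2))"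
    unfolding sum_distrib_left by (rule Bochner_Integration.integrable_sum[OF i])
  show "P h = (LINT x|M1. w x * (\<Sum>n\<le>N. (cmod (h n x))\<^sup>2))"
    unfolding sum_distrib_left P_def wint_def by (rule Bochner_Integration.integral_sum[OF i, symmetric])
qed

lemma wint_nl_diff_le:
  assumes \<phi>: "\<phi> \<in> H" and \<psi>: "\<psi> \<in> H" and m: "m \<le> N"
  shows "wint M1 w (\<lambda>x. nl \<phi> m x - nl \<psi> m x) \<le> L * P (vdiff \<phi> \<psi>)"
proof -
  note d = Hs_vec_vdiff[OF admissibleD(1)[OF \<phi>] admissibleD(1)[OF \<psi>]]
  have "AE x in M1. (cmod (nl \<phi> m x - nl \<psi> m x))\<^sup>2 \<le> L * (\<Sum>n\<le>N. (cmod (vdiff \<phi> \<psi> n x))\<^sup>2)"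
    unfolding vdiff_def by (rule nl_lipschitz[OF m admissibleD(4)[OF \<phi>] admissibleD(4)[OF \<psi>]])
  moreover have "integrable M1 (\<lambda>x. w x * (L * (\<Sum>n\<le>N. (cmod (vdiff \<phi> \<psi> n x))\<^sup>2)))"
    using integrable_mult_right[OF P_integral(1)[OF d], of L] by (simp add: mult.left_commute)
  ultimately have "wint M1 w (\<lambda>x. nl \<phi> m x - nl \<psi> m x) \<le> (LINT x|M1. w x * (L * (\<Sum>n\<le>N. (cmod (vdiff \<phi> \<psi> n x))\<^sup>2)))"
    by (intro wint_mono_AE[OF w1 w0] wsq_diff[OF w1 w0] wsq_nl \<phi> \<psi> m)
  also have "\<dots> = L * P (vdiff \<phi> \<psi>)"
    unfolding P_integral(2)[OF d] by (simp add: mult.left_commute)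
  finally show ?thesis .
qed

lemma sum_wint_nl_diff_le:
  assumes "\<phi> \<in> H" "\<psi> \<in> H"
  shows "(\<Sum>m\<le>N. wint M1 w (\<lambda>x. nl \<phi> m x - nl \<psi> m x)) \<le> L * real (N + 1) * P (vdiff \<phi> \<psi>)"
proof -
  have "(\<Sum>m\<le>N. wint M1 w (\<lambda>x. nl \<phi> m x - nl \<psi> m x)) \<le> (\<Sum>m\<le>N. L * P (vdiff \<phi> \<psi>))"
    by (intro sum_mono wint_nl_diff_le assms) simp
  then show ?thesis by (simp add: algebra_simps)
qed

lemma Q_F_le:
  assumes \<phi>: "\<phi> \<in> H" and \<psi>: "\<psi> \<in> H"
  shows "Q (vdiff (F \<phi>) (F \<psi>)) \<le> L * real (N + 1) * P (vdiff \<phi> \<psi>)"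
proof -
  define a where "a = F \<phi>"
  define b where "b = F \<psi>"
  have a: "a \<in> H" and b: "b \<in> H" unfolding a_def b_def using F_minimizer(1) \<phi> \<psi> by auto
  note aH = admissibleD(1)[OF a] and bH = admissibleD(1)[OF b]
  have 1: "J \<phi> a + Q (vdiff a b) \<le> J \<phi> b" unfolding a_def by (rule F_minimizer(2)[OF \<phi> b])
  have 2: "J \<psi> b + Q (vdiff a b) \<le> J \<psi> a"
    unfolding Q_sym[OF aH bH] unfolding b_def by (rule F_minimizer(2)[OF \<psi> a])
  have "J \<phi> b - J \<psi> b + J \<psi> a - J \<phi> a = (\<Sum>m\<le>N. wint M1 w (\<lambda>x. lin_op m b x + nl \<phi> m x)
      - wint M1 w (\<lambda>x. lin_op m b x + nl \<psi> m x) + wint M1 w (\<lambda>x. lin_op m a x + nl \<psi> m x) - wint M1 w (\<lambda>x. lin_op m a x + nl \<phi> m x))"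
    unfolding J_eq sum_subtractf[symmetric] sum.distrib[symmetric] by (intro sum.cong refl) simp
  also have "\<dots> \<le> (\<Sum>m\<le>N. wint M1 w (lin_op m (vdiff a b)) + wint M1 w (\<lambda>x. nl \<phi> m x - nl \<psi> m x))"
  proof (rule sum_mono)
    fix m assume "m \<in> {..N}"
    then have m: "m \<le> N" by simp
    have "wint M1 w (\<lambda>x. lin_op m a x - lin_op m b x) = wint M1 w (lin_op m (vdiff a b))"
      by (rule wint_cong) (simp add: lin_op_vdiff[OF aH bH m])
    with wint_parallelogram_cross[OF w1 w0 wsq_lin_op[OF aH m] wsq_lin_op[OF bH m] wsq_nl[OF \<phi> m] wsq_nl[OF \<psi> m]]
    show "wint M1 w (\<lambda>x. lin_op m b x + nl \<phi> m x) - wint M1 w (\<lambda>x. lin_op m b x + nl \<psi> m x)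
       + wint M1 w (\<lambda>x. lin_op m a x + nl \<psi> m x) - wint M1 w (\<lambda>x. lin_op m a x + nl \<phi> m x)
       \<le> wint M1 w (lin_op m (vdiff a b)) + wint M1 w (\<lambda>x. nl \<phi> m x - nl \<psi> m x)" by simp
  qed
  also have "\<dots> \<le> Q (vdiff a b) + L * real (N + 1) * P (vdiff \<phi> \<psi>)"
    unfolding sum.distrib by (intro add_mono Q_parts(1) sum_wint_nl_diff_le \<phi> \<psi>)
  finally show ?thesis using 1 2 unfolding a_def b_def by linarith
qed

text \<open>The Carleman inequality controls each component by its Laplacian, which is traded for
  \<open>lin_op\<close> at the total cost \<open>2 * K * (S * P h)\<close>; as
  \<open>4 * K * S \<le> lam ^ 3\<close>, this is at most half of the left side. What remains is at
  most \<open>2 * K * Q h\<close>, and clearing the half gives \<open>4 * K\<close>.\<close>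

lemma coercivity:
  assumes h: "Hs_vec h" and h0: "\<And>n x. n \<le> N \<Longrightarrow> x \<in> frontier \<Omega> \<Longrightarrow> h n x = 0"
  shows "lam ^ 3 * P h \<le> 4 * K * Q h"
proof -
  let ?r = "\<lambda>m. \<Sum>n\<le>N. (s_coeff T m n)\<^sup>2"
  have lap: "wint M1 w (laplacian (h m)) \<le> 2 * wint M1 w (lin_op m h) + 2 * (?r m * P h)" if m: "m \<le> N" for m
  proof -
    have A: "integrable M1 (\<lambda>x. w x * (cmod (lin_op m h x))\<^sup>2)" using wsq_lin_op[OF h m] by (simp add: wsq_def)
    have eq: "w x * (2 * (cmod (lin_op m h x))\<^sup>2 + 2 * (?r m * (\<Sum>n\<le>N. (cmod (h n x))\<^sup>2))) =
       2 * (w x * (cmod (lin_op m h x))\<^sup>2) + 2 * ?r m * (w x * (\<Sum>n\<le>N. (cmod (h n x))\<^sup>2))" for x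
      by (simp only: distrib_left mult.assoc mult.left_commute)
    have "wint M1 w (laplacian (h m)) \<le>
        (LINT x|M1. w x * (2 * (cmod (lin_op m h x))\<^sup>2 + 2 * (?r m * (\<Sum>n\<le>N. (cmod (h n x))\<^sup>2))))"
    proof (rule wint_mono_AE[OF w1 w0 wsq_laplacian[OF Hs_vec_D[OF h m]]])
      show "integrable M1 (\<lambda>x. w x * (2 * (cmod (lin_op m h x))\<^sup>2 + 2 * (?r m * (\<Sum>n\<le>N. (cmod (h n x))\<^sup>2))))"
        unfolding eq by (intro Bochner_Integration.integrable_add integrable_mult_right A P_integral(1) h)
      show "AE x in M1. (cmod (laplacian (h m) x))\<^sup>2 \<le> 2 * (cmod (lin_op m h x))\<^sup>2 + 2 * (?r m * (\<Sum>n\<le>N. (cmod (h n x))\<^sup>2))"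
        by (intro AE_I2 lin_op_laplacian(2) m)
    qed
    also have "\<dots> = 2 * wint M1 w (lin_op m h) + 2 * ?r m * P h"
      unfolding eq P_integral(2)[OF h] unfolding wint_def
      by (simp only: Bochner_Integration.integral_add integrable_mult_right A P_integral(1)[OF h] integral_mult_right_zero)
    finally show ?thesis by (simp only: mult.assoc)
  qed
  have "lam ^ 3 * P h = (\<Sum>m\<le>N. lam ^ 3 * wint M1 w (h m))" by (simp add: P_def sum_distrib_left)
  also have "\<dots> \<le> (\<Sum>m\<le>N. K * ((2 * wint M1 w (lin_op m h) + 2 * (?r m * P h)) + lam ^ 3 * wint M2 w (nd (h m))))"
  proof (rule sum_mono)
    fix m assume "m \<in> {..N}"
    then have m: "m \<le> N" by simp
    have "lam ^ 3 * wint M1 w (h m) \<le> K * (wint M1 w (laplacian (h m)) + lam ^ 3 * wint M2 w (nd (h m)))"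
      unfolding wint_def using h0[OF m] by (intro carleman Hs_vec_D[OF h m]) blast
    also have "\<dots> \<le> K * ((2 * wint M1 w (lin_op m h) + 2 * (?r m * P h)) + lam ^ 3 * wint M2 w (nd (h m)))"
      using lap[OF m] LK by (intro mult_left_mono) auto
    finally show "lam ^ 3 * wint M1 w (h m) \<le> K * ((2 * wint M1 w (lin_op m h) + 2 * (?r m * P h)) + lam ^ 3 * wint M2 w (nd (h m)))" .
  qed
  also have "\<dots> = K * (2 * (\<Sum>m\<le>N. wint M1 w (lin_op m h)) + 2 * (S * P h) + lam ^ 3 * (\<Sum>m\<le>N. wint M2 w (nd (h m))))"
    by (simp only: sum_distrib_left[symmetric] sum.distrib sum_distrib_right[symmetric])
  finally have 1: "lam ^ 3 * P h \<le> K * (2 * (\<Sum>m\<le>N. wint M1 w (lin_op m h)) + 2 * (S * P h) + lam ^ 3 * (\<Sum>m\<le>N. wint M2 w (nd (h m))))" .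
  define A where "A = (\<Sum>m\<le>N. wint M1 w (lin_op m h))"
  define B where "B = lam ^ 3 * (\<Sum>m\<le>N. wint M2 w (nd (h m)))"
  have B0: "B \<ge> 0" unfolding B_def using lam3 by (intro mult_nonneg_nonneg sum_wint_nonneg) simp
  have "4 * K * S * 1 \<le> 4 * K * S * real (N + 1)"
    using LK S_nonneg by (intro mult_left_mono mult_nonneg_nonneg) auto
  moreover have "4 * K * S * real (N + 1) = 4 * K * real (N + 1) * S" by (simp only: mult.assoc mult.commute[of S])
  ultimately have "4 * K * S \<le> lam ^ 3" using lam_s by linarith
  then have "4 * K * S * P h \<le> lam ^ 3 * P h" by (rule mult_right_mono[OF _ P_nonneg])
  then have 2: "4 * (K * (S * P h)) \<le> lam ^ 3 * P h" by (simp only: mult.assoc)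
  have "K * (A + B) \<le> K * Q h" using Q_parts(5)[of h] LK unfolding A_def B_def by (intro mult_left_mono) auto
  moreover have "K * B \<ge> 0" using B0 LK by simp
  moreover have "lam ^ 3 * P h \<le> 2 * (K * A) + 2 * (K * (S * P h)) + K * B"
    using 1 unfolding A_def[symmetric] B_def[symmetric] by (simp add: algebra_simps)
  ultimately show ?thesis using 2 by (simp add: algebra_simps)
qed

lemma coercivity_vdiff:
  assumes "u \<in> H" "v \<in> H"
  shows "lam ^ 3 * P (vdiff u v) \<le> 4 * K * Q (vdiff u v)"
  by (intro coercivity Hs_vec_vdiff admissibleD(1) assms)
    (simp add: vdiff_def admissibleD(2)[OF assms(1)] admissibleD(2)[OF assms(2)])

text \<open>The \<open>16 * K\<close> in \<open>lam_L\<close> is the \<open>4 * K\<close> of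
  coercivity times the 4 gained here. This 4 becomes the contraction factor and, in the error
  estimate, lets the nonlinear part be absorbed into \<open>Q\<close>.\<close>

lemma nonlinearity_absorbed:
  assumes "u \<in> H" "v \<in> H"
  shows "4 * (L * real (N + 1) * P (vdiff u v)) \<le> Q (vdiff u v)"
proof -
  have "16 * K * (L * real (N + 1)) * P (vdiff u v) \<le> lam ^ 3 * P (vdiff u v)"
    by (rule mult_right_mono[OF lam_L P_nonneg])
  also have "\<dots> \<le> 4 * K * Q (vdiff u v)" by (rule coercivity_vdiff[OF assms])
  finally have "(4 * K) * (4 * (L * real (N + 1) * P (vdiff u v))) \<le> (4 * K) * Q (vdiff u v)"
    by (simp only: mult.assoc)
  then show ?thesis using LK by simp
qed

lemma P_F_contraction:
  assumes \<phi>: "\<phi> \<in> H" and \<psi>: "\<psi> \<in> H"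
  shows "4 * P (vdiff (F \<phi>) (F \<psi>)) \<le> P (vdiff \<phi> \<psi>)"
proof -
  have "4 * (L * real (N + 1) * P (vdiff (F \<phi>) (F \<psi>))) \<le> L * real (N + 1) * P (vdiff \<phi> \<psi>)"
    using nonlinearity_absorbed[OF F_minimizer(1)[OF \<phi>] F_minimizer(1)[OF \<psi>]] Q_F_le[OF \<phi> \<psi>] by linarith
  then have "(L * real (N + 1)) * (4 * P (vdiff (F \<phi>) (F \<psi>))) \<le> (L * real (N + 1)) * P (vdiff \<phi> \<psi>)"
    by (simp only: mult.left_commute)
  then show ?thesis using LK by simp
qed

lemma Hs_sq_F_le:
  assumes \<phi>: "\<phi> \<in> H" and \<psi>: "\<psi> \<in> H"
  shows "Hs_sq (vdiff (F \<phi>) (F \<psi>)) \<le> L * real (N + 1) / \<epsilon> * P (vdiff \<phi> \<psi>)"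
proof -
  have "\<epsilon> * Hs_sq (vdiff (F \<phi>) (F \<psi>)) \<le> L * real (N + 1) * P (vdiff \<phi> \<psi>)"
    using Q_parts(2)[of "vdiff (F \<phi>) (F \<psi>)"] Q_F_le[OF \<phi> \<psi>] by linarith
  then show ?thesis using \<epsilon> by (simp add: field_simps)
qed

lemma P_diameter: "\<exists>B\<ge>0. \<forall>u\<in>H. \<forall>v\<in>H. P (vdiff u v) \<le> B"
proof -
  define B where "B = (2 * M)\<^sup>2 * (LINT x|M1. w x)"
  have "P (vdiff u v) \<le> real (N + 1) * B" if u: "u \<in> H" and v: "v \<in> H" for u v
  proof -
    note d = Hs_vec_vdiff[OF admissibleD(1)[OF u] admissibleD(1)[OF v]]
    have "P (vdiff u v) \<le> (\<Sum>n\<le>N. B)"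
      unfolding P_def B_def
    proof (intro sum_mono wint1_le wsq_Hs Hs_vec_D[OF d])
      fix n x assume "n \<in> {..N}" and x: "x \<in> \<Omega>"
      then have n: "n \<le> N" by simp
      have "cmod (u n x - v n x) \<le> cmod (u n x) + cmod (v n x)" by (rule norm_triangle_ineq4)
      moreover have "cmod (u n x) \<le> M" "cmod (v n x) \<le> M"
        using admissibleD(4)[OF u] admissibleD(4)[OF v] n x by blast+
      ultimately have "cmod (vdiff u v n x) \<le> 2 * M" unfolding vdiff_def by linarith
      then show "(cmod (vdiff u v n x))\<^sup>2 \<le> (2 * M)\<^sup>2" by (intro power_mono) auto
    qed simp
    then show ?thesis by simp
  qed
  moreover have "B \<ge> 0" unfolding B_def by (intro mult_nonneg_nonneg integral_nonneg_AE AE_I2 w0) auto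
  then have "real (N + 1) * B \<ge> 0" by simp
  ultimately show ?thesis by blast
qed

text \<open>The iterates are Cauchy in \<open>P\<close> by contraction and in \<open>Hs_sq\<close>
  after one more application of \<open>F\<close>, where \<open>admissible_complete\<close> supplies
  a limit. \<open>P_diameter\<close> bounds the starting distances uniformly in the indices.\<close>

lemma unique_fixed_point: "\<exists>!v. v \<in> H \<and> F v = v"
proof (rule ex_ex1I)
  let ?c = "L * real (N + 1) / \<epsilon>"
  have c: "?c \<ge> 0" using LK \<epsilon> by simp
  define U where "U k = (F ^^ k) (restrict (\<lambda>n x. 0) {..N})" for k
  have US: "U (Suc k) = F (U k)" for k by (simp add: U_def)
  have U0: "U 0 \<in> H" unfolding U_def funpow_0 by (rule zero_admissible)
  have U: "U k \<in> H" for k by (induction k) (simp_all add: U0 US F_minimizer(1))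
  note UH = admissibleD(1)[OF U]
  obtain B where B: "B \<ge> 0" "\<And>u v. u \<in> H \<Longrightarrow> v \<in> H \<Longrightarrow> P (vdiff u v) \<le> B" using P_diameter by blast
  \<comment> \<open>Both indices are shifted together, so that the starting distance is bounded by
    the diameter and no geometric series over consecutive steps is summed.\<close>
  have PU: "P (vdiff (U (k + j)) (U (l + j))) \<le> (1 / 4) ^ j * B" for j k l
  proof (induction j)
    case 0
    show ?case using B(2)[OF U U] by simp
  next
    case (Suc j)
    then show ?case using P_F_contraction[OF U U, of "k + j" "l + j"] by (simp add: US)
  qed
  have "\<exists>n. \<forall>k\<ge>n. \<forall>l\<ge>n. Hs_sq (vdiff (U k) (U l)) < e" if e: "e > 0" for e
  proof -
    have "(\<lambda>j. ?c * ((1 / 4) ^ j * B)) \<longlonglongrightarrow> ?c * (0 * B)"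
      by (intro tendsto_intros LIMSEQ_realpow_zero) auto
    then have "eventually (\<lambda>j. ?c * ((1 / 4) ^ j * B) < e) sequentially"
      using e by (intro order_tendstoD(2)) auto
    then obtain j where j: "?c * ((1 / 4) ^ j * B) < e" by (auto simp: eventually_sequentially)
    \<comment> \<open>\<open>Suc j\<close>: the first \<open>j\<close> applications of
      \<open>F\<close> contract \<open>P\<close>, the last one converts \<open>P\<close> into
      \<open>Hs_sq\<close>.\<close>
    have "Hs_sq (vdiff (U k) (U l)) < e" if kl: "k \<ge> Suc j" "l \<ge> Suc j" for k l
    proof -
      define k' where "k' = k - Suc j"
      define l' where "l' = l - Suc j"
      have k': "k = Suc (k' + j)" and l': "l = Suc (l' + j)" using kl by (auto simp: k'_def l'_def)
      have "Hs_sq (vdiff (U k) (U l)) \<le> ?c * P (vdiff (U (k' + j)) (U (l' + j)))"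
        unfolding k' l' US by (rule Hs_sq_F_le[OF U U])
      also have "\<dots> \<le> ?c * ((1 / 4) ^ j * B)" by (rule mult_left_mono[OF PU c])
      finally show ?thesis using j by linarith
    qed
    then show ?thesis by blast
  qed
  from admissible_complete[OF U this] obtain v where v: "v \<in> H" and lim: "(\<lambda>k. Hs_sq (vdiff (U k) v)) \<longlonglongrightarrow> 0" by blast
  note vH = admissibleD(1)[OF v] and FvH = admissibleD(1)[OF F_minimizer(1)[OF v]]
  obtain C where C: "C \<ge> 0" "\<And>h. Hs_vec h \<Longrightarrow> P h \<le> C * Hs_sq h" using P_upper by blast
  \<comment> \<open>The limit is fixed because \<open>v\<close> and \<open>F v\<close> are both
    close to \<open>U (Suc k)\<close>, the second since \<open>Hs_sq_F_le\<close> bounds the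
    distance of images by \<open>P\<close> and \<open>P\<close> is continuous for the H^s
    norm.\<close>
  have bound: "Hs_sq (vdiff v (F v)) \<le> 2 * Hs_sq (vdiff (U (Suc k)) v) + 2 * (?c * (C * Hs_sq (vdiff (U k) v)))" for k
  proof -
    have "Hs_sq (vdiff (U (Suc k)) (F v)) \<le> ?c * P (vdiff (U k) v)" unfolding US by (rule Hs_sq_F_le[OF U v])
    also have "\<dots> \<le> ?c * (C * Hs_sq (vdiff (U k) v))" by (rule mult_left_mono[OF C(2)[OF Hs_vec_vdiff[OF UH vH]] c])
    finally show ?thesis using Hs_sq_triangle[OF vH UH FvH, of "Suc k"] Hs_sq_sym[OF vH UH, of "Suc k"] by linarith
  qed
  have "(\<lambda>k. 2 * Hs_sq (vdiff (U (Suc k)) v) + 2 * (?c * (C * Hs_sq (vdiff (U k) v)))) \<longlonglongrightarrow> 2 * 0 + 2 * (?c * (C * 0))"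
    by (intro tendsto_add tendsto_mult_left lim LIMSEQ_Suc[OF lim])
  then have "(\<lambda>k. 2 * Hs_sq (vdiff (U (Suc k)) v) + 2 * (?c * (C * Hs_sq (vdiff (U k) v)))) \<longlonglongrightarrow> 0" by simp
  from LIMSEQ_le_const[OF this] bound have "Hs_sq (vdiff v (F v)) \<le> 0" by blast
  from Hs_sq_zero_imp_eq[OF v F_minimizer(1)[OF v] this] v show "\<exists>v. v \<in> H \<and> F v = v" by auto
next
  fix u v assume u: "u \<in> H \<and> F u = u" and v: "v \<in> H \<and> F v = v"
  \<comment> \<open>Contraction annihilates \<open>P\<close> first; \<open>Hs_sq_F_le\<close>, whose
    left side is the same difference at fixed points, then annihilates the H^s norm.\<close>
  then have "P (vdiff u v) \<le> 0" using P_F_contraction[of u v] P_nonneg[of "vdiff u v"] by simp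
  then have "P (vdiff u v) = 0" using P_nonneg[of "vdiff u v"] by simp
  then have "Hs_sq (vdiff u v) \<le> 0" using Hs_sq_F_le[of u v] u v by simp
  then show "u = v" using u v by (intro Hs_sq_zero_imp_eq) auto
qed

section \<open>The error estimate\<close>

lemma weighted_norm_vdiff_eq:
  assumes h: "Hs_vec h"
  shows "(weighted_norm \<Omega> x0 \<beta> s N lam \<epsilon> h)\<^sup>2 = P h + 2 * (\<Sum>m\<le>N. wint M2 w (nd (h m))) + 2 * \<epsilon> / lam ^ 3 * Hs_sq h"
proof -
  have i: "integrable M2 (\<lambda>x. w x * (cmod (nd (h n) x))\<^sup>2)" if "n \<in> {..N}" for n
    using wsq_nd[OF Hs_vec_D[OF h]] that by (simp add: wsq_def)
  have "(LINT x|M2. w x * (\<Sum>n\<le>N. (cmod (nd (h n) x))\<^sup>2)) = (\<Sum>m\<le>N. wint M2 w (nd (h m)))"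
    unfolding sum_distrib_left wint_def by (rule Bochner_Integration.integral_sum[OF i])
  moreover have "(Hs_vec_norm \<Omega> s N h)\<^sup>2 = Hs_sq h"
    using Hs_sq_nonneg[of h] by (simp add: Hs_vec_norm_def Hs_sq_def)
  moreover have "2 * \<epsilon> / lam ^ 3 * Hs_sq h \<ge> 0" using \<epsilon> lam3 Hs_sq_nonneg[of h] by simp
  ultimately show ?thesis
    unfolding weighted_norm_def set_lebesgue_integral_lebesgue_on[OF \<Omega>_leb(1)[OF \<Omega>]] P_integral(2)[OF h, symmetric]
    using P_nonneg[of h] sum_wint_nonneg[of M2 "\<lambda>m. nd (h m)"] by simp
qed

lemma wint_cong_AE:
  assumes "wsq M' w g" "wsq M' w g'" "AE x in M'. cmod (g x) = cmod (g' x)"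
  shows "wint M' w g = wint M' w g'"
  unfolding wint_def
proof (rule integral_cong_AE)
  show "AE x in M'. w x * (cmod (g x))\<^sup>2 = w x * (cmod (g' x))\<^sup>2" using assms(3) by eventually_elim simp
qed (use assms in \<open>auto simp: wsq_def dest: borel_measurable_integrable\<close>)

text \<open>The exact solution is a competitor for the functional frozen at the fixed point
  \<open>u\<close>. Its residual there is \<open>nl u m - nl us m\<close> and its boundary misfit is
  the noise, so \<open>Q\<close> of the error is at most a nonlinear part, absorbed by
  \<open>nonlinearity_absorbed\<close>, plus noise and regularisation.\<close>

lemma error_estimate:
  assumes u: "u \<in> H" and Fu: "F u = u" and us: "us \<in> H" and fs: "\<And>m. m \<le> N \<Longrightarrow> fs m \<in> L2_boundary \<Omega>"
    and sol: "solves_reduced_system \<Omega> T p N q fs us"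
  shows "(weighted_norm \<Omega> x0 \<beta> s N lam \<epsilon> (\<lambda>n x. u n x - us n x))\<^sup>2
        \<le> (8 * K + 4) * (\<epsilon> / lam ^ 3) * (Hs_vec_norm \<Omega> s N us)\<^sup>2
          + (8 * K + 4) * (LINT x|surface_measure \<Omega>. w x * (\<Sum>m\<le>N. (cmod (f m x - fs m x))\<^sup>2))"
proof -
  note uH = admissibleD(1)[OF u] and usH = admissibleD(1)[OF us]
  define h where "h = vdiff u us"
  have h: "Hs_vec h" unfolding h_def by (rule Hs_vec_vdiff[OF uH usH])
  define G where "G = (\<Sum>m\<le>N. wint M2 w (\<lambda>x. f m x - fs m x))"
  have Geq: "G = (LINT x|M2. w x * (\<Sum>m\<le>N. (cmod (f m x - fs m x))\<^sup>2))"
  proof -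
    have i: "integrable M2 (\<lambda>x. w x * (cmod (f m x - fs m x))\<^sup>2)" if "m \<in> {..N}" for m
      using wsq_diff[OF w2 w0 wsq2_L2[OF f] wsq2_L2[OF fs], of m m] that by (simp add: wsq_def)
    show ?thesis unfolding G_def sum_distrib_left wint_def by (rule Bochner_Integration.integral_sum[OF i, symmetric])
  qed
  have J: "J u us = (\<Sum>m\<le>N. wint M1 w (\<lambda>x. nl u m x - nl us m x)) + lam ^ 3 * G + \<epsilon> * Hs_sq us"
  proof -
    have A: "wint M1 w (\<lambda>x. lin_op m us x + nl u m x) = wint M1 w (\<lambda>x. nl u m x - nl us m x)" if m: "m \<le> N" for m
    proof (rule wint_cong_AE)
      have "AE x in M1. residual T p N q us us m x = 0" using sol m by (simp add: solves_reduced_system_def)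
      then show "AE x in M1. cmod (lin_op m us x + nl u m x) = cmod (nl u m x - nl us m x)"
      proof eventually_elim
        case (elim x)
        then have "lin_op m us x + nl us m x = 0" by (simp add: residual_def lin_op_def nl_term_def)
        then have "lin_op m us x = - nl us m x" by (simp add: eq_neg_iff_add_eq_0)
        then show ?case by simp
      qed
    qed (intro wsq_add[OF w1 w0] wsq_diff[OF w1 w0] wsq_lin_op usH wsq_nl u us m)+
    have B: "wint M2 w (\<lambda>x. nd (us m) x - f m x) = wint M2 w (\<lambda>x. f m x - fs m x)" if m: "m \<le> N" for m
    proof (rule wint_cong_AE)
      have "AE x in M2. nd (us m) x = fs m x" using sol m by (simp add: solves_reduced_system_def)
      then show "AE x in M2. cmod (nd (us m) x - f m x) = cmod (f m x - fs m x)"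
        by eventually_elim (simp add: norm_minus_commute)
    qed (intro wsq_diff[OF w2 w0] wsq_nd Hs_vec_D[OF usH m] wsq2_L2 f fs m)+
    show ?thesis unfolding J_eq G_def Hs_sq_def sum_distrib_left sum.distrib[symmetric]
      by (intro sum.cong refl) (simp add: A B)
  qed
  have "Q h \<le> J u us"
    using F_minimizer(2)[OF u us] J_nonneg[of u u] unfolding Fu h_def by linarith
  then have "Q h \<le> L * real (N + 1) * P h + lam ^ 3 * G + \<epsilon> * Hs_sq us"
    unfolding J using sum_wint_nl_diff_le[OF u us] unfolding h_def by linarith
  moreover have "4 * (L * real (N + 1) * P h) \<le> Q h" unfolding h_def by (rule nonlinearity_absorbed[OF u us])
  moreover have "Q h \<ge> 0" by (rule Q_parts(4))
  \<comment> \<open>Absorbing a quarter of \<open>Q h\<close> leaves the factor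
    \<open>4 / 3\<close>, rounded up to 2.\<close>
  moreover have "a \<le> 2 * (c + d)" if "a \<le> b + c + d" "4 * b \<le> a" "0 \<le> a" for a b c d :: real using that by argo
  ultimately have Qh: "Q h \<le> 2 * (lam ^ 3 * G + \<epsilon> * Hs_sq us)" by blast
  define Y where "Y = (\<Sum>m\<le>N. wint M2 w (nd (h m)))"
  \<comment> \<open>Times \<open>lam ^ 3\<close> the squared norm consists of the term with
    \<open>P\<close>, which coercivity bounds by \<open>4 * K * Q h\<close>, and of twice two
    summands of \<open>Q h\<close>; the factor 2 of \<open>Qh\<close> then turns
    \<open>4 * K + 2\<close> into \<open>8 * K + 4\<close>.\<close>
  have "lam ^ 3 * (P h + 2 * Y + 2 * \<epsilon> / lam ^ 3 * Hs_sq h) = lam ^ 3 * P h + 2 * (lam ^ 3 * Y + \<epsilon> * Hs_sq h)"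
    using lam3 by (simp add: field_simps)
  also have "\<dots> \<le> 4 * K * Q h + 2 * Q h"
    using coercivity_vdiff[OF u us] Q_parts(3)[of h] unfolding h_def Y_def by (intro add_mono mult_left_mono) auto
  also have "\<dots> = (4 * K + 2) * Q h" by (simp add: algebra_simps)
  also have "\<dots> \<le> (4 * K + 2) * (2 * (lam ^ 3 * G + \<epsilon> * Hs_sq us))" using LK by (intro mult_left_mono Qh) auto
  also have "\<dots> = lam ^ 3 * ((8 * K + 4) * (\<epsilon> / lam ^ 3) * Hs_sq us + (8 * K + 4) * G)"
    using lam3 by (simp add: field_simps)
  finally have "P h + 2 * Y + 2 * \<epsilon> / lam ^ 3 * Hs_sq h \<le> (8 * K + 4) * (\<epsilon> / lam ^ 3) * Hs_sq us + (8 * K + 4) * G"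
    using lam3 by (simp only: mult_le_cancel_left_pos)
  moreover have "(Hs_vec_norm \<Omega> s N us)\<^sup>2 = Hs_sq us"
    using Hs_sq_nonneg[of us] by (simp add: Hs_vec_norm_def Hs_sq_def)
  moreover have "(weighted_norm \<Omega> x0 \<beta> s N lam \<epsilon> h)\<^sup>2 = P h + 2 * Y + 2 * \<epsilon> / lam ^ 3 * Hs_sq h"
    unfolding Y_def by (rule weighted_norm_vdiff_eq[OF h])
  ultimately show ?thesis unfolding Geq h_def vdiff_def by simp
qed

end

text \<open>The order of quantifiers expresses the dependence of the constants: \<open>lam1\<close>
  and \<open>C\<close> precede \<open>q\<close>, of which only the essential supremum
  \<open>qnorm\<close> is prescribed, as well as \<open>\<epsilon>\<close>, the data and the exact
  solution. Existence and uniqueness of the fixed point are asserted alongside, so that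
  \<open>fixed_point\<close> denotes it.\<close>

theorem theorem5p1:
  fixes \<Omega> :: "'a::euclidean_space set" and x0 :: 'a
    and \<beta>0 \<beta> s T p M qnorm :: real and N :: nat
  assumes "bounded_smooth_domain \<Omega>"
    and "x0 \<notin> closure \<Omega>"
    and "T > 0" and "p > 1" and "M > 0"
    and "s > real DIM('a) / 2 + 2"
    and "\<beta>0 > 0" and "carleman_estimate \<Omega> x0 \<beta>0" and "\<beta> \<ge> \<beta>0"
  shows "\<exists>lam1 \<ge> carleman_lambda0 \<Omega> x0 \<beta>. \<exists>C>0.
    \<forall>(q :: 'a \<Rightarrow> real \<Rightarrow> real) (\<epsilon> :: real) (f :: nat \<Rightarrow> 'a \<Rightarrow> complex) (lam :: real).
      (\<lambda>(x, t). q x t) \<in> borel_measurable (lebesgue_on (\<Omega> \<times> {0<..<T})) \<longrightarrow>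
      esssup (lebesgue_on (\<Omega> \<times> {0<..<T})) (\<lambda>(x, t). ereal \<bar>q x t\<bar>) = ereal qnorm \<longrightarrow>
      \<epsilon> > 0 \<longrightarrow>
      (\<forall>m\<le>N. f m \<in> L2_boundary \<Omega>) \<longrightarrow>
      lam \<ge> lam1 \<longrightarrow>
      (\<exists>!v. is_fixed_point \<Omega> x0 \<beta> s T p N M q f lam \<epsilon> v) \<and>
      (\<forall>(us :: nat \<Rightarrow> 'a \<Rightarrow> complex) (fs :: nat \<Rightarrow> 'a \<Rightarrow> complex).
        us \<in> admissible \<Omega> s N M \<longrightarrow>
        (\<forall>m\<le>N. fs m \<in> L2_boundary \<Omega>) \<longrightarrow>
        solves_reduced_system \<Omega> T p N q fs us \<longrightarrow>
        (weighted_norm \<Omega> x0 \<beta> s N lam \<epsilon>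
            (\<lambda>n x. fixed_point \<Omega> x0 \<beta> s T p N M q f lam \<epsilon> n x - us n x))\<^sup>2
        \<le> C * (\<epsilon> / lam ^ 3) * (Hs_vec_norm \<Omega> s N us)\<^sup>2
          + C * (LINT x|surface_measure \<Omega>.
              carleman_weight x0 \<beta> lam x * (\<Sum>m\<le>N. (cmod (f m x - fs m x))\<^sup>2)))"
proof -
  note \<Omega> = assms(1) and x0 = assms(2) and T = assms(3) and p = assms(4) and M = assms(5) and s = assms(6)
  obtain K where K: "K > 0" "\<forall>lam\<ge>max 1 (carleman_lambda0 \<Omega> x0 \<beta>). \<forall>u\<in>Hs \<Omega> s. (\<forall>x\<in>frontier \<Omega>. u x = 0) \<longrightarrow>
    lam ^ 3 * (LINT x|lebesgue_on \<Omega>. carleman_weight x0 \<beta> lam x * (cmod (u x))\<^sup>2) \<le>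
    K * ((LINT x|lebesgue_on \<Omega>. carleman_weight x0 \<beta> lam x * (cmod (laplacian u x))\<^sup>2) +
      lam ^ 3 * (LINT x|surface_measure \<Omega>. carleman_weight x0 \<beta> lam x * (cmod (normal_deriv \<Omega> u x))\<^sup>2))"
    using carleman_integrated[OF \<Omega> x0 s assms(7-9)] by (elim exE conjE)
  have "\<Omega> \<in> sets borel" by (rule bounded_smooth_domainD(4)[OF \<Omega>])
  from nonlinear_term_properties[OF T p this, where Q=qnorm and N=N and M=M]
  obtain L where L: "L > 0" and nl: "\<forall>q. (\<lambda>(x, t). q x t) \<in> borel_measurable (lebesgue_on (\<Omega> \<times> {0<..<T})) \<longrightarrow>
    esssup (lebesgue_on (\<Omega> \<times> {0<..<T})) (\<lambda>(x, t). ereal \<bar>q x t\<bar>) = ereal qnorm \<longrightarrow>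
    (\<forall>\<phi> m. m \<le> N \<longrightarrow> (\<forall>n\<le>N. \<phi> n \<in> borel_measurable borel) \<longrightarrow> (\<forall>n\<le>N. \<forall>x\<in>\<Omega>. cmod (\<phi> n x) \<le> M) \<longrightarrow>
       nl_term T p N q \<phi> m \<in> borel_measurable (lebesgue_on \<Omega>) \<and>
       (AE x in lebesgue_on \<Omega>. (cmod (nl_term T p N q \<phi> m x))\<^sup>2 \<le> L)) \<and>
    (\<forall>\<phi> \<psi> m. m \<le> N \<longrightarrow> (\<forall>n\<le>N. \<forall>x\<in>\<Omega>. cmod (\<phi> n x) \<le> M) \<longrightarrow> (\<forall>n\<le>N. \<forall>x\<in>\<Omega>. cmod (\<psi> n x) \<le> M) \<longrightarrow>
       (AE x in lebesgue_on \<Omega>. (cmod (nl_term T p N q \<phi> m x - nl_term T p N q \<psi> m x))\<^sup>2 \<le>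
           L * (\<Sum>n\<le>N. (cmod (\<phi> n x - \<psi> n x))\<^sup>2)))"
    by (elim exE conjE)
  define b1 where "b1 = 4 * K * real (N + 1) * (\<Sum>m\<le>N. \<Sum>n\<le>N. (s_coeff T m n)\<^sup>2)"
  define b2 where "b2 = 16 * K * (L * real (N + 1))"
  \<comment> \<open>\<open>b1\<close> and \<open>b2\<close> are thresholds for
    \<open>lam ^ 3\<close>; as \<open>lam \<ge> 1\<close> it is enough that \<open>lam\<close>
    itself exceeds them.\<close>
  define lam1 where "lam1 = max (max 1 (carleman_lambda0 \<Omega> x0 \<beta>)) (max b1 b2)"
  show ?thesis
  proof (rule exI[of _ lam1], rule conjI[rotated], rule exI[of _ "8 * K + 4"], intro conjI allI impI)
    show "carleman_lambda0 \<Omega> x0 \<beta> \<le> lam1" "8 * K + 4 > 0" using K(1) by (simp_all add: lam1_def)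
    fix q :: "'a \<Rightarrow> real \<Rightarrow> real" and \<epsilon> lam :: real and f :: "nat \<Rightarrow> 'a \<Rightarrow> complex"
    assume qm: "(\<lambda>(x, t). q x t) \<in> borel_measurable (lebesgue_on (\<Omega> \<times> {0<..<T}))"
      and qe: "esssup (lebesgue_on (\<Omega> \<times> {0<..<T})) (\<lambda>(x, t). ereal \<bar>q x t\<bar>) = ereal qnorm"
      and \<epsilon>: "\<epsilon> > 0" and f: "\<forall>m\<le>N. f m \<in> L2_boundary \<Omega>" and lam: "lam \<ge> lam1"
    note nlq = nl[THEN spec, THEN mp, THEN mp, OF qm qe]
    have lam': "lam \<ge> max 1 (carleman_lambda0 \<Omega> x0 \<beta>)" "lam \<ge> 1" "lam \<ge> b1" "lam \<ge> b2"
      using lam by (simp_all add: lam1_def)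
    have "lam ^ 1 \<le> lam ^ 3" by (rule power_increasing[OF _ lam'(2)]) simp
    then have cube: "b1 \<le> lam ^ 3" "b2 \<le> lam ^ 3" using lam' by simp_all
    have f': "f m \<in> L2_boundary \<Omega>" if "m \<le> N" for m using f that by (elim allE impE)
    have nlb: "nl_term T p N q \<phi> m \<in> borel_measurable (lebesgue_on \<Omega>) \<and>
       (AE x in lebesgue_on \<Omega>. (cmod (nl_term T p N q \<phi> m x))\<^sup>2 \<le> L)"
      if "m \<le> N" "\<forall>n\<le>N. \<phi> n \<in> borel_measurable borel" "\<forall>n\<le>N. \<forall>x\<in>\<Omega>. cmod (\<phi> n x) \<le> M" for \<phi> m
      by (rule nlq[THEN conjunct1, THEN spec, THEN spec, THEN mp, THEN mp, THEN mp, OF that])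
    have nll: "AE x in lebesgue_on \<Omega>. (cmod (nl_term T p N q \<phi> m x - nl_term T p N q \<psi> m x))\<^sup>2 \<le>
           L * (\<Sum>n\<le>N. (cmod (\<phi> n x - \<psi> n x))\<^sup>2)"
      if "m \<le> N" "\<forall>n\<le>N. \<forall>x\<in>\<Omega>. cmod (\<phi> n x) \<le> M" "\<forall>n\<le>N. \<forall>x\<in>\<Omega>. cmod (\<psi> n x) \<le> M" for \<phi> \<psi> m
      by (rule nlq[THEN conjunct2, THEN spec, THEN spec, THEN spec, THEN mp, THEN mp, THEN mp, OF that])
    note carl = K(2)[THEN spec, THEN mp, OF lam'(1), THEN bspec, THEN mp]
    interpret regularized_system \<Omega> x0 \<beta> s T p M lam \<epsilon> L K N q f
      by (rule regularized_system.intro[OF \<Omega> x0 s M \<epsilon> lam'(2) L K(1) f' nlb nll carl cube[unfolded b1_def b2_def]])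
    have fp: "is_fixed_point \<Omega> x0 \<beta> s T p N M q f lam \<epsilon> v \<longleftrightarrow> v \<in> H \<and> F v = v" for v
      by (simp add: is_fixed_point_def)
    show ex1: "\<exists>!v. is_fixed_point \<Omega> x0 \<beta> s T p N M q f lam \<epsilon> v"
      unfolding fp by (rule unique_fixed_point)
    define u where "u = fixed_point \<Omega> x0 \<beta> s T p N M q f lam \<epsilon>"
    have u: "u \<in> H" "F u = u" using theI'[OF ex1] unfolding u_def fixed_point_def fp by auto
    fix us fs :: "nat \<Rightarrow> 'a \<Rightarrow> complex"
    assume "us \<in> H" "\<forall>m\<le>N. fs m \<in> L2_boundary \<Omega>" "solves_reduced_system \<Omega> T p N q fs us"
    then show "(weighted_norm \<Omega> x0 \<beta> s N lam \<epsilon>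
            (\<lambda>n x. fixed_point \<Omega> x0 \<beta> s T p N M q f lam \<epsilon> n x - us n x))\<^sup>2
        \<le> (8 * K + 4) * (\<epsilon> / lam ^ 3) * (Hs_vec_norm \<Omega> s N us)\<^sup>2
          + (8 * K + 4) * (LINT x|surface_measure \<Omega>.
              carleman_weight x0 \<beta> lam x * (\<Sum>m\<le>N. (cmod (f m x - fs m x))\<^sup>2))"
      unfolding u_def[symmetric] by (intro error_estimate u) auto
  qed
qed

end
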